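(* Let $\nu\in\mathbb R$, let $M,L\ge 0$ be integers with $\nu\le L\le M+\nu$, let $0<\gamma\le 1$, and let $T\in SIO_\nu(M+\gamma)$. Assume that $T$ satisfies $WBP_\nu$ and that $T^*(x^\alpha)=0$ for all $|\alpha|\le L$. Then for any $\psi\in\mathcal D_P$, with $P$ sufficiently large, there are kernel functions $\theta_k(x,y)$ ($k\in\mathbb Z$) such that $$\psi_k*Tf(x)=\int_{\mathbb R^n}\theta_k(x,y)f(y)\,dy\qquad\text{for } f\in\mathscr S_P,$$ and such that $$|D_y^\alpha\theta_k(x,y)|\lesssim 2^{(\nu+|\alpha|)k}\,\Phi_k^{n+\nu+M+\gamma}(x-y)\quad\text{for }|\alpha|\le\lfloor L-\nu\rfloor,$$ $$|D_y^\alpha\theta_k(x,y+h)-D_y^\alpha\theta_k(x,y)|\lesssim 2^{(\nu+|\alpha|)k}(2^k|h|)^{\gamma'}\,\Phi_k^{n+\nu+M+\gamma}(x-y)\quad\text{for }|\alpha|=\lfloor L-\nu\rfloor,$$ for all $x,y,h\in\mathbb R^n$ with $|h|<(2^{-k}+|x-y|)/2$ and any $0<\gamma'<\gamma$.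
   Context: Test functions. $\mathscr S$ is the Schwartz class on $\mathbb R^n$; for $P\in\mathbb N_0$, $\mathscr S_P\subset\mathscr S$ is the closed subspace of functions with $\int f(x)x^\alpha dx=0$ for $|\alpha|\le P$; $\mathcal D_P\subset C_0^\infty$ is the subspace of functions with vanishing moments up to order $P$; $\mathcal D_P'$ is its dual. $\langle\cdot,\cdot\rangle$ is the bilinear pairing. A linear map $T:\mathscr S_P\to\mathscr S'$ is continuous if there is $\mathcal K\in\mathscr S'(\mathbb R^{2n})$ with $\langle Tf,g\rangle=\langle\mathcal K,g\otimes f\rangle=\int\mathcal K(x,y)g(x)f(y)\,dy\,dx$ (formal integral) for $f\in\mathscr S_P,g\in\mathscr S$. "$T$ and $T^*$ are continuous from $\mathscr S_P$ into $\mathscr S'$" means $T$ is, and there is another operator $T^*$ (the transpose), also continuous from $\mathscr S_P$ into $\mathscr S'$, with $\langle Tf,g\rangle=\langle T^*g,f\rangle$ for $f,g\in\mathscr S_P$. $SIO_\nu(M+\gamma)$ ($\nu\in\mathbb R$, $M\in\mathbb N_0$, $0<\gamma\le1$): linear operators $T$ such that, for some $P\in\mathbb N_0$, $T$ and $T^*$ are continuous from $\mathscr S_P$ into $\mathscr S'$, and there is a function $K(x,y)$ with $\langle Tf,g\rangle=\int_{\mathbb R^{2n}}K(x,y)f(y)g(x)\,dy\,dx$ for all $(f,g)\in\mathcal D_P\times C_0^\infty$ or $(f,g)\in C_0^\infty\times\mathcal D_P$ with disjoint supports, $|D_x^\alpha D_y^\beta K(x,y)|\lesssim|x-y|^{-(n+\nu+|\alpha|+|\beta|)}$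 for $x\ne y$, $|\alpha|+|\beta|\le M$, and $|D_x^\alpha D_y^\beta K(x+h,y)-D_x^\alpha D_y^\beta K(x,y)|+|D_x^\alpha D_y^\beta K(x,y)-D_x^\alpha D_y^\beta K(x,y+h)|\lesssim|h|^\gamma|x-y|^{-(n+\nu+M+\gamma)}$ for $|h|<|x-y|/2$, $|\alpha|+|\beta|=M$. $WBP_\nu$: $T\in SIO_\nu$ satisfies $WBP_\nu$ if there are integers $M',N\ge0$ and $C>0$ with $|\langle T\psi,\varphi\rangle|+|\langle T^*\psi,\varphi\rangle|\le C|B|^{1-\nu/n}$ for every ball $B$ and all $\psi\in\mathcal D_{M'}$, $\varphi\in C_0^\infty$ supported in $B$ with $\|D^\alpha\psi\|_{L^\infty},\|D^\alpha\varphi\|_{L^\infty}\le|B|^{-|\alpha|/n}$ for $|\alpha|\le N$. Moments: for $T\in SIO_\nu(M+\gamma)$, let $P$ be as in the definition of $SIO_\nu(M+\gamma)$, taken so that $P\ge M+|\nu|$, let $\eta\in\mathcal D_{2P}$ with $\eta=1$ on $B(0,1)$, $\eta_R(x)=\eta(x/R)$. For $|\alpha|<M+\nu+\gamma$, $\langle T(x^\alpha),\psi\rangle=\lim_{R\to\infty}\langle T(x^\alpha\eta_R),\psi\rangle$ for $\psi\in\mathcal D_P$ (well defined, independent of $\eta$). $T(x^\alpha)=0$ means that for some integer $P\ge0$, $T(x^\alpha)=0$ in $\mathcal D_P'$. $T^*(x^\alpha)$ is defined in the same way with $T^*$ in place of $T$. Other notation: $\psi_k(x)=2^{kn}\psi(2^kx)$;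 $\psi_k*Tf(x)=\langle Tf,\psi_k(x-\cdot)\rangle$; $\Phi_k^N(x)=2^{kn}(1+2^k|x|)^{-N}$; $A\lesssim B$ means $A\le CB$ with $C$ independent of $k,x,y,h$. *)

theory Defs
  imports "HOL-Analysis.Analysis"
begin

text \<open>
  \<open>\<real>\<^sup>n\<close> is an arbitrary Euclidean space \<open>'a\<close> with \<open>n = DIM('a)\<close>, and \<open>\<real>\<^sup>2\<^sup>n\<close> is \<open>'a \<times> 'a\<close>.
  A multi-index assigns an exponent to every vector of the orthonormal \<open>Basis\<close>; its values outside
  \<open>Basis\<close> are never used. All functions are complex valued.
\<close>

type_synonym 'a multi_index = "'a \<Rightarrow> nat"
type_synonym 'a cfun = "'a \<Rightarrow> complex"

definition mi_order :: "('a::euclidean_space) multi_index \<Rightarrow> nat" where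
  "mi_order \<alpha> = (\<Sum>b\<in>Basis. \<alpha> b)"

definition mi_power :: "('a::euclidean_space) multi_index \<Rightarrow> 'a \<Rightarrow> real" where
  "mi_power \<alpha> x = (\<Prod>b\<in>Basis. (x \<bullet> b) ^ \<alpha> b)"

definition partial_deriv :: "'a::euclidean_space \<Rightarrow> 'a cfun \<Rightarrow> 'a cfun" where
  "partial_deriv b f x = vector_derivative (\<lambda>t. f (x + t *\<^sub>R b)) (at 0)"

primrec C_k_on :: "nat \<Rightarrow> ('a::euclidean_space) set \<Rightarrow> 'a cfun \<Rightarrow> bool" where
  "C_k_on 0 S f \<longleftrightarrow> continuous_on S f"
| "C_k_on (Suc k) S f \<longleftrightarrow> continuous_on S f \<and>
     (\<forall>b\<in>Basis. (\<forall>x\<in>S. (\<lambda>t. f (x + t *\<^sub>R b)) differentiable (at 0)) \<and>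
                 C_k_on k S (partial_deriv b f))"

text \<open>
  The partial derivatives are taken in an arbitrary fixed order of the coordinates. The order is
  immaterial: \<open>mi_deriv \<alpha>\<close> is only ever used together with continuous differentiability up to
  order \<open>|\<alpha>|\<close>.
\<close>

definition basis_list :: "('a::euclidean_space) list" where
  "basis_list = (SOME bs. distinct bs \<and> set bs = Basis)"

lemma basis_list: "distinct (basis_list :: 'a::euclidean_space list)"
  "set (basis_list :: 'a list) = Basis"
proof -
  have "\<exists>bs :: 'a list. distinct bs \<and> set bs = Basis"
    using finite_distinct_list[OF finite_Basis] by blast
  then have "distinct (basis_list :: 'a list) \<and> set (basis_list :: 'a list) = Basis"
    unfolding basis_list_def by (rule someI_ex)
  then show "distinct (basis_list :: 'a list)" "set (basis_list :: 'a list) = Basis" by auto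
qed

definition mi_deriv :: "('a::euclidean_space) multi_index \<Rightarrow> 'a cfun \<Rightarrow> 'a cfun" where
  "mi_deriv \<alpha> f = foldr (\<lambda>b g. (partial_deriv b ^^ \<alpha> b) g) basis_list f"

definition fsupport :: "('a::euclidean_space) cfun \<Rightarrow> 'a set" where
  "fsupport f = closure {x. f x \<noteq> 0}"

definition smooth :: "('a::euclidean_space) cfun \<Rightarrow> bool" where
  "smooth f \<longleftrightarrow> (\<forall>k. C_k_on k UNIV f)"

definition schwartz :: "('a::euclidean_space) cfun set" where
  "schwartz = {f. smooth f \<and> (\<forall>\<alpha> \<beta>. bounded (range (\<lambda>x. mi_power \<alpha> x *\<^sub>R mi_deriv \<beta> f x)))}"

definition test_fun :: "('a::euclidean_space) cfun set" where
  "test_fun = {f. smooth f \<and> compact (fsupport f)}"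

definition vanishing_moments :: "nat \<Rightarrow> ('a::euclidean_space) cfun \<Rightarrow> bool" where
  "vanishing_moments P f \<longleftrightarrow>
     (\<forall>\<alpha>. mi_order \<alpha> \<le> P \<longrightarrow> (LINT x|lborel. f x * complex_of_real (mi_power \<alpha> x)) = 0)"

definition schwartz_vm :: "nat \<Rightarrow> ('a::euclidean_space) cfun set" where
  "schwartz_vm P = {f \<in> schwartz. vanishing_moments P f}"

definition test_vm :: "nat \<Rightarrow> ('a::euclidean_space) cfun set" where
  "test_vm P = {f \<in> test_fun. vanishing_moments P f}"

definition linear_functional_on :: "('a::euclidean_space) cfun set \<Rightarrow> ('a cfun \<Rightarrow> complex) \<Rightarrow> bool" where
  "linear_functional_on V u \<longleftrightarrow>
     (\<forall>f\<in>V. \<forall>g\<in>V. u (\<lambda>x. f x + g x) = u f + u g) \<and>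
     (\<forall>f\<in>V. \<forall>c. u (\<lambda>x. c * f x) = c * u f)"

definition schwartz_seminorm :: "nat \<Rightarrow> ('a::euclidean_space) cfun \<Rightarrow> real" where
  "schwartz_seminorm N f =
     Sup {norm (mi_power \<alpha> x *\<^sub>R mi_deriv \<beta> f x) | \<alpha> \<beta> x. mi_order \<alpha> \<le> N \<and> mi_order \<beta> \<le> N}"

text \<open>
  Tempered distributions: linear functionals on the Schwartz class, continuous for the Frechet
  topology given by the increasing family \<open>schwartz_seminorm\<close>.
\<close>

definition tempered :: "(('a::euclidean_space) cfun \<Rightarrow> complex) \<Rightarrow> bool" where
  "tempered u \<longleftrightarrow> linear_functional_on schwartz u \<and>
     (\<exists>C N. \<forall>f\<in>schwartz. norm (u f) \<le> C * schwartz_seminorm N f)"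

text \<open>
  An operator is represented by its bilinear pairing: \<open>T f g\<close> is \<open>\<langle>Tf, g\<rangle>\<close>. Its values matter only for
  those \<open>f\<close> on which the operator is defined, i.e. \<open>f \<in> schwartz_vm P\<close> with \<open>P\<close> as below.
\<close>

type_synonym 'a operator = "'a cfun \<Rightarrow> 'a cfun \<Rightarrow> complex"

definition tensor :: "('a::euclidean_space) cfun \<Rightarrow> 'a cfun \<Rightarrow> ('a \<times> 'a) cfun" where
  "tensor g f = (\<lambda>(x, y). g x * f y)"

definition continuous_op :: "nat \<Rightarrow> ('a::euclidean_space) operator \<Rightarrow> bool" where
  "continuous_op P T \<longleftrightarrow>
     (\<forall>f\<in>schwartz_vm P. tempered (T f)) \<and>
     (\<forall>g\<in>schwartz. linear_functional_on (schwartz_vm P) (\<lambda>f. T f g)) \<and>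
     (\<exists>\<K>. tempered \<K> \<and> (\<forall>f\<in>schwartz_vm P. \<forall>g\<in>schwartz. T f g = \<K> (tensor g f)))"

definition continuous_with_transpose ::
    "nat \<Rightarrow> ('a::euclidean_space) operator \<Rightarrow> 'a operator \<Rightarrow> bool" where
  "continuous_with_transpose P T Tt \<longleftrightarrow>
     continuous_op P T \<and> continuous_op P Tt \<and>
     (\<forall>f\<in>schwartz_vm P. \<forall>g\<in>schwartz_vm P. T f g = Tt g f)"

definition mixed_deriv :: "('a::euclidean_space) multi_index \<Rightarrow> 'a multi_index \<Rightarrow>
    ('a \<Rightarrow> 'a \<Rightarrow> complex) \<Rightarrow> 'a \<Rightarrow> 'a \<Rightarrow> complex" where
  "mixed_deriv \<alpha> \<beta> K x y = mi_deriv \<alpha> (\<lambda>x'. mi_deriv \<beta> (K x') y) x"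

definition standard_kernel ::
    "real \<Rightarrow> nat \<Rightarrow> real \<Rightarrow> (('a::euclidean_space) \<Rightarrow> 'a \<Rightarrow> complex) \<Rightarrow> bool" where
  "standard_kernel \<nu> M \<gamma> K \<longleftrightarrow>
     C_k_on M {(x, y). x \<noteq> y} (\<lambda>(x, y). K x y) \<and>
     (\<exists>C. \<forall>\<alpha> \<beta> x y. mi_order \<alpha> + mi_order \<beta> \<le> M \<longrightarrow> x \<noteq> y \<longrightarrow>
        norm (mixed_deriv \<alpha> \<beta> K x y)
          \<le> C * norm (x - y) powr
              - (real DIM('a) + \<nu> + real (mi_order \<alpha>) + real (mi_order \<beta>))) \<and>
     (\<exists>C. \<forall>\<alpha> \<beta> x y h. mi_order \<alpha> + mi_order \<beta> = M \<longrightarrow> norm h < norm (x - y) / 2 \<longrightarrow>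
        norm (mixed_deriv \<alpha> \<beta> K (x + h) y - mixed_deriv \<alpha> \<beta> K x y)
        + norm (mixed_deriv \<alpha> \<beta> K x y - mixed_deriv \<alpha> \<beta> K x (y + h))
          \<le> C * norm h powr \<gamma> * norm (x - y) powr - (real DIM('a) + \<nu> + real M + \<gamma>))"

definition kernel_pairing ::
    "(('a::euclidean_space) \<Rightarrow> 'a \<Rightarrow> complex) \<Rightarrow> 'a cfun \<Rightarrow> 'a cfun \<Rightarrow> complex" where
  "kernel_pairing K f g = (LINT z|lborel. K (fst z) (snd z) * f (snd z) * g (fst z))"

text \<open>
  For \<open>f \<in> test_fun\<close> and \<open>g \<in> test_vm P\<close> the function \<open>f\<close> need not be in the domain of \<open>T\<close>; then
  \<open>\<langle>Tf, g\<rangle>\<close> means \<open>\<langle>T\<^sup>*g, f\<rangle>\<close>, which agrees with \<open>T f g\<close> when both functions have vanishing moments.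
\<close>

definition SIO_with ::
    "real \<Rightarrow> nat \<Rightarrow> real \<Rightarrow> nat \<Rightarrow> ('a::euclidean_space) operator \<Rightarrow> 'a operator \<Rightarrow> bool" where
  "SIO_with \<nu> M \<gamma> P T Tt \<longleftrightarrow>
     continuous_with_transpose P T Tt \<and>
     (\<exists>K. standard_kernel \<nu> M \<gamma> K \<and>
        (\<forall>f\<in>test_vm P. \<forall>g\<in>test_fun. fsupport f \<inter> fsupport g = {} \<longrightarrow>
            T f g = kernel_pairing K f g) \<and>
        (\<forall>f\<in>test_fun. \<forall>g\<in>test_vm P. fsupport f \<inter> fsupport g = {} \<longrightarrow>
            Tt g f = kernel_pairing K f g))"

definition SIO :: "real \<Rightarrow> nat \<Rightarrow> real \<Rightarrow> ('a::euclidean_space) operator \<Rightarrow> 'a operator \<Rightarrow> bool" where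
  "SIO \<nu> M \<gamma> T Tt \<longleftrightarrow> (\<exists>P. SIO_with \<nu> M \<gamma> P T Tt)"

text \<open>
  The weak boundedness property. The first conjunct says that \<open>T\<close> and \<open>T\<^sup>*\<close> are defined on
  \<open>test_vm M'\<close>; the estimate for some \<open>M'\<close> implies the one for every larger \<open>M'\<close>.
\<close>

definition WBP :: "real \<Rightarrow> ('a::euclidean_space) operator \<Rightarrow> 'a operator \<Rightarrow> bool" where
  "WBP \<nu> T Tt \<longleftrightarrow>
     (\<exists>M' N C. C > 0 \<and> continuous_with_transpose M' T Tt \<and>
       (\<forall>c r. r > 0 \<longrightarrow>
         (\<forall>\<psi>\<in>test_vm M'. \<forall>\<phi>\<in>test_fun.
            fsupport \<psi> \<subseteq> ball c r \<longrightarrow> fsupport \<phi> \<subseteq> ball c r \<longrightarrow>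
            (\<forall>\<alpha> x. mi_order \<alpha> \<le> N \<longrightarrow>
               norm (mi_deriv \<alpha> \<psi> x)
                 \<le> measure lborel (ball c r) powr - (real (mi_order \<alpha>) / real DIM('a)) \<and>
               norm (mi_deriv \<alpha> \<phi> x)
                 \<le> measure lborel (ball c r) powr - (real (mi_order \<alpha>) / real DIM('a))) \<longrightarrow>
            norm (T \<psi> \<phi>) + norm (Tt \<psi> \<phi>)
              \<le> C * measure lborel (ball c r) powr (1 - \<nu> / real DIM('a)))))"

text \<open>
  \<open>T(x\<^sup>\<alpha>) = 0\<close>, for \<open>|\<alpha>| < M + \<nu> + \<gamma>\<close>. As \<open>\<eta>\<close> has vanishing moments up to order \<open>2P\<close> and
  \<open>|\<alpha>| \<le> P\<close>, the functions \<open>x\<^sup>\<alpha> \<eta>(x/R)\<close> lie in \<open>test_vm P\<close>. The limit does not depend on the choice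
  of \<open>\<eta>\<close>. The condition \<open>T\<^sup>*(x\<^sup>\<alpha>) = 0\<close> is obtained by interchanging \<open>T\<close> and \<open>Tt\<close>: if \<open>T\<close> has
  kernel \<open>K(x, y)\<close>, then \<open>T\<^sup>*\<close> has kernel \<open>K(y, x)\<close>.
\<close>

definition monomial_vanishes :: "real \<Rightarrow> nat \<Rightarrow> real \<Rightarrow>
    ('a::euclidean_space) operator \<Rightarrow> 'a operator \<Rightarrow> 'a multi_index \<Rightarrow> bool" where
  "monomial_vanishes \<nu> M \<gamma> T Tt \<alpha> \<longleftrightarrow>
     (\<exists>P. SIO_with \<nu> M \<gamma> P T Tt \<and> real M + \<bar>\<nu>\<bar> \<le> real P \<and>
       (\<exists>\<eta>\<in>test_vm (2 * P). (\<forall>x\<in>ball 0 1. \<eta> x = 1) \<and>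
         (\<exists>Q\<ge>P. \<forall>\<psi>\<in>test_vm Q.
            ((\<lambda>R::real. T (\<lambda>x. complex_of_real (mi_power \<alpha> x) * \<eta> (x /\<^sub>R R)) \<psi>) \<longlongrightarrow> 0) at_top)))"

definition dilate :: "int \<Rightarrow> ('a::euclidean_space) cfun \<Rightarrow> 'a cfun" where
  "dilate k \<psi> x =
     complex_of_real (2 powr (real_of_int k * real DIM('a))) * \<psi> ((2 powr real_of_int k) *\<^sub>R x)"

definition conv_op :: "('a::euclidean_space) cfun \<Rightarrow> 'a operator \<Rightarrow> 'a cfun \<Rightarrow> 'a cfun" where
  "conv_op \<phi> T f x = T f (\<lambda>y. \<phi> (x - y))"

definition bump :: "int \<Rightarrow> real \<Rightarrow> 'a::euclidean_space \<Rightarrow> real" where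
  "bump k N x =
     2 powr (real_of_int k * real DIM('a)) * (1 + 2 powr real_of_int k * norm x) powr - N"

end

theory Submission
  imports Defs
begin

text \<open>
  Let \<open>u\<^sub>t\<^sup>x = T\<^sup>*\<psi>\<^sub>t\<^sup>x\<close> with \<open>\<psi>\<^sub>t\<^sup>x(z) = \<psi>((x - z)/t)\<close> and \<open>t = 2\<^sup>-\<^sup>k\<close>. The kernel function \<open>\<theta>\<^sub>k(x, \<cdot>)\<close> is the density
  of the distribution \<open>u\<^sub>t\<^sup>x\<close>, up to the factor \<open>2\<^sup>k\<^sup>n\<close>. Take \<open>\<kappa>\<close> of mass one whose moments of order
  \<open>1, \<dots>, P\<close> vanish; then \<open>\<chi> = 2\<^sup>n \<kappa>(2\<cdot>) - \<kappa>\<close> has vanishing moments up to order \<open>P\<close>, and the density is the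
  limit of the mollifications of \<open>u\<^sub>t\<^sup>x\<close> by \<open>\<kappa>\<close> at the scales \<open>2\<^sup>-\<^sup>jt\<close>, that is, a telescoping series
  whose terms are, up to normalisation, the pairings of \<open>u\<^sub>t\<^sup>x\<close> with translates of \<open>\<chi>\<close> at scale
  \<open>s = 2\<^sup>-\<^sup>jt\<close>.

  Such a pairing equals \<open>\<langle>T\<chi>\<^sub>s\<^sup>y, \<psi>\<^sub>t\<^sup>x\<rangle>\<close>. As \<open>T\<^sup>*\<close> annihilates polynomials of degree \<open>L\<close>, the Taylor polynomial
  of \<open>\<psi>\<^sub>t\<^sup>x\<close> at \<open>y\<close> may be subtracted; the remainder is paired with \<open>T\<chi>\<^sub>s\<^sup>y\<close> by weak boundedness near \<open>y\<close>
  and by the kernel, together with the moments of \<open>\<chi>\<close>, away from \<open>y\<close>. This gains \<open>(s/t)\<^sup>L\<^sup>-\<^sup>\<nu>\<^sup>+\<^sup>d\<close> for every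
  \<open>d < \<gamma>\<close>. A derivative in \<open>y\<close> costs a factor \<open>1/s\<close>, so the series may be differentiated
  \<open>\<lfloor>L - \<nu>\<rfloor>\<close> times, and interpolation between consecutive derivatives of the terms gives the Hoelder estimate.
\<close>

subsection \<open>Iterated partial derivatives\<close>

text \<open>Three obstacles shape the proof. The polynomial subtracted from
  \<open>scl x t \<psi>\<close> is not a test function, so it is cut off at radius R, and what
  remains far from y is integrated against the kernel before R tends to infinity. That integrand
  decays like |u - y| to the power L + d - N, with N = n + \<nu> + M + \<gamma>; convergence in the
  extreme case L = M + \<nu> requires d < \<gamma>, and this is the origin of the loss \<gamma>' <
  \<gamma>. Next, \<kappa> has mass one and so lies outside the domain of T. All terms of the series
  are therefore read as values of the functional \<open>Tt (scl x t \<psi>)\<close>, which acts on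
  every test function; only the differences, built from \<chi>, are moved back to T. Finally, one
  derivative more than the series admits gives the i-th term a factor as large as 2 to the power i(1
  - d). Interpolation with exponent g against the convergent bound leaves 2 to the power -i(d - g),
  so d is taken between g and \<gamma>. A Schwartz function is reached by cut-off: its truncations
  lose their vanishing moments, which is harmless for a functional that is tempered on the whole
  Schwartz class.\<close>

abbreviation pd :: "('a::euclidean_space) list \<Rightarrow> 'a cfun \<Rightarrow> 'a cfun" where
  "pd w f \<equiv> foldr partial_deriv w f"

definition coord_diff :: "'a::euclidean_space \<Rightarrow> 'a cfun \<Rightarrow> 'a \<Rightarrow> bool" where
  "coord_diff b f x \<longleftrightarrow> (\<lambda>t. f (x + t *\<^sub>R b)) differentiable (at 0)"

lemma C_k_on_Suc:
  "C_k_on (Suc k) S f \<longleftrightarrow> continuous_on S f \<and>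
     (\<forall>b\<in>Basis. (\<forall>x\<in>S. coord_diff b f x) \<and> C_k_on k S (partial_deriv b f))"
  by (simp add: coord_diff_def)

declare C_k_on.simps(2) [simp del] C_k_on_Suc [simp]

section \<open>Calculus of coordinate derivatives and of the classes C^k\<close>

lemma coord_diff_vector_derivative:
  "coord_diff b f x \<longleftrightarrow> ((\<lambda>t. f (x + t *\<^sub>R b)) has_vector_derivative partial_deriv b f x) (at 0)"
  unfolding partial_deriv_def coord_diff_def using vector_derivative_works by blast

lemma coord_vector_derivative_at:
  assumes "coord_diff b f (x + t *\<^sub>R b)"
  shows "((\<lambda>s. f (x + s *\<^sub>R b)) has_vector_derivative partial_deriv b f (x + t *\<^sub>R b)) (at t within S)"
proof -
  have "((\<lambda>s. f ((x + t *\<^sub>R b) + s *\<^sub>R b)) has_vector_derivative partial_deriv b f (x + t *\<^sub>R b)) (at (t - t))"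
    using iffD1[OF coord_diff_vector_derivative assms] by simp
  moreover have "((\<lambda>s. s - t) has_vector_derivative 1) (at t within S)"
    by (auto intro!: derivative_eq_intros)
  ultimately have "((\<lambda>s. f ((x + t *\<^sub>R b) + s *\<^sub>R b)) \<circ> (\<lambda>s. s - t) has_vector_derivative
      1 *\<^sub>R partial_deriv b f (x + t *\<^sub>R b)) (at t within S)"
    by (intro vector_diff_chain_within) (auto intro: has_vector_derivative_at_within)
  then show ?thesis by (simp add: o_def algebra_simps)
qed

lemma partial_deriv_eqI:
  assumes "((\<lambda>t. f (x + t *\<^sub>R b)) has_vector_derivative D) (at 0)"
  shows "coord_diff b f x" "partial_deriv b f x = D"
  using assms unfolding partial_deriv_def coord_diff_def
  by (auto intro: vector_derivative_at differentiableI_vector)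

lemma eventually_on_open_line:
  fixes x b :: "'a::real_normed_vector"
  assumes "open S" "x \<in> S"
  shows "\<forall>\<^sub>F t in nhds 0. x + t *\<^sub>R b \<in> S"
proof -
  have "((\<lambda>t. x + t *\<^sub>R b) \<longlongrightarrow> x + 0 *\<^sub>R b) (nhds 0)"
    by (intro tendsto_add tendsto_scaleR tendsto_const filterlim_ident)
  then show ?thesis using assms topological_tendstoD by fastforce
qed

lemma partial_deriv_cong_open:
  assumes "open S" "x \<in> S" "\<And>z. z \<in> S \<Longrightarrow> f z = g z"
  shows "coord_diff b f x \<longleftrightarrow> coord_diff b g x" "partial_deriv b f x = partial_deriv b g x"
proof -
  have ev: "\<forall>\<^sub>F t in nhds 0. f (x + t *\<^sub>R b) = g (x + t *\<^sub>R b)"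
    using eventually_on_open_line[OF assms(1,2)] by eventually_elim (use assms(3) in auto)
  have h: "((\<lambda>t. f (x + t *\<^sub>R b)) has_vector_derivative D) (at 0) \<longleftrightarrow>
        ((\<lambda>t. g (x + t *\<^sub>R b)) has_vector_derivative D) (at 0)" for D
    using ev by (intro has_vector_derivative_cong_ev) (auto elim: eventually_mono simp: assms)
  show "coord_diff b f x \<longleftrightarrow> coord_diff b g x"
    by (metis h coord_diff_vector_derivative partial_deriv_eqI(1))
  show "partial_deriv b f x = partial_deriv b g x"
    unfolding partial_deriv_def vector_derivative_def h ..
qed

lemma C_k_on_continuous: "C_k_on k S f \<Longrightarrow> continuous_on S f"
  by (cases k) auto

lemma C_k_on_cong:
  assumes "open S" "\<And>z. z \<in> S \<Longrightarrow> f z = g z"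
  shows "C_k_on k S f \<longleftrightarrow> C_k_on k S g"
  using assms(2)
proof (induction k arbitrary: f g)
  case 0
  then show ?case by (auto cong: continuous_on_cong)
next
  case (Suc k)
  have "C_k_on k S (partial_deriv b f) \<longleftrightarrow> C_k_on k S (partial_deriv b g)" for b
    by (intro Suc.IH partial_deriv_cong_open(2)[OF assms(1)] Suc.prems)
  moreover have "coord_diff b f x \<longleftrightarrow> coord_diff b g x" if "x \<in> S" for b x
    by (intro partial_deriv_cong_open(1)[OF assms(1)] Suc.prems that)
  moreover have "continuous_on S f \<longleftrightarrow> continuous_on S g"
    using Suc.prems by (auto cong: continuous_on_cong)
  ultimately show ?case by simp
qed

lemma C_k_on_Suc_imp: "C_k_on (Suc k) S f \<Longrightarrow> C_k_on k S f"
  by (induction k arbitrary: f) auto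

lemma C_k_on_le: "C_k_on k S f \<Longrightarrow> l \<le> k \<Longrightarrow> C_k_on l S f"
proof (induction k)
  case (Suc k)
  then show ?case using C_k_on_Suc_imp[of k S f] by (cases "l = Suc k") auto
qed simp

lemma C_k_on_subset: "C_k_on k S f \<Longrightarrow> U \<subseteq> S \<Longrightarrow> C_k_on k U f"
  by (induction k arbitrary: f) (auto intro: continuous_on_subset)

lemma C_k_on_SucD:
  assumes "C_k_on (Suc k) S f" "b \<in> Basis"
  shows "C_k_on k S (partial_deriv b f)" "x \<in> S \<Longrightarrow> coord_diff b f x"
  using assms by auto

lemma pd_cong_open:
  assumes "open S" "\<And>z. z \<in> S \<Longrightarrow> f z = g z" "x \<in> S"
  shows "pd w f x = pd w g x"
  using assms(3)
proof (induction w arbitrary: x)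
  case (Cons b w)
  then show ?case
    using partial_deriv_cong_open(2)[OF assms(1) Cons.prems Cons.IH] by simp
qed (use assms in auto)

lemma C_k_on_pd:
  assumes "C_k_on (length w + k) S f" "set w \<subseteq> Basis"
  shows "C_k_on k S (pd w f)"
  using assms
proof (induction w arbitrary: k)
  case (Cons b w)
  then show ?case using Cons.IH[of "Suc k"] C_k_on_SucD(1)[of k S "pd w f" b] by simp
qed auto

lemma partial_deriv_add:
  assumes "coord_diff b f x" "coord_diff b g x"
  shows "coord_diff b (\<lambda>z. f z + g z) x"
    "partial_deriv b (\<lambda>z. f z + g z) x = partial_deriv b f x + partial_deriv b g x"
  using partial_deriv_eqI[of "\<lambda>z. f z + g z", OF
      has_vector_derivative_add[OF assms[unfolded coord_diff_vector_derivative]]] by blast+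

lemma partial_deriv_mult:
  assumes "coord_diff b f x" "coord_diff b g x"
  shows "coord_diff b (\<lambda>z. f z * g z) x"
    "partial_deriv b (\<lambda>z. f z * g z) x = f x * partial_deriv b g x + partial_deriv b f x * g x"
proof -
  have "((\<lambda>t. f (x + t *\<^sub>R b) * g (x + t *\<^sub>R b)) has_vector_derivative
      f (x + 0 *\<^sub>R b) * partial_deriv b g x + partial_deriv b f x * g (x + 0 *\<^sub>R b)) (at 0)"
    using assms[unfolded coord_diff_vector_derivative] by (intro has_vector_derivative_mult) auto
  then show "coord_diff b (\<lambda>z. f z * g z) x"
    "partial_deriv b (\<lambda>z. f z * g z) x = f x * partial_deriv b g x + partial_deriv b f x * g x"
    using partial_deriv_eqI[of "\<lambda>z. f z * g z"] by auto
qed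

lemma partial_deriv_const: "coord_diff b (\<lambda>z. c) x" "partial_deriv b (\<lambda>z. c) = (\<lambda>z. 0)"
  by (auto intro!: partial_deriv_eqI derivative_eq_intros ext)

lemma partial_deriv_cmult:
  assumes "coord_diff b f x"
  shows "coord_diff b (\<lambda>z. c * f z) x"
    "partial_deriv b (\<lambda>z. c * f z) x = c * partial_deriv b f x"
  using partial_deriv_mult[OF partial_deriv_const(1)[of b c x] assms] by (auto simp: partial_deriv_const(2))

lemma C_k_on_const: "C_k_on k S (\<lambda>z. c)"
  by (induction k arbitrary: c) (auto simp: partial_deriv_const)

lemma C_k_on_add:
  assumes "open S" "C_k_on k S f" "C_k_on k S g"
  shows "C_k_on k S (\<lambda>z. f z + g z)"
  using assms(2,3)
proof (induction k arbitrary: f g)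
  case (Suc k)
  have "C_k_on k S (partial_deriv b (\<lambda>z. f z + g z))" if "b \<in> Basis" for b
    using Suc.IH[of "partial_deriv b f" "partial_deriv b g"] Suc.prems that
    by (subst C_k_on_cong[OF assms(1), where g="\<lambda>z. partial_deriv b f z + partial_deriv b g z"])
      (auto simp: partial_deriv_add)
  then show ?case using Suc.prems by (auto intro!: continuous_intros partial_deriv_add)
qed (auto intro!: continuous_intros)

lemma C_k_on_mult:
  assumes "open S" "C_k_on k S f" "C_k_on k S g"
  shows "C_k_on k S (\<lambda>z. f z * g z)"
  using assms(2,3)
proof (induction k arbitrary: f g)
  case (Suc k)
  have "C_k_on k S (partial_deriv b (\<lambda>z. f z * g z))" if "b \<in> Basis" for b
    using Suc.IH[of f "partial_deriv b g"] Suc.IH[of "partial_deriv b f" g]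
      Suc.prems that C_k_on_Suc_imp[of k S f] C_k_on_Suc_imp[of k S g]
    by (subst C_k_on_cong[OF assms(1),
          where g="\<lambda>z. f z * partial_deriv b g z + partial_deriv b f z * g z"])
      (auto simp: partial_deriv_mult intro!: C_k_on_add[OF assms(1)])
  then show ?case using Suc.prems by (auto intro!: continuous_intros partial_deriv_mult)
qed (auto intro!: continuous_intros)

lemma partial_deriv_affine:
  assumes "coord_diff b f (c *\<^sub>R x + y)"
  shows "coord_diff b (\<lambda>z. f (c *\<^sub>R z + y)) x"
    "partial_deriv b (\<lambda>z. f (c *\<^sub>R z + y)) x = of_real c * partial_deriv b f (c *\<^sub>R x + y)"
proof -
  have "((\<lambda>s. f ((c *\<^sub>R x + y) + s *\<^sub>R b)) has_vector_derivative partial_deriv b f (c *\<^sub>R x + y)) (at (c * 0))"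
    using iffD1[OF coord_diff_vector_derivative assms] by simp
  moreover have "((\<lambda>s. c * s) has_vector_derivative c) (at 0)"
    by (auto intro!: derivative_eq_intros)
  ultimately have "((\<lambda>s. f ((c *\<^sub>R x + y) + s *\<^sub>R b)) \<circ> (\<lambda>s. c * s) has_vector_derivative
      c *\<^sub>R partial_deriv b f (c *\<^sub>R x + y)) (at 0)"
    by (intro vector_diff_chain_at)
  then have *: "((\<lambda>s. f (c *\<^sub>R (x + s *\<^sub>R b) + y)) has_vector_derivative
      of_real c * partial_deriv b f (c *\<^sub>R x + y)) (at 0)"
    by (simp add: o_def algebra_simps scaleR_conv_of_real)
  show "coord_diff b (\<lambda>z. f (c *\<^sub>R z + y)) x"
    "partial_deriv b (\<lambda>z. f (c *\<^sub>R z + y)) x = of_real c * partial_deriv b f (c *\<^sub>R x + y)"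
    using partial_deriv_eqI[OF *] by auto
qed

lemma smooth_partial_deriv: "smooth f \<Longrightarrow> b \<in> Basis \<Longrightarrow> smooth (partial_deriv b f)"
  unfolding smooth_def using C_k_on_SucD(1) by blast

lemma smooth_coord_diff: "smooth f \<Longrightarrow> b \<in> Basis \<Longrightarrow> coord_diff b f x"
  unfolding smooth_def using C_k_on_SucD(2)[of 0 UNIV f b x] by blast

lemma smooth_continuous: "smooth f \<Longrightarrow> continuous_on S f"
  unfolding smooth_def by (meson C_k_on_continuous continuous_on_subset subset_UNIV)

lemma smooth_C_k_on: "smooth f \<Longrightarrow> C_k_on k S f"
  unfolding smooth_def by (meson C_k_on_subset subset_UNIV)

lemma smooth_pd: "smooth f \<Longrightarrow> set w \<subseteq> Basis \<Longrightarrow> smooth (pd w f)"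
  by (induction w) (auto intro: smooth_partial_deriv)

lemma smooth_const: "smooth (\<lambda>z. c)"
  by (simp add: smooth_def C_k_on_const)

lemma smooth_add: "smooth f \<Longrightarrow> smooth g \<Longrightarrow> smooth (\<lambda>z. f z + g z)"
  by (simp add: smooth_def C_k_on_add)

lemma smooth_mult: "smooth f \<Longrightarrow> smooth g \<Longrightarrow> smooth (\<lambda>z. f z * g z)"
  by (simp add: smooth_def C_k_on_mult)

lemma smooth_cmult: "smooth f \<Longrightarrow> smooth (\<lambda>z. c * f z)"
  by (intro smooth_mult smooth_const)

lemma smooth_diff: "smooth f \<Longrightarrow> smooth g \<Longrightarrow> smooth (\<lambda>z. f z - g z)"
  using smooth_add[OF _ smooth_cmult[of g "-1"], of f] by simp

lemma smooth_sum: "(\<And>i. i \<in> I \<Longrightarrow> smooth (f i)) \<Longrightarrow> smooth (\<lambda>z. \<Sum>i\<in>I. f i z)"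
  by (induction I rule: infinite_finite_induct) (auto intro: smooth_add smooth_const)

lemma smooth_affine:
  assumes "smooth f" shows "smooth (\<lambda>z. f (c *\<^sub>R z + y))"
proof -
  have "C_k_on k UNIV (\<lambda>z. f (c *\<^sub>R z + y))" if "smooth f" for k f
    using that
  proof (induction k arbitrary: f)
    case 0
    then show ?case
      by (auto intro!: continuous_on_compose2[OF smooth_continuous[OF 0]] continuous_intros)
  next
    case (Suc k)
    have "partial_deriv b (\<lambda>z. f (c *\<^sub>R z + y)) = (\<lambda>x. of_real c * partial_deriv b f (c *\<^sub>R x + y))"
      if "b \<in> Basis" for b
      using partial_deriv_affine(2)[OF smooth_coord_diff[OF Suc.prems that]] by auto
    then show ?case
      using Suc.IH smooth_partial_deriv[OF Suc.prems] Suc.prems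
      by (auto intro!: continuous_on_compose2[OF smooth_continuous[OF Suc.prems]] continuous_intros
          C_k_on_mult C_k_on_const partial_deriv_affine smooth_coord_diff)
  qed
  then show ?thesis using assms by (simp add: smooth_def)
qed

lemma pd_add:
  assumes "open S" "C_k_on (length w) S f" "C_k_on (length w) S g" "set w \<subseteq> Basis" "x \<in> S"
  shows "pd w (\<lambda>z. f z + g z) x = pd w f x + pd w g x"
  using assms(2-5)
proof (induction w arbitrary: x)
  case (Cons b w)
  have ih: "pd w (\<lambda>z. f z + g z) z = pd w f z + pd w g z" if "z \<in> S" for z
    using Cons.prems that by (intro Cons.IH) (auto intro: C_k_on_Suc_imp simp del: C_k_on_Suc)
  have "coord_diff b (pd w f) x" "coord_diff b (pd w g) x"
    using C_k_on_pd[of w 1 S f] C_k_on_pd[of w 1 S g] C_k_on_SucD(2)[of 0 S _ b x] Cons.prems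
    by (auto simp del: C_k_on_Suc)
  then show ?case
    using partial_deriv_cong_open(2)[OF assms(1) \<open>x \<in> S\<close> ih, where b=b] partial_deriv_add(2) by auto
qed auto

lemma pd_cmult:
  assumes "open S" "C_k_on (length w) S f" "set w \<subseteq> Basis" "x \<in> S"
  shows "pd w (\<lambda>z. c * f z) x = c * pd w f x"
  using assms(2-4)
proof (induction w arbitrary: x)
  case (Cons b w)
  have ih: "pd w (\<lambda>z. c * f z) z = c * pd w f z" if "z \<in> S" for z
    using Cons.prems that by (intro Cons.IH) (auto intro: C_k_on_Suc_imp simp del: C_k_on_Suc)
  have "coord_diff b (pd w f) x"
    using C_k_on_pd[of w 1 S f] C_k_on_SucD(2)[of 0 S _ b x] Cons.prems
    by (auto simp del: C_k_on_Suc)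
  then show ?case
    using partial_deriv_cong_open(2)[OF assms(1) \<open>x \<in> S\<close> ih, where b=b] partial_deriv_cmult(2) by auto
qed auto

lemma pd_diff:
  assumes "open S" "C_k_on (length w) S f" "C_k_on (length w) S g" "set w \<subseteq> Basis" "x \<in> S"
  shows "pd w (\<lambda>z. f z - g z) x = pd w f x - pd w g x"
proof -
  have "C_k_on (length w) S (\<lambda>z. - 1 * g z)"
    using assms by (intro C_k_on_mult C_k_on_const) auto
  then show ?thesis
    using pd_add[OF assms(1,2) _ assms(4,5), of "\<lambda>z. - 1 * g z"] pd_cmult[OF assms(1,3,4,5), where c="-1"]
    by simp
qed

lemma pd_affine:
  assumes "smooth f" "set w \<subseteq> Basis"
  shows "pd w (\<lambda>z. f (c *\<^sub>R z + y)) x = of_real c ^ length w * pd w f (c *\<^sub>R x + y)"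
  using assms(2)
proof (induction w arbitrary: x)
  case (Cons b w)
  have sm: "smooth (pd w f)" using Cons assms smooth_pd by auto
  have "pd w (\<lambda>z. f (c *\<^sub>R z + y)) = (\<lambda>x. of_real c ^ length w * pd w f (c *\<^sub>R x + y))"
    using Cons by auto
  then show ?case
    using Cons.prems smooth_coord_diff[OF smooth_affine[OF sm], where b=b]
      partial_deriv_affine(2)[OF smooth_coord_diff[OF sm], where b=b]
    by (auto simp: partial_deriv_cmult)
qed auto

section \<open>Mean value estimates and symmetry of higher derivatives\<close>

lemma norm_increment_le:
  fixes g :: "real \<Rightarrow> complex"
  assumes "\<And>t. t \<in> closed_segment 0 d \<Longrightarrow> (g has_vector_derivative g' t) (at t)"
    and "\<And>t. t \<in> closed_segment 0 d \<Longrightarrow> norm (g' t - c) \<le> A"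
  shows "norm (g d - g 0 - d *\<^sub>R c) \<le> A * \<bar>d\<bar>"
proof -
  have "((\<lambda>t. g t - t *\<^sub>R c) has_vector_derivative g' t - c) (at t within closed_segment 0 d)"
    if "t \<in> closed_segment 0 d" for t
    using has_vector_derivative_at_within[OF assms(1)[OF that]]
    by (auto intro!: derivative_eq_intros)
  moreover have "onorm (\<lambda>h. h *\<^sub>R (g' t - c)) \<le> A" if "t \<in> closed_segment 0 d" for t
    using mult_right_mono[OF assms(2)[OF that] abs_ge_zero]
    by (intro onorm_le) (simp add: mult.commute)
  ultimately have "norm ((g d - d *\<^sub>R c) - (g 0 - 0 *\<^sub>R c)) \<le> A * norm (d - 0)"
    by (intro differentiable_bound[where S="closed_segment 0 d" and f'="\<lambda>t h. h *\<^sub>R (g' t - c)"])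
      (auto simp: has_vector_derivative_def)
  then show ?thesis by (simp add: algebra_simps)
qed


text \<open>The second difference of f over a square of side h is symmetric in the two directions.
  Two applications of the mean value inequality show that, divided by h^2, it tends to either of the
  two mixed derivatives.\<close>

lemma partial_deriv_commute:
  assumes "open S" "C_k_on 2 S f" "x \<in> S" "a \<in> Basis" "b \<in> Basis"
  shows "partial_deriv a (partial_deriv b f) x = partial_deriv b (partial_deriv a f) x"
proof -
  have C: "C_k_on 1 S (partial_deriv u f)" "C_k_on 0 S (partial_deriv v (partial_deriv u f))"
    "\<And>z. z \<in> S \<Longrightarrow> coord_diff u f z" "\<And>z. z \<in> S \<Longrightarrow> coord_diff v (partial_deriv u f) z"
    if "u \<in> Basis" "v \<in> Basis" for u v
    using assms(2) that by (auto simp: numeral_2_eq_2)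
  have key: "\<exists>d>0. \<forall>h. 0 < h \<and> h < d \<longrightarrow>
      norm (f (x + h *\<^sub>R u + h *\<^sub>R v) - f (x + h *\<^sub>R u) - f (x + h *\<^sub>R v) + f x
        - (h * h) *\<^sub>R partial_deriv v (partial_deriv u f) x) \<le> e * (h * h)"
    if e: "e > 0" and u: "u \<in> Basis" and v: "v \<in> Basis" for e u v
  proof -
    let ?c = "partial_deriv v (partial_deriv u f) x"
    have "continuous_on S (partial_deriv v (partial_deriv u f))"
      using C(2)[OF u v] by simp
    then have "isCont (partial_deriv v (partial_deriv u f)) x"
      using assms(1,3) continuous_on_eq_continuous_at by blast
    then obtain d1 where d1: "d1 > 0" "\<And>z. dist z x < d1 \<Longrightarrow> dist (partial_deriv v (partial_deriv u f) z) ?c < e"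
      using e unfolding continuous_at_eps_delta by blast
    obtain d2 where d2: "d2 > 0" "ball x d2 \<subseteq> S"
      using assms(1,3) openE by blast
    \<comment> \<open>Halved because the displacement along u and v can have length up to s + t,
      which is below 2 d.\<close>
    define d where "d = min d1 d2 / 2"
    have d: "d > 0" using d1 d2 by (simp add: d_def)
    have near: "x + s *\<^sub>R u + t *\<^sub>R v \<in> S \<and> norm (partial_deriv v (partial_deriv u f) (x + s *\<^sub>R u + t *\<^sub>R v) - ?c) \<le> e"
      if "0 \<le> s" "0 \<le> t" "s \<le> h" "t \<le> h" "h < d" for s t h
    proof -
      have "norm (s *\<^sub>R u + t *\<^sub>R v) \<le> s + t"
        using norm_triangle_ineq[of "s *\<^sub>R u" "t *\<^sub>R v"] that u v by simp
      also have "\<dots> < min d1 d2" using that by (simp add: d_def)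
      finally have "dist (x + s *\<^sub>R u + t *\<^sub>R v) x < min d1 d2"
        by (simp add: dist_norm add.assoc)
      then show ?thesis
        using d1(2)[of "x + s *\<^sub>R u + t *\<^sub>R v"] subsetD[OF d2(2), of "x + s *\<^sub>R u + t *\<^sub>R v"]
        by (simp add: dist_commute less_imp_le flip: dist_norm)
    qed
    have "norm (f (x + h *\<^sub>R u + h *\<^sub>R v) - f (x + h *\<^sub>R u) - f (x + h *\<^sub>R v) + f x
        - (h * h) *\<^sub>R ?c) \<le> e * (h * h)" if h: "0 < h" "h < d" for h
    proof -
      \<comment> \<open>Increment of the u-derivative in direction v, compared with h times the
        mixed derivative at x.\<close>
      have inner: "norm (partial_deriv u f (x + h *\<^sub>R v + t *\<^sub>R u) - partial_deriv u f (x + t *\<^sub>R u) - h *\<^sub>R ?c) \<le> e * h"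
        if t: "0 \<le> t" "t \<le> h" for t
      proof -
        have "norm (partial_deriv u f ((x + t *\<^sub>R u) + h *\<^sub>R v) - partial_deriv u f ((x + t *\<^sub>R u) + 0 *\<^sub>R v) - h *\<^sub>R ?c) \<le> e * \<bar>h\<bar>"
          using h t near[of t _ h]
          by (intro norm_increment_le[where g'="\<lambda>s. partial_deriv v (partial_deriv u f) ((x + t *\<^sub>R u) + s *\<^sub>R v)"]
              coord_vector_derivative_at C(4)[OF u v]) (auto simp: closed_segment_eq_real_ivl)
        then show ?thesis using h by (simp add: algebra_simps)
      qed
      \<comment> \<open>The second difference is the increment of g over the interval from 0 to h,
        and the derivative of g is the quantity estimated in \<open>inner\<close>.\<close>
      define g where "g s = f ((x + h *\<^sub>R v) + s *\<^sub>R u) - f (x + s *\<^sub>R u)" for s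
      have "norm (g h - g 0 - h *\<^sub>R (h *\<^sub>R ?c)) \<le> (e * h) * \<bar>h\<bar>"
      proof (rule norm_increment_le[where g'="\<lambda>s. partial_deriv u f ((x + h *\<^sub>R v) + s *\<^sub>R u) - partial_deriv u f (x + s *\<^sub>R u)"])
        fix t assume "t \<in> closed_segment 0 h"
        then have t: "0 \<le> t" "t \<le> h" using h by (auto simp: closed_segment_eq_real_ivl)
        have "x + h *\<^sub>R v + t *\<^sub>R u \<in> S" "x + t *\<^sub>R u \<in> S"
          using near[of t h h] near[of t 0 h] t h by (auto simp: algebra_simps)
        then show "(g has_vector_derivative partial_deriv u f ((x + h *\<^sub>R v) + t *\<^sub>R u) - partial_deriv u f (x + t *\<^sub>R u)) (at t)"
          unfolding g_def using C(3)[OF u u] by (intro has_vector_derivative_diff coord_vector_derivative_at) auto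
        show "norm (partial_deriv u f (x + h *\<^sub>R v + t *\<^sub>R u) - partial_deriv u f (x + t *\<^sub>R u) - h *\<^sub>R ?c) \<le> e * h"
          using inner t by blast
      qed
      then show ?thesis using h by (simp add: g_def algebra_simps)
    qed
    then show ?thesis using d by blast
  qed
  have "norm (partial_deriv b (partial_deriv a f) x - partial_deriv a (partial_deriv b f) x) \<le> e" if e: "e > 0" for e
  proof -
    have e2: "e / 2 > 0" using e by simp
    obtain d1 where d1: "d1 > 0" "\<And>h. 0 < h \<Longrightarrow> h < d1 \<Longrightarrow>
      norm (f (x + h *\<^sub>R a + h *\<^sub>R b) - f (x + h *\<^sub>R a) - f (x + h *\<^sub>R b) + f x
        - (h * h) *\<^sub>R partial_deriv b (partial_deriv a f) x) \<le> e / 2 * (h * h)"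
      using key[OF e2 assms(4,5)] by blast
    obtain d2 where d2: "d2 > 0" "\<And>h. 0 < h \<Longrightarrow> h < d2 \<Longrightarrow>
      norm (f (x + h *\<^sub>R b + h *\<^sub>R a) - f (x + h *\<^sub>R b) - f (x + h *\<^sub>R a) + f x
        - (h * h) *\<^sub>R partial_deriv a (partial_deriv b f) x) \<le> e / 2 * (h * h)"
      using key[OF e2 assms(5,4)] by blast
    define h where "h = min d1 d2 / 2"
    have h: "0 < h" "h < d1" "h < d2" using d1 d2 by (auto simp: h_def)
    define D where "D = f (x + h *\<^sub>R a + h *\<^sub>R b) - f (x + h *\<^sub>R a) - f (x + h *\<^sub>R b) + f x"
    have "D = f (x + h *\<^sub>R b + h *\<^sub>R a) - f (x + h *\<^sub>R b) - f (x + h *\<^sub>R a) + f x"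
      by (simp add: D_def add.commute add.left_commute)
    then have "norm (D - (h * h) *\<^sub>R partial_deriv b (partial_deriv a f) x) \<le> e / 2 * (h * h)"
      "norm (D - (h * h) *\<^sub>R partial_deriv a (partial_deriv b f) x) \<le> e / 2 * (h * h)"
      using d1(2)[OF h(1,2)] d2(2)[OF h(1,3)] D_def by (metis, metis)
    then have "norm ((h * h) *\<^sub>R partial_deriv b (partial_deriv a f) x - (h * h) *\<^sub>R partial_deriv a (partial_deriv b f) x) \<le> e * (h * h)"
      using norm_triangle_ineq4[of "D - (h * h) *\<^sub>R partial_deriv b (partial_deriv a f) x"
        "D - (h * h) *\<^sub>R partial_deriv a (partial_deriv b f) x"]
      by (simp add: norm_minus_commute)
    then have "(h * h) * norm (partial_deriv b (partial_deriv a f) x - partial_deriv a (partial_deriv b f) x) \<le> (h * h) * e"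
      using h by (simp add: scaleR_diff_right[symmetric] mult.commute abs_mult)
    then show ?thesis using h by simp
  qed
  then have "norm (partial_deriv b (partial_deriv a f) x - partial_deriv a (partial_deriv b f) x) \<le> 0"
    by (metis add_0 field_le_epsilon)
  then show ?thesis by simp
qed

lemma pd_move_to_front:
  assumes "open S" "C_k_on (Suc (length v)) S f" "set v \<subseteq> Basis" "a \<in> Basis" "x \<in> S"
  shows "pd v (partial_deriv a f) x = partial_deriv a (pd v f) x"
  using assms(2-5)
proof (induction v arbitrary: x)
  case (Cons b v)
  have "pd v (partial_deriv a f) z = partial_deriv a (pd v f) z" if "z \<in> S" for z
    using Cons.prems that by (intro Cons.IH) (auto intro: C_k_on_Suc_imp simp del: C_k_on_Suc)
  then have "pd (b # v) (partial_deriv a f) x = partial_deriv b (partial_deriv a (pd v f)) x"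
    unfolding foldr.simps o_apply by (rule partial_deriv_cong_open(2)[OF assms(1) Cons.prems(4)])
  also have "\<dots> = partial_deriv a (partial_deriv b (pd v f)) x"
    using Cons.prems C_k_on_pd[of v 2 S f]
    by (intro partial_deriv_commute[OF assms(1)]) (simp_all del: C_k_on_Suc)
  finally show ?case by simp
qed simp_all

text \<open>Any letter can be pulled to the front through the preceding letters by symmetry of
  second derivatives; the induction sorts one letter at a time.\<close>

lemma pd_perm:
  assumes "open S" "C_k_on (length w) S f" "set w \<subseteq> Basis" "mset w = mset v" "x \<in> S"
  shows "pd w f x = pd v f x"
  using assms(2-5)
proof (induction w arbitrary: v x)
  case (Cons a w)
  then obtain v1 v2 where v: "v = v1 @ a # v2"
    by (metis in_set_conv_decomp list.set_intros(1) mset_eq_setD)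
  have m: "mset w = mset (v1 @ v2)" using Cons.prems(3) v by simp
  have len: "length w = length v1 + length v2" using m by (metis length_append size_mset)
  have sv: "set v1 \<subseteq> Basis" "set v2 \<subseteq> Basis"
    using mset_eq_setD[OF m] Cons.prems(2) by auto
  have "pd w f z = pd (v1 @ v2) f z" if "z \<in> S" for z
    using Cons.prems that m by (intro Cons.IH) (auto intro: C_k_on_Suc_imp simp del: C_k_on_Suc)
  then have "pd (a # w) f x = partial_deriv a (pd (v1 @ v2) f) x"
    unfolding foldr.simps o_apply by (rule partial_deriv_cong_open(2)[OF assms(1) Cons.prems(4)])
  also have "\<dots> = pd v1 (partial_deriv a (pd v2 f)) x"
    using pd_move_to_front[OF assms(1), of v1 "pd v2 f" a x] Cons.prems sv len
      C_k_on_pd[of v2 "Suc (length v1)" S f] by (simp add: add.commute del: C_k_on_Suc)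
  finally show ?case by (simp add: v)
qed simp_all

section \<open>Words of basis vectors against multi-indices\<close>

definition canonical_word :: "('a::euclidean_space) multi_index \<Rightarrow> 'a list" where
  "canonical_word \<alpha> = concat (map (\<lambda>b. replicate (\<alpha> b) b) basis_list)"

lemma set_canonical_word: "set (canonical_word \<alpha>) \<subseteq> Basis"
  by (auto simp: canonical_word_def basis_list(2) split: if_splits)

lemma mi_deriv_conv_pd: "mi_deriv \<alpha> f = pd (canonical_word \<alpha>) f"
proof -
  have "foldr partial_deriv (replicate n b) g = (partial_deriv b ^^ n) g" for n and b :: 'a and g
    by (induction n) auto
  then have "foldr (\<lambda>b g. (partial_deriv b ^^ \<alpha> b) g) bs f = pd (concat (map (\<lambda>b. replicate (\<alpha> b) b) bs)) f" for bs
    by (induction bs) auto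
  then show ?thesis by (simp add: mi_deriv_def canonical_word_def)
qed

lemma count_canonical_word:
  "count (mset (canonical_word \<alpha>)) b = (if b \<in> Basis then \<alpha> b else 0)"
proof -
  have "distinct bs \<Longrightarrow> count (mset (concat (map (\<lambda>b. replicate (\<alpha> b) b) bs))) b =
      (if b \<in> set bs then \<alpha> b else 0)" for bs
    by (induction bs) auto
  from this[OF basis_list(1)] show ?thesis by (simp add: canonical_word_def basis_list(2))
qed

lemma length_canonical_word: "length (canonical_word \<alpha>) = mi_order \<alpha>"
proof -
  have "length (canonical_word \<alpha>) = (\<Sum>b\<leftarrow>basis_list. \<alpha> b)"
    by (simp add: canonical_word_def length_concat o_def)
  also have "\<dots> = mi_order \<alpha>"
    unfolding mi_order_def using basis_list by (metis sum_list_distinct_conv_sum_set)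
  finally show ?thesis .
qed

text \<open>The bridge between the two notations: estimates are proved for words, which allow
  induction one derivative at a time, while the definitions and the theorem speak of
  multi-indices.\<close>

lemma pd_conv_mi_deriv:
  assumes "open S" "C_k_on (length w) S f" "set w \<subseteq> Basis" "x \<in> S"
  shows "pd w f x = mi_deriv (count (mset w)) f x" "mi_order (count (mset w)) = length w"
proof -
  have "mset w = mset (canonical_word (count (mset w)))"
  proof (rule multiset_eqI)
    fix b show "count (mset w) b = count (mset (canonical_word (count (mset w)))) b"
      unfolding count_canonical_word using assms(3)
      by (metis count_inI set_mset_mset subsetD)
  qed
  then show "pd w f x = mi_deriv (count (mset w)) f x" "mi_order (count (mset w)) = length w"
    using pd_perm[OF assms(1-3) _ assms(4)] mi_deriv_conv_pd length_canonical_word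
    by (metis, metis size_mset)
qed

lemma length_word_mi_order:
  "set w \<subseteq> Basis \<Longrightarrow> mi_order (count (mset w)) = length w"
  using pd_conv_mi_deriv(2)[OF open_UNIV, of w "\<lambda>_. 0"] by (simp add: C_k_on_const)

text \<open>The displacement h is built up one coordinate at a time and the one-dimensional mean
  value inequality is used on each leg; the dimension counts the legs.\<close>

lemma increment_le:
  fixes f :: "('a::euclidean_space) cfun" and A :: real
  assumes "C_k_on 1 S f" "cball y r \<subseteq> S" "norm h \<le> r" "0 \<le> A"
    and A: "\<And>z b. z \<in> cball y r \<Longrightarrow> b \<in> Basis \<Longrightarrow> norm (partial_deriv b f z) \<le> A"
  shows "norm (f (y + h) - f y) \<le> DIM('a) * A * norm h"
proof -
  define p where "p B = (\<Sum>b\<in>B. (h \<bullet> b) *\<^sub>R b)" for B :: "'a set"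
  have inner_p: "p B \<bullet> c = (if c \<in> B then h \<bullet> c else 0)" if "B \<subseteq> Basis" "c \<in> Basis" for B c
  proof -
    have "finite B" using finite_subset[OF that(1) finite_Basis] .
    have "p B \<bullet> c = (\<Sum>b\<in>B. (h \<bullet> b) * (b \<bullet> c))" by (simp add: p_def inner_sum_left)
    also have "\<dots> = (\<Sum>b\<in>B. if b = c then h \<bullet> c else 0)"
      using that by (intro sum.cong) (auto simp: inner_not_same_Basis subset_iff)
    finally show ?thesis using \<open>finite B\<close> by simp
  qed
  have *: "norm (f (y + p B) - f y) \<le> card B * A * norm h" if "finite B" "B \<subseteq> Basis" for B
    using that
  proof (induction B rule: finite_induct)
    case empty
    then show ?case by (simp add: p_def)
  next
    case (insert b B)
    have pins: "p (insert b B) = p B + (h \<bullet> b) *\<^sub>R b"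
      using insert by (simp add: p_def add.commute)
    \<comment> \<open>Every point of the path has coordinates dominated by those of h, relative to
      y, so the path never leaves the ball.\<close>
    have in_ball: "y + p B + t *\<^sub>R b \<in> cball y r" if "t \<in> closed_segment 0 (h \<bullet> b)" for t
    proof -
      have t: "\<bar>t\<bar> \<le> \<bar>h \<bullet> b\<bar>"
        using that by (auto simp: closed_segment_eq_real_ivl split: if_splits)
      have "norm (p B + t *\<^sub>R b) \<le> norm h"
      proof (rule norm_le_componentwise)
        fix c :: 'a assume "c \<in> Basis"
        then show "\<bar>(p B + t *\<^sub>R b) \<bullet> c\<bar> \<le> \<bar>h \<bullet> c\<bar>"
          using inner_p[of B c] insert t by (auto simp: inner_add_left inner_Basis)
      qed
      moreover have "dist y (y + p B + t *\<^sub>R b) = norm (p B + t *\<^sub>R b)"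
        by (metis add.assoc add_diff_cancel_left' dist_commute dist_norm)
      ultimately show ?thesis using assms(3) by simp
    qed
    have "norm (f ((y + p B) + (h \<bullet> b) *\<^sub>R b) - f ((y + p B) + 0 *\<^sub>R b) - (h \<bullet> b) *\<^sub>R 0) \<le> A * \<bar>h \<bullet> b\<bar>"
    proof (rule norm_increment_le[where g="\<lambda>t. f ((y + p B) + t *\<^sub>R b)" and g'="\<lambda>t. partial_deriv b f (y + p B + t *\<^sub>R b)"])
      fix t assume t: "t \<in> closed_segment 0 (h \<bullet> b)"
      have "coord_diff b f (y + p B + t *\<^sub>R b)"
        using C_k_on_SucD(2)[of 0 S f b] assms(1) subsetD[OF assms(2) in_ball[OF t]] insert.prems
        by (simp del: C_k_on_Suc)
      then show "((\<lambda>t. f (y + p B + t *\<^sub>R b)) has_vector_derivative partial_deriv b f (y + p B + t *\<^sub>R b)) (at t)"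
        by (rule coord_vector_derivative_at)
      show "norm (partial_deriv b f (y + p B + t *\<^sub>R b) - 0) \<le> A"
        using A[OF in_ball[OF t]] insert.prems by simp
    qed
    moreover have b: "b \<in> Basis" using insert.prems by simp
    ultimately have "norm (f (y + p (insert b B)) - f (y + p B)) \<le> A * norm h"
      using order_trans[OF _ mult_left_mono[OF Basis_le_norm[of b h, OF b] \<open>0 \<le> A\<close>]] 
      by (simp add: pins add.assoc)
    then have "norm (f (y + p (insert b B)) - f y) \<le> A * norm h + card B * A * norm h"
      using insert by (intro norm_diff_triangle_le[where y="f (y + p B)"]) auto
    then show ?case using insert by (simp add: algebra_simps)
  qed
  have "p Basis = h" by (simp add: p_def euclidean_representation)
  then show ?thesis using *[of Basis] by simp
qed

lemma smooth_increment_le: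
  fixes f :: "('a::euclidean_space) cfun" and A :: real
  assumes "smooth f" "0 \<le> A" "\<And>z b. norm (z - y) \<le> norm h \<Longrightarrow> b \<in> Basis \<Longrightarrow> norm (partial_deriv b f z) \<le> A"
  shows "norm (f (y + h) - f y) \<le> DIM('a) * A * norm h"
  using assms by (intro increment_le[where S=UNIV and r="norm h"] smooth_C_k_on)
    (auto simp: dist_norm norm_minus_commute)

text \<open>Two mean value estimates instead of a Taylor formula; the constant A in place of A/2 is
  immaterial for the limits that use it.\<close>

lemma smooth_second_order:
  assumes "smooth f" "b \<in> Basis" "\<And>z. norm (partial_deriv b (partial_deriv b f) z) \<le> A"
  shows "norm (f (x + t *\<^sub>R b) - f x - t *\<^sub>R partial_deriv b f x) \<le> A * t\<^sup>2"
proof -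
  have sm: "smooth (partial_deriv b f)" using assms smooth_partial_deriv by blast
  have A: "0 \<le> A" using assms(3) norm_ge_zero order_trans by blast
  have "norm (partial_deriv b f (x + s *\<^sub>R b) - partial_deriv b f x) \<le> A * \<bar>t\<bar>"
    if "s \<in> closed_segment 0 t" for s
  proof -
    have "norm (partial_deriv b f (x + s *\<^sub>R b) - partial_deriv b f (x + 0 *\<^sub>R b) - s *\<^sub>R 0) \<le> A * \<bar>s\<bar>"
      using assms by (intro norm_increment_le[where g'="\<lambda>s. partial_deriv b (partial_deriv b f) (x + s *\<^sub>R b)"]
          coord_vector_derivative_at smooth_coord_diff[OF sm]) auto
    moreover have "\<bar>s\<bar> \<le> \<bar>t\<bar>" using that by (auto simp: closed_segment_eq_real_ivl split: if_splits)
    ultimately show ?thesis using mult_left_mono[OF _ A, of "\<bar>s\<bar>" "\<bar>t\<bar>"] by simp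
  qed
  then have "norm (f (x + t *\<^sub>R b) - f (x + 0 *\<^sub>R b) - t *\<^sub>R partial_deriv b f x) \<le> (A * \<bar>t\<bar>) * \<bar>t\<bar>"
    using assms by (intro norm_increment_le[where g'="\<lambda>s. partial_deriv b f (x + s *\<^sub>R b)"]
          coord_vector_derivative_at smooth_coord_diff[OF assms(1)]) auto
  then show ?thesis by (simp add: power2_eq_square)
qed

text \<open>Leibniz rule, the power of 2 counting its terms. The induction runs from the end of the
  word because its last letter is the innermost derivative, the one to which the product rule
  applies.\<close>

lemma norm_pd_mult_le:
  assumes "smooth f" "smooth g" "set w \<subseteq> Basis" "0 \<le> A" "0 \<le> B"
    and "\<And>v. set v \<subseteq> Basis \<Longrightarrow> length v \<le> length w \<Longrightarrow> norm (pd v f x) \<le> A"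
    and "\<And>v. set v \<subseteq> Basis \<Longrightarrow> length v \<le> length w \<Longrightarrow> norm (pd v g x) \<le> B"
  shows "norm (pd w (\<lambda>z. f z * g z) x) \<le> 2 ^ length w * A * B"
  using assms
proof (induction w arbitrary: f g rule: rev_induct)
  case Nil
  then show ?case using mult_mono[of "norm (f x)" A "norm (g x)" B] Nil.prems(6,7)[of "[]"]
    by (simp add: norm_mult)
next
  case (snoc b w)
  have b: "b \<in> Basis" and w: "set w \<subseteq> Basis" using snoc by auto
  have sm: "smooth (partial_deriv b f)" "smooth (partial_deriv b g)"
    using b snoc smooth_partial_deriv by auto
  have step: "norm (pd v (partial_deriv b h) x) \<le> C" if "set v \<subseteq> Basis" "length v \<le> length w"
    "\<And>v. set v \<subseteq> Basis \<Longrightarrow> length v \<le> length (w @ [b]) \<Longrightarrow> norm (pd v h x) \<le> C" for v h C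
    using that(3)[of "v @ [b]"] that(1,2) b by simp
  have "partial_deriv b (\<lambda>z. f z * g z) = (\<lambda>z. f z * partial_deriv b g z + partial_deriv b f z * g z)"
    using snoc b by (intro ext partial_deriv_mult smooth_coord_diff)
  then have "pd (w @ [b]) (\<lambda>z. f z * g z) x =
      pd w (\<lambda>z. f z * partial_deriv b g z) x + pd w (\<lambda>z. partial_deriv b f z * g z) x"
    using sm snoc w by (simp add: pd_add[OF open_UNIV] smooth_C_k_on smooth_mult)
  also have "norm \<dots> \<le> 2 ^ length w * A * B + 2 ^ length w * A * B"
    using sm snoc.prems w step[where h=f] step[where h=g]
    by (intro order_trans[OF norm_triangle_ineq] add_mono snoc.IH) auto
  also have "\<dots> = 2 ^ length (w @ [b]) * A * B" by simp
  finally show ?case .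
qed

lemma pd_sum:
  assumes "finite I" "\<And>i. i \<in> I \<Longrightarrow> smooth (f i)" "set w \<subseteq> Basis"
  shows "pd w (\<lambda>z. \<Sum>i\<in>I. f i z) x = (\<Sum>i\<in>I. pd w (f i) x)"
  using assms
proof (induction I rule: finite_induct)
  case empty
  then show ?case using pd_cmult[OF open_UNIV smooth_C_k_on[OF smooth_const], of w x 0 0] by simp
next
  case (insert i I)
  then show ?case by (simp add: pd_add[OF open_UNIV] smooth_C_k_on smooth_sum)
qed

lemma smooth_power: "smooth f \<Longrightarrow> smooth (\<lambda>z. f z ^ k)"
  by (induction k) (auto intro: smooth_const smooth_mult)

lemma smooth_prod: "(\<And>i. i \<in> I \<Longrightarrow> smooth (f i)) \<Longrightarrow> smooth (\<lambda>z. \<Prod>i\<in>I. f i z)"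
  by (induction I rule: infinite_finite_induct) (auto intro: smooth_mult smooth_const)

lemma smooth_inner: "smooth (\<lambda>z. of_real (z \<bullet> c))"
proof -
  have *: "((\<lambda>t. complex_of_real ((x + t *\<^sub>R b) \<bullet> c)) has_vector_derivative of_real (b \<bullet> c)) (at 0)" for x b :: 'a
    by (auto intro!: derivative_eq_intros simp: inner_add_left)
  have "C_k_on k UNIV (\<lambda>z. complex_of_real (z \<bullet> c))" for k
    using partial_deriv_eqI[of "\<lambda>z. complex_of_real (z \<bullet> c)", OF *]
    by (cases k) (auto intro!: continuous_intros simp: C_k_on_const cong: C_k_on_cong)
  then show ?thesis by (simp add: smooth_def)
qed

subsection \<open>Polynomials and Taylor expansion\<close>

text \<open>Polynomials of degree at most L, generated by monomials and sums. A linear statement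
  about them is proved by rule induction, with no choice of coefficients.\<close>

inductive polyf :: "nat \<Rightarrow> ('a::euclidean_space) cfun \<Rightarrow> bool" where
  monomial: "mi_order \<alpha> \<le> L \<Longrightarrow> polyf L (\<lambda>z. c * of_real (mi_power \<alpha> z))"
| add: "polyf L p \<Longrightarrow> polyf L q \<Longrightarrow> polyf L (\<lambda>z. p z + q z)"

lemma polyf_le: "polyf k p \<Longrightarrow> k \<le> l \<Longrightarrow> polyf l p"
  by (induction rule: polyf.induct) (auto intro: polyf.intros)

lemma polyf_const: "polyf 0 (\<lambda>z. c)"
  using polyf.monomial[of "\<lambda>_. 0" 0 c] by (simp add: mi_order_def mi_power_def)

lemma polyf_cmult: "polyf k p \<Longrightarrow> polyf k (\<lambda>z. c * p z)"
proof (induction rule: polyf.induct)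
  case (monomial \<alpha> L d)
  then show ?case using polyf.monomial[of \<alpha> L "c * d"] by (simp add: mult.assoc)
next
  case (add L p q)
  then show ?case using polyf.add by (simp add: distrib_left)
qed

lemma polyf_sum:
  "(\<And>i. i \<in> I \<Longrightarrow> polyf k (f i)) \<Longrightarrow> polyf k (\<lambda>z. \<Sum>i\<in>I. f i z)"
  by (induction I rule: infinite_finite_induct) (auto intro: polyf_le[OF polyf_const] polyf.add)

lemma mi_power_add: "mi_power (\<lambda>b. \<alpha> b + \<beta> b) z = mi_power \<alpha> z * mi_power \<beta> z"
  by (simp add: mi_power_def power_add prod.distrib)

lemma mi_order_add: "mi_order (\<lambda>b. \<alpha> b + \<beta> b) = mi_order \<alpha> + mi_order \<beta>"
  by (simp add: mi_order_def sum.distrib)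

lemma polyf_mult: "polyf k p \<Longrightarrow> polyf l q \<Longrightarrow> polyf (k + l) (\<lambda>z. p z * q z)"
proof (induction rule: polyf.induct)
  case (monomial \<alpha> k c)
  from monomial(2,1) show ?case
  proof (induction rule: polyf.induct)
    case (monomial \<beta> l d)
    then show ?case
      using polyf.monomial[of "\<lambda>b. \<alpha> b + \<beta> b" "k + l" "c * d"]
      by (simp add: mi_power_add mi_order_add mult.assoc mult.left_commute)
  next
    case (add L p q)
    then show ?case using polyf.add by (simp add: distrib_left)
  qed
next
  case (add L p r)
  then show ?case using polyf.add by (simp add: distrib_right)
qed

lemma polyf_power: "polyf k p \<Longrightarrow> polyf (m * k) (\<lambda>z. p z ^ m)"
  by (induction m) (auto intro: polyf_mult polyf_const)

lemma polyf_prod: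
  "finite I \<Longrightarrow> (\<And>i. i \<in> I \<Longrightarrow> polyf (k i) (f i)) \<Longrightarrow> polyf (\<Sum>i\<in>I. k i) (\<lambda>z. \<Prod>i\<in>I. f i z)"
  by (induction I rule: finite_induct) (auto intro: polyf_mult polyf_const)

lemma mi_power_unit:
  assumes "b \<in> Basis" shows "mi_power (\<lambda>c. if c = b then 1 else 0) z = z \<bullet> b"
proof -
  have "mi_power (\<lambda>c. if c = b then 1 else 0) z = (\<Prod>c\<in>Basis. if c = b then z \<bullet> b else 1)"
    unfolding mi_power_def by (intro prod.cong) auto
  then show ?thesis using assms by simp
qed

lemma polyf_inner:
  assumes "b \<in> Basis" shows "polyf 1 (\<lambda>z. of_real (z \<bullet> b))"
proof -
  have "mi_order (\<lambda>c. if c = b then 1 else 0) = 1"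
    using assms by (simp add: mi_order_def)
  then show ?thesis
    using polyf.monomial[of "\<lambda>c. if c = b then 1 else 0" 1 1] mi_power_unit[OF assms] by simp
qed

lemma polyf_affine: "polyf k p \<Longrightarrow> polyf k (\<lambda>z. p (c *\<^sub>R z + y))"
proof (induction rule: polyf.induct)
  case (monomial \<alpha> L d)
  have "polyf (\<Sum>b\<in>Basis. \<alpha> b * 1) (\<lambda>z. \<Prod>b\<in>Basis. (of_real c * of_real (z \<bullet> b) + of_real (y \<bullet> b)) ^ \<alpha> b)"
    by (intro polyf_prod polyf_power polyf.add polyf_cmult polyf_inner polyf_le[OF polyf_const]) auto
  then have "polyf L (\<lambda>z. \<Prod>b\<in>Basis. (of_real c * of_real (z \<bullet> b) + of_real (y \<bullet> b)) ^ \<alpha> b)"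
    using monomial polyf_le by (simp add: mi_order_def)
  from polyf_cmult[OF this, of d] show ?case
    by (simp add: mi_power_def inner_add_left)
qed (rule polyf.add)

lemma polyf_mono_shift: "mi_order \<alpha> \<le> k \<Longrightarrow> polyf k (\<lambda>z. d * of_real (mi_power \<alpha> (c *\<^sub>R z + y)))"
  using polyf_affine[OF polyf.monomial] .

lemma smooth_mi_power: "smooth (\<lambda>z. of_real (mi_power \<alpha> z))"
proof -
  have "smooth (\<lambda>z. \<Prod>b\<in>Basis. complex_of_real (z \<bullet> b) ^ \<alpha> b)"
    by (intro smooth_prod smooth_power smooth_inner)
  then show ?thesis by (simp add: mi_power_def)
qed

lemma smooth_polyf: "polyf k p \<Longrightarrow> smooth p"
  by (induction rule: polyf.induct) (auto intro: smooth_cmult smooth_mi_power smooth_add)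

text \<open>If the exponent of b is 0, truncated subtraction leaves it 0 and the factor in front
  makes the product vanish, as it should.\<close>

lemma partial_deriv_monomial:
  assumes b: "b \<in> Basis"
  shows "partial_deriv b (\<lambda>z. c * of_real (mi_power \<alpha> z)) =
    (\<lambda>z. (c * of_nat (\<alpha> b)) * of_real (mi_power (\<alpha>(b := \<alpha> b - 1)) z))"
proof
  fix x :: 'a
  define R where "R = (\<Prod>d\<in>Basis - {b}. (x \<bullet> d) ^ \<alpha> d)"
  have e: "mi_power \<beta> (x + t *\<^sub>R b) = (x \<bullet> b + t) ^ \<beta> b * R" if "\<And>d. d \<noteq> b \<Longrightarrow> \<beta> d = \<alpha> d" for t and \<beta> :: "'a multi_index"
    unfolding mi_power_def R_def using b that
    by (subst prod.remove[OF finite_Basis b]) (auto simp: inner_add_left inner_Basis intro!: prod.cong)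
  have "((\<lambda>t. (x \<bullet> b + t) ^ \<alpha> b * R) has_real_derivative of_nat (\<alpha> b) * (x \<bullet> b + 0) ^ (\<alpha> b - 1) * R) (at 0)"
    by (auto intro!: derivative_eq_intros)
  then have "((\<lambda>t. c * of_real ((x \<bullet> b + t) ^ \<alpha> b * R)) has_vector_derivative
      c * of_real (of_nat (\<alpha> b) * (x \<bullet> b + 0) ^ (\<alpha> b - 1) * R)) (at 0)"
    by (intro has_vector_derivative_mult_right has_vector_derivative_of_real)
  then show "partial_deriv b (\<lambda>z. c * of_real (mi_power \<alpha> z)) x =
      (c * of_nat (\<alpha> b)) * of_real (mi_power (\<alpha>(b := \<alpha> b - 1)) x)"
    using e[of \<alpha>] e[of "\<alpha>(b := \<alpha> b - 1)" 0]
    by (intro partial_deriv_eqI(2)) (simp_all add: mult.assoc)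
qed

text \<open>The second claim records what the first loses through 0 - 1 = 0: differentiation kills
  constants.\<close>

lemma polyf_partial_deriv:
  assumes "polyf k p" "b \<in> Basis"
  shows "polyf (k - 1) (partial_deriv b p)" "k = 0 \<Longrightarrow> partial_deriv b p = (\<lambda>z. 0)"
proof -
  have "polyf (k - 1) (partial_deriv b p) \<and> (k = 0 \<longrightarrow> partial_deriv b p = (\<lambda>z. 0))"
    using assms
  proof (induction rule: polyf.induct)
    case (monomial \<alpha> L c)
    show ?case
    proof (cases "\<alpha> b = 0")
      case True
      then have "partial_deriv b (\<lambda>z. c * of_real (mi_power \<alpha> z)) = (\<lambda>z. 0)"
        using monomial by (simp add: partial_deriv_monomial)
      then show ?thesis using polyf_le[OF polyf_const] by simp
    next
      case False
      have "mi_order (\<alpha>(b := \<alpha> b - 1)) + 1 = mi_order \<alpha>"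
      proof -
        have "(\<Sum>d\<in>Basis. (\<alpha>(b := \<alpha> b - 1)) d) = (\<alpha> b - 1) + (\<Sum>d\<in>Basis - {b}. \<alpha> d)"
          using monomial by (subst sum.remove[OF finite_Basis, of b]) (auto intro!: sum.cong)
        then show ?thesis
          using False monomial unfolding mi_order_def by (simp add: sum.remove[OF finite_Basis, of b \<alpha>])
      qed
      then show ?thesis using monomial by (auto simp: partial_deriv_monomial intro!: polyf.monomial)
    qed
  next
    case (add L p q)
    then have "partial_deriv b (\<lambda>z. p z + q z) = (\<lambda>z. partial_deriv b p z + partial_deriv b q z)"
      by (intro ext partial_deriv_add smooth_coord_diff smooth_polyf)
    then show ?case using add by (auto intro: polyf.add)
  qed
  then show "polyf (k - 1) (partial_deriv b p)" "k = 0 \<Longrightarrow> partial_deriv b p = (\<lambda>z. 0)" by auto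
qed

lemma polyf_pd:
  assumes "polyf k p" "set w \<subseteq> Basis"
  shows "polyf (k - length w) (pd w p)" "k < length w \<Longrightarrow> pd w p = (\<lambda>z. 0)"
proof -
  have "polyf (k - length w) (pd w p) \<and> (k < length w \<longrightarrow> pd w p = (\<lambda>z. 0))"
    using assms(2)
  proof (induction w)
    case (Cons b w)
    then have ih: "polyf (k - length w) (pd w p)" "k < length w \<Longrightarrow> pd w p = (\<lambda>z. 0)" by auto
    then show ?case
      using polyf_partial_deriv[OF ih(1), of b] Cons.prems by auto
  qed (use assms in auto)
  then show "polyf (k - length w) (pd w p)" "k < length w \<Longrightarrow> pd w p = (\<lambda>z. 0)" by auto
qed

lemma polyf_0_const: "polyf 0 p \<Longrightarrow> p x = p y"
proof (induction "0::nat" p rule: polyf.induct)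
  case (monomial \<alpha> c)
  then have "\<forall>b\<in>Basis. \<alpha> b = 0" by (simp add: mi_order_def)
  then show ?case by (simp add: mi_power_def)
qed auto

text \<open>The base is at least 1, so the exponent may later be raised to any larger order.\<close>

lemma abs_mi_power_le: "\<bar>mi_power \<alpha> z\<bar> \<le> (1 + norm z) ^ mi_order \<alpha>"
proof -
  have "\<bar>mi_power \<alpha> z\<bar> = (\<Prod>b\<in>Basis. \<bar>z \<bullet> b\<bar> ^ \<alpha> b)"
    by (simp add: mi_power_def abs_prod power_abs)
  also have "\<dots> \<le> (\<Prod>b\<in>Basis. (1 + norm z) ^ \<alpha> b)"
  proof (intro prod_mono conjI power_mono)
    fix b :: 'a assume "b \<in> Basis"
    then show "\<bar>z \<bullet> b\<bar> \<le> 1 + norm z" using Basis_le_norm[of b z] by linarith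
  qed auto
  finally show ?thesis by (simp add: mi_order_def power_sum)
qed

text \<open>The falling factorial m (m - 1) ... (m - k + 1). For k > m truncated subtraction
  produces a zero factor, matching the derivative of order k of a power of exponent m.\<close>

definition falling :: "nat \<Rightarrow> nat \<Rightarrow> nat" where
  "falling m k = (\<Prod>i<k. m - i)"

lemma falling_self: "falling m m = fact m"
  unfolding falling_def by (simp add: fact_prod_rev atLeast0LessThan)

lemma falling_Suc: "falling m (Suc k) = falling m k * (m - k)"
  unfolding falling_def by simp

lemma falling_eq_0: "m < k \<Longrightarrow> falling m k = 0"
  unfolding falling_def by (auto intro!: bexI[of _ m])

lemma funpow_partial_deriv_monomial:
  assumes "b \<in> Basis"
  shows "(partial_deriv b ^^ k) (\<lambda>z. c * of_real (mi_power \<alpha> z)) =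
    (\<lambda>z. (c * of_nat (falling (\<alpha> b) k)) * of_real (mi_power (\<alpha>(b := \<alpha> b - k)) z))"
proof (induction k)
  case (Suc k)
  have "(partial_deriv b ^^ Suc k) (\<lambda>z. c * of_real (mi_power \<alpha> z)) =
      partial_deriv b (\<lambda>z. (c * of_nat (falling (\<alpha> b) k)) * of_real (mi_power (\<alpha>(b := \<alpha> b - k)) z))"
    unfolding funpow.simps o_apply Suc.IH ..
  also have "\<dots> = (\<lambda>z. (c * of_nat (falling (\<alpha> b) k) * of_nat (\<alpha> b - k)) * of_real (mi_power (\<alpha>(b := \<alpha> b - k - 1)) z))"
    using partial_deriv_monomial[OF assms, of "c * of_nat (falling (\<alpha> b) k)" "\<alpha>(b := \<alpha> b - k)"] by simp
  also have "\<alpha> b - k - 1 = \<alpha> b - Suc k" by simp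
  finally show ?case by (simp only: falling_Suc of_nat_mult mult.assoc)
qed (simp add: falling_def)

text \<open>If the indices differ at b, then either the falling factorial vanishes (too many
  derivatives) or a positive power of the coordinate survives and vanishes at 0. Both indices are
  normalised off \<open>Basis\<close>, so that equality as functions is equality of
  multi-indices.\<close>

lemma mi_deriv_monomial_0:
  fixes \<alpha> \<beta> :: "('a::euclidean_space) multi_index"
  assumes "\<And>b. b \<notin> Basis \<Longrightarrow> \<alpha> b = 0" "\<And>b. b \<notin> Basis \<Longrightarrow> \<beta> b = 0"
  shows "mi_deriv \<beta> (\<lambda>z. of_real (mi_power \<alpha> z)) 0 = (if \<alpha> = \<beta> then of_nat (\<Prod>b\<in>Basis. fact (\<alpha> b)) else 0)"
proof -
  have *: "foldr (\<lambda>b g. (partial_deriv b ^^ \<beta> b) g) bs (\<lambda>z. of_real (mi_power \<alpha> z)) =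
      (\<lambda>z. of_nat (\<Prod>b\<in>set bs. falling (\<alpha> b) (\<beta> b)) *
        of_real (mi_power (\<lambda>b. if b \<in> set bs then \<alpha> b - \<beta> b else \<alpha> b) z))"
    if "distinct bs" "set bs \<subseteq> Basis" for bs
    using that
  proof (induction bs)
    case (Cons b bs)
    let ?\<alpha> = "\<lambda>d. if d \<in> set bs then \<alpha> d - \<beta> d else \<alpha> d"
    have e: "?\<alpha>(b := \<alpha> b - \<beta> b) = (\<lambda>d. if d \<in> set (b # bs) then \<alpha> d - \<beta> d else \<alpha> d)" "?\<alpha> b = \<alpha> b"
      using Cons.prems by auto
    have "foldr (\<lambda>b g. (partial_deriv b ^^ \<beta> b) g) (b # bs) (\<lambda>z. of_real (mi_power \<alpha> z)) =
      (partial_deriv b ^^ \<beta> b) (\<lambda>z. of_nat (\<Prod>b\<in>set bs. falling (\<alpha> b) (\<beta> b)) * of_real (mi_power ?\<alpha> z))"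
      using Cons by simp
    also have "\<dots> = (\<lambda>z. (of_nat (\<Prod>b\<in>set bs. falling (\<alpha> b) (\<beta> b)) * of_nat (falling (\<alpha> b) (\<beta> b))) *
        of_real (mi_power (\<lambda>d. if d \<in> set (b # bs) then \<alpha> d - \<beta> d else \<alpha> d) z))"
    proof -
      have "b \<in> Basis" using Cons.prems by simp
      from funpow_partial_deriv_monomial[OF this, of "\<beta> b" "of_nat (\<Prod>b\<in>set bs. falling (\<alpha> b) (\<beta> b))" ?\<alpha>]
      show ?thesis unfolding e(2) unfolding e(1) .
    qed
    also have "of_nat (\<Prod>b\<in>set bs. falling (\<alpha> b) (\<beta> b)) * of_nat (falling (\<alpha> b) (\<beta> b)) =
        complex_of_nat (\<Prod>b\<in>set (b # bs). falling (\<alpha> b) (\<beta> b))"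
      using Cons.prems by (simp add: mult.commute)
    finally show ?case .
  qed simp
  have m0: "mi_power \<delta> (0::'a) = (if \<forall>b\<in>Basis. \<delta> b = 0 then 1 else 0)" for \<delta>
    by (auto simp: mi_power_def)
  have "mi_deriv \<beta> (\<lambda>z. of_real (mi_power \<alpha> z)) 0 = of_nat (\<Prod>b\<in>Basis. falling (\<alpha> b) (\<beta> b)) *
      (if \<forall>b\<in>Basis. \<alpha> b - \<beta> b = 0 then 1 else 0)"
    using *[OF basis_list(1)] by (simp add: mi_deriv_def basis_list(2) m0)
  also have "\<dots> = (if \<alpha> = \<beta> then of_nat (\<Prod>b\<in>Basis. fact (\<alpha> b)) else 0)"
  proof (cases "\<alpha> = \<beta>")
    case False
    then obtain b where b: "b \<in> Basis" "\<alpha> b \<noteq> \<beta> b" using assms ext[of \<alpha> \<beta>] by metis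
    then show ?thesis
    proof (cases "\<alpha> b < \<beta> b")
      case True
      then have "(\<Prod>b\<in>Basis. falling (\<alpha> b) (\<beta> b)) = 0" using b falling_eq_0 by auto
      then show ?thesis using False by simp
    qed (use b False in force)
  qed (simp add: falling_self)
  finally show ?thesis .
qed

text \<open>Values outside \<open>Basis\<close> are arbitrary in a multi-index; fixing them to 0
  gives one representative of each and hence a finite set to sum over.\<close>

lemma finite_multi_indices:
  "finite {\<alpha> :: ('a::euclidean_space) multi_index. mi_order \<alpha> \<le> M \<and> (\<forall>b. b \<notin> Basis \<longrightarrow> \<alpha> b = 0)}"
proof (rule finite_subset)
  show "finite {\<alpha> :: 'a \<Rightarrow> nat. \<forall>b. (b \<in> Basis \<longrightarrow> \<alpha> b \<in> {..M}) \<and> (b \<notin> Basis \<longrightarrow> \<alpha> b = 0)}"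
    by (intro finite_set_of_finite_funs) auto
  show "{\<alpha> :: 'a multi_index. mi_order \<alpha> \<le> M \<and> (\<forall>b. b \<notin> Basis \<longrightarrow> \<alpha> b = 0)} \<subseteq>
      {\<alpha>. \<forall>b. (b \<in> Basis \<longrightarrow> \<alpha> b \<in> {..M}) \<and> (b \<notin> Basis \<longrightarrow> \<alpha> b = 0)}"
  proof clarify
    fix \<alpha> :: "'a multi_index" and b :: 'a
    assume \<alpha>: "mi_order \<alpha> \<le> M" "\<forall>b. b \<notin> Basis \<longrightarrow> \<alpha> b = 0"
    have "\<alpha> b \<le> mi_order \<alpha>" if "b \<in> Basis"
      using that member_le_sum[of b Basis \<alpha>] by (simp add: mi_order_def)
    then show "(b \<in> Basis \<longrightarrow> \<alpha> b \<in> {..M}) \<and> (b \<notin> Basis \<longrightarrow> \<alpha> b = 0)"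
      using \<alpha> by auto
  qed
qed

text \<open>The usual Taylor coefficients work because the derivatives of the monomials at the
  centre are orthogonal to each other.\<close>

lemma taylor_poly_exists:
  fixes f :: "('a::euclidean_space) cfun"
  assumes S: "open S" "C_k_on M S f" "y \<in> S"
  shows "\<exists>p. polyf M p \<and> (\<forall>w. set w \<subseteq> Basis \<longrightarrow> length w \<le> M \<longrightarrow> pd w (\<lambda>z. f z - p z) y = 0)"
proof -
  define I where "I = {\<alpha> :: 'a multi_index. mi_order \<alpha> \<le> M \<and> (\<forall>b. b \<notin> Basis \<longrightarrow> \<alpha> b = 0)}"
  have I: "finite I" unfolding I_def by (rule finite_multi_indices)
  define c where "c \<alpha> = mi_deriv \<alpha> f y / of_nat (\<Prod>b\<in>Basis. fact (\<alpha> b))" for \<alpha>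
  define p where "p z = (\<Sum>\<alpha>\<in>I. c \<alpha> * of_real (mi_power \<alpha> (1 *\<^sub>R z + - y)))" for z
  have p: "polyf M p"
    unfolding p_def by (intro polyf_sum polyf_mono_shift) (simp add: I_def)
  have *: "mi_deriv \<beta> p y = mi_deriv \<beta> f y" if \<beta>: "\<beta> \<in> I" for \<beta>
  proof -
    let ?w = "canonical_word \<beta>"
    have "mi_deriv \<beta> p y = (\<Sum>\<alpha>\<in>I. pd ?w (\<lambda>z. c \<alpha> * of_real (mi_power \<alpha> (1 *\<^sub>R z + - y))) y)"
      unfolding mi_deriv_conv_pd p_def using set_canonical_word
      by (intro pd_sum I smooth_cmult smooth_affine[OF smooth_mi_power]) auto
    also have "\<dots> = (\<Sum>\<alpha>\<in>I. c \<alpha> * mi_deriv \<beta> (\<lambda>z. of_real (mi_power \<alpha> z)) 0)"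
    proof (rule sum.cong[OF refl])
      fix \<alpha> :: "'a multi_index"
      have sm: "smooth (\<lambda>z. complex_of_real (mi_power \<alpha> z))" by (rule smooth_mi_power)
      have "pd ?w (\<lambda>z. c \<alpha> * of_real (mi_power \<alpha> (1 *\<^sub>R z + - y))) y =
          c \<alpha> * pd ?w (\<lambda>z. of_real (mi_power \<alpha> (1 *\<^sub>R z + - y))) y"
        by (rule pd_cmult[OF open_UNIV smooth_C_k_on[OF smooth_affine[OF sm]] set_canonical_word]) simp
      also have "\<dots> = c \<alpha> * mi_deriv \<beta> (\<lambda>z. of_real (mi_power \<alpha> z)) 0"
        using pd_affine[OF sm set_canonical_word, of \<beta> 1 "- y" y] by (simp add: mi_deriv_conv_pd)
      finally show "pd ?w (\<lambda>z. c \<alpha> * of_real (mi_power \<alpha> (1 *\<^sub>R z + - y))) y = \<dots>" .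
    qed
    also have "\<dots> = (\<Sum>\<alpha>\<in>I. if \<alpha> = \<beta> then c \<beta> * of_nat (\<Prod>b\<in>Basis. fact (\<beta> b)) else 0)"
      using \<beta> by (intro sum.cong) (auto simp: I_def mi_deriv_monomial_0)
    also have "\<dots> = mi_deriv \<beta> f y" using I \<beta> by (simp add: c_def)
    finally show ?thesis .
  qed
  have "pd w (\<lambda>z. f z - p z) y = 0" if w: "set w \<subseteq> Basis" "length w \<le> M" for w
  proof -
    have Cf: "C_k_on (length w) S f" using S C_k_on_le w by blast
    have Cp: "C_k_on (length w) S p" using smooth_C_k_on smooth_polyf p by blast
    have "count (mset w) \<in> I"
      using length_word_mi_order[OF w(1)] w by (auto simp: I_def count_eq_zero_iff)
    then show ?thesis
      using * pd_conv_mi_deriv(1)[OF S(1) Cf w(1) S(3)] pd_conv_mi_deriv(1)[OF S(1) Cp w(1) S(3)]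
        pd_diff[OF S(1) Cf Cp w(1) S(3)] by simp
  qed
  then show ?thesis using p by blast
qed

text \<open>Descent from the top order M: i counts the derivatives still missing. As all derivatives
  vanish at y, each mean value estimate gains one power of |h| and costs a factor of the
  dimension.\<close>

lemma vanishing_derivs_bound:
  fixes r :: "('a::euclidean_space) cfun" and A g \<rho> :: real
  assumes S: "open S" "C_k_on M S r" "cball y \<rho> \<subseteq> S" and A: "0 \<le> A" "0 \<le> g"
    and zero: "\<And>w. set w \<subseteq> Basis \<Longrightarrow> length w \<le> M \<Longrightarrow> pd w r y = 0"
    and top: "\<And>w h. set w \<subseteq> Basis \<Longrightarrow> length w = M \<Longrightarrow> norm h \<le> \<rho> \<Longrightarrow> norm (pd w r (y + h)) \<le> A * norm h powr g"
  shows "set w \<subseteq> Basis \<Longrightarrow> length w + i = M \<Longrightarrow> norm h \<le> \<rho> \<Longrightarrow>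
    norm (pd w r (y + h)) \<le> real DIM('a) ^ i * A * norm h powr (real i + g)"
proof (induction i arbitrary: w h)
  case 0
  then show ?case using top by simp
next
  case (Suc i)
  show ?case
  proof (cases "h = 0")
    case True
    then show ?thesis using zero Suc.prems by simp
  next
    case False
    let ?B = "real DIM('a) ^ i * A * norm h powr (real i + g)"
    have "C_k_on 1 S (pd w r)"
      using S(2) C_k_on_le[of M S r "length w + 1"] C_k_on_pd[of w 1 S r] Suc.prems by (simp del: C_k_on_Suc)
    moreover have "norm (partial_deriv b (pd w r) z) \<le> ?B" if z: "z \<in> cball y (norm h)" and b: "b \<in> Basis" for z b
    proof -
      have n: "norm (z - y) \<le> norm h" using z by (simp add: dist_norm norm_minus_commute)
      have "norm (pd (b # w) r (y + (z - y))) \<le> real DIM('a) ^ i * A * norm (z - y) powr (real i + g)"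
        using Suc.prems n b by (intro Suc.IH) auto
      also have "\<dots> \<le> ?B" using n A by (intro mult_left_mono powr_mono2) auto
      finally show ?thesis by simp
    qed
    ultimately have "norm (pd w r (y + h) - pd w r y) \<le> DIM('a) * ?B * norm h"
      using S Suc.prems A by (intro increment_le[where S=S and r="norm h"]) auto
    moreover have "norm h powr (real i + g) * norm h = norm h powr (real (Suc i) + g)"
      using False powr_add[of "norm h" "real i + g" 1] by (simp add: algebra_simps)
    ultimately show ?thesis using zero[of w] Suc.prems by (simp add: mult.assoc)
  qed
qed

text \<open>J is the set of admissible radii. A kernel slice has a singularity and allows only a
  bounded interval, whereas a test function allows all of \<open>UNIV\<close>; one statement covers
  both.\<close>

lemma taylor_remainder:
  fixes f :: "('a::euclidean_space) cfun" and A g :: real and J :: "real set"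
  assumes S: "open S" "C_k_on M S f" and J: "0 \<in> J" "\<And>\<rho>. \<rho> \<in> J \<Longrightarrow> {0..\<rho>} \<subseteq> J \<and> cball y \<rho> \<subseteq> S"
    and A: "0 \<le> A" "0 \<le> g"
    and H: "\<And>\<alpha> h. mi_order \<alpha> = M \<Longrightarrow> norm h \<in> J \<Longrightarrow> norm (mi_deriv \<alpha> f (y + h) - mi_deriv \<alpha> f y) \<le> A * norm h powr g"
  obtains p where "polyf M p"
    "\<And>w h. set w \<subseteq> Basis \<Longrightarrow> length w \<le> M \<Longrightarrow> norm h \<in> J \<Longrightarrow>
      norm (pd w (\<lambda>z. f z - p z) (y + h)) \<le> real DIM('a) ^ M * A * norm h powr (real M - real (length w) + g)"
proof -
  have y: "y \<in> S" using J(2)[OF J(1)] by auto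
  obtain p where p: "polyf M p" "\<And>w. set w \<subseteq> Basis \<Longrightarrow> length w \<le> M \<Longrightarrow> pd w (\<lambda>z. f z - p z) y = 0"
    using taylor_poly_exists[OF S(1,2) y] by blast
  have Cp: "C_k_on k S p" for k using smooth_C_k_on smooth_polyf p by blast
  have "C_k_on M S (\<lambda>z. f z + (-1) * p z)"
    using S Cp by (intro C_k_on_add C_k_on_mult C_k_on_const)
  then have Cr: "C_k_on M S (\<lambda>z. f z - p z)" by simp
  have top: "norm (pd w (\<lambda>z. f z - p z) (y + h)) \<le> A * norm h powr g"
    if w: "set w \<subseteq> Basis" "length w = M" and h: "norm h \<in> J" for w h
  proof -
    have "y + h \<in> cball y (norm h)" by (simp add: dist_norm)
    then have in_S: "y + h \<in> S" using J(2)[OF h] by blast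
    have Cf: "C_k_on (length w) S f" using S w by simp
    have e: "pd w (\<lambda>z. f z - p z) x = mi_deriv (count (mset w)) f x - pd w p x" if "x \<in> S" for x
      using pd_diff[OF S(1) Cf Cp w(1) that] pd_conv_mi_deriv(1)[OF S(1) Cf w(1) that] by simp
    \<comment> \<open>Derivatives of order M of a polynomial of degree M are constant, so the top
      derivative of the remainder is an increment of that of f.\<close>
    have "pd w p (y + h) = pd w p y"
      using polyf_pd(1)[OF p(1) w(1)] w(2) polyf_0_const by (metis diff_self_eq_0)
    then have "pd w (\<lambda>z. f z - p z) (y + h) = mi_deriv (count (mset w)) f (y + h) - mi_deriv (count (mset w)) f y"
      using e[OF in_S] e[OF y] p(2)[of w] w by simp
    then show ?thesis using H[OF _ h, of "count (mset w)"] length_word_mi_order[OF w(1)] w by simp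
  qed
  show ?thesis
  proof (rule that[OF p(1)])
    fix w :: "'a list" and h :: 'a
    assume w: "set w \<subseteq> Basis" "length w \<le> M" and h: "norm h \<in> J"
    have down: "norm h' \<in> J" if "norm h' \<le> norm h" for h' :: 'a
      using subsetD[of "{0..norm h}" J "norm h'"] J(2)[OF h] that by simp
    have sub: "cball y (norm h) \<subseteq> S" using J(2)[OF h] by blast
    have "norm (pd w (\<lambda>z. f z - p z) (y + h)) \<le> real DIM('a) ^ (M - length w) * A * norm h powr (real (M - length w) + g)"
      using w by (intro vanishing_derivs_bound[OF S(1) Cr sub A p(2) top[OF _ _ down]]) auto
    also have "\<dots> \<le> real DIM('a) ^ M * A * norm h powr (real M - real (length w) + g)"
      using w A by (simp add: of_nat_diff) (intro mult_right_mono power_increasing, auto)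
    finally show "norm (pd w (\<lambda>z. f z - p z) (y + h)) \<le> \<dots>" .
  qed
qed

subsection \<open>Test functions\<close>

lemma test_funI:
  assumes "smooth f" "\<And>x. A < norm x \<Longrightarrow> f x = 0"
  shows "f \<in> test_fun"
proof -
  have "fsupport f \<subseteq> cball 0 A"
    unfolding fsupport_def using assms(2)
    by (intro closure_minimal) (auto simp: not_less[symmetric])
  then have "compact (fsupport f)"
    by (metis bounded_cball bounded_subset closed_closure compact_eq_bounded_closed fsupport_def)
  then show ?thesis using assms(1) by (simp add: test_fun_def)
qed

lemma test_fun_smooth: "f \<in> test_fun \<Longrightarrow> smooth f"
  by (simp add: test_fun_def)

lemma test_funE:
  assumes "f \<in> test_fun"
  obtains A where "A > 0" "\<And>x. A < norm x \<Longrightarrow> f x = 0"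
proof -
  have "bounded (fsupport f)" using assms by (simp add: test_fun_def compact_imp_bounded)
  then obtain A where A: "A > 0" "\<And>x. x \<in> fsupport f \<Longrightarrow> norm x \<le> A"
    using bounded_normE by blast
  have "f x = 0" if "A < norm x" for x
    using A(2)[of x] closure_subset[of "{x. f x \<noteq> 0}"] that unfolding fsupport_def by (auto simp: not_less)
  then show ?thesis using that A(1) by blast
qed

lemma fsupport_subset:
  assumes "closed S" "\<And>x. x \<notin> S \<Longrightarrow> f x = 0"
  shows "fsupport f \<subseteq> S"
  unfolding fsupport_def using assms by (intro closure_minimal) auto

lemma pd_zero_outside:
  assumes "\<And>x. A < norm x \<Longrightarrow> f x = 0" "set w \<subseteq> Basis" "A < norm x"
  shows "pd w f x = 0"
proof -
  have op: "open {x :: 'a. A < norm x}"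
    by (intro open_Collect_less continuous_intros)
  have "pd w f x = pd w (\<lambda>z. 0) x"
    by (rule pd_cong_open[OF op]) (use assms in auto)
  also have "\<dots> = 0"
    using polyf_pd(2)[OF polyf_const[of 0] assms(2)] by (cases w) auto
  finally show ?thesis .
qed

lemma test_fun_pd: "f \<in> test_fun \<Longrightarrow> set w \<subseteq> Basis \<Longrightarrow> pd w f \<in> test_fun"
  by (metis pd_zero_outside smooth_pd test_funE test_funI test_fun_smooth)

lemma test_fun_partial_deriv: "f \<in> test_fun \<Longrightarrow> b \<in> Basis \<Longrightarrow> partial_deriv b f \<in> test_fun"
  using test_fun_pd[of f "[b]"] by simp

lemma test_fun_mult: "f \<in> test_fun \<Longrightarrow> smooth g \<Longrightarrow> (\<lambda>z. f z * g z) \<in> test_fun"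
  by (metis (mono_tags, lifting) mult_eq_0_iff smooth_mult test_funE test_funI test_fun_smooth)

lemma test_fun_mult': "f \<in> test_fun \<Longrightarrow> smooth g \<Longrightarrow> (\<lambda>z. g z * f z) \<in> test_fun"
  using test_fun_mult[of f g] by (simp add: mult.commute)

lemma test_fun_cmult: "f \<in> test_fun \<Longrightarrow> (\<lambda>z. c * f z) \<in> test_fun"
  by (intro test_fun_mult' smooth_const)

lemma test_fun_add:
  assumes "f \<in> test_fun" "g \<in> test_fun" shows "(\<lambda>z. f z + g z) \<in> test_fun"
proof -
  obtain A B where "\<And>x. A < norm x \<Longrightarrow> f x = 0" "\<And>x. B < norm x \<Longrightarrow> g x = 0"
    using assms test_funE by metis
  then show ?thesis using assms
    by (intro test_funI[where A="max A B"] smooth_add) (auto intro: test_fun_smooth)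
qed

lemma test_fun_zero: "(\<lambda>z. 0) \<in> test_fun"
  by (rule test_funI[where A=0]) (auto intro: smooth_const)

lemma test_fun_sum:
  "(\<And>i. i \<in> I \<Longrightarrow> f i \<in> test_fun) \<Longrightarrow> (\<lambda>z. \<Sum>i\<in>I. f i z) \<in> test_fun"
  by (induction I rule: infinite_finite_induct) (auto intro: test_fun_add test_fun_zero)

lemma test_fun_diff: "f \<in> test_fun \<Longrightarrow> g \<in> test_fun \<Longrightarrow> (\<lambda>z. f z - g z) \<in> test_fun"
  using test_fun_add[OF _ test_fun_cmult[of g "-1"], of f] by simp

lemma test_fun_affine:
  fixes f :: "('a::euclidean_space) cfun"
  assumes "f \<in> test_fun" "c \<noteq> 0" shows "(\<lambda>z. f (c *\<^sub>R z + y)) \<in> test_fun"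
proof -
  obtain A where A: "\<And>x. A < norm x \<Longrightarrow> f x = 0" using assms test_funE by metis
  show ?thesis
  proof (rule test_funI[where A="(A + norm y) / \<bar>c\<bar>"])
    fix x :: 'a assume "(A + norm y) / \<bar>c\<bar> < norm x"
    then have "A + norm y < norm (c *\<^sub>R x)" using assms(2) by (simp add: divide_less_eq mult.commute)
    also have "\<dots> \<le> norm (c *\<^sub>R x + y) + norm y" using norm_triangle_ineq4[of "c *\<^sub>R x + y" y] by simp
    finally show "f (c *\<^sub>R x + y) = 0" using A by simp
  qed (use assms smooth_affine test_fun_smooth in blast)
qed

lemma test_fun_bounded:
  assumes "f \<in> test_fun" shows "\<exists>B>0. \<forall>x. norm (f x) \<le> B"
proof -
  obtain A where A: "\<And>x. A < norm x \<Longrightarrow> f x = 0" using assms test_funE by metis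
  have "compact (f ` cball 0 A)"
    by (intro compact_continuous_image smooth_continuous test_fun_smooth assms compact_cball)
  then obtain B where B: "B > 0" "\<And>x. x \<in> cball 0 A \<Longrightarrow> norm (f x) \<le> B"
    using compact_imp_bounded bounded_normE by (metis imageI)
  have "norm (f x) \<le> B" for x
    using B A[of x] by (cases "x \<in> cball 0 A") (auto simp: not_le)
  then show ?thesis using B(1) by blast
qed

lemma finite_words: "finite {w :: ('a::euclidean_space) list. set w \<subseteq> Basis \<and> length w \<le> N}"
  using finite_lists_length_le[OF finite_Basis] .

text \<open>Extracts one constant for all words of bounded length. All parameters of an estimate are
  packed into the argument x, and g carries its decay.\<close>

lemma finite_uniform_bound:
  assumes "finite W" "\<And>w. w \<in> W \<Longrightarrow> \<exists>C::real. \<forall>x. f w x \<le> C * g x" "\<And>x. 0 \<le> g x"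
  shows "\<exists>C>0. \<forall>w\<in>W. \<forall>x. f w x \<le> C * g x"
  using assms(1,2)
proof (induction W rule: finite_induct)
  case empty
  show ?case by (intro exI[of _ 1]) auto
next
  case (insert w W)
  then obtain C where C: "C > 0" "\<And>w x. w \<in> W \<Longrightarrow> f w x \<le> C * g x" by auto
  obtain D where D: "\<And>x. f w x \<le> D * g x" using insert.prems[of w] by blast
  have "f v x \<le> (C + \<bar>D\<bar>) * g x" if "v \<in> insert w W" for v x
  proof -
    have "C * g x \<le> (C + \<bar>D\<bar>) * g x" "D * g x \<le> (C + \<bar>D\<bar>) * g x"
      using C(1) assms(3) by (auto intro!: mult_right_mono)
    then show ?thesis using that C(2)[of v x] D[of x] by fastforce
  qed
  then show ?case using C(1) by (intro exI[of _ "C + \<bar>D\<bar>"]) auto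
qed

lemma test_fun_pd_bounded:
  fixes f :: "('a::euclidean_space) cfun"
  assumes "f \<in> test_fun"
  shows "\<exists>B>0. \<forall>w x. set w \<subseteq> Basis \<longrightarrow> length w \<le> N \<longrightarrow> norm (pd w f x) \<le> B"
proof -
  have "\<exists>B>0. \<forall>w\<in>{w. set w \<subseteq> Basis \<and> length w \<le> N}. \<forall>x. norm (pd w f x) \<le> B * 1"
    using test_fun_bounded[OF test_fun_pd[OF assms]]
    by (intro finite_uniform_bound finite_words) (auto, metis)
  then show ?thesis by auto
qed

section \<open>Integrals of test functions and integration by parts\<close>

lemma test_fun_measurable [measurable_dest]: "f \<in> test_fun \<Longrightarrow> f \<in> borel_measurable borel"
  by (intro borel_measurable_continuous_onI smooth_continuous test_fun_smooth)

lemma continuous_integrable_compact: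
  fixes f :: "('a::euclidean_space) cfun"
  assumes "continuous_on UNIV f" "\<And>x. A < norm x \<Longrightarrow> f x = 0"
  shows "integrable lborel f"
proof -
  have "integrable lborel (\<lambda>x. indicator (cball 0 A) x *\<^sub>R f x)"
    using assms(1) by (intro borel_integrable_compact compact_cball) (auto intro: continuous_on_subset)
  moreover have "(\<lambda>x. indicator (cball 0 A) x *\<^sub>R f x) = f"
    using assms(2) by (intro ext) (auto simp: indicator_def not_le[symmetric])
  ultimately show ?thesis by simp
qed

lemma test_fun_integrable: "f \<in> test_fun \<Longrightarrow> integrable lborel f"
  using continuous_integrable_compact smooth_continuous test_fun_smooth test_funE by metis

lemma
  fixes f :: "('a::euclidean_space) cfun"
  assumes "c \<noteq> 0" "f \<in> borel_measurable borel"
  shows integral_affine: "(LINT z|lborel. f (c *\<^sub>R z + y)) = of_real (\<bar>c\<bar> powr - DIM('a)) * (LINT z|lborel. f z)"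
    and integrable_affine: "integrable lborel f \<Longrightarrow> integrable lborel (\<lambda>z. f (c *\<^sub>R z + y))"
proof -
  have L: "(lborel :: 'a measure) = density (distr lborel borel (\<lambda>x. y + c *\<^sub>R x)) (\<lambda>_. ennreal (\<bar>c\<bar> ^ DIM('a)))"
    using lborel_affine[OF assms(1), of y] by simp
  note [measurable] = assms(2)
  have "(LINT z|lborel. f z) = (LINT x|distr lborel borel (\<lambda>x. y + c *\<^sub>R x). (\<bar>c\<bar> ^ DIM('a)) *\<^sub>R f x)"
    by (subst L) (simp add: integral_density)
  also have "\<dots> = (\<bar>c\<bar> ^ DIM('a)) *\<^sub>R (LINT z|lborel. f (c *\<^sub>R z + y))"
    by (subst integral_distr) (auto simp: add.commute)
  finally show "(LINT z|lborel. f (c *\<^sub>R z + y)) = of_real (\<bar>c\<bar> powr - DIM('a)) * (LINT z|lborel. f z)"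
    using assms(1) by (simp add: powr_minus powr_realpow scaleR_conv_of_real flip: of_real_mult mult.assoc)
  assume "integrable lborel f"
  then have "integrable (density (distr lborel borel (\<lambda>x. y + c *\<^sub>R x)) (\<lambda>_. ennreal (\<bar>c\<bar> ^ DIM('a)))) f"
    using L by simp
  then have "integrable (distr lborel borel (\<lambda>x. y + c *\<^sub>R x)) (\<lambda>x. (\<bar>c\<bar> ^ DIM('a)) *\<^sub>R f x)"
    by (simp add: integrable_density)
  then have "integrable lborel (\<lambda>z. (\<bar>c\<bar> ^ DIM('a)) *\<^sub>R f (y + c *\<^sub>R z))"
    by (subst (asm) integrable_distr_eq) auto
  then have "integrable lborel (\<lambda>z. (1 / \<bar>c\<bar> ^ DIM('a)) *\<^sub>R ((\<bar>c\<bar> ^ DIM('a)) *\<^sub>R f (y + c *\<^sub>R z)))"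
    by (rule integrable_scaleR_right)
  then show "integrable lborel (\<lambda>z. f (c *\<^sub>R z + y))"
    using assms(1) by (simp add: add.commute)
qed

lemma norm_integral_le_ball:
  fixes f :: "('a::euclidean_space) cfun"
  assumes "\<And>x. norm (f x) \<le> B" "\<And>x. norm (x - c) > A \<Longrightarrow> f x = 0" "0 \<le> A"
  shows "norm (LINT x|lborel. f x) \<le> B * measure lborel (cball c A)"
proof (cases "integrable lborel f")
  case True
  have "norm (LINT x|lborel. f x) \<le> (LINT x|lborel. B * indicator (cball c A) x)"
  proof (rule Bochner_Integration.integral_norm_bound_integral[OF True])
    show "integrable lborel (\<lambda>x. B * indicator (cball c A) x)"
      using emeasure_lborel_cball_finite[of c A] by (intro integrable_mult_right) auto
    show "norm (f x) \<le> B * indicator (cball c A) x" for x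
      using assms(1)[of x] assms(2)[of x]
      by (auto simp: indicator_def dist_norm norm_minus_commute not_le)
  qed
  then show ?thesis by simp
next
  \<comment> \<open>The integral of a non-integrable function is 0 by default, so the bound holds
    here as well and integrability need not be assumed.\<close>
  case False
  have "0 \<le> B" using assms(1) norm_ge_zero order_trans by blast
  then show ?thesis using False by (simp add: not_integrable_integral_eq)
qed

text \<open>Translation invariance replaces the fundamental theorem: f(x + t b) - f(x) has integral
  0 and differs from t times the derivative by O(t^2) on a fixed ball. Dividing by t and letting t
  tend to 0 gives the claim.\<close>

lemma integral_partial_deriv_0:
  fixes f :: "('a::euclidean_space) cfun"
  assumes f: "f \<in> test_fun" and b: "b \<in> Basis"
  shows "(LINT x|lborel. partial_deriv b f x) = 0"
proof -
  obtain A where A: "A > 0" "\<And>x. A < norm x \<Longrightarrow> f x = 0" using f test_funE by metis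
  obtain B where B: "B > 0" "\<And>x. norm (pd [b, b] f x) \<le> B"
    using test_fun_pd_bounded[OF f, of 2] b by (metis (no_types, lifting) One_nat_def Suc_1 dual_order.refl
        empty_subsetI insert_subset length_Cons list.set(1,2) list.size(3))
  \<comment> \<open>The translations have length t at most 1, hence the ball of radius A +
    1.\<close>
  define V where "V = B * measure lborel (cball (0::'a) (A + 1))"
  let ?I = "LINT x|lborel. partial_deriv b f x"
  have "norm ?I \<le> V * t" if t: "0 < t" "t \<le> 1" for t
  proof -
    define d where "d x = f (x + t *\<^sub>R b) - f x - of_real t * partial_deriv b f x" for x
    have "norm (d x) \<le> B * t\<^sup>2" for x
      using smooth_second_order[OF test_fun_smooth[OF f] b, of B x t] B by (simp add: d_def scaleR_conv_of_real)
    moreover have "d x = 0" if "norm (x - 0) > A + 1" for x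
    proof -
      have "norm x \<le> norm (x + t *\<^sub>R b) + t" using norm_triangle_ineq4[of "x + t *\<^sub>R b" "t *\<^sub>R b"] b t by simp
      then show ?thesis using that t A(2)[of x] A(2)[of "x + t *\<^sub>R b"] pd_zero_outside[OF A(2), where w="[b]" and x=x] b
        by (simp add: d_def)
    qed
    ultimately have "norm (LINT x|lborel. d x) \<le> (B * t\<^sup>2) * measure lborel (cball (0::'a) (A + 1))"
      using A(1) by (intro norm_integral_le_ball) auto
    moreover have "(LINT x|lborel. d x) = - (of_real t * ?I)"
    proof -
      have i1: "integrable lborel (\<lambda>x. f (x + t *\<^sub>R b))" "(LINT x|lborel. f (x + t *\<^sub>R b)) = (LINT x|lborel. f x)"
        using integrable_affine[of 1 f "t *\<^sub>R b"] integral_affine[of 1 f "t *\<^sub>R b"]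
          test_fun_integrable[OF f] test_fun_measurable[OF f] by auto
      show ?thesis
        unfolding d_def using i1 test_fun_integrable[OF f] test_fun_integrable[OF test_fun_partial_deriv[OF f b]]
        by (subst Bochner_Integration.integral_diff, simp, simp, subst Bochner_Integration.integral_diff) simp_all
    qed
    ultimately have "t * norm ?I \<le> t * (V * t)"
      using t by (simp add: norm_mult V_def power2_eq_square mult_ac)
    then show ?thesis using t by simp
  qed
  then have ev: "\<forall>\<^sub>F t in at_right 0. norm ?I \<le> V * t"
    by (auto simp: eventually_at_right_field intro!: exI[of _ 1])
  have lim: "((\<lambda>t. V * t) \<longlongrightarrow> V * 0) (at_right 0)"
    by (intro tendsto_intros)
  have "norm ?I \<le> V * 0"
    using tendsto_lowerbound[OF lim ev] by simp
  then show ?thesis by simp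
qed

lemma integral_by_parts:
  fixes f :: "('a::euclidean_space) cfun"
  assumes f: "f \<in> test_fun" and g: "smooth g" and b: "b \<in> Basis"
  shows "(LINT x|lborel. partial_deriv b f x * g x) = - (LINT x|lborel. f x * partial_deriv b g x)"
proof -
  have "partial_deriv b (\<lambda>x. f x * g x) = (\<lambda>x. f x * partial_deriv b g x + partial_deriv b f x * g x)"
    using test_fun_smooth[OF f] g b by (intro ext partial_deriv_mult smooth_coord_diff)
  then have "(LINT x|lborel. f x * partial_deriv b g x + partial_deriv b f x * g x) = 0"
    using integral_partial_deriv_0[OF test_fun_mult[OF f g] b] by simp
  moreover have "integrable lborel (\<lambda>x. f x * partial_deriv b g x)" "integrable lborel (\<lambda>x. partial_deriv b f x * g x)"
    using f g b by (auto intro!: test_fun_integrable test_fun_mult test_fun_partial_deriv smooth_partial_deriv)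
  ultimately show ?thesis by (simp add: add_eq_0_iff2)
qed

section \<open>Vanishing moments under differentiation, affine maps and multiplication by
  monomials\<close>

lemma test_vmD: "f \<in> test_vm P \<Longrightarrow> f \<in> test_fun" "f \<in> test_vm P \<Longrightarrow> vanishing_moments P f"
  by (auto simp: test_vm_def)

lemma integral_polyf_0:
  assumes f: "f \<in> test_vm P" and p: "polyf P p"
  shows "(LINT x|lborel. f x * p x) = 0"
  using p f
proof (induction rule: polyf.induct)
  case (monomial \<alpha> L c)
  have "(LINT x|lborel. f x * (c * of_real (mi_power \<alpha> x))) = c * (LINT x|lborel. f x * of_real (mi_power \<alpha> x))"
    by (simp add: mult.left_commute)
  then show ?case using monomial by (simp add: test_vm_def vanishing_moments_def)
next
  case (add L p q)
  have "integrable lborel (\<lambda>x. f x * p x)" "integrable lborel (\<lambda>x. f x * q x)"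
    using add smooth_polyf test_vmD(1) by (auto intro!: test_fun_integrable test_fun_mult)
  then show ?case using add by (simp add: distrib_left)
qed

lemma test_vmI:
  assumes "f \<in> test_fun" "\<And>\<alpha>. mi_order \<alpha> \<le> P \<Longrightarrow> (LINT x|lborel. f x * of_real (mi_power \<alpha> x)) = 0"
  shows "f \<in> test_vm P"
  using assms by (simp add: test_vm_def vanishing_moments_def)

lemma test_vm_mono: "f \<in> test_vm P \<Longrightarrow> Q \<le> P \<Longrightarrow> f \<in> test_vm Q"
  by (simp add: test_vm_def vanishing_moments_def)

lemma test_vm_partial_deriv:
  assumes "f \<in> test_vm P" "b \<in> Basis" shows "partial_deriv b f \<in> test_vm P"
proof (rule test_vmI)
  fix \<alpha> :: "'a multi_index" assume "mi_order \<alpha> \<le> P"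
  then have "polyf (P - 1) (partial_deriv b (\<lambda>x. of_real (mi_power \<alpha> x)))"
    using polyf_partial_deriv(1)[OF polyf.monomial[of \<alpha> P 1] assms(2)] by simp
  then have "polyf P (partial_deriv b (\<lambda>x. of_real (mi_power \<alpha> x)))" by (rule polyf_le) simp
  then show "(LINT x|lborel. partial_deriv b f x * of_real (mi_power \<alpha> x)) = 0"
    using integral_by_parts[OF test_vmD(1)[OF assms(1)] smooth_mi_power assms(2)] integral_polyf_0[OF assms(1)] by simp
qed (use assms test_vmD test_fun_partial_deriv in blast)

lemma test_vm_pd: "f \<in> test_vm P \<Longrightarrow> set w \<subseteq> Basis \<Longrightarrow> pd w f \<in> test_vm P"
  by (induction w) (auto intro: test_vm_partial_deriv)

lemma integral_affine_mult:
  fixes f :: "('a::euclidean_space) cfun"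
  assumes "c \<noteq> 0" "f \<in> test_fun" "continuous_on UNIV g"
  shows "(LINT z|lborel. f (c *\<^sub>R z + y) * g z) =
    of_real (\<bar>c\<bar> powr - DIM('a)) * (LINT z|lborel. f z * g ((1 / c) *\<^sub>R z + (- (1 / c)) *\<^sub>R y))"
proof -
  have c: "(1 / c) *\<^sub>R (c *\<^sub>R z + y) + (- (1 / c)) *\<^sub>R y = z" for z
    using assms(1) by (simp add: algebra_simps)
  have [measurable]: "f \<in> borel_measurable borel" "g \<in> borel_measurable borel"
    using assms test_fun_measurable borel_measurable_continuous_onI by auto
  show ?thesis
    using integral_affine[OF assms(1), of "\<lambda>z. f z * g ((1 / c) *\<^sub>R z + (- (1 / c)) *\<^sub>R y)" y] unfolding c by simp
qed

lemma test_vm_affine: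
  assumes "f \<in> test_vm P" "c \<noteq> 0" shows "(\<lambda>z. f (c *\<^sub>R z + y)) \<in> test_vm P"
proof (rule test_vmI)
  fix \<alpha> :: "'a multi_index" assume "mi_order \<alpha> \<le> P"
  then have "polyf P (\<lambda>z. of_real (mi_power \<alpha> ((1 / c) *\<^sub>R z + (- (1 / c)) *\<^sub>R y)))"
    using polyf_mono_shift[of \<alpha> P 1 "1 / c" "(- (1 / c)) *\<^sub>R y"] by simp
  from integral_polyf_0[OF assms(1) this]
  show "(LINT x|lborel. f (c *\<^sub>R x + y) * of_real (mi_power \<alpha> x)) = 0"
    using integral_affine_mult[OF assms(2) test_vmD(1)[OF assms(1)] smooth_continuous[OF smooth_mi_power[of \<alpha>]]] by simp
qed (use assms test_vmD test_fun_affine in blast)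

lemma test_vm_cmult: "f \<in> test_vm P \<Longrightarrow> (\<lambda>z. c * f z) \<in> test_vm P"
  by (rule test_vmI) (auto simp: mult.assoc test_vm_def vanishing_moments_def intro: test_fun_cmult)

text \<open>With Q = P it puts a monomial of order at most P, cut off by a function in
  \<open>test_vm (2 * P)\<close>, into the domain of the operators.\<close>

lemma test_vm_monomial_mult:
  assumes "f \<in> test_vm (P + Q)" "mi_order \<alpha> \<le> Q"
  shows "(\<lambda>z. of_real (mi_power \<alpha> z) * f z) \<in> test_vm P"
proof (rule test_vmI)
  fix \<beta> :: "'a multi_index" assume "mi_order \<beta> \<le> P"
  then have "polyf (P + Q) (\<lambda>z. of_real (mi_power (\<lambda>b. \<alpha> b + \<beta> b) z))"
    using polyf.monomial[of "\<lambda>b. \<alpha> b + \<beta> b" "P + Q" 1] assms(2) by (simp add: mi_order_add)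
  from integral_polyf_0[OF assms(1) this]
  show "(LINT x|lborel. of_real (mi_power \<alpha> x) * f x * of_real (mi_power \<beta> x)) = 0"
    by (simp add: mi_power_add mult_ac)
qed (use assms test_vmD test_fun_mult' smooth_mi_power in blast)

subsection \<open>Integral estimates\<close>

text \<open>Dilation by s about y without normalisation: sup norms are preserved, which suits weak
  boundedness. The argument is z - y, so the functions of the overview are obtained by first
  reflecting the profile.\<close>

definition scl :: "'a::euclidean_space \<Rightarrow> real \<Rightarrow> 'a cfun \<Rightarrow> 'a cfun" where
  "scl y s f = (\<lambda>z. f ((1 / s) *\<^sub>R (z - y)))"

lemma scl_conv_affine: "scl y s f = (\<lambda>z. f ((1 / s) *\<^sub>R z + (- (1 / s)) *\<^sub>R y))"
  by (simp add: scl_def algebra_simps)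

lemma scl_test_fun: "f \<in> test_fun \<Longrightarrow> s > 0 \<Longrightarrow> scl y s f \<in> test_fun"
  unfolding scl_conv_affine by (rule test_fun_affine) auto

lemma scl_test_vm: "f \<in> test_vm P \<Longrightarrow> s > 0 \<Longrightarrow> scl y s f \<in> test_vm P"
  unfolding scl_conv_affine by (rule test_vm_affine) auto

lemma smooth_scl: "smooth f \<Longrightarrow> smooth (scl y s f)"
  unfolding scl_conv_affine by (rule smooth_affine)

lemma scl_eq_0:
  assumes "\<And>z. \<rho> < norm z \<Longrightarrow> f z = 0" "s > 0" "\<rho> * s < norm (z - y)"
  shows "scl y s f z = 0"
  using assms by (simp add: scl_def pos_less_divide_eq)

lemma fsupport_scl_subset:
  assumes "\<And>z. \<rho> < norm z \<Longrightarrow> f z = 0" "s > 0"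
  shows "fsupport (scl y s f) \<subseteq> cball y (\<rho> * s)"
  using scl_eq_0[OF assms] by (intro fsupport_subset) (auto simp: dist_norm norm_minus_commute not_le)

lemma norm_integral_scl_le:
  fixes f g :: "('a::euclidean_space) cfun"
  assumes "\<And>z. \<rho> < norm z \<Longrightarrow> f z = 0" "s > 0" "0 < \<rho>" "0 \<le> B" "0 \<le> Z"
    and "\<And>v. norm (v - y) \<le> \<rho> * s \<Longrightarrow> norm (g v) \<le> B" "\<And>z. norm (f z) \<le> Z"
  shows "norm (LINT v|lborel. g v * scl y s f v) \<le> (unit_ball_vol DIM('a) * \<rho> ^ DIM('a) * Z) * B * s ^ DIM('a)"
proof -
  have "norm (LINT v|lborel. g v * scl y s f v) \<le> (B * Z) * measure lborel (cball y (\<rho> * s))"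
  proof (rule norm_integral_le_ball)
    fix x show "norm (g x * scl y s f x) \<le> B * Z"
    proof (cases "norm (x - y) \<le> \<rho> * s")
      case True
      then show ?thesis using assms by (auto simp: norm_mult scl_def intro!: mult_mono)
    next
      case False
      then show ?thesis using assms by (simp add: scl_eq_0[where \<rho>=\<rho>])
    qed
    show "\<rho> * s < norm (x - y) \<Longrightarrow> g x * scl y s f x = 0"
      using assms by (simp add: scl_eq_0[where \<rho>=\<rho>])
  qed (use assms in auto)
  then show ?thesis
    using assms by (simp add: content_cball power_mult_distrib mult_ac)
qed

text \<open>The moments of \<zeta> allow the Taylor polynomial of order M of f at y to be
  subtracted, leaving a remainder of order M + \<gamma> on a ball of radius proportional to s. Here
  f stands for a kernel slice with singular point u; the constant depends on neither.\<close>

lemma slice_integral_bound: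
  fixes \<zeta> :: "('a::euclidean_space) cfun"
  assumes \<zeta>: "\<zeta> \<in> test_vm M" "\<And>z. \<rho> < norm z \<Longrightarrow> \<zeta> z = 0" "0 < \<rho>" and g: "0 \<le> g"
  obtains C where "C > 0"
    "\<And>f u y s A. \<lbrakk>0 \<le> A; 0 < s; 3 * \<rho> * s \<le> norm (u - y); C_k_on M (- {u}) f;
      \<forall>\<alpha> h. mi_order \<alpha> = M \<longrightarrow> norm h < norm (u - y) / 2 \<longrightarrow>
        norm (mi_deriv \<alpha> f (y + h) - mi_deriv \<alpha> f y) \<le> A * norm h powr g\<rbrakk> \<Longrightarrow>
      norm (LINT v|lborel. f v * scl y s \<zeta> v) \<le> C * A * s powr (real DIM('a) + real M + g)"
proof -
  obtain Z where Z: "Z > 0" "\<And>z. norm (\<zeta> z) \<le> Z" using test_fun_bounded[OF test_vmD(1)[OF \<zeta>(1)]] by blast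
  define C where "C = unit_ball_vol DIM('a) * \<rho> ^ DIM('a) * Z * real DIM('a) ^ M * \<rho> powr (real M + g)"
  have "C > 0" using \<zeta> Z unit_ball_vol_pos[of "real DIM('a)"] by (simp add: C_def)
  moreover have "norm (LINT v|lborel. f v * scl y s \<zeta> v) \<le> C * A * s powr (real DIM('a) + real M + g)"
    if A: "0 \<le> A" and s: "0 < s" and far: "3 * \<rho> * s \<le> norm (u - y)" and f: "C_k_on M (- {u}) f"
      and H: "\<forall>\<alpha> h. mi_order \<alpha> = M \<longrightarrow> norm h < norm (u - y) / 2 \<longrightarrow>
        norm (mi_deriv \<alpha> f (y + h) - mi_deriv \<alpha> f y) \<le> A * norm h powr g" for f u y s A
  proof -
    \<comment> \<open>The factor 3 makes the support radius strictly less than half the distance to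
      u, as the Hoelder condition requires, and keeps u outside the support.\<close>
    have rs: "\<rho> * s > 0" "3 * (\<rho> * s) \<le> norm (u - y)" using \<zeta>(3) s far by auto
    obtain p where p: "polyf M p" "\<And>w h. set w \<subseteq> Basis \<Longrightarrow> length w \<le> M \<Longrightarrow> norm h \<in> {0..\<rho> * s} \<Longrightarrow>
      norm (pd w (\<lambda>z. f z - p z) (y + h)) \<le> real DIM('a) ^ M * A * norm h powr (real M - real (length w) + g)"
    proof (rule taylor_remainder[of "- {u}" M f "{0..\<rho> * s}" y A g])
      show "{0..r} \<subseteq> {0..\<rho> * s} \<and> cball y r \<subseteq> - {u}" if "r \<in> {0..\<rho> * s}" for r
        using that rs by (auto simp: dist_norm norm_minus_commute)
      show "norm (mi_deriv \<alpha> f (y + h) - mi_deriv \<alpha> f y) \<le> A * norm h powr g"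
        if "mi_order \<alpha> = M" "norm h \<in> {0..\<rho> * s}" for \<alpha> h
        using that rs H by auto
    qed (use f A g rs in auto)
    have bd: "norm (f v - p v) \<le> real DIM('a) ^ M * A * (\<rho> * s) powr (real M + g)" if "norm (v - y) \<le> \<rho> * s" for v
    proof -
      have "norm (f v - p v) \<le> real DIM('a) ^ M * A * norm (v - y) powr (real M + g)"
        using p(2)[of "[]" "v - y"] that by simp
      also have "\<dots> \<le> real DIM('a) ^ M * A * (\<rho> * s) powr (real M + g)"
        using A that g by (intro mult_left_mono powr_mono2) auto
      finally show ?thesis .
    qed
    show ?thesis
    proof (cases "integrable lborel (\<lambda>v. f v * scl y s \<zeta> v)")
      case True
      have vm: "scl y s \<zeta> \<in> test_vm M" using \<zeta> s by (intro scl_test_vm)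
      have ip: "integrable lborel (\<lambda>v. p v * scl y s \<zeta> v)"
        using vm by (intro test_fun_integrable test_fun_mult' smooth_polyf[OF p(1)] test_vmD)
      have "(LINT v|lborel. f v * scl y s \<zeta> v) = (LINT v|lborel. (f v - p v) * scl y s \<zeta> v)"
        using Bochner_Integration.integral_diff[OF True ip] integral_polyf_0[OF vm p(1)]
        by (simp add: left_diff_distrib mult.commute)
      also have "norm \<dots> \<le> (unit_ball_vol DIM('a) * \<rho> ^ DIM('a) * Z) * (real DIM('a) ^ M * A * (\<rho> * s) powr (real M + g)) * s ^ DIM('a)"
        using \<zeta> s Z bd A by (intro norm_integral_scl_le) auto
      also have "\<dots> = C * A * s powr (real DIM('a) + real M + g)"
        using \<zeta>(3) s unfolding add.assoc powr_add[of s "real DIM('a)"]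
        by (simp add: C_def powr_mult powr_realpow mult_ac)
      finally show ?thesis .
    next
      case False
      then show ?thesis using \<open>C > 0\<close> A by (simp add: not_integrable_integral_eq)
    qed
  qed
  ultimately show ?thesis using that by blast
qed

lemma cball_borel [measurable]: "cball y r \<in> sets borel"
  by (simp add: borel_closed)

text \<open>A dyadic majorant in place of polar coordinates: on the shell between 2^i r and 2^(i+1)
  r the integrand is at most its value at the inner radius. The shells are enlarged to full balls,
  which costs only a constant, and the volumes form a geometric series of ratio
  \<open>2 powr - e\<close>.\<close>

lemma nn_integral_tail:
  fixes e :: real assumes e: "0 < e"
  obtains C where "C > 0" "\<And>(y::'a::euclidean_space) r. 0 < r \<Longrightarrow>
    (\<integral>\<^sup>+z. ennreal (norm (z - y) powr - (real DIM('a) + e)) * indicator {z. r \<le> norm (z - y)} z \<partial>lborel) \<le> ennreal (C * r powr - e)"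
proof -
  let ?n = "real DIM('a)"
  define q where "q = (2::real) powr - e"
  have q: "0 < q" "q < 1" using e by (auto simp: q_def powr_less_one)
  define C where "C = unit_ball_vol ?n * 2 powr ?n / (1 - q)"
  have "C > 0" using q unit_ball_vol_pos[of ?n] by (simp add: C_def)
  moreover have "(\<integral>\<^sup>+z. ennreal (norm (z - y) powr - (?n + e)) * indicator {z. r \<le> norm (z - y)} z \<partial>lborel) \<le> ennreal (C * r powr - e)"
    if r: "0 < r" for y :: 'a and r
  proof -
    define a where "a i = (2 ^ i * r) powr - (?n + e)" for i :: nat
    define h where "h i z = ennreal (a i) * indicator (cball y (2 ^ Suc i * r)) z" for i :: nat and z
    have "ennreal (norm (z - y) powr - (?n + e)) * indicator {z. r \<le> norm (z - y)} z \<le> (\<Sum>i. h i z)" for z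
    proof (cases "r \<le> norm (z - y)")
      case True
      define x where "x = norm (z - y) / r"
      have x: "1 \<le> x" using True r by (simp add: x_def)
      obtain j where "x < 2 ^ j" using real_arch_pow[of 2 x] by auto
      \<comment> \<open>Index of the shell containing z; minimality yields the lower bound
        \<open>i2\<close>.\<close>
      define i where "i = (LEAST j. x < 2 ^ Suc j)"
      have "x < 2 ^ Suc j" using order.strict_trans2[OF \<open>x < 2 ^ j\<close> power_increasing[of j "Suc j" 2]] by simp
      then have i1: "x < 2 ^ Suc i" unfolding i_def by (rule LeastI)
      have i2: "2 ^ i \<le> x"
      proof (cases i)
        case (Suc k)
        then have "\<not> x < 2 ^ Suc k" unfolding i_def using not_less_Least by (metis i_def lessI)
        then show ?thesis using Suc by simp
      qed (use x in simp)
      have "norm (z - y) < 2 ^ Suc i * r" "2 ^ i * r \<le> norm (z - y)"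
        using i1 i2 r by (auto simp: x_def field_simps)
      then have "norm (z - y) powr - (?n + e) \<le> a i" "z \<in> cball y (2 ^ Suc i * r)"
        using e r by (auto simp: a_def dist_norm norm_minus_commute intro!: powr_mono2')
      then have "ennreal (norm (z - y) powr - (?n + e)) \<le> h i z" by (simp add: h_def ennreal_leI)
      also have "\<dots> \<le> (\<Sum>i. h i z)" using sum_le_suminf[of "\<lambda>i. h i z" "{i}"] by simp
      finally show ?thesis using True by simp
    qed simp
    then have "(\<integral>\<^sup>+z. ennreal (norm (z - y) powr - (?n + e)) * indicator {z. r \<le> norm (z - y)} z \<partial>lborel) \<le> (\<integral>\<^sup>+z. (\<Sum>i. h i z) \<partial>lborel)"
      by (intro nn_integral_mono) auto
    also have "\<dots> = (\<Sum>i. \<integral>\<^sup>+z. h i z \<partial>lborel)"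
      unfolding h_def by (intro nn_integral_suminf) measurable
    also have "\<dots> = (\<Sum>i. ennreal (unit_ball_vol ?n * 2 powr ?n * r powr - e * q ^ i))"
    proof (rule suminf_cong)
      fix i
      have "(\<integral>\<^sup>+z. h i z \<partial>lborel) = ennreal (a i) * emeasure lborel (cball y (2 ^ Suc i * r))"
        unfolding h_def by (subst nn_integral_cmult_indicator) auto
      also have "\<dots> = ennreal (a i * (unit_ball_vol ?n * (2 ^ Suc i * r) ^ DIM('a)))"
        using r by (simp add: emeasure_cball ennreal_mult' a_def)
      also have "a i * (unit_ball_vol ?n * (2 ^ Suc i * r) ^ DIM('a)) = unit_ball_vol ?n * 2 powr ?n * r powr - e * q ^ i"
      proof -
        have "(2 ^ Suc i * r) ^ DIM('a) = 2 powr ?n * (2 ^ i * r) powr ?n"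
          using r by (simp add: powr_realpow power_mult_distrib mult_ac)
        moreover have "a i * (2 ^ i * r) powr ?n = (2 ^ i * r) powr - e"
          unfolding a_def by (simp flip: powr_add)
        moreover have "(2 ^ i * r) powr - e = r powr - e * q ^ i"
          using r by (simp add: powr_mult q_def powr_powr mult.commute flip: powr_realpow)
        ultimately show ?thesis by (simp add: mult_ac)
      qed
      finally show "(\<integral>\<^sup>+z. h i z \<partial>lborel) = ennreal (unit_ball_vol ?n * 2 powr ?n * r powr - e * q ^ i)" .
    qed
    also have "\<dots> = ennreal (\<Sum>i. unit_ball_vol ?n * 2 powr ?n * r powr - e * q ^ i)"
      using q unit_ball_vol_nonneg[of ?n] by (intro suminf_ennreal2) (auto intro!: summable_mult summable_geometric)
    also have "(\<Sum>i. unit_ball_vol ?n * 2 powr ?n * r powr - e * q ^ i) = C * r powr - e"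
      using q by (simp add: suminf_mult summable_geometric suminf_geometric C_def)
    finally show ?thesis .
  qed
  ultimately show ?thesis using that by blast
qed

lemma powr_ratio:
  fixes s t a :: real
  shows "0 < s \<Longrightarrow> 0 < t \<Longrightarrow> (s / t) powr a = s powr a * t powr - a"
  by (simp add: powr_divide powr_minus field_simps)

lemma norm_integral_tail:
  fixes e :: real assumes e: "0 < e"
  obtains C where "C > 0" "\<And>(G :: ('a::euclidean_space) cfun) y r a. \<lbrakk>0 < r; 0 \<le> a;
      \<forall>z. r \<le> norm (z - y) \<longrightarrow> norm (G z) \<le> a * norm (z - y) powr - (real DIM('a) + e);
      \<forall>z. norm (z - y) < r \<longrightarrow> G z = 0\<rbrakk> \<Longrightarrow> norm (LINT z|lborel. G z) \<le> C * a * r powr - e"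
proof -
  obtain C where C: "C > 0" "\<And>(y::'a) r. 0 < r \<Longrightarrow>
    (\<integral>\<^sup>+z. ennreal (norm (z - y) powr - (real DIM('a) + e)) * indicator {z. r \<le> norm (z - y)} z \<partial>lborel) \<le> ennreal (C * r powr - e)"
    using nn_integral_tail[OF e] by blast
  have "norm (LINT z|lborel. G z) \<le> C * a * r powr - e"
    if r: "0 < r" "0 \<le> a" and G: "\<forall>z. r \<le> norm (z - y) \<longrightarrow> norm (G z) \<le> a * norm (z - y) powr - (real DIM('a) + e)"
      "\<forall>z. norm (z - y) < r \<longrightarrow> G z = 0" for G :: "'a cfun" and y r a
  proof (cases "integrable lborel G")
    case True
    have "ennreal (norm (LINT z|lborel. G z)) \<le> (\<integral>\<^sup>+z. norm (G z) \<partial>lborel)"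
      by (rule integral_norm_bound_ennreal[OF True])
    also have "\<dots> \<le> (\<integral>\<^sup>+z. ennreal a * (ennreal (norm (z - y) powr - (real DIM('a) + e)) * indicator {z. r \<le> norm (z - y)} z) \<partial>lborel)"
      using G r by (intro nn_integral_mono) (auto simp: indicator_def ennreal_mult'[symmetric] not_le intro!: ennreal_leI)
    also have "\<dots> \<le> ennreal a * ennreal (C * r powr - e)"
      by (subst nn_integral_cmult) (measurable, intro mult_left_mono C(2) r, simp)
    finally have "norm (LINT z|lborel. G z) \<le> a * (C * r powr - e)"
      using r C(1) by (simp add: ennreal_mult'[symmetric])
    then show ?thesis by (simp add: mult_ac)
  next
    case False
    then show ?thesis using r C(1) by (simp add: not_integrable_integral_eq)
  qed
  then show ?thesis using that C(1) by blast
qed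

lemma integrable_decay:
  fixes G :: "('a::euclidean_space) cfun"
  assumes "G \<in> borel_measurable borel" "\<And>z. norm (G z) \<le> b" "0 < e" "0 \<le> a"
    and "\<And>z. 1 \<le> norm (z - y) \<Longrightarrow> norm (G z) \<le> a * norm (z - y) powr - (real DIM('a) + e)"
  shows "integrable lborel G"
proof -
  obtain C where C: "C > 0" "\<And>(y::'a) r. 0 < r \<Longrightarrow>
    (\<integral>\<^sup>+z. ennreal (norm (z - y) powr - (real DIM('a) + e)) * indicator {z. r \<le> norm (z - y)} z \<partial>lborel) \<le> ennreal (C * r powr - e)"
    using nn_integral_tail[OF assms(3)] by blast
  have b: "0 \<le> b" using assms(2) norm_ge_zero order_trans by blast
  have "(\<integral>\<^sup>+z. norm (G z) \<partial>lborel) \<le> (\<integral>\<^sup>+z. ennreal b * indicator (cball y 1) z +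
      ennreal a * (ennreal (norm (z - y) powr - (real DIM('a) + e)) * indicator {z. 1 \<le> norm (z - y)} z) \<partial>lborel)"
  proof (rule nn_integral_mono)
    fix z
    show "ennreal (norm (G z)) \<le> ennreal b * indicator (cball y 1) z +
      ennreal a * (ennreal (norm (z - y) powr - (real DIM('a) + e)) * indicator {z. 1 \<le> norm (z - y)} z)"
    proof (cases "1 \<le> norm (z - y)")
      case True
      then have "ennreal (norm (G z)) \<le> ennreal a * (ennreal (norm (z - y) powr - (real DIM('a) + e)))"
        using assms(4) assms(5)[of z] by (simp add: ennreal_mult'[symmetric] ennreal_leI)
      then show ?thesis using True by (simp add: add_increasing)
    next
      case False
      then have "z \<in> cball y 1" by (simp add: dist_norm norm_minus_commute)
      then show ?thesis using assms(2)[of z] False by (simp add: ennreal_leI)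
    qed
  qed
  also have "\<dots> = ennreal b * emeasure lborel (cball y 1) + ennreal a *
      (\<integral>\<^sup>+z. ennreal (norm (z - y) powr - (real DIM('a) + e)) * indicator {z. 1 \<le> norm (z - y)} z \<partial>lborel)"
    by (subst nn_integral_add) (auto simp: nn_integral_cmult nn_integral_cmult_indicator)
  also have "\<dots> \<le> ennreal b * emeasure lborel (cball y 1) + ennreal a * ennreal (C * 1 powr - e)"
    by (intro add_left_mono mult_left_mono C(2)) auto
  also have "\<dots> < \<infinity>"
    using emeasure_lborel_cball_finite[of y 1] by (simp add: less_top[symmetric] ennreal_mult_eq_top_iff)
  finally show ?thesis using assms(1) by (intro integrableI_bounded) auto
qed

text \<open>The value 0 is the default for a non-integrable integrand, and every nonnegative bound
  holds for it. An estimate of either iterated integral therefore bounds the pairing without a proof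
  that the kernel is integrable against f and g.\<close>

lemma kernel_pairing_Fubini:
  fixes K :: "'a::euclidean_space \<Rightarrow> 'a \<Rightarrow> complex"
  shows "kernel_pairing K f g = 0 \<or>
      kernel_pairing K f g = (LINT u|lborel. (LINT v|lborel. K u v * f v) * g u) \<and>
      kernel_pairing K f g = (LINT v|lborel. (LINT u|lborel. K u v * g u) * f v)"
proof (cases "integrable lborel (\<lambda>z. K (fst z) (snd z) * f (snd z) * g (fst z))")
  case True
  then have i: "integrable (lborel \<Otimes>\<^sub>M lborel) (\<lambda>(u, v). K u v * f v * g u)"
    by (simp add: lborel_prod case_prod_unfold)
  have "kernel_pairing K f g = (LINT z|(lborel \<Otimes>\<^sub>M lborel). (case z of (u, v) \<Rightarrow> K u v * f v * g u))"
    by (simp add: kernel_pairing_def lborel_prod case_prod_unfold)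
  moreover have "\<dots> = (LINT u|lborel. (LINT v|lborel. K u v * f v) * g u)"
    using lborel_pair.integral_fst'[OF i] by simp
  moreover have "(LINT v|lborel. (LINT u|lborel. K u v * f v * g u)) = (LINT u|lborel. (LINT v|lborel. K u v * f v * g u))"
    by (rule lborel_pair.Fubini_integral[OF i])
  moreover have "(LINT v|lborel. (LINT u|lborel. K u v * f v * g u)) = (LINT v|lborel. (LINT u|lborel. K u v * g u) * f v)"
    by (intro Bochner_Integration.integral_cong refl) (simp add: mult.assoc mult.left_commute mult.commute)
  ultimately show ?thesis by simp
next
  case False
  then show ?thesis by (simp add: kernel_pairing_def not_integrable_integral_eq)
qed

text \<open>The bound is global in z and uniform in the centre a: increments of the top derivatives
  are controlled by the next derivatives when |h| is at most 1 and by the sup norm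
  otherwise.\<close>

lemma test_fun_taylor:
  fixes \<psi> :: "('a::euclidean_space) cfun"
  assumes \<psi>: "\<psi> \<in> test_fun" and d: "0 < d" "d \<le> 1"
  obtains C where "C > 0" "\<And>a. \<exists>p. polyf L p \<and> (\<forall>w z. set w \<subseteq> Basis \<longrightarrow> length w \<le> L \<longrightarrow>
      norm (pd w (\<lambda>z. \<psi> z - p z) z) \<le> C * norm (z - a) powr (real L - real (length w) + d))"
proof -
  obtain B where B: "B > 0" "\<And>w x. set w \<subseteq> Basis \<Longrightarrow> length w \<le> Suc L \<Longrightarrow> norm (pd w \<psi> x) \<le> B"
    using test_fun_pd_bounded[OF \<psi>] by metis
  have B': "norm (mi_deriv \<alpha> \<psi> x) \<le> B" if "mi_order \<alpha> \<le> L" for \<alpha> x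
    unfolding mi_deriv_conv_pd using that by (intro B set_canonical_word) (simp add: length_canonical_word)
  \<comment> \<open>Large enough both for the Lipschitz constant n B and for the crude increment 2
    B.\<close>
  define A where "A = 2 * real DIM('a) * B"
  have n1: "real DIM('a) \<ge> 1" by (simp add: Suc_leI)
  have A: "A > 0" using B by (simp add: A_def)
  have H: "norm (mi_deriv \<alpha> \<psi> (a + h) - mi_deriv \<alpha> \<psi> a) \<le> A * norm h powr d" if \<alpha>: "mi_order \<alpha> = L" for \<alpha> a h
  proof (cases "norm h \<le> 1")
    case True
    let ?w = "canonical_word \<alpha>"
    have "norm (partial_deriv b (mi_deriv \<alpha> \<psi>) z) \<le> B" if "b \<in> Basis" for b z
      using B(2)[of "b # ?w" z] that \<alpha> set_canonical_word[of \<alpha>] by (simp add: mi_deriv_conv_pd length_canonical_word)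
    moreover have "smooth (mi_deriv \<alpha> \<psi>)"
      unfolding mi_deriv_conv_pd by (intro smooth_pd set_canonical_word test_fun_smooth \<psi>)
    ultimately have "norm (mi_deriv \<alpha> \<psi> (a + h) - mi_deriv \<alpha> \<psi> a) \<le> DIM('a) * B * norm h"
      using B by (intro smooth_increment_le) auto
    also have "\<dots> \<le> DIM('a) * B * norm h powr d"
      using True d B powr_mono'[of d 1 "norm h"] by (cases "h = 0") (auto intro!: mult_left_mono)
    also have "\<dots> \<le> A * norm h powr d" using B by (intro mult_right_mono) (auto simp: A_def)
    finally show ?thesis .
  next
    case False
    have "norm (mi_deriv \<alpha> \<psi> (a + h) - mi_deriv \<alpha> \<psi> a) \<le> B + B"
      using \<alpha> by (intro order_trans[OF norm_triangle_ineq4] add_mono B') auto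
    also have "\<dots> \<le> A * 1" using mult_right_mono[OF n1, of "2 * B"] B by (simp add: A_def mult_ac)
    also have "\<dots> \<le> A * norm h powr d" using False d A by (intro mult_left_mono ge_one_powr_ge_zero) auto
    finally show ?thesis .
  qed
  define C where "C = real DIM('a) ^ L * A"
  have "\<exists>p. polyf L p \<and> (\<forall>w z. set w \<subseteq> Basis \<longrightarrow> length w \<le> L \<longrightarrow>
      norm (pd w (\<lambda>z. \<psi> z - p z) z) \<le> C * norm (z - a) powr (real L - real (length w) + d))" for a
  proof -
    obtain p where p: "polyf L p" "\<And>w h. set w \<subseteq> Basis \<Longrightarrow> length w \<le> L \<Longrightarrow> norm h \<in> UNIV \<Longrightarrow>
      norm (pd w (\<lambda>z. \<psi> z - p z) (a + h)) \<le> real DIM('a) ^ L * A * norm h powr (real L - real (length w) + d)"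
      using A d H smooth_C_k_on[OF test_fun_smooth[OF \<psi>]]
      by (elim taylor_remainder[of UNIV L \<psi> UNIV a A d, rotated -1]) auto
    have "norm (pd w (\<lambda>z. \<psi> z - p z) z) \<le> C * norm (z - a) powr (real L - real (length w) + d)"
      if "set w \<subseteq> Basis" "length w \<le> L" for w z
      using p(2)[of w "z - a"] that by (simp add: C_def)
    then show ?thesis using p(1) by blast
  qed
  moreover have "C > 0" using A by (simp add: C_def)
  ultimately show ?thesis using that by blast
qed

subsection \<open>Almost orthogonality\<close>

text \<open>One P serves all hypotheses. They are stated in the form in which they are applied: the
  kernel through its slices and their pure derivatives of order M, weak boundedness with the sizes a
  and b of both functions factored out, and the vanishing of T^* on polynomials through cut-offs
  \<open>q R\<close> that equal p on |z| < R and grow like |z|^L uniformly in R.\<close>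

locale sio =
  fixes T Tt :: "('a::euclidean_space) operator" and K :: "'a \<Rightarrow> 'a \<Rightarrow> complex"
    and \<nu> \<gamma> N CK CW :: real and M L P N0 :: nat and \<eta> :: "'a cfun"
  assumes N_def: "N = real DIM('a) + \<nu> + real M + \<gamma>"
    and order: "\<nu> \<le> real L" "real L \<le> real M + \<nu>" "0 < \<gamma>" "\<gamma> \<le> 1" "M \<le> P" "L \<le> P"
    and linear: "\<zeta> \<in> test_vm P \<Longrightarrow> linear_functional_on test_fun (T \<zeta>)"
    and transpose: "f \<in> test_vm P \<Longrightarrow> g \<in> test_vm P \<Longrightarrow> T f g = Tt g f"
    and kernel: "f \<in> test_vm P \<Longrightarrow> g \<in> test_fun \<Longrightarrow> fsupport f \<inter> fsupport g = {} \<Longrightarrow> T f g = kernel_pairing K f g"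
    and kernel_transpose: "f \<in> test_fun \<Longrightarrow> g \<in> test_vm P \<Longrightarrow> fsupport f \<inter> fsupport g = {} \<Longrightarrow> Tt g f = kernel_pairing K f g"
    and CK: "CK > 0"
    and kernel_C_k: "C_k_on M (- {u}) (K u)" "C_k_on M (- {v}) (\<lambda>u. K u v)"
    and kernel_Hoelder: "mi_order \<alpha> = M \<Longrightarrow> norm h < norm (u - v) / 2 \<Longrightarrow>
        norm (mi_deriv \<alpha> (K u) (v + h) - mi_deriv \<alpha> (K u) v)
          \<le> CK * norm (u - v) powr - N * norm h powr \<gamma>"
      "mi_order \<alpha> = M \<Longrightarrow> norm h < norm (u - v) / 2 \<Longrightarrow>
        norm (mi_deriv \<alpha> (\<lambda>u. K u v) (u + h) - mi_deriv \<alpha> (\<lambda>u. K u v) u)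
          \<le> CK * norm (u - v) powr - N * norm h powr \<gamma>"
    and CW: "CW > 0"
    and wbp: "\<lbrakk>0 < r; \<zeta> \<in> test_vm P; \<phi> \<in> test_fun; 0 < a; 0 < b;
        \<And>z. 1 < norm z \<Longrightarrow> \<zeta> z = 0; \<And>z. 1 < norm z \<Longrightarrow> \<phi> z = 0;
        \<And>w z. set w \<subseteq> Basis \<Longrightarrow> length w \<le> N0 \<Longrightarrow> norm (pd w \<zeta> z) \<le> a;
        \<And>w z. set w \<subseteq> Basis \<Longrightarrow> length w \<le> N0 \<Longrightarrow> norm (pd w \<phi> z) \<le> b\<rbrakk> \<Longrightarrow>
        norm (T (scl y r \<zeta>) (scl y r \<phi>)) + norm (Tt (scl y r \<zeta>) (scl y r \<phi>))
          \<le> CW * a * b * r powr (real DIM('a) - \<nu>)"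
    and moments: "polyf L p \<Longrightarrow> \<exists>q C. 0 \<le> C \<and>
        (\<forall>R\<ge>1. q R \<in> test_fun \<and> (\<forall>z. norm z < R \<longrightarrow> q R z = p z) \<and> (\<forall>z. norm (q R z) \<le> C * (1 + norm z) ^ L)) \<and>
        (\<forall>\<zeta>\<in>test_vm P. ((\<lambda>R::real. T \<zeta> (q R)) \<longlongrightarrow> 0) at_top)"
    and eta: "\<eta> \<in> test_fun" "norm z < 1 \<Longrightarrow> \<eta> z = 1"
begin

lemma N_pos: "0 < N" "real DIM('a) < N"
  using order by (auto simp: N_def add.assoc)

lemma linear_add: "\<zeta> \<in> test_vm P \<Longrightarrow> f \<in> test_fun \<Longrightarrow> g \<in> test_fun \<Longrightarrow> T \<zeta> (\<lambda>x. f x + g x) = T \<zeta> f + T \<zeta> g"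
  using linear unfolding linear_functional_on_def by blast

text \<open>Cancellation in one variable with the other frozen. The two bounds serve T and its
  transpose respectively, the kernel being regular in each variable.\<close>

lemma kernel_inner_bound:
  assumes \<zeta>: "\<zeta> \<in> test_vm P" "\<And>z. \<rho> < norm z \<Longrightarrow> \<zeta> z = 0" "0 < \<rho>"
  obtains C where "C > 0"
    "\<And>u y s. 0 < s \<Longrightarrow> 3 * \<rho> * s \<le> norm (u - y) \<Longrightarrow>
      norm (LINT v|lborel. K u v * scl y s \<zeta> v) \<le> C * norm (u - y) powr - N * s powr (real DIM('a) + real M + \<gamma>)"
    "\<And>v y s. 0 < s \<Longrightarrow> 3 * \<rho> * s \<le> norm (v - y) \<Longrightarrow>
      norm (LINT u|lborel. K u v * scl y s \<zeta> u) \<le> C * norm (v - y) powr - N * s powr (real DIM('a) + real M + \<gamma>)"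
proof -
  have vmM: "\<zeta> \<in> test_vm M" using \<zeta> order test_vm_mono by blast
  obtain C where C: "C > 0"
    "\<And>f u y s A. \<lbrakk>0 \<le> A; 0 < s; 3 * \<rho> * s \<le> norm (u - y); C_k_on M (- {u}) f;
      \<forall>\<alpha> h. mi_order \<alpha> = M \<longrightarrow> norm h < norm (u - y) / 2 \<longrightarrow>
        norm (mi_deriv \<alpha> f (y + h) - mi_deriv \<alpha> f y) \<le> A * norm h powr \<gamma>\<rbrakk> \<Longrightarrow>
      norm (LINT v|lborel. f v * scl y s \<zeta> v) \<le> C * A * s powr (real DIM('a) + real M + \<gamma>)"
    by (rule slice_integral_bound[OF vmM \<zeta>(2,3) less_imp_le[OF order(3)]], assumption+, rule that)
  show ?thesis
  proof (rule that[of "C * CK"])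
    show "norm (LINT v|lborel. K u v * scl y s \<zeta> v) \<le> C * CK * norm (u - y) powr - N * s powr (real DIM('a) + real M + \<gamma>)"
      if "0 < s" "3 * \<rho> * s \<le> norm (u - y)" for u y s
      using C(2)[of "CK * norm (u - y) powr - N" s u y "K u"] that CK kernel_C_k(1) kernel_Hoelder(1)
      by (simp add: mult.assoc)
    show "norm (LINT u|lborel. K u v * scl y s \<zeta> u) \<le> C * CK * norm (v - y) powr - N * s powr (real DIM('a) + real M + \<gamma>)"
      if "0 < s" "3 * \<rho> * s \<le> norm (v - y)" for v y s
      using C(2)[of "CK * norm (v - y) powr - N" s v y "\<lambda>u. K u v"] that CK kernel_C_k(2)
        kernel_Hoelder(2)[of _ _ y v]
      by (simp add: mult.assoc norm_minus_commute)
  qed (use C CK in simp)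
qed

text \<open>
  The part of \<open>\<psi> - p\<close> near \<open>y\<close>, where \<open>p\<close> is the Taylor polynomial of \<open>\<psi>\<close> at \<open>y\<close>, at scale \<open>s\<close>.
\<close>

lemma local_part_bound:
  assumes \<zeta>: "\<zeta> \<in> test_vm P" "\<And>z. \<rho> < norm z \<Longrightarrow> \<zeta> z = 0" and \<rho>: "1 \<le> \<rho>" "\<rho> \<le> \<kappa>"
    and \<theta>: "\<theta> \<in> test_fun" "\<And>z. 1 < norm z \<Longrightarrow> \<theta> z = 0"
    and \<psi>: "\<psi> \<in> test_fun" and d: "0 < d" "d \<le> 1" and Ct: "0 < Ct"
  obtains C where "C > 0"
    "\<And>p a y s t. \<lbrakk>0 < s; s \<le> t; polyf L p;
       \<forall>w z. set w \<subseteq> Basis \<longrightarrow> length w \<le> L \<longrightarrow>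
          norm (pd w (\<lambda>z. \<psi> z - p z) z) \<le> Ct * norm (z - a) powr (real L - real (length w) + d)\<rbrakk> \<Longrightarrow>
      norm (T (scl y s \<zeta>) (scl y (\<kappa> * s) (\<lambda>z. (\<psi> ((\<kappa> * s / t) *\<^sub>R z + a) - p ((\<kappa> * s / t) *\<^sub>R z + a)) * \<theta> z)))
        \<le> C * s powr (real DIM('a) - \<nu>) * (s / t) powr (real L + d)"
proof -
  have \<kappa>: "1 \<le> \<kappa>" using \<rho> by simp
  \<comment> \<open>Weak boundedness wants both functions at one scale inside the unit ball; \<zeta>
    at scale s is \<zeta>' at the larger scale \<kappa> s, where the cut-off lives.\<close>
  define \<zeta>' where "\<zeta>' = (\<lambda>z. \<zeta> (\<kappa> *\<^sub>R z + 0))"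
  have \<zeta>': "\<zeta>' \<in> test_vm P" unfolding \<zeta>'_def using \<zeta> \<kappa> by (intro test_vm_affine) auto
  have \<zeta>'0: "\<zeta>' z = 0" if "1 < norm z" for z
  proof -
    have "\<kappa> * 1 < \<kappa> * norm z" using that \<kappa> by (intro mult_strict_left_mono) auto
    then have "\<rho> < \<kappa> * norm z" using \<rho> by linarith
    then show ?thesis using \<kappa> unfolding \<zeta>'_def by (intro \<zeta>(2)) simp
  qed
  obtain a1 where a1: "a1 > 0" "\<And>w x. set w \<subseteq> Basis \<Longrightarrow> length w \<le> N0 \<Longrightarrow> norm (pd w \<zeta>' x) \<le> a1"
    using test_fun_pd_bounded[OF test_vmD(1)[OF \<zeta>']] by metis
  obtain B1 where B1: "B1 > 0" "\<And>w x. set w \<subseteq> Basis \<Longrightarrow> length w \<le> N0 \<Longrightarrow> norm (pd w \<psi> x) \<le> B1"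
    using test_fun_pd_bounded[OF \<psi>] by metis
  obtain B2 where B2: "B2 > 0" "\<And>w x. set w \<subseteq> Basis \<Longrightarrow> length w \<le> N0 \<Longrightarrow> norm (pd w \<theta> x) \<le> B2"
    using test_fun_pd_bounded[OF \<theta>(1)] by metis
  \<comment> \<open>The first summand handles derivatives of order up to L, by the Taylor estimate,
    and the second those of higher order.\<close>
  define CF where "CF = Ct + B1 * \<kappa> powr real N0"
  have CF: "CF > 0" using Ct B1 \<kappa> by (simp add: CF_def add_pos_nonneg)
  define C where "C = CW * a1 * (2 ^ N0 * CF * B2) * (\<kappa> powr (real L + d)) * \<kappa> powr (real DIM('a) - \<nu>)"
  have "C > 0" using CW a1 CF B2 \<kappa> by (simp add: C_def)
  moreover have "norm (T (scl y s \<zeta>) (scl y (\<kappa> * s) (\<lambda>z. (\<psi> ((\<kappa> * s / t) *\<^sub>R z + a) - p ((\<kappa> * s / t) *\<^sub>R z + a)) * \<theta> z)))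
        \<le> C * s powr (real DIM('a) - \<nu>) * (s / t) powr (real L + d)"
    if s: "0 < s" "s \<le> t" and p: "polyf L p" and rem: "\<forall>w z. set w \<subseteq> Basis \<longrightarrow> length w \<le> L \<longrightarrow>
          norm (pd w (\<lambda>z. \<psi> z - p z) z) \<le> Ct * norm (z - a) powr (real L - real (length w) + d)" for p a y s t
  proof -
    define e where "e = \<kappa> * s / t"
    have e: "0 < e" "e \<le> \<kappa>" using s \<kappa> by (auto simp: e_def field_simps)
    have smr: "smooth (\<lambda>z. \<psi> z - p z)" using \<psi> p by (intro smooth_diff test_fun_smooth smooth_polyf)
    define F where "F = (\<lambda>z. \<psi> (e *\<^sub>R z + a) - p (e *\<^sub>R z + a))"
    define G where "G = (\<lambda>z. F z * \<theta> z)"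
    have smF: "smooth F" unfolding F_def using smooth_affine[OF smr] .
    have G: "G \<in> test_fun" unfolding G_def using smF \<theta>(1) by (intro test_fun_mult')
    have F_bd: "norm (pd w F z) \<le> CF * e powr (real L + d)"
      if w: "set w \<subseteq> Basis" "length w \<le> N0" and z: "norm z \<le> 1" for w z
    proof -
      have "pd w F z = of_real e ^ length w * pd w (\<lambda>z. \<psi> z - p z) (e *\<^sub>R z + a)"
        unfolding F_def by (rule pd_affine[OF smr w(1)])
      then have nF: "norm (pd w F z) = e powr real (length w) * norm (pd w (\<lambda>z. \<psi> z - p z) (e *\<^sub>R z + a))"
        using e by (simp add: norm_mult norm_power powr_realpow)
      show ?thesis
      proof (cases "length w \<le> L")
        case True
        have "norm (pd w (\<lambda>z. \<psi> z - p z) (e *\<^sub>R z + a)) \<le> Ct * norm (e *\<^sub>R z) powr (real L - real (length w) + d)"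
          using rem[rule_format, OF w(1) True, of "e *\<^sub>R z + a"] by simp
        also have "\<dots> \<le> Ct * e powr (real L - real (length w) + d)"
          using z e True d Ct by (intro mult_left_mono powr_mono2) (auto simp: mult_le_cancel_left1)
        finally have "norm (pd w F z) \<le> e powr real (length w) * (Ct * e powr (real L - real (length w) + d))"
          unfolding nF by (rule mult_left_mono) simp
        also have "\<dots> = Ct * e powr (real L + d)"
          by (simp add: mult.left_commute flip: powr_add)
        also have "\<dots> \<le> CF * e powr (real L + d)"
          using B1 by (intro mult_right_mono) (auto simp: CF_def)
        finally show ?thesis .
      next
        case False
        \<comment> \<open>More than L derivatives annihilate p. The surplus powers of e are bounded
          because e is at most \<kappa>, and this yields the order L + d again.\<close>
        have "pd w (\<lambda>z. \<psi> z - p z) (e *\<^sub>R z + a) = pd w \<psi> (e *\<^sub>R z + a) - pd w p (e *\<^sub>R z + a)"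
          using \<psi> p w by (intro pd_diff[OF open_UNIV]) (auto intro: smooth_C_k_on test_fun_smooth smooth_polyf)
        then have "norm (pd w (\<lambda>z. \<psi> z - p z) (e *\<^sub>R z + a)) \<le> B1"
          using polyf_pd(2)[OF p w(1)] False B1(2)[OF w] by simp
        then have "norm (pd w F z) \<le> e powr real (length w) * B1"
          unfolding nF by (rule mult_left_mono) simp
        also have "e powr real (length w) = e powr (real L + d) * e powr (real (length w) - real L - d)"
          by (simp flip: powr_add)
        also have "\<dots> * B1 \<le> e powr (real L + d) * \<kappa> powr real N0 * B1"
        proof -
          have "e powr (real (length w) - real L - d) \<le> \<kappa> powr (real (length w) - real L - d)"
            using e d False by (intro powr_mono2) auto
          also have "\<dots> \<le> \<kappa> powr real N0" using w d \<kappa> by (intro powr_mono) auto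
          finally show ?thesis using B1(1) by (intro mult_right_mono mult_left_mono) auto
        qed
        also have "\<dots> \<le> CF * e powr (real L + d)"
          using Ct by (simp add: CF_def algebra_simps)
        finally show ?thesis .
      qed
    qed
    have G0: "G z = 0" if "1 < norm z" for z using \<theta>(2)[OF that] by (simp add: G_def)
    have E: "0 \<le> CF * e powr (real L + d)" "0 < CF * e powr (real L + d)" using CF e by auto
    have G_bd: "norm (pd w G z) \<le> 2 ^ N0 * (CF * e powr (real L + d)) * B2"
      if w: "set w \<subseteq> Basis" "length w \<le> N0" for w z
    proof (cases "norm z \<le> 1")
      case True
      have "norm (pd w G z) \<le> 2 ^ length w * (CF * e powr (real L + d)) * B2"
        unfolding G_def using w True E B2
        by (intro norm_pd_mult_le smF test_fun_smooth \<theta>) (auto intro!: F_bd B2(2))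
      also have "\<dots> \<le> 2 ^ N0 * (CF * e powr (real L + d)) * B2"
        using w E B2 by (intro mult_right_mono power_increasing) auto
      finally show ?thesis .
    next
      case False
      then show ?thesis using pd_zero_outside[OF G0 w(1), where x=z] E B2 by simp
    qed
    have "scl y (\<kappa> * s) \<zeta>' = scl y s \<zeta>"
      using \<kappa> s by (simp add: scl_def \<zeta>'_def)
    moreover have "norm (T (scl y (\<kappa> * s) \<zeta>') (scl y (\<kappa> * s) G)) + norm (Tt (scl y (\<kappa> * s) \<zeta>') (scl y (\<kappa> * s) G))
        \<le> CW * a1 * (2 ^ N0 * (CF * e powr (real L + d)) * B2) * (\<kappa> * s) powr (real DIM('a) - \<nu>)"
      using \<zeta>' \<zeta>'0 G G0 a1 E B2 G_bd s \<kappa> by (intro wbp) auto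
    ultimately have "norm (T (scl y s \<zeta>) (scl y (\<kappa> * s) G)) \<le> CW * a1 * (2 ^ N0 * (CF * e powr (real L + d)) * B2) * (\<kappa> * s) powr (real DIM('a) - \<nu>)"
      using norm_ge_zero[of "Tt (scl y s \<zeta>) (scl y (\<kappa> * s) G)"] by (simp only:)
    also have "\<dots> = C * s powr (real DIM('a) - \<nu>) * (s / t) powr (real L + d)"
    proof -
      have "e powr (real L + d) = \<kappa> powr (real L + d) * (s / t) powr (real L + d)"
        using \<kappa> s by (simp add: e_def flip: powr_mult)
      moreover have "(\<kappa> * s) powr (real DIM('a) - \<nu>) = \<kappa> powr (real DIM('a) - \<nu>) * s powr (real DIM('a) - \<nu>)"
        using \<kappa> s by (simp add: powr_mult)
      ultimately show ?thesis by (simp add: C_def mult_ac)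
    qed
    finally show ?thesis by (simp add: G_def F_def e_def)
  qed
  ultimately show ?thesis using that by blast
qed

text \<open>
  The Taylor polynomial of \<open>scl x t \<psi>\<close> at \<open>y\<close> is subtracted, which \<open>moments\<close> permits; \<open>L + d\<close> is the order of
  the remainder.
\<close>

lemma near_bound:
  assumes \<zeta>: "\<zeta> \<in> test_vm P" "\<And>z. \<rho> < norm z \<Longrightarrow> \<zeta> z = 0" and \<rho>: "1 \<le> \<rho>"
    and \<psi>: "\<psi> \<in> test_fun" and d: "0 < d" "d < \<gamma>"
  obtains C where "C > 0"
    "\<And>x y s t. 0 < s \<Longrightarrow> s \<le> t \<Longrightarrow>
      norm (T (scl y s \<zeta>) (scl x t \<psi>)) \<le> C * s powr (real DIM('a) - \<nu>) * (s / t) powr (real L + d)"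
proof -
  obtain R0 where R0: "R0 > 0" "\<And>z. R0 < norm z \<Longrightarrow> \<eta> z = 0" using eta test_funE by metis
  define R\<eta> where "R\<eta> = max 1 R0"
  have R\<eta>: "1 \<le> R\<eta>" "R0 \<le> R\<eta>" by (auto simp: R\<eta>_def)
  \<comment> \<open>Chosen so that the cut-off \<omega> below is \<eta> at scale 4 \<rho> s: it
    equals 1 well beyond the support of \<zeta> at scale s and vanishes beyond \<kappa> s.\<close>
  define \<kappa> where "\<kappa> = 4 * \<rho> * R\<eta>"
  have \<kappa>: "1 \<le> \<kappa>" "\<rho> \<le> \<kappa>" "4 * \<rho> \<le> \<kappa>"
    using \<rho> R\<eta> mult_mono[of 1 "4 * \<rho>" 1 R\<eta>] mult_left_mono[of 1 R\<eta> "4 * \<rho>"] by (auto simp: \<kappa>_def)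
  define \<theta> where "\<theta> = (\<lambda>z. \<eta> (R\<eta> *\<^sub>R z + 0))"
  have \<theta>: "\<theta> \<in> test_fun" unfolding \<theta>_def using eta R\<eta> by (intro test_fun_affine) auto
  have \<theta>0: "\<theta> z = 0" if "1 < norm z" for z
  proof -
    have "R\<eta> * 1 < R\<eta> * norm z" using that R\<eta> by (intro mult_strict_left_mono) auto
    then have "R0 < R\<eta> * norm z" using R\<eta> by linarith
    then show ?thesis using R\<eta> unfolding \<theta>_def by (intro R0(2)) simp
  qed
  obtain B\<theta> where B\<theta>: "B\<theta> > 0" "\<And>z. norm (\<theta> z) \<le> B\<theta>" using test_fun_bounded[OF \<theta>] by blast
  obtain B\<psi> where B\<psi>: "B\<psi> > 0" "\<And>z. norm (\<psi> z) \<le> B\<psi>" using test_fun_bounded[OF \<psi>] by blast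
  have d1: "d \<le> 1" using d order by simp
  obtain Ct where Ct: "Ct > 0" "\<And>a. \<exists>p. polyf L p \<and> (\<forall>w z. set w \<subseteq> Basis \<longrightarrow> length w \<le> L \<longrightarrow>
      norm (pd w (\<lambda>z. \<psi> z - p z) z) \<le> Ct * norm (z - a) powr (real L - real (length w) + d))"
    by (rule test_fun_taylor[OF \<psi> d(1) d1, where L=L]) (rule that)
  obtain C1 where C1: "C1 > 0"
    "\<And>p a y s t. \<lbrakk>0 < s; s \<le> t; polyf L p;
       \<forall>w z. set w \<subseteq> Basis \<longrightarrow> length w \<le> L \<longrightarrow>
          norm (pd w (\<lambda>z. \<psi> z - p z) z) \<le> Ct * norm (z - a) powr (real L - real (length w) + d)\<rbrakk> \<Longrightarrow>
      norm (T (scl y s \<zeta>) (scl y (\<kappa> * s) (\<lambda>z. (\<psi> ((\<kappa> * s / t) *\<^sub>R z + a) - p ((\<kappa> * s / t) *\<^sub>R z + a)) * \<theta> z)))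
        \<le> C1 * s powr (real DIM('a) - \<nu>) * (s / t) powr (real L + d)"
    by (rule local_part_bound[OF \<zeta> \<rho> \<kappa>(2) \<theta> \<theta>0 \<psi> d(1) d1 Ct(1)], assumption+, rule that)
  have \<rho>0: "0 < \<rho>" using \<rho> by simp
  obtain CH where CH: "CH > 0" "\<And>u y s. 0 < s \<Longrightarrow> 3 * \<rho> * s \<le> norm (u - y) \<Longrightarrow>
      norm (LINT v|lborel. K u v * scl y s \<zeta> v) \<le> CH * norm (u - y) powr - N * s powr (real DIM('a) + real M + \<gamma>)"
    "\<And>v y s. 0 < s \<Longrightarrow> 3 * \<rho> * s \<le> norm (v - y) \<Longrightarrow>
      norm (LINT u|lborel. K u v * scl y s \<zeta> u) \<le> CH * norm (v - y) powr - N * s powr (real DIM('a) + real M + \<gamma>)"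
    by (rule kernel_inner_bound[OF \<zeta> \<rho>0], assumption+, rule that)
  \<comment> \<open>The exponent of the far integrand: -N + L + d = -(n + e1). Its positivity is
    exactly where L \<le> M + \<nu> and d < \<gamma> enter.\<close>
  define e1 where "e1 = \<nu> + real M + \<gamma> - real L - d"
  have e1: "0 < e1" using order d by (simp add: e1_def)
  obtain Ctl where Ctl: "Ctl > 0" "\<And>(G :: 'a cfun) y r a. \<lbrakk>0 < r; 0 \<le> a;
      \<forall>z. r \<le> norm (z - y) \<longrightarrow> norm (G z) \<le> a * norm (z - y) powr - (real DIM('a) + e1);
      \<forall>z. norm (z - y) < r \<longrightarrow> G z = 0\<rbrakk> \<Longrightarrow> norm (LINT z|lborel. G z) \<le> Ctl * a * r powr - e1"
    by (rule norm_integral_tail[OF e1]) (rule that)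
  define C2 where "C2 = Ctl * CH * (1 + B\<theta>) * (4 * \<rho>) powr - e1"
  have C2: "C2 > 0" using Ctl CH B\<theta> \<rho> by (simp add: C2_def)
  have "norm (T (scl y s \<zeta>) (scl x t \<psi>)) \<le> (C1 + C2 * Ct) * s powr (real DIM('a) - \<nu>) * (s / t) powr (real L + d)"
    if s: "0 < s" "s \<le> t" for x y s t
  proof -
    have t: "0 < t" using s by simp
    \<comment> \<open>The point y in the coordinates of \<psi>, hence the centre of the Taylor
      expansion.\<close>
    define a where "a = (1 / t) *\<^sub>R (y - x)"
    obtain p where p: "polyf L p" "\<And>w z. set w \<subseteq> Basis \<Longrightarrow> length w \<le> L \<Longrightarrow>
      norm (pd w (\<lambda>z. \<psi> z - p z) z) \<le> Ct * norm (z - a) powr (real L - real (length w) + d)"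
      using Ct(2)[of a] by blast
    have p': "polyf L (\<lambda>u. p ((1 / t) *\<^sub>R u + (- (1 / t)) *\<^sub>R x))"
      by (rule polyf_affine[OF p(1)])
    obtain q Cq where Cq: "0 \<le> Cq" and qq: "\<forall>R\<ge>1. q R \<in> test_fun \<and>
          (\<forall>z. norm z < R \<longrightarrow> q R z = p ((1 / t) *\<^sub>R z + (- (1 / t)) *\<^sub>R x)) \<and>
          (\<forall>z. norm (q R z) \<le> Cq * (1 + norm z) ^ L)"
        "\<forall>\<zeta>\<in>test_vm P. ((\<lambda>R::real. T \<zeta> (q R)) \<longlongrightarrow> 0) at_top"
      using moments[OF p'] by blast
    then have q: "\<And>R. 1 \<le> R \<Longrightarrow> q R \<in> test_fun"
        "\<And>R z. 1 \<le> R \<Longrightarrow> norm z < R \<Longrightarrow> q R z = p ((1 / t) *\<^sub>R z + (- (1 / t)) *\<^sub>R x)"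
        "\<And>R z. 1 \<le> R \<Longrightarrow> norm (q R z) \<le> Cq * (1 + norm z) ^ L"
      and q_lim: "\<And>\<zeta>. \<zeta> \<in> test_vm P \<Longrightarrow> ((\<lambda>R::real. T \<zeta> (q R)) \<longlongrightarrow> 0) at_top"
      by blast+
    define \<zeta>s where "\<zeta>s = scl y s \<zeta>"
    have \<zeta>s: "\<zeta>s \<in> test_vm P" unfolding \<zeta>s_def using \<zeta> s by (intro scl_test_vm)
    define r where "r = \<kappa> * s"
    have r: "0 < r" "4 * \<rho> * s \<le> r" using \<kappa> s by (auto simp: r_def)
    define \<omega> where "\<omega> = scl y r \<theta>"
    have \<omega>: "\<omega> \<in> test_fun" unfolding \<omega>_def using \<theta> r by (intro scl_test_fun)
    have \<omega>1: "\<omega> u = 1" if "norm (u - y) < 4 * \<rho> * s" for u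
    proof -
      have "norm (R\<eta> *\<^sub>R ((1 / r) *\<^sub>R (u - y)) + 0) = norm (u - y) / (4 * \<rho> * s)"
        using R\<eta> \<rho> s by (simp add: r_def \<kappa>_def divide_simps)
      also have "\<dots> < 1" using that \<rho> s by simp
      finally show ?thesis unfolding \<omega>_def scl_def \<theta>_def by (rule eta(2))
    qed
    define G where "G = (\<lambda>z. (\<psi> ((\<kappa> * s / t) *\<^sub>R z + a) - p ((\<kappa> * s / t) *\<^sub>R z + a)) * \<theta> z)"
    define E where "E = (B\<psi> + Cq) * 4 ^ L"
    have E: "0 \<le> E" using B\<psi> Cq by (simp add: E_def)
    define X where "X = C1 * s powr (real DIM('a) - \<nu>) * (s / t) powr (real L + d)"
    define Y where "Y = C2 * s powr (real DIM('a) - \<nu> + real L + d)"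
    have Y: "0 \<le> Y" using C2 by (simp add: Y_def)
    have ring: "\<psi> ((1 / t) *\<^sub>R (u - x)) - p ((1 / t) *\<^sub>R u + (- (1 / t)) *\<^sub>R x) =
        \<psi> ((1 / t) *\<^sub>R (u - y) + a) - p ((1 / t) *\<^sub>R (u - y) + a)" for u
      by (simp add: a_def algebra_simps)
    have main: "norm (T \<zeta>s (scl x t \<psi>)) \<le> X + Y * (Ct * t powr - (real L + d) + E * (R / 2) powr - d) + norm (T \<zeta>s (q R))"
      if R: "R \<ge> 2 * norm y + r + 1" for R
    proof -
      \<comment> \<open>This choice of R places the support of \<omega> where \<open>q R\<close>
        equals the polynomial, and forces |u - y| \<ge> R/2 wherever it does not.\<close>
      have R1: "1 \<le> R" "norm y + r < R" "2 * norm y \<le> R" using R r norm_ge_zero[of y] by linarith+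
      define g where "g = (\<lambda>u. scl x t \<psi> u - q R u)"
      have g: "g \<in> test_fun" unfolding g_def using \<psi> t q(1)[OF R1(1)] by (intro test_fun_diff scl_test_fun)
      have g_in: "g u = \<psi> ((1 / t) *\<^sub>R (u - y) + a) - p ((1 / t) *\<^sub>R (u - y) + a)" if "norm u < R" for u
        using q(2)[OF R1(1) that] ring[of u] by (simp add: g_def scl_def)
      have loc: "(\<lambda>u. g u * \<omega> u) = scl y r G"
      proof
        fix u show "g u * \<omega> u = scl y r G u"
        proof (cases "norm (u - y) \<le> r")
          case True
          have "norm u < R" using True R1 norm_triangle_ineq2[of u y] by simp
          then show ?thesis using g_in[of u] \<kappa> s t by (simp add: \<omega>_def scl_def G_def r_def)
        next
          case False
          then have "1 < norm ((1 / r) *\<^sub>R (u - y))" using r by (simp add: pos_less_divide_eq)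
          then show ?thesis using \<theta>0 by (simp add: \<omega>_def scl_def G_def)
        qed
      qed
      \<comment> \<open>Supported away from \<zeta> at scale s, so its pairing is given by the
        kernel.\<close>
      define far where "far = (\<lambda>u. g u * (1 - \<omega> u))"
      have far: "far \<in> test_fun" unfolding far_def
        using g \<omega> by (intro test_fun_mult smooth_diff smooth_const test_fun_smooth)
      have sum: "scl x t \<psi> = (\<lambda>u. (g u * \<omega> u + far u) + q R u)"
        by (auto simp: far_def g_def algebra_simps)
      have split: "T \<zeta>s (scl x t \<psi>) = T \<zeta>s (scl y r G) + T \<zeta>s far + T \<zeta>s (q R)"
        unfolding sum using g \<omega> far q(1)[OF R1(1)] \<zeta>s
        by (simp add: linear_add test_fun_add test_fun_mult test_fun_smooth flip: loc)
      have loc_bd: "norm (T \<zeta>s (scl y r G)) \<le> X"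
        unfolding \<zeta>s_def G_def X_def r_def using s p by (intro C1(2)) blast+
      have far_bd: "norm (T \<zeta>s far) \<le> Y * (Ct * t powr - (real L + d) + E * (R / 2) powr - d)"
      proof -
        let ?D = "Ct * t powr - (real L + d) + E * (R / 2) powr - d"
        have D: "0 \<le> ?D" using Ct E by simp
        have "fsupport far \<subseteq> {u. 4 * \<rho> * s \<le> norm (u - y)}"
        proof (rule fsupport_subset)
          show "closed {u. 4 * \<rho> * s \<le> norm (u - y)}" by (intro closed_Collect_le continuous_intros)
          show "far u = 0" if "u \<notin> {u. 4 * \<rho> * s \<le> norm (u - y)}" for u using that \<omega>1[of u] by (simp add: far_def)
        qed
        moreover have "fsupport \<zeta>s \<subseteq> cball y (\<rho> * s)" unfolding \<zeta>s_def using \<zeta> s by (intro fsupport_scl_subset)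
        moreover have "\<rho> * s < 4 * \<rho> * s" using \<rho> s by simp
        ultimately have "fsupport \<zeta>s \<inter> fsupport far = {}"
          by (fastforce simp: dist_norm norm_minus_commute)
        then have Tk: "T \<zeta>s far = kernel_pairing K \<zeta>s far" using \<zeta>s far by (intro kernel)
        have g_bd: "norm (g u) \<le> ?D * norm (u - y) powr (real L + d)" if u: "4 * \<rho> * s \<le> norm (u - y)" for u
        proof (cases "norm u < R")
          case True
          have "norm (g u) \<le> Ct * norm ((1 / t) *\<^sub>R (u - y)) powr (real L + d)"
            using p(2)[of "[]" "(1 / t) *\<^sub>R (u - y) + a"] g_in[OF True] by simp
          also have "norm ((1 / t) *\<^sub>R (u - y)) powr (real L + d) = norm (u - y) powr (real L + d) * t powr - (real L + d)"
            using t by (cases "u = y") (simp_all add: powr_ratio del: minus_add_distrib)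
          also have "Ct * (norm (u - y) powr (real L + d) * t powr - (real L + d)) = Ct * t powr - (real L + d) * norm (u - y) powr (real L + d)"
            by (simp only: mult_ac)
          also have "\<dots> \<le> ?D * norm (u - y) powr (real L + d)"
            using E by (intro mult_right_mono) auto
          finally show ?thesis .
        next
          case False
          have uy: "norm u \<le> norm (u - y) + norm y" using norm_triangle_ineq[of "u - y" y] by simp
          \<comment> \<open>Beyond radius R only the growth bound of \<open>q R\<close> is known.
            The missing decay |u - y|^(-d) is at most (R/2)^(-d), which disappears in the
            limit.\<close>
          have u1: "1 + norm u \<le> 4 * norm (u - y)" "R / 2 \<le> norm (u - y)" using uy False R1 by auto
          have p1: "1 \<le> (4 * norm (u - y)) ^ L" using u1 norm_ge_zero[of u] by (intro one_le_power) linarith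
          have "norm (g u) \<le> B\<psi> + Cq * (1 + norm u) ^ L"
            unfolding g_def using q(3)[OF R1(1), of u] B\<psi>(2) by (intro order_trans[OF norm_triangle_ineq4] add_mono) (auto simp: scl_def)
          also have "\<dots> \<le> B\<psi> * (4 * norm (u - y)) ^ L + Cq * (4 * norm (u - y)) ^ L"
            using p1 B\<psi>(1) Cq u1 by (intro add_mono mult_left_mono power_mono) auto
          also have "\<dots> = E * norm (u - y) powr real L"
            using powr_realpow[of "norm (u - y)" L] u1(2) R1(1)
            by (simp add: E_def power_mult_distrib distrib_right mult.assoc del: zero_less_norm_iff right_minus_eq)
          also have "norm (u - y) powr real L = norm (u - y) powr - d * norm (u - y) powr (real L + d)"
            by (simp flip: powr_add)
          also have "E * (norm (u - y) powr - d * norm (u - y) powr (real L + d)) \<le> E * ((R / 2) powr - d * norm (u - y) powr (real L + d))"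
            using E u1 R1 d by (intro mult_left_mono mult_right_mono powr_mono2') auto
          also have "\<dots> \<le> ?D * norm (u - y) powr (real L + d)"
            using Ct by (simp add: distrib_right mult.assoc)
          finally show ?thesis .
        qed
        define A where "A = CH * s powr (real DIM('a) + real M + \<gamma>) * ?D * (1 + B\<theta>)"
        have A: "0 \<le> A" unfolding A_def using CH D B\<theta> by (intro mult_nonneg_nonneg) auto
        have "norm (LINT u|lborel. (LINT v|lborel. K u v * \<zeta>s v) * far u) \<le> Ctl * A * (4 * \<rho> * s) powr - e1"
        proof (rule Ctl(2)[OF _ A]; (intro allI impI)?)
          show "0 < 4 * \<rho> * s" using \<rho> s by simp
          show "(LINT v|lborel. K u v * \<zeta>s v) * far u = 0" if "norm (u - y) < 4 * \<rho> * s" for u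
            using \<omega>1[OF that] by (simp add: far_def)
          fix u assume u: "4 * \<rho> * s \<le> norm (u - y)"
          have h1: "norm (LINT v|lborel. K u v * \<zeta>s v) \<le> CH * norm (u - y) powr - N * s powr (real DIM('a) + real M + \<gamma>)"
            unfolding \<zeta>s_def using u \<rho> s by (intro CH(2)) (auto intro: order_trans[rotated])
          have h2: "norm (1 - \<omega> u) \<le> 1 + B\<theta>"
            using norm_triangle_ineq4[of 1 "\<omega> u"] B\<theta>(2)[of "(1 / r) *\<^sub>R (u - y)"] by (simp add: \<omega>_def scl_def)
          have "norm ((LINT v|lborel. K u v * \<zeta>s v) * far u) \<le>
              (CH * norm (u - y) powr - N * s powr (real DIM('a) + real M + \<gamma>)) * ((?D * norm (u - y) powr (real L + d)) * (1 + B\<theta>))"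
            unfolding far_def norm_mult using h1 h2 g_bd[OF u] CH D
            by (intro mult_mono) (auto intro!: mult_nonneg_nonneg)
          also have "\<dots> = A * (norm (u - y) powr - N * norm (u - y) powr (real L + d))"
            by (simp add: A_def mult_ac)
          also have "norm (u - y) powr - N * norm (u - y) powr (real L + d) = norm (u - y) powr - (real DIM('a) + e1)"
            by (simp add: e1_def N_def algebra_simps flip: powr_add)
          finally show "norm ((LINT v|lborel. K u v * \<zeta>s v) * far u) \<le> A * norm (u - y) powr - (real DIM('a) + e1)" .
        qed
        then have "norm (kernel_pairing K \<zeta>s far) \<le> Ctl * A * (4 * \<rho> * s) powr - e1"
          using kernel_pairing_Fubini[of K \<zeta>s far] Ctl A by auto
        also have "\<dots> = Y * ?D"
        proof -
          have "(4 * \<rho> * s) powr - e1 = (4 * \<rho>) powr - e1 * s powr - e1" using \<rho> s by (simp add: powr_mult)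
          moreover have "s powr (real DIM('a) + real M + \<gamma>) * s powr - e1 = s powr (real DIM('a) - \<nu> + real L + d)"
            by (simp add: e1_def algebra_simps flip: powr_add)
          ultimately show ?thesis
            by (simp add: A_def Y_def C2_def mult_ac)
        qed
        finally show ?thesis unfolding Tk .
      qed
      show ?thesis
        unfolding split by (rule norm_triangle_mono[OF norm_triangle_mono[OF loc_bd far_bd] order_refl])
    qed
    \<comment> \<open>The left side does not depend on R, so both the growth error and the pairing
      with \<open>q R\<close> may be sent to 0.\<close>
    have "((\<lambda>R::real. (R / 2) powr - d) \<longlongrightarrow> 0) at_top"
      using d by (intro tendsto_neg_powr filterlim_at_top_mult_tendsto_pos[where c="1/2" and f="\<lambda>_. 1/2", simplified])
        (auto intro: filterlim_ident)
    then have lim: "((\<lambda>R. X + Y * (Ct * t powr - (real L + d) + E * (R / 2) powr - d) + norm (T \<zeta>s (q R))) \<longlongrightarrow>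
        X + Y * (Ct * t powr - (real L + d) + E * 0) + norm (0::complex)) at_top"
      using q_lim[OF \<zeta>s] by (intro tendsto_intros)
    have "norm (T \<zeta>s (scl x t \<psi>)) \<le> X + Y * (Ct * t powr - (real L + d) + E * 0) + norm (0::complex)"
    proof (rule tendsto_lowerbound[OF lim])
      show "\<forall>\<^sub>F R in at_top. norm (T \<zeta>s (scl x t \<psi>)) \<le>
          X + Y * (Ct * t powr - (real L + d) + E * (R / 2) powr - d) + norm (T \<zeta>s (q R))"
        by (rule eventually_mono[OF eventually_ge_at_top main])
    qed simp
    also have "\<dots> = (C1 + C2 * Ct) * s powr (real DIM('a) - \<nu>) * (s / t) powr (real L + d)"
    proof -
      have "s powr (real DIM('a) - \<nu> + real L + d) = s powr (real DIM('a) - \<nu>) * s powr (real L + d)"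
        by (simp add: algebra_simps flip: powr_add)
      moreover have "(s / t) powr (real L + d) = s powr (real L + d) * t powr - (real L + d)"
        using s t by (intro powr_ratio)
      ultimately show ?thesis by (simp only: X_def Y_def) (simp add: algebra_simps)
    qed
    finally show ?thesis unfolding \<zeta>s_def .
  qed
  moreover have "C1 + C2 * Ct > 0" using C1 C2 Ct by (simp add: add_pos_pos)
  ultimately show ?thesis using that by blast
qed

text \<open>In the far region |x - y| exceeds t, so 1 + |x - y|/t is at most twice |x - y|/t; this
  is the source of the factor 2^N.\<close>

lemma far_weight:
  assumes "1 \<le> \<rho>" "0 < t" "4 * \<rho> * t < norm (x - y)"
  shows "norm (x - y) powr - N \<le> 2 powr N * t powr - N * (1 + norm (x - y) / t) powr - N"
proof -
  have "1 * t \<le> 4 * \<rho> * t" using assms by (intro mult_right_mono) auto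
  then have "t < norm (x - y)" using assms by linarith
  then have "1 + norm (x - y) / t \<le> 2 * (norm (x - y) / t)" using assms by (simp add: field_simps)
  then have "(2 * (norm (x - y) / t)) powr - N \<le> (1 + norm (x - y) / t) powr - N"
    using assms N_pos by (intro powr_mono2') (auto intro: add_pos_nonneg)
  moreover have "(2 * (norm (x - y) / t)) powr - N = 2 powr - N * (norm (x - y) powr - N * t powr N)"
    using assms by (simp add: powr_mult powr_divide powr_minus field_simps)
  ultimately have "2 powr N * t powr - N * (2 powr - N * (norm (x - y) powr - N * t powr N)) \<le> 2 powr N * t powr - N * (1 + norm (x - y) / t) powr - N"
    by (intro mult_left_mono) auto
  moreover have "2 powr N * t powr - N * (2 powr - N * (norm (x - y) powr - N * t powr N)) = norm (x - y) powr - N"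
    using assms by (simp add: powr_minus field_simps)
  ultimately show ?thesis by simp
qed

text \<open>In the near region the weight is bounded below and can be inserted at the cost of a
  constant.\<close>

lemma near_weight:
  assumes "1 \<le> \<rho>" "0 < t" "norm (x - y) \<le> 4 * \<rho> * t"
  shows "1 \<le> (1 + 4 * \<rho>) powr N * (1 + norm (x - y) / t) powr - N"
proof -
  have "norm (x - y) / t \<le> 4 * \<rho>" using assms by (simp add: field_simps)
  then have "(1 + 4 * \<rho>) powr - N \<le> (1 + norm (x - y) / t) powr - N"
    using assms N_pos by (intro powr_mono2') (auto intro: add_pos_nonneg)
  then have "(1 + 4 * \<rho>) powr N * (1 + 4 * \<rho>) powr - N \<le> (1 + 4 * \<rho>) powr N * (1 + norm (x - y) / t) powr - N"
    by (intro mult_left_mono) auto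
  then show ?thesis using assms by (simp flip: powr_add)
qed

lemma far_disjoint:
  assumes "\<And>z. \<rho> < norm z \<Longrightarrow> f z = 0" "\<And>z. \<rho> < norm z \<Longrightarrow> g z = 0" "1 \<le> \<rho>"
    and "0 < s" "s \<le> t" "4 * \<rho> * t < norm (x - y)"
  shows "fsupport (scl y s f) \<inter> fsupport (scl x t g) = {}"
proof -
  have "fsupport (scl y s f) \<subseteq> cball y (\<rho> * s)" "fsupport (scl x t g) \<subseteq> cball x (\<rho> * t)"
    using assms(4,5) by (intro fsupport_scl_subset assms(1,2); simp)+
  moreover have "\<rho> * s + \<rho> * t < dist x y"
    using assms mult_left_mono[of s t \<rho>] mult_pos_pos[of \<rho> t] unfolding dist_norm by linarith
  ultimately have "z \<notin> fsupport (scl x t g)" if "z \<in> fsupport (scl y s f)" for z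
    using that dist_triangle2[of x y z] by (metis add.commute add_mono leD mem_cball order_trans subsetD)
  then show ?thesis by blast
qed

lemma half_distance:
  assumes "1 \<le> \<rho>" "4 * \<rho> * t < norm (x - y)" "0 < t" "norm (u - x) \<le> \<rho> * t"
  shows "norm (x - y) / 2 \<le> norm (u - y)" "3 * \<rho> * t \<le> norm (u - y)"
proof -
  have "norm (x - y) \<le> norm (u - y) + norm (u - x)" using norm_triangle_ineq4[of "u - y" "u - x"] by simp
  moreover have "0 < \<rho> * t" using assms by simp
  ultimately show "norm (x - y) / 2 \<le> norm (u - y)" "3 * \<rho> * t \<le> norm (u - y)" using assms(2,4) by linarith+
qed

text \<open>Near y the polynomial subtraction gives the gain in s/t. At distances large compared
  with t the supports are disjoint, and the moments of \<zeta> against the kernel give even (s/t)^(M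
  + \<gamma>).\<close>

lemma bound_cancelling:
  assumes \<psi>: "\<psi> \<in> test_vm P" "\<And>z. \<rho> < norm z \<Longrightarrow> \<psi> z = 0"
    and \<zeta>: "\<zeta> \<in> test_vm P" "\<And>z. \<rho> < norm z \<Longrightarrow> \<zeta> z = 0" and \<rho>: "1 \<le> \<rho>" and d: "0 < d" "d < \<gamma>"
  obtains C where "C > 0"
    "\<And>x y s t. 0 < s \<Longrightarrow> s \<le> t \<Longrightarrow> norm (Tt (scl x t \<psi>) (scl y s \<zeta>))
      \<le> C * (s powr real DIM('a) * t powr - \<nu> * (s / t) powr (real L - \<nu> + d) * (1 + norm (x - y) / t) powr - N)"
proof -
  have \<rho>0: "0 < \<rho>" using \<rho> by simp
  obtain C1 where C1: "C1 > 0" "\<And>x y s t. 0 < s \<Longrightarrow> s \<le> t \<Longrightarrow>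
      norm (T (scl y s \<zeta>) (scl x t \<psi>)) \<le> C1 * s powr (real DIM('a) - \<nu>) * (s / t) powr (real L + d)"
    by (rule near_bound[OF \<zeta> \<rho> test_vmD(1)[OF \<psi>(1)] d], assumption+, rule that)
  obtain CH where CH: "CH > 0" "\<And>u y s. 0 < s \<Longrightarrow> 3 * \<rho> * s \<le> norm (u - y) \<Longrightarrow>
      norm (LINT v|lborel. K u v * scl y s \<zeta> v) \<le> CH * norm (u - y) powr - N * s powr (real DIM('a) + real M + \<gamma>)"
    "\<And>v y s. 0 < s \<Longrightarrow> 3 * \<rho> * s \<le> norm (v - y) \<Longrightarrow>
      norm (LINT u|lborel. K u v * scl y s \<zeta> u) \<le> CH * norm (v - y) powr - N * s powr (real DIM('a) + real M + \<gamma>)"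
    by (rule kernel_inner_bound[OF \<zeta> \<rho>0], assumption+, rule that)
  obtain Z where Z: "Z > 0" "\<And>z. norm (\<psi> z) \<le> Z" using test_fun_bounded[OF test_vmD(1)[OF \<psi>(1)]] by blast
  define C2 where "C2 = (unit_ball_vol (real DIM('a)) * \<rho> ^ DIM('a) * Z) * CH * 2 powr N * 2 powr N"
  have C2: "C2 > 0" using \<rho> Z CH unit_ball_vol_pos[of "real DIM('a)"] by (simp add: C2_def)
  define C where "C = C1 * (1 + 4 * \<rho>) powr N + C2"
  have C: "C > 0" using C1 C2 \<rho> by (simp add: C_def add_pos_pos)
  have "norm (Tt (scl x t \<psi>) (scl y s \<zeta>)) \<le> C * (s powr real DIM('a) * t powr - \<nu> * (s / t) powr (real L - \<nu> + d) * (1 + norm (x - y) / t) powr - N)"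
    if s: "0 < s" "s \<le> t" for x y s t
  proof -
    let ?W = "(1 + norm (x - y) / t) powr - N"
    let ?E = "s powr real DIM('a) * t powr - \<nu> * (s / t) powr (real L - \<nu> + d)"
    have t: "0 < t" using s by simp
    have E: "0 \<le> ?E * ?W" by simp
    have vm: "scl y s \<zeta> \<in> test_vm P" "scl x t \<psi> \<in> test_vm P" using \<psi> \<zeta> s t by (auto intro: scl_test_vm)
    \<comment> \<open>Both functions have vanishing moments, so the pairing may be read as one of T,
      to which the vanishing of T^* on polynomials applies.\<close>
    have tr: "Tt (scl x t \<psi>) (scl y s \<zeta>) = T (scl y s \<zeta>) (scl x t \<psi>)" using transpose[OF vm] by simp
    show ?thesis
    proof (cases "norm (x - y) \<le> 4 * \<rho> * t")
      case True
      have "s powr (real DIM('a) - \<nu>) * (s / t) powr (real L + d) = ?E"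
      proof -
        have "s powr (real DIM('a) - \<nu>) = s powr real DIM('a) * t powr - \<nu> * (s / t) powr - \<nu>"
          using s t by (simp add: powr_divide powr_minus powr_diff field_simps)
        moreover have "(s / t) powr - \<nu> * (s / t) powr (real L + d) = (s / t) powr (real L - \<nu> + d)"
          by (simp add: algebra_simps flip: powr_add)
        ultimately show ?thesis by (simp add: mult.assoc)
      qed
      then have "norm (T (scl y s \<zeta>) (scl x t \<psi>)) \<le> C1 * ?E" using C1(2)[OF s, of y x] by (simp add: mult.assoc)
      also have "\<dots> \<le> C1 * ?E * ((1 + 4 * \<rho>) powr N * ?W)"
        using mult_left_mono[OF near_weight[OF \<rho> t True], of "C1 * ?E"] C1 by simp
      also have "\<dots> = (C1 * (1 + 4 * \<rho>) powr N) * (?E * ?W)" by (simp add: mult_ac)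
      also have "\<dots> \<le> C * (?E * ?W)" using E C2 by (intro mult_right_mono) (auto simp: C_def)
      finally show ?thesis unfolding tr by (simp add: mult_ac)
    next
      case False
      then have far: "4 * \<rho> * t < norm (x - y)" by simp
      have Tk: "T (scl y s \<zeta>) (scl x t \<psi>) = kernel_pairing K (scl y s \<zeta>) (scl x t \<psi>)"
        using vm far_disjoint[OF \<zeta>(2) \<psi>(2) \<rho> s far] by (intro kernel test_vmD) auto
      define B where "B = CH * (2 powr N * norm (x - y) powr - N) * s powr (real DIM('a) + real M + \<gamma>)"
      have B: "0 \<le> B" using CH by (simp add: B_def)
      have inner: "norm (LINT v|lborel. K u v * scl y s \<zeta> v) \<le> B" if u: "norm (u - x) \<le> \<rho> * t" for u
      proof -
        have h: "norm (x - y) / 2 \<le> norm (u - y)" "3 * \<rho> * t \<le> norm (u - y)"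
          using half_distance[OF \<rho> far t u] by auto
        have "3 * \<rho> * s \<le> norm (u - y)" using h(2) s \<rho> mult_left_mono[of s t "3 * \<rho>"] by linarith
        then have "norm (LINT v|lborel. K u v * scl y s \<zeta> v) \<le> CH * norm (u - y) powr - N * s powr (real DIM('a) + real M + \<gamma>)"
          by (rule CH(2)[OF s(1)])
        also have "norm (u - y) powr - N \<le> (norm (x - y) / 2) powr - N"
          using h far mult_pos_pos[of \<rho> t] \<rho>0 t N_pos by (intro powr_mono2') linarith+
        also have "(norm (x - y) / 2) powr - N = 2 powr N * norm (x - y) powr - N"
          by (simp add: powr_divide powr_minus field_simps)
        finally show ?thesis using CH by (simp add: B_def mult_left_mono mult_right_mono)
      qed
      have "norm (LINT u|lborel. (LINT v|lborel. K u v * scl y s \<zeta> v) * scl x t \<psi> u)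
          \<le> (unit_ball_vol (real DIM('a)) * \<rho> ^ DIM('a) * Z) * B * t ^ DIM('a)"
        using \<psi> t \<rho>0 B Z inner by (intro norm_integral_scl_le) auto
      then have "norm (T (scl y s \<zeta>) (scl x t \<psi>)) \<le> (unit_ball_vol (real DIM('a)) * \<rho> ^ DIM('a) * Z) * B * t ^ DIM('a)"
        unfolding Tk using kernel_pairing_Fubini[of K "scl y s \<zeta>" "scl x t \<psi>"] B Z \<rho>0 t by auto
      also have "\<dots> = (unit_ball_vol (real DIM('a)) * \<rho> ^ DIM('a) * Z * CH * 2 powr N) * (s powr (real DIM('a) + real M + \<gamma>) * t powr real DIM('a)) * norm (x - y) powr - N"
        using t by (simp add: B_def powr_realpow mult_ac)
      also have "\<dots> \<le> (unit_ball_vol (real DIM('a)) * \<rho> ^ DIM('a) * Z * CH * 2 powr N) * (s powr (real DIM('a) + real M + \<gamma>) * t powr real DIM('a)) * (2 powr N * t powr - N * ?W)"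
        using far_weight[OF \<rho> t far] \<rho> Z CH unit_ball_vol_nonneg[of "real DIM('a)"] by (intro mult_left_mono) auto
      also have "\<dots> = C2 * (s powr (real DIM('a) + real M + \<gamma>) * t powr real DIM('a) * t powr - N) * ?W" by (simp add: C2_def mult_ac)
      also have "s powr (real DIM('a) + real M + \<gamma>) * t powr real DIM('a) * t powr - N = s powr real DIM('a) * t powr - \<nu> * (s / t) powr (real M + \<gamma>)"
      proof -
        have "t powr real DIM('a) * t powr - N = t powr - \<nu> * t powr - (real M + \<gamma>)"
          by (simp add: N_def algebra_simps flip: powr_add)
        moreover have "s powr (real DIM('a) + real M + \<gamma>) = s powr real DIM('a) * s powr (real M + \<gamma>)"
          by (simp add: algebra_simps flip: powr_add)
        moreover have "(s / t) powr (real M + \<gamma>) = s powr (real M + \<gamma>) * t powr - (real M + \<gamma>)"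
          using s t by (intro powr_ratio)
        ultimately show ?thesis by (simp only: mult.assoc) (simp only: mult.left_commute)
      qed
      \<comment> \<open>Since s/t \<le> 1, L - \<nu> \<le> M and d < \<gamma>, the stronger gain is
        relaxed to the one available near y.\<close>
      also have "C2 * (s powr real DIM('a) * t powr - \<nu> * (s / t) powr (real M + \<gamma>)) * ?W \<le> C2 * ?E * ?W"
        using s t d order C2 by (intro mult_right_mono mult_left_mono powr_mono') auto
      also have "\<dots> \<le> C * (?E * ?W)" using mult_right_mono[OF _ E, of C2 C] C1 \<rho> by (simp add: C_def mult.assoc)
      finally show ?thesis unfolding tr by (simp add: mult_ac)
    qed
  qed
  then show ?thesis using that C by blast
qed

text \<open>Needed for \<phi> without vanishing moments, the coarsest mollification. Weak
  boundedness of the transpose applies near the diagonal; far from it the cancellation comes from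
  \<psi> instead.\<close>

lemma bound_same_scale:
  assumes \<psi>: "\<psi> \<in> test_vm P" "\<And>z. \<rho> < norm z \<Longrightarrow> \<psi> z = 0"
    and \<phi>: "\<phi> \<in> test_fun" "\<And>z. \<rho> < norm z \<Longrightarrow> \<phi> z = 0" and \<rho>: "1 \<le> \<rho>"
  obtains C where "C > 0"
    "\<And>x y t. 0 < t \<Longrightarrow> norm (Tt (scl x t \<psi>) (scl y t \<phi>)) \<le> C * (t powr (real DIM('a) - \<nu>) * (1 + norm (x - y) / t) powr - N)"
proof -
  have \<rho>0: "0 < \<rho>" using \<rho> by simp
  \<comment> \<open>The factor 5 is 4 + 1: the centres are at most 4 \<rho> t apart and each support
    has radius \<rho> t, so a ball of radius 5 \<rho> t about x holds both.\<close>
  define \<psi>' where "\<psi>' = (\<lambda>z. \<psi> ((5 * \<rho>) *\<^sub>R z + 0))"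
  have \<psi>': "\<psi>' \<in> test_vm P" unfolding \<psi>'_def using \<psi> \<rho> by (intro test_vm_affine) auto
  have \<psi>'0: "\<psi>' z = 0" if "1 < norm z" for z
  proof -
    have "5 * \<rho> * 1 < 5 * \<rho> * norm z" using that \<rho> by (intro mult_strict_left_mono) auto
    then have "\<rho> < 5 * \<rho> * norm z" using \<rho> by linarith
    then show ?thesis using \<rho> unfolding \<psi>'_def by (intro \<psi>(2)) simp
  qed
  obtain a1 where a1: "a1 > 0" "\<And>w x. set w \<subseteq> Basis \<Longrightarrow> length w \<le> N0 \<Longrightarrow> norm (pd w \<psi>' x) \<le> a1"
    using test_fun_pd_bounded[OF test_vmD(1)[OF \<psi>']] by metis
  obtain b1 where b1: "b1 > 0" "\<And>w x. set w \<subseteq> Basis \<Longrightarrow> length w \<le> N0 \<Longrightarrow> norm (pd w \<phi> x) \<le> b1"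
    using test_fun_pd_bounded[OF \<phi>(1)] by metis
  obtain CH where CH: "CH > 0" "\<And>u y s. 0 < s \<Longrightarrow> 3 * \<rho> * s \<le> norm (u - y) \<Longrightarrow>
      norm (LINT v|lborel. K u v * scl y s \<psi> v) \<le> CH * norm (u - y) powr - N * s powr (real DIM('a) + real M + \<gamma>)"
    "\<And>v y s. 0 < s \<Longrightarrow> 3 * \<rho> * s \<le> norm (v - y) \<Longrightarrow>
      norm (LINT u|lborel. K u v * scl y s \<psi> u) \<le> CH * norm (v - y) powr - N * s powr (real DIM('a) + real M + \<gamma>)"
    by (rule kernel_inner_bound[OF \<psi> \<rho>0], assumption+, rule that)
  obtain Z where Z: "Z > 0" "\<And>z. norm (\<phi> z) \<le> Z" using test_fun_bounded[OF \<phi>(1)] by blast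
  define C1 where "C1 = CW * a1 * ((5 * \<rho>) ^ N0 * b1) * (5 * \<rho>) powr (real DIM('a) - \<nu>)"
  have C1: "C1 > 0" using CW a1 b1 \<rho> by (simp add: C1_def)
  define C2 where "C2 = (unit_ball_vol (real DIM('a)) * \<rho> ^ DIM('a) * Z) * CH * 2 powr N * 2 powr N"
  have C2: "C2 > 0" using \<rho> Z CH unit_ball_vol_pos[of "real DIM('a)"] by (simp add: C2_def)
  define C where "C = C1 * (1 + 4 * \<rho>) powr N + C2"
  have C: "C > 0" using C1 C2 \<rho> by (simp add: C_def add_pos_pos)
  have "norm (Tt (scl x t \<psi>) (scl y t \<phi>)) \<le> C * (t powr (real DIM('a) - \<nu>) * (1 + norm (x - y) / t) powr - N)"
    if t: "0 < t" for x y t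
  proof -
    let ?W = "(1 + norm (x - y) / t) powr - N"
    have E: "0 \<le> t powr (real DIM('a) - \<nu>) * ?W" by simp
    show ?thesis
    proof (cases "norm (x - y) \<le> 4 * \<rho> * t")
      case True
      define b where "b = (1 / t) *\<^sub>R (x - y)"
      have nb: "norm b \<le> 4 * \<rho>" using True t by (simp add: b_def pos_divide_le_eq mult_ac)
      define \<phi>' where "\<phi>' = (\<lambda>z. \<phi> ((5 * \<rho>) *\<^sub>R z + b))"
      have \<phi>': "\<phi>' \<in> test_fun" unfolding \<phi>'_def using \<phi> \<rho> by (intro test_fun_affine) auto
      have \<phi>'0: "\<phi>' z = 0" if "1 < norm z" for z
      proof -
        have "5 * \<rho> * 1 < 5 * \<rho> * norm z" using that \<rho> by (intro mult_strict_left_mono) auto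
        moreover have "norm ((5 * \<rho>) *\<^sub>R z) = 5 * \<rho> * norm z" using \<rho> by simp
        ultimately have "\<rho> < norm ((5 * \<rho>) *\<^sub>R z) - norm b" using nb by linarith
        also have "\<dots> \<le> norm ((5 * \<rho>) *\<^sub>R z + b)" by (rule norm_diff_ineq)
        finally show ?thesis unfolding \<phi>'_def by (rule \<phi>(2))
      qed
      have \<phi>'b: "norm (pd w \<phi>' z) \<le> (5 * \<rho>) ^ N0 * b1" if w: "set w \<subseteq> Basis" "length w \<le> N0" for w z
      proof -
        have "norm (pd w \<phi>' z) = (5 * \<rho>) ^ length w * norm (pd w \<phi> ((5 * \<rho>) *\<^sub>R z + b))"
          unfolding \<phi>'_def using \<rho> by (simp add: pd_affine[OF test_fun_smooth[OF \<phi>(1)] w(1)] norm_mult norm_power)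
        also have "\<dots> \<le> (5 * \<rho>) ^ N0 * b1"
          using w \<rho> b1 by (intro mult_mono power_increasing) auto
        finally show ?thesis .
      qed
      have "norm (T (scl x (5 * \<rho> * t) \<psi>') (scl x (5 * \<rho> * t) \<phi>')) + norm (Tt (scl x (5 * \<rho> * t) \<psi>') (scl x (5 * \<rho> * t) \<phi>'))
          \<le> CW * a1 * ((5 * \<rho>) ^ N0 * b1) * (5 * \<rho> * t) powr (real DIM('a) - \<nu>)"
        using \<psi>' \<psi>'0 \<phi>' \<phi>'0 \<phi>'b a1 b1 \<rho> t by (intro wbp) auto
      moreover have "scl x (5 * \<rho> * t) \<psi>' = scl x t \<psi>" using \<rho> by (simp add: scl_def \<psi>'_def)
      moreover have "scl x (5 * \<rho> * t) \<phi>' = scl y t \<phi>"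
        using \<rho> t by (auto simp: scl_def \<phi>'_def b_def algebra_simps)
      ultimately have "norm (Tt (scl x t \<psi>) (scl y t \<phi>)) \<le> CW * a1 * ((5 * \<rho>) ^ N0 * b1) * (5 * \<rho> * t) powr (real DIM('a) - \<nu>)"
        using norm_ge_zero[of "T (scl x t \<psi>) (scl y t \<phi>)"] by (simp only:)
      also have "\<dots> = C1 * t powr (real DIM('a) - \<nu>)" using \<rho> t by (simp add: C1_def powr_mult)
      also have "\<dots> \<le> C1 * t powr (real DIM('a) - \<nu>) * ((1 + 4 * \<rho>) powr N * ?W)"
        using mult_left_mono[OF near_weight[OF \<rho> t True], of "C1 * t powr (real DIM('a) - \<nu>)"] C1 by simp
      also have "\<dots> = (C1 * (1 + 4 * \<rho>) powr N) * (t powr (real DIM('a) - \<nu>) * ?W)" by (simp add: mult_ac)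
      also have "\<dots> \<le> C * (t powr (real DIM('a) - \<nu>) * ?W)" using E C2 by (intro mult_right_mono) (auto simp: C_def)
      finally show ?thesis .
    next
      case False
      then have far: "4 * \<rho> * t < norm (x - y)" by simp
      then have far': "4 * \<rho> * t < norm (y - x)" by (simp add: norm_minus_commute)
      have Tk: "Tt (scl x t \<psi>) (scl y t \<phi>) = kernel_pairing K (scl y t \<phi>) (scl x t \<psi>)"
        using \<psi> \<phi> t far_disjoint[OF \<phi>(2) \<psi>(2) \<rho> t order_refl far]
        by (intro kernel_transpose scl_test_fun scl_test_vm) auto
      define B where "B = CH * (2 powr N * norm (x - y) powr - N) * t powr (real DIM('a) + real M + \<gamma>)"
      have B: "0 \<le> B" using CH by (simp add: B_def)
      have inner: "norm (LINT u|lborel. K u v * scl x t \<psi> u) \<le> B" if v: "norm (v - y) \<le> \<rho> * t" for v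
      proof -
        have h: "norm (y - x) / 2 \<le> norm (v - x)" "3 * \<rho> * t \<le> norm (v - x)"
          using half_distance[OF \<rho> far' t v] by auto
        then have "norm (LINT u|lborel. K u v * scl x t \<psi> u) \<le> CH * norm (v - x) powr - N * t powr (real DIM('a) + real M + \<gamma>)"
          by (intro CH(3)[OF t])
        also have "norm (v - x) powr - N \<le> (norm (x - y) / 2) powr - N"
          using h far mult_pos_pos[of \<rho> t] \<rho>0 t N_pos norm_minus_commute[of x y] by (intro powr_mono2') linarith+
        also have "(norm (x - y) / 2) powr - N = 2 powr N * norm (x - y) powr - N"
          by (simp add: powr_divide powr_minus field_simps)
        finally show ?thesis using CH by (simp add: B_def mult_left_mono mult_right_mono)
      qed
      have "norm (LINT v|lborel. (LINT u|lborel. K u v * scl x t \<psi> u) * scl y t \<phi> v)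
          \<le> (unit_ball_vol (real DIM('a)) * \<rho> ^ DIM('a) * Z) * B * t ^ DIM('a)"
        using \<phi> t \<rho>0 B Z inner by (intro norm_integral_scl_le) auto
      then have "norm (Tt (scl x t \<psi>) (scl y t \<phi>)) \<le> (unit_ball_vol (real DIM('a)) * \<rho> ^ DIM('a) * Z) * B * t ^ DIM('a)"
        unfolding Tk using kernel_pairing_Fubini[of K "scl y t \<phi>" "scl x t \<psi>"] B Z \<rho>0 t by auto
      also have "\<dots> = (unit_ball_vol (real DIM('a)) * \<rho> ^ DIM('a) * Z * CH * 2 powr N) * (t powr (real DIM('a) + real M + \<gamma>) * t powr real DIM('a)) * norm (x - y) powr - N"
        using t by (simp add: B_def powr_realpow mult_ac)
      also have "\<dots> \<le> (unit_ball_vol (real DIM('a)) * \<rho> ^ DIM('a) * Z * CH * 2 powr N) * (t powr (real DIM('a) + real M + \<gamma>) * t powr real DIM('a)) * (2 powr N * t powr - N * ?W)"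
        using far_weight[OF \<rho> t far] \<rho> Z CH unit_ball_vol_nonneg[of "real DIM('a)"] by (intro mult_left_mono) auto
      also have "\<dots> = C2 * (t powr (real DIM('a) + real M + \<gamma>) * t powr real DIM('a) * t powr - N) * ?W" by (simp add: C2_def mult_ac)
      also have "t powr (real DIM('a) + real M + \<gamma>) * t powr real DIM('a) * t powr - N = t powr (real DIM('a) - \<nu>)"
        by (simp add: N_def algebra_simps flip: powr_add)
      also have "C2 * t powr (real DIM('a) - \<nu>) * ?W \<le> C * (t powr (real DIM('a) - \<nu>) * ?W)"
        using mult_right_mono[OF _ E, of C2 C] C1 \<rho> by (simp add: C_def mult.assoc)
      finally show ?thesis .
    qed
  qed
  then show ?thesis using that C by blast
qed

end

subsection \<open>Mollification of distributions\<close>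

text \<open>Continuity on functions supported in each fixed ball, with order m and constant
  depending on the ball. The arbitrary majorant B avoids suprema of derivatives.\<close>

definition distribution :: "(('a::euclidean_space) cfun \<Rightarrow> complex) \<Rightarrow> bool" where
  "distribution u \<longleftrightarrow> linear_functional_on test_fun u \<and>
     (\<forall>A. \<exists>C m. 0 \<le> C \<and> (\<forall>g\<in>test_fun. \<forall>B. (\<forall>x. A < norm x \<longrightarrow> g x = 0) \<longrightarrow>
        (\<forall>w x. set w \<subseteq> Basis \<longrightarrow> length w \<le> m \<longrightarrow> norm (pd w g x) \<le> B) \<longrightarrow> norm (u g) \<le> C * B))"

lemma distribution_add: "distribution u \<Longrightarrow> f \<in> test_fun \<Longrightarrow> g \<in> test_fun \<Longrightarrow> u (\<lambda>x. f x + g x) = u f + u g"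
  unfolding distribution_def linear_functional_on_def by blast

lemma distribution_cmult: "distribution u \<Longrightarrow> f \<in> test_fun \<Longrightarrow> u (\<lambda>x. c * f x) = c * u f"
  unfolding distribution_def linear_functional_on_def by blast

lemma distribution_diff:
  assumes "distribution u" "f \<in> test_fun" "g \<in> test_fun" shows "u (\<lambda>x. f x - g x) = u f - u g"
  using distribution_add[OF assms(1,2) test_fun_cmult[OF assms(3)], of "-1"] distribution_cmult[OF assms(1,3), of "-1"]
  by simp

lemma distribution_sum:
  assumes "distribution u" "\<And>i. i \<in> I \<Longrightarrow> f i \<in> test_fun"
  shows "u (\<lambda>x. \<Sum>i\<in>I. f i x) = (\<Sum>i\<in>I. u (f i))"
  using assms(2)
proof (induction I rule: infinite_finite_induct)
  case (insert i I)
  then show ?case by (simp add: distribution_add[OF assms(1)] test_fun_sum)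
qed (use distribution_cmult[OF assms(1) test_fun_zero, of 0] in auto)

lemma distributionE:
  assumes "distribution u"
  obtains C m where "0 \<le> C" "\<And>g B. g \<in> test_fun \<Longrightarrow> \<forall>x. A < norm x \<longrightarrow> g x = 0 \<Longrightarrow>
    \<forall>w x. set w \<subseteq> Basis \<longrightarrow> length w \<le> m \<longrightarrow> norm (pd w g x) \<le> B \<Longrightarrow> norm (u g) \<le> C * B"
proof -
  obtain C m where "0 \<le> C" "\<forall>g\<in>test_fun. \<forall>B. (\<forall>x. A < norm x \<longrightarrow> g x = 0) \<longrightarrow>
        (\<forall>w x. set w \<subseteq> Basis \<longrightarrow> length w \<le> m \<longrightarrow> norm (pd w g x) \<le> B) \<longrightarrow> norm (u g) \<le> C * B"
    using assms unfolding distribution_def by blast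
  then show ?thesis by (intro that) blast+
qed

text \<open>With this reflection, \<open>u (shift g y)\<close> is the convolution of u and g at
  y.\<close>

definition shift :: "'a::euclidean_space cfun \<Rightarrow> 'a \<Rightarrow> 'a cfun" where
  "shift g y = (\<lambda>z. g (y - z))"

lemma shift_conv_affine: "shift g y = (\<lambda>z. g ((-1) *\<^sub>R z + y))"
  by (simp add: shift_def)

lemma shift_test_fun: "g \<in> test_fun \<Longrightarrow> shift g y \<in> test_fun"
  unfolding shift_conv_affine by (rule test_fun_affine) auto

lemma pd_shift: "smooth g \<Longrightarrow> set w \<subseteq> Basis \<Longrightarrow> pd w (shift g y) z = (-1) ^ length w * pd w g (y - z)"
  unfolding shift_conv_affine by (subst pd_affine) simp_all

lemma shift_eq_0: "(\<And>z. A < norm z \<Longrightarrow> g z = 0) \<Longrightarrow> A + norm y < norm z \<Longrightarrow> shift g y z = 0"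
  using norm_triangle_ineq2[of z y] by (simp add: shift_def norm_minus_commute)

lemma pd_partial_deriv_commute:
  "smooth g \<Longrightarrow> set w \<subseteq> Basis \<Longrightarrow> b \<in> Basis \<Longrightarrow> pd w (partial_deriv b g) x = partial_deriv b (pd w g) x"
  by (rule pd_move_to_front[OF open_UNIV smooth_C_k_on]) auto

lemma quadratic_error_derivative:
  fixes G :: "('a::euclidean_space) cfun"
  assumes "\<And>t. \<bar>t\<bar> \<le> 1 \<Longrightarrow> norm (G (y + t *\<^sub>R b) - G y - of_real t * D) \<le> C * t\<^sup>2"
  shows "coord_diff b G y" "partial_deriv b G y = D"
proof -
  have "((\<lambda>t. norm (G (y + t *\<^sub>R b) - G y - t *\<^sub>R D) / \<bar>t\<bar>) \<longlongrightarrow> 0) (at 0)"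
  proof (rule Lim_null_comparison)
    show "\<forall>\<^sub>F t in at 0. norm (norm (G (y + t *\<^sub>R b) - G y - t *\<^sub>R D) / \<bar>t\<bar>) \<le> \<bar>C\<bar> * \<bar>t\<bar>"
      unfolding eventually_at
    proof (intro exI conjI ballI impI)
      fix t :: real assume t: "t \<noteq> 0 \<and> dist t 0 < 1"
      have "norm (G (y + t *\<^sub>R b) - G y - t *\<^sub>R D) \<le> C * t\<^sup>2"
        using assms[of t] t by (simp add: scaleR_conv_of_real)
      also have "\<dots> \<le> (\<bar>C\<bar> * \<bar>t\<bar>) * \<bar>t\<bar>" by (simp add: power2_eq_square abs_mult_self mult.assoc mult_right_mono)
      finally show "norm (norm (G (y + t *\<^sub>R b) - G y - t *\<^sub>R D) / \<bar>t\<bar>) \<le> \<bar>C\<bar> * \<bar>t\<bar>"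
        using t by (simp add: divide_le_eq)
    qed simp
    show "((\<lambda>t. \<bar>C\<bar> * \<bar>t\<bar>) \<longlongrightarrow> 0) (at 0)" by (intro tendsto_mult_right_zero tendsto_rabs_zero tendsto_ident_at)
  qed
  then have "((\<lambda>t. G (y + t *\<^sub>R b)) has_vector_derivative D) (at 0)"
    by (simp add: has_vector_derivative_def has_derivative_at bounded_linear_scaleR_left)
  then show "coord_diff b G y" "partial_deriv b G y = D" by (rule partial_deriv_eqI)+
qed

text \<open>The difference quotients of \<open>shift g y\<close> in y converge together with their
  derivatives up to the order of u, with error O(t^2). Displacements of length at most 1 keep all
  supports in a single ball, so one continuity estimate for u suffices.\<close>

lemma
  fixes u :: "('a::euclidean_space) cfun \<Rightarrow> complex"
  assumes u: "distribution u" and g: "g \<in> test_fun"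
  shows distribution_shift_deriv: "b \<in> Basis \<Longrightarrow> coord_diff b (\<lambda>y. u (shift g y)) y"
      "b \<in> Basis \<Longrightarrow> partial_deriv b (\<lambda>y. u (shift g y)) = (\<lambda>y. u (shift (partial_deriv b g) y))"
    and distribution_shift_continuous: "continuous_on UNIV (\<lambda>y. u (shift g y))"
proof -
  have smg: "smooth g" using g by (rule test_fun_smooth)
  obtain A where A: "A > 0" "\<And>z. A < norm z \<Longrightarrow> g z = 0" using g test_funE by metis
  have zero: "shift g' (y + h) z = 0" if "norm h \<le> 1" "A + norm y + 1 < norm z" "\<And>z. A < norm z \<Longrightarrow> g' z = 0" for g' y h z
    using that norm_triangle_ineq[of y h] by (intro shift_eq_0[of A g']) auto
  have zero': "shift g' y z = 0" if "A + norm y + 1 < norm z" "\<And>z. A < norm z \<Longrightarrow> g' z = 0" for g' y z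
    using zero[of 0 y z g'] that by simp
  have sms: "smooth (shift g y)" for y using shift_test_fun[OF g] test_fun_smooth by blast
  have quad: "\<exists>C. \<forall>t. \<bar>t\<bar> \<le> 1 \<longrightarrow> norm (u (shift g (y + t *\<^sub>R b)) - u (shift g y) - of_real t * u (shift (partial_deriv b g) y)) \<le> C * t\<^sup>2"
    if b: "b \<in> Basis" for b y
  proof -
    have db: "partial_deriv b g \<in> test_fun" using test_fun_partial_deriv[OF g b] .
    obtain C m where C: "0 \<le> C" "\<And>g B. g \<in> test_fun \<Longrightarrow> \<forall>x. A + norm y + 1 < norm x \<longrightarrow> g x = 0 \<Longrightarrow>
      \<forall>w x. set w \<subseteq> Basis \<longrightarrow> length w \<le> m \<longrightarrow> norm (pd w g x) \<le> B \<Longrightarrow> norm (u g) \<le> C * B"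
      by (rule distributionE[OF u, where A="A + norm y + 1"], rule that)
    \<comment> \<open>Two orders above m, because the remainder of each derivative of order up to m
      is controlled by its second derivative.\<close>
    obtain B where B: "B > 0" "\<And>w x. set w \<subseteq> Basis \<Longrightarrow> length w \<le> m + 2 \<Longrightarrow> norm (pd w g x) \<le> B"
      using test_fun_pd_bounded[OF g] by metis
    have "norm (u (shift g (y + t *\<^sub>R b)) - u (shift g y) - of_real t * u (shift (partial_deriv b g) y)) \<le> C * B * t\<^sup>2"
      if t: "\<bar>t\<bar> \<le> 1" for t
    proof -
      let ?S = "\<lambda>z. (shift g (y + t *\<^sub>R b) z - shift g y z) - of_real t * shift (partial_deriv b g) y z"
      have S: "?S \<in> test_fun" using g db by (intro test_fun_diff test_fun_cmult shift_test_fun)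
      have eq: "u ?S = u (shift g (y + t *\<^sub>R b)) - u (shift g y) - of_real t * u (shift (partial_deriv b g) y)"
        using g db by (simp add: distribution_diff[OF u] distribution_cmult[OF u] test_fun_diff test_fun_cmult shift_test_fun)
      have "norm (u ?S) \<le> C * (B * t\<^sup>2)"
      proof (rule C(2)[OF S]; intro allI impI)
        fix z :: 'a assume z: "A + norm y + 1 < norm z"
        have "partial_deriv b g v = 0" if "A < norm v" for v
          using pd_zero_outside[OF A(2) _ that, where w="[b]"] b by simp
        then show "?S z = 0"
          using zero[OF _ z A(2), of "t *\<^sub>R b"] zero'[OF z A(2)] zero'[OF z, of "partial_deriv b g"] t b by simp
      next
        fix w :: "'a list" and x assume w: "set w \<subseteq> Basis" "length w \<le> m"
        have smw: "smooth (pd w g)" using smooth_pd[OF smg w(1)] .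
        have "pd w ?S x = (pd w (shift g (y + t *\<^sub>R b)) x - pd w (shift g y) x) - of_real t * pd w (shift (partial_deriv b g) y) x"
          using w(1) shift_test_fun[OF g] shift_test_fun[OF db]
          by (simp add: pd_diff[OF open_UNIV] pd_cmult[OF open_UNIV] smooth_C_k_on test_fun_smooth smooth_diff smooth_cmult)
        also have "\<dots> = (-1) ^ length w * (pd w g ((y - x) + t *\<^sub>R b) - pd w g (y - x) - t *\<^sub>R partial_deriv b (pd w g) (y - x))"
          using w(1) smg test_fun_smooth[OF db] b
          by (simp add: pd_shift pd_partial_deriv_commute algebra_simps scaleR_conv_of_real)
        also have "norm \<dots> = norm (pd w g ((y - x) + t *\<^sub>R b) - pd w g (y - x) - t *\<^sub>R partial_deriv b (pd w g) (y - x))"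
          by (simp add: norm_mult norm_power)
        also have "\<dots> \<le> B * t\<^sup>2"
          using B(2)[of "b # b # w"] w b by (intro smooth_second_order[OF smw b]) auto
        finally show "norm (pd w ?S x) \<le> B * t\<^sup>2" .
      qed
      then show ?thesis unfolding eq by (simp add: mult.assoc)
    qed
    then show ?thesis by blast
  qed
  show "coord_diff b (\<lambda>y. u (shift g y)) y" if "b \<in> Basis" for b y
    using quad[OF that, of y] quadratic_error_derivative(1)[of "\<lambda>y. u (shift g y)" y b] by blast
  show "partial_deriv b (\<lambda>y. u (shift g y)) = (\<lambda>y. u (shift (partial_deriv b g) y))" if "b \<in> Basis" for b
  proof
    fix y show "partial_deriv b (\<lambda>y. u (shift g y)) y = u (shift (partial_deriv b g) y)"
      using quad[OF that, of y] quadratic_error_derivative(2)[of "\<lambda>y. u (shift g y)" y b] by blast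
  qed
  have "isCont (\<lambda>y. u (shift g y)) y" for y
  proof -
    obtain C m where C: "0 \<le> C" "\<And>g B. g \<in> test_fun \<Longrightarrow> \<forall>x. A + norm y + 1 < norm x \<longrightarrow> g x = 0 \<Longrightarrow>
      \<forall>w x. set w \<subseteq> Basis \<longrightarrow> length w \<le> m \<longrightarrow> norm (pd w g x) \<le> B \<Longrightarrow> norm (u g) \<le> C * B"
      by (rule distributionE[OF u, where A="A + norm y + 1"], rule that)
    obtain B where B: "B > 0" "\<And>w x. set w \<subseteq> Basis \<Longrightarrow> length w \<le> m + 1 \<Longrightarrow> norm (pd w g x) \<le> B"
      using test_fun_pd_bounded[OF g] by metis
    have "norm (u (shift g (y + h)) - u (shift g y)) \<le> C * (DIM('a) * B) * norm h" if h: "norm h \<le> 1" for h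
    proof -
      let ?S = "\<lambda>z. shift g (y + h) z - shift g y z"
      have S: "?S \<in> test_fun" using g by (intro test_fun_diff shift_test_fun)
      have "norm (u ?S) \<le> C * (DIM('a) * B * norm h)"
      proof (rule C(2)[OF S]; intro allI impI)
        fix z :: 'a assume z: "A + norm y + 1 < norm z"
        show "?S z = 0" using zero[OF h z A(2)] zero'[OF z A(2)] by simp
      next
        fix w :: "'a list" and x assume w: "set w \<subseteq> Basis" "length w \<le> m"
        have smw: "smooth (pd w g)" using smooth_pd[OF smg w(1)] .
        have "pd w ?S x = (-1) ^ length w * (pd w g ((y - x) + h) - pd w g (y - x))"
          using w(1) sms smg by (simp add: pd_diff[OF open_UNIV] smooth_C_k_on pd_shift algebra_simps)
        also have "norm \<dots> = norm (pd w g ((y - x) + h) - pd w g (y - x))"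
          by (simp add: norm_mult norm_power)
        also have "\<dots> \<le> DIM('a) * B * norm h"
          using B(2)[of "_ # w"] B(1) w by (intro smooth_increment_le[OF smw]) auto
        finally show "norm (pd w ?S x) \<le> DIM('a) * B * norm h" .
      qed
      then show ?thesis using g by (simp add: distribution_diff[OF u] shift_test_fun mult.assoc)
    qed
    then have bd: "norm (u (shift g z) - u (shift g y)) \<le> C * (DIM('a) * B) * norm (z - y)" if "norm (z - y) \<le> 1" for z
      using that by (metis add_diff_cancel_left' diff_add_cancel add.commute)
    have "((\<lambda>z. u (shift g z) - u (shift g y)) \<longlongrightarrow> 0) (at y)"
    proof (rule Lim_null_comparison)
      show "\<forall>\<^sub>F z in at y. norm (u (shift g z) - u (shift g y)) \<le> C * (DIM('a) * B) * norm (z - y)"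
        unfolding eventually_at using bd by (intro exI[of _ 1]) (auto simp: dist_norm)
      have "((\<lambda>z. C * (DIM('a) * B) * norm (z - y)) \<longlongrightarrow> C * (DIM('a) * B) * norm (y - y)) (at y)"
        by (intro tendsto_intros)
      then show "((\<lambda>z. C * (DIM('a) * B) * norm (z - y)) \<longlongrightarrow> 0) (at y)" by simp
    qed
    then show ?thesis by (simp add: isCont_def LIM_zero_iff)
  qed
  then show "continuous_on UNIV (\<lambda>y. u (shift g y))"
    by (simp add: continuous_on_eq_continuous_at)
qed

lemma distribution_shift_smooth:
  assumes u: "distribution u" and g: "g \<in> test_fun"
  shows "smooth (\<lambda>y. u (shift g y))"
proof -
  have "C_k_on k UNIV (\<lambda>y. u (shift g y))" for k
    using g
  proof (induction k arbitrary: g)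
    case 0
    then show ?case using distribution_shift_continuous[OF u] by simp
  next
    case (Suc k)
    then show ?case
      using distribution_shift_continuous[OF u] distribution_shift_deriv[OF u Suc.prems]
        Suc.IH[OF test_fun_partial_deriv[OF Suc.prems]]
      by simp
  qed
  then show ?thesis by (simp add: smooth_def)
qed

lemma pd_distribution_shift:
  assumes u: "distribution u" and g: "g \<in> test_fun" and w: "set w \<subseteq> Basis"
  shows "pd w (\<lambda>y. u (shift g y)) = (\<lambda>y. u (shift (pd w g) y))"
  using w
proof (induction w)
  case (Cons b w)
  then show ?case
    using distribution_shift_deriv(2)[OF u test_fun_pd[OF g], of w b] by simp
qed simp

section \<open>Approximation of a distribution by its mollifications\<close>

lemma integral_by_parts_pd:
  assumes f: "f \<in> test_fun" and g: "smooth g" and w: "set w \<subseteq> Basis"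
  shows "(LINT x|lborel. pd w f x * g x) = (-1) ^ length w * (LINT x|lborel. f x * pd w g x)"
  using w g
proof (induction w arbitrary: g)
  case (Cons b w)
  have "(LINT x|lborel. pd (b # w) f x * g x) = - (LINT x|lborel. pd w f x * partial_deriv b g x)"
    using integral_by_parts[OF test_fun_pd[OF f] Cons.prems(2), of w b] Cons.prems by simp
  also have "\<dots> = - ((-1) ^ length w * (LINT x|lborel. f x * pd w (partial_deriv b g) x))"
    using Cons.IH[of "partial_deriv b g"] Cons.prems smooth_partial_deriv[OF Cons.prems(2), of b] by simp
  finally show ?case
    using Cons.prems by (simp add: pd_partial_deriv_commute)
qed simp

text \<open>A tile inside the \<delta>-ball of its tag sees an oscillation of at most e, so its
  error is at most e times its volume; the volumes add up to that of the box.\<close>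

lemma tagged_division_sum_error:
  fixes F :: "('a::euclidean_space) cfun"
  assumes p: "p tagged_division_of cbox a b" and fine: "(\<lambda>x. ball x \<delta>) fine p" and e: "0 \<le> e"
    and F: "continuous_on (cbox a b) F" "\<And>x y. dist x y < \<delta> \<Longrightarrow> norm (F x - F y) \<le> e"
  shows "norm ((\<Sum>(x, K)\<in>p. of_real (measure lborel K) * F x) - integral (cbox a b) F) \<le> e * measure lborel (cbox a b)"
proof -
  have Fi: "F integrable_on cbox a b" using F(1) by (rule integrable_continuous)
  have "(\<Sum>(x, K)\<in>p. of_real (measure lborel K) * F x) - integral (cbox a b) F =
      (\<Sum>(x, K)\<in>p. of_real (measure lborel K) * F x - integral K F)"
    unfolding integral_combine_tagged_division_topdown[OF Fi p] by (simp add: sum_subtractf split_def)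
  also have "norm \<dots> \<le> (\<Sum>(x, K)\<in>p. e * measure lborel K)"
  proof (rule sum_norm_le, clarify)
    fix x K assume xK: "(x, K) \<in> p"
    obtain c d where K: "K = cbox c d" using tagged_division_ofD(4)[OF p xK] by blast
    have sub: "K \<subseteq> cbox a b" "K \<subseteq> ball x \<delta>"
      using tagged_division_ofD(3)[OF p xK] fineD[OF fine xK] by auto
    have FK: "F integrable_on cbox c d" using F(1) sub(1) unfolding K by (intro integrable_continuous) (rule continuous_on_subset)
    have "((\<lambda>y. F x - F y) has_integral (measure lborel K *\<^sub>R F x - integral K F)) (cbox c d)"
      unfolding K by (intro has_integral_diff has_integral_const integrable_integral FK)
    then have "norm (measure lborel K *\<^sub>R F x - integral K F) \<le> e * measure lborel (cbox c d)"
      using sub(2) e F(2) unfolding K by (intro has_integral_bound) (auto simp: subset_iff)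
    then show "norm (of_real (measure lborel K) * F x - integral K F) \<le> e * measure lborel K"
      by (simp add: K scaleR_conv_of_real)
  qed
  also have "\<dots> = e * measure lborel (cbox a b)"
    by (simp add: additive_content_tagged_division[OF p, symmetric] sum_distrib_left split_def)
  finally show ?thesis .
qed

lemma integral_eq_cbox:
  fixes F :: "('a::euclidean_space) cfun"
  assumes "F \<in> test_fun" "\<And>x. x \<notin> cbox a b \<Longrightarrow> F x = 0"
  shows "integral (cbox a b) F = (LINT x|lborel. F x)"
proof -
  have "F integrable_on cbox a b"
    by (intro integrable_continuous smooth_continuous test_fun_smooth assms)
  then have "(F has_integral integral (cbox a b) F) UNIV"
    using assms(2) by (intro has_integral_on_superset[OF integrable_integral]) auto
  moreover have "(F has_integral (LINT x|lborel. F x)) UNIV"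
    by (rule has_integral_integral_lborel[OF test_fun_integrable[OF assms(1)]])
  ultimately show ?thesis by (rule has_integral_unique)
qed

lemma test_fun_pd_Lipschitz:
  fixes f :: "('a::euclidean_space) cfun"
  assumes f: "f \<in> test_fun"
  obtains B where "B > 0" "\<And>w x. set w \<subseteq> Basis \<Longrightarrow> length w \<le> m \<Longrightarrow> norm (pd w f x) \<le> B"
    "\<And>w x y. set w \<subseteq> Basis \<Longrightarrow> length w \<le> m \<Longrightarrow> norm (pd w f x - pd w f y) \<le> B * dist x y"
proof -
  obtain B where B: "B > 0" "\<And>w x. set w \<subseteq> Basis \<Longrightarrow> length w \<le> m + 1 \<Longrightarrow> norm (pd w f x) \<le> B"
    using test_fun_pd_bounded[OF f] by metis
  have n: "1 \<le> real DIM('a)" by (simp add: Suc_leI)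
  show ?thesis
  proof (rule that[of "DIM('a) * B"])
    show "norm (pd w f x) \<le> DIM('a) * B" if "set w \<subseteq> Basis" "length w \<le> m" for w x
    proof -
      have "norm (pd w f x) \<le> 1 * B" using B(2)[of w x] that by simp
      also have "\<dots> \<le> DIM('a) * B" using n B(1) by (intro mult_right_mono) auto
      finally show ?thesis .
    qed
    show "norm (pd w f x - pd w f y) \<le> DIM('a) * B * dist x y" if w: "set w \<subseteq> Basis" "length w \<le> m" for w x y
      using smooth_increment_le[OF smooth_pd[OF test_fun_smooth[OF f] w(1)], of B y "x - y"] B(2)[of "_ # w"] B(1) w
      by (simp add: dist_norm)
  qed (use B in simp)
qed

text \<open>
  The functions \<open>\<lambda>z. \<Sum> measure lborel K * g (y\<^sub>K - z) * f y\<^sub>K\<close>, for a fine tagged division, approximate \<open>f\<close>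
  together with its derivatives when \<open>g\<close> is an approximate identity; \<open>u\<close> maps them to the Riemann sums
  of the integral.
\<close>

lemma distribution_mollify:
  fixes u :: "('a::euclidean_space) cfun \<Rightarrow> complex"
  assumes u: "distribution u" and \<kappa>: "\<kappa> \<in> test_fun" "(LINT x|lborel. \<kappa> x) = 1" and f: "f \<in> test_fun"
  shows "\<exists>C. \<forall>s. 0 < s \<longrightarrow> s \<le> 1 \<longrightarrow>
    norm (u f - (LINT y|lborel. (of_real (s powr - DIM('a)) * u (scl y s \<kappa>)) * f y)) \<le> C * s"
proof -
  obtain A where A: "A > 0" "\<And>x. A < norm x \<Longrightarrow> f x = 0" using f test_funE by metis
  obtain \<rho> where \<rho>: "\<rho> > 0" "\<And>x. \<rho> < norm x \<Longrightarrow> \<kappa> x = 0" using \<kappa> test_funE by metis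
  obtain C m where C: "0 \<le> C" "\<And>g B. g \<in> test_fun \<Longrightarrow> \<forall>x. A + \<rho> < norm x \<longrightarrow> g x = 0 \<Longrightarrow>
      \<forall>w x. set w \<subseteq> Basis \<longrightarrow> length w \<le> m \<longrightarrow> norm (pd w g x) \<le> B \<Longrightarrow> norm (u g) \<le> C * B"
    by (rule distributionE[OF u, where A="A + \<rho>"], rule that)
  obtain Bf where Bf: "Bf > 0" "\<And>w x. set w \<subseteq> Basis \<Longrightarrow> length w \<le> m \<Longrightarrow> norm (pd w f x) \<le> Bf"
    "\<And>w x y. set w \<subseteq> Basis \<Longrightarrow> length w \<le> m \<Longrightarrow> norm (pd w f x - pd w f y) \<le> Bf * dist x y"
    by (rule test_fun_pd_Lipschitz[OF f, where m=m], rule that)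
  obtain Z where Z: "Z > 0" "\<And>z. norm (\<kappa> z) \<le> Z" using test_fun_bounded[OF \<kappa>(1)] by blast
  define C1 where "C1 = unit_ball_vol (real DIM('a)) * \<rho> ^ DIM('a) * Z * (Bf * \<rho>)"
  have C1: "0 \<le> C1" using Z \<rho> Bf unit_ball_vol_nonneg[of "real DIM('a)"] by (simp add: C1_def)
  obtain a where box: "cball 0 A \<subseteq> cbox (- a) (a :: 'a)"
    using bounded_subset_cbox_symmetric[OF bounded_cball] by blast
  have f0: "f x = 0" if "x \<notin> cbox (- a) a" for x 
    using A(2)[of x] that box by (metis in_mono mem_cball_0 not_le)
  define V where "V = measure lborel (cbox (- a) a)"
  have V: "0 \<le> V" by (simp add: V_def)
  have "norm (u f - (LINT y|lborel. (of_real (s powr - DIM('a)) * u (scl y s \<kappa>)) * f y)) \<le> C * C1 * s"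
    if s: "0 < s" "s \<le> 1" for s
  proof -
    define c where "c = complex_of_real (s powr - DIM('a))"
    \<comment> \<open>The reflected profile, because \<open>shift\<close> reflects once more: the
      shifts of g are then the normalised functions \<open>scl y s \<kappa>\<close>.\<close>
    define g where "g = (\<lambda>v. c * \<kappa> ((- (1 / s)) *\<^sub>R v + 0))"
    have g: "g \<in> test_fun" unfolding g_def using \<kappa>(1) s by (intro test_fun_cmult test_fun_affine) auto
    have smg: "smooth g" using g test_fun_smooth by blast
    have gs: "shift g y = (\<lambda>z. c * scl y s \<kappa> z)" for y
      by (simp add: shift_def g_def scl_def algebra_simps)
    have g0: "g v = 0" if "\<rho> < norm v" for v
    proof -
      have "\<rho> * s \<le> \<rho>" using \<rho> s by (simp add: mult_le_cancel_left1)
      then have "\<rho> < norm ((- (1 / s)) *\<^sub>R v + 0)" using that s by (simp add: pos_less_divide_eq)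
      then show ?thesis unfolding g_def using \<rho>(2) by simp
    qed
    define U where "U y = u (shift g y)" for y
    have U_eq: "U y = of_real (s powr - DIM('a)) * u (scl y s \<kappa>)" for y
      using scl_test_fun[OF \<kappa>(1) s(1)] by (simp add: U_def gs distribution_cmult[OF u] c_def)
    have smU: "smooth U" unfolding U_def using distribution_shift_smooth[OF u g] .
    let ?I = "LINT y|lborel. U y * f y"
    have mass: "(LINT y|lborel. g (y - z)) = 1" for z
    proof -
      have "(LINT y|lborel. g (y - z)) = c * (LINT y|lborel. \<kappa> ((- (1 / s)) *\<^sub>R y + (1 / s) *\<^sub>R z))"
        by (simp add: g_def algebra_simps)
      also have "\<dots> = c * (of_real (\<bar>- (1 / s)\<bar> powr - DIM('a)) * (LINT y|lborel. \<kappa> y))"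
        using s test_fun_measurable[OF \<kappa>(1)] by (subst integral_affine) auto
      also have "\<dots> = 1" using s \<kappa>(2)
        by (simp add: c_def powr_divide powr_minus flip: of_real_mult)
      finally show ?thesis .
    qed
    obtain Bg where Bg: "Bg > 0" "\<And>w x. set w \<subseteq> Basis \<Longrightarrow> length w \<le> m \<Longrightarrow> norm (pd w g x) \<le> Bg"
      "\<And>w x y. set w \<subseteq> Basis \<Longrightarrow> length w \<le> m \<Longrightarrow> norm (pd w g x - pd w g y) \<le> Bg * dist x y"
      by (rule test_fun_pd_Lipschitz[OF g, where m=m], rule that)
    have Uf: "(\<lambda>y. U y * f y) \<in> test_fun" using f smU by (intro test_fun_mult')
    obtain BU where BU: "BU > 0" "\<And>w x. set w \<subseteq> Basis \<Longrightarrow> length w \<le> 0 \<Longrightarrow> norm (pd w (\<lambda>y. U y * f y) x) \<le> BU"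
      "\<And>w x y. set w \<subseteq> Basis \<Longrightarrow> length w \<le> 0 \<Longrightarrow> norm (pd w (\<lambda>y. U y * f y) x - pd w (\<lambda>y. U y * f y) y) \<le> BU * dist x y"
      by (rule test_fun_pd_Lipschitz[OF Uf, where m=0], rule that)
    \<comment> \<open>Parts moves the word onto f, mass one brings the value at z under the
      integral, and the Lipschitz bound on a ball of radius \<rho> s yields the factor s.\<close>
    have conv: "norm ((LINT y|lborel. (-1) ^ length w * pd w g (y - z) * f y) - pd w f z) \<le> C1 * s"
      if w: "set w \<subseteq> Basis" "length w \<le> m" for w z
    proof -
      have "(\<lambda>y. g (1 *\<^sub>R y + - z)) \<in> test_fun" using g by (intro test_fun_affine) auto
      then have gz: "(\<lambda>y. g (y - z)) \<in> test_fun" by simp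
      have pdz: "pd w (\<lambda>y. g (y - z)) y = pd w g (y - z)" for y
        using pd_affine[OF smg w(1), of 1 "- z" y] by simp
      have "(LINT y|lborel. (-1) ^ length w * pd w g (y - z) * f y) = (-1) ^ length w * (LINT y|lborel. pd w (\<lambda>y. g (y - z)) y * f y)"
        by (simp add: pdz mult.assoc)
      also have "\<dots> = (LINT y|lborel. g (y - z) * pd w f y)"
        unfolding integral_by_parts_pd[OF gz test_fun_smooth[OF f] w(1)]
        by (simp add: mult.assoc[symmetric] power_add[symmetric] power2_eq_square mult_2[symmetric] flip: power_mult_distrib)
      finally have "(LINT y|lborel. (-1) ^ length w * pd w g (y - z) * f y) - pd w f z =
          (LINT y|lborel. g (y - z) * pd w f y) - (LINT y|lborel. g (y - z) * pd w f z)"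
        using mass[of z] by simp
      also have "\<dots> = (LINT y|lborel. g (y - z) * pd w f y - g (y - z) * pd w f z)"
        using gz test_fun_smooth[OF test_fun_pd[OF f w(1)]]
        by (intro Bochner_Integration.integral_diff[symmetric] test_fun_integrable test_fun_mult smooth_const)
      also have "\<dots> = c * (LINT y|lborel. (pd w f y - pd w f z) * scl z s (\<lambda>v. \<kappa> (- v)) y)"
        by (simp add: g_def scl_def algebra_simps flip: integral_mult_right_zero)
      finally have e: "(LINT y|lborel. (-1) ^ length w * pd w g (y - z) * f y) - pd w f z =
          c * (LINT y|lborel. (pd w f y - pd w f z) * scl z s (\<lambda>v. \<kappa> (- v)) y)" .
      have "norm (LINT y|lborel. (pd w f y - pd w f z) * scl z s (\<lambda>v. \<kappa> (- v)) y)
          \<le> (unit_ball_vol (real DIM('a)) * \<rho> ^ DIM('a) * Z) * (Bf * (\<rho> * s)) * s ^ DIM('a)"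
      proof (rule norm_integral_scl_le)
        show "norm (pd w f v - pd w f z) \<le> Bf * (\<rho> * s)" if "norm (v - z) \<le> \<rho> * s" for v
          using order_trans[OF Bf(3)[OF w, of v z] mult_left_mono[of "dist v z" "\<rho> * s" Bf]] that Bf(1)
          by (simp add: dist_norm)
      qed (use \<rho> Z s Bf in auto)
      then have "norm ((LINT y|lborel. (-1) ^ length w * pd w g (y - z) * f y) - pd w f z) \<le>
          s powr - DIM('a) * ((unit_ball_vol (real DIM('a)) * \<rho> ^ DIM('a) * Z) * (Bf * (\<rho> * s)) * s ^ DIM('a))"
        unfolding e norm_mult by (simp add: c_def mult_left_mono)
      also have "\<dots> = C1 * s"
        using s by (simp add: C1_def powr_minus powr_realpow field_simps)
      finally show ?thesis .
    qed
    \<comment> \<open>Here s is fixed; e pays for the Riemann sums alone and is removed at the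
      end.\<close>
    have "norm (u f - ?I) \<le> C * C1 * s + e" if e: "e > 0" for e
    proof -
      \<comment> \<open>The Riemann error occurs once in the integral and once, multiplied by C, in
        the approximation of f: in total (C + 1) V e' \<le> e.\<close>
      define e' where "e' = e / ((C + 1) * (V + 1))"
      have e': "e' > 0" using e C V by (simp add: e'_def)
      \<comment> \<open>The denominator adds Lipschitz constants of the two kinds of integrands: U
        f, and the derivatives of g(y - z) times f(y), uniformly in z.\<close>
      define \<delta> where "\<delta> = e' / (2 * Bg * Bf + BU)"
      have \<delta>: "\<delta> > 0" using e' Bg Bf BU by (simp add: \<delta>_def add_pos_pos)
      have \<delta>1: "2 * Bg * Bf * r \<le> e'" "BU * r \<le> e'" if "0 \<le> r" "r < \<delta>" for r
      proof -
        have "(2 * Bg * Bf + BU) * r \<le> e'"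
          using that Bg Bf BU by (simp add: \<delta>_def pos_less_divide_eq add_pos_pos mult.commute less_imp_le)
        moreover have "0 \<le> 2 * Bg * Bf * r" "0 \<le> BU * r" using that Bg Bf BU by auto
        ultimately show "2 * Bg * Bf * r \<le> e'" "BU * r \<le> e'" by (simp_all only: distrib_right)
      qed
      obtain p where p: "p tagged_division_of cbox (- a) a" "(\<lambda>x. ball x \<delta>) fine p"
        using fine_division_exists[OF gauge_ball[OF \<delta>]] by blast
      have fin: "finite p" using p(1) by blast
      define h where "h = (\<lambda>z. \<Sum>xK\<in>p. (of_real (measure lborel (snd xK)) * f (fst xK)) * shift g (fst xK) z)"
      have h: "h \<in> test_fun" unfolding h_def using g by (intro test_fun_sum test_fun_cmult shift_test_fun)
      have uh: "u h = (\<Sum>(x, K)\<in>p. of_real (measure lborel K) * (U x * f x))"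
      proof -
        have "u h = (\<Sum>xK\<in>p. u (\<lambda>z. (of_real (measure lborel (snd xK)) * f (fst xK)) * shift g (fst xK) z))"
          unfolding h_def using g by (intro distribution_sum[OF u] test_fun_cmult shift_test_fun)
        also have "\<dots> = (\<Sum>(x, K)\<in>p. of_real (measure lborel K) * (U x * f x))"
        proof (rule sum.cong[OF refl])
          fix xK :: "'a \<times> 'a set"
          have "u (\<lambda>z. (of_real (measure lborel (snd xK)) * f (fst xK)) * shift g (fst xK) z) =
              (of_real (measure lborel (snd xK)) * f (fst xK)) * u (shift g (fst xK))"
            by (rule distribution_cmult[OF u shift_test_fun[OF g]])
          then show "u (\<lambda>z. (of_real (measure lborel (snd xK)) * f (fst xK)) * shift g (fst xK) z) =
              (case xK of (x, K) \<Rightarrow> of_real (measure lborel K) * (U x * f x))"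
            by (simp only: U_def split_def mult_ac)
        qed
        finally show ?thesis .
      qed
      \<comment> \<open>By linearity \<open>u h\<close> is a Riemann sum of the integral of U
        f.\<close>
      have r1: "norm (u h - ?I) \<le> e' * V"
      proof -
        have "norm ((\<Sum>(x, K)\<in>p. of_real (measure lborel K) * (U x * f x)) - integral (cbox (- a) a) (\<lambda>y. U y * f y)) \<le> e' * V"
          unfolding V_def
        proof (rule tagged_division_sum_error[OF p])
          show "norm (U x * f x - U y * f y) \<le> e'" if "dist x y < \<delta>" for x y
            using BU(3)[of "[]" x y] \<delta>1(2)[of "dist x y"] that by simp
        qed (use e' in \<open>auto intro: smooth_continuous test_fun_smooth Uf\<close>)
        moreover have "integral (cbox (- a) a) (\<lambda>y. U y * f y) = ?I"
          using f0 by (intro integral_eq_cbox Uf) auto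
        ultimately show ?thesis by (simp add: uh)
      qed
      \<comment> \<open>Continuity of u turns the uniform closeness of the derivatives of h and f
        into closeness of the values.\<close>
      have r2: "norm (u (\<lambda>z. f z - h z)) \<le> C * (C1 * s + e' * V)"
      proof (rule C(2); (intro allI impI)?)
        show "(\<lambda>z. f z - h z) \<in> test_fun" using f h by (intro test_fun_diff)
      next
        fix z :: 'a assume z: "A + \<rho> < norm z"
        have "f x * shift g x z = 0" for x
        proof (cases "A < norm x")
          case False
          then have "\<rho> < norm (x - z)" using z norm_triangle_ineq2[of z x] by (simp add: norm_minus_commute)
          then show ?thesis using g0 by (simp add: shift_def)
        qed (use A in auto)
        then have "h z = 0" unfolding h_def by (intro sum.neutral) (auto simp: mult.assoc)
        then show "f z - h z = 0" using A(2)[of z] z \<rho>(1) by simp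
      next
        fix w :: "'a list" and z assume w: "set w \<subseteq> Basis" "length w \<le> m"
        let ?F = "\<lambda>y. (-1) ^ length w * pd w g (y - z) * f y"
        have "(\<lambda>y. pd w g (1 *\<^sub>R y + - z)) \<in> test_fun" using test_fun_pd[OF g w(1)] by (intro test_fun_affine) auto
        then have F: "?F \<in> test_fun" using test_fun_smooth[OF f] by (intro test_fun_mult test_fun_cmult) auto
        have "pd w h z = (\<Sum>xK\<in>p. pd w (\<lambda>z. (of_real (measure lborel (snd xK)) * f (fst xK)) * shift g (fst xK) z) z)"
          unfolding h_def using fin w(1) g by (intro pd_sum) (auto intro: test_fun_smooth test_fun_cmult shift_test_fun)
        also have "\<dots> = (\<Sum>(x, K)\<in>p. of_real (measure lborel K) * ?F x)"
        proof (rule sum.cong[OF refl])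
          fix xK :: "'a \<times> 'a set"
          have "pd w (\<lambda>z. (of_real (measure lborel (snd xK)) * f (fst xK)) * shift g (fst xK) z) z =
              (of_real (measure lborel (snd xK)) * f (fst xK)) * pd w (shift g (fst xK)) z"
            using w(1) by (intro pd_cmult[OF open_UNIV] smooth_C_k_on test_fun_smooth shift_test_fun g) auto
          then show "pd w (\<lambda>z. (of_real (measure lborel (snd xK)) * f (fst xK)) * shift g (fst xK) z) z =
              (case xK of (x, K) \<Rightarrow> of_real (measure lborel K) * ?F x)"
            by (simp only: pd_shift[OF smg w(1)] split_def mult_ac)
        qed
        finally have "norm (pd w h z - integral (cbox (- a) a) ?F) \<le> e' * V"
          unfolding V_def
        proof (simp only:, intro tagged_division_sum_error[OF p])
          fix x y :: 'a assume xy: "dist x y < \<delta>"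
          have "norm (?F x - ?F y) = norm (pd w g (x - z) * f x - pd w g (y - z) * f y)"
            by (simp add: norm_mult norm_power mult.assoc flip: right_diff_distrib)
          also have "\<dots> = norm (pd w g (x - z) * (f x - f y) + (pd w g (x - z) - pd w g (y - z)) * f y)"
            by (simp add: algebra_simps)
          also have "\<dots> \<le> Bg * (Bf * dist x y) + (Bg * dist x y) * Bf"
            using Bg(2)[OF w, of "x - z"] Bg(3)[OF w, of "x - z" "y - z"] Bf(2)[of "[]" y] Bf(3)[of "[]" x y] Bg(1) Bf(1)
            by (intro order_trans[OF norm_triangle_ineq] add_mono) (auto simp: norm_mult dist_norm intro!: mult_mono)
          also have "\<dots> \<le> e'" using \<delta>1(1)[of "dist x y"] xy by (simp add: mult_ac)
          finally show "norm (?F x - ?F y) \<le> e'" .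
        qed (use e' in \<open>auto intro: smooth_continuous test_fun_smooth F\<close>)
        moreover have "integral (cbox (- a) a) ?F = (LINT y|lborel. ?F y)"
          using f0 by (intro integral_eq_cbox F) auto
        ultimately have "norm (pd w f z - pd w h z) \<le> C1 * s + e' * V"
          using conv[OF w, of z] norm_triangle_ineq4[of "pd w h z - (LINT y|lborel. ?F y)" "pd w f z - (LINT y|lborel. ?F y)"]
          by (simp add: norm_minus_commute)
        then show "norm (pd w (\<lambda>z. f z - h z) z) \<le> C1 * s + e' * V"
          using f h w(1) by (simp add: pd_diff[OF open_UNIV] smooth_C_k_on test_fun_smooth)
      qed
      have "norm (u f - ?I) \<le> C * (C1 * s + e' * V) + e' * V"
        using norm_triangle_mono[OF r2 r1] f h by (simp add: distribution_diff[OF u])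
      also have "\<dots> \<le> C * C1 * s + e"
      proof -
        have "e' * ((C + 1) * V) \<le> e' * ((C + 1) * (V + 1))"
          using e' C by (intro mult_left_mono) auto
        also have "\<dots> = e" using C V by (simp add: e'_def)
        finally show ?thesis by (simp add: algebra_simps)
      qed
      finally show ?thesis .
    qed
    then have "norm (u f - ?I) \<le> C * C1 * s" by (rule field_le_epsilon)
    then show ?thesis by (simp add: U_eq)
  qed
  then show ?thesis by blast
qed

section \<open>Termwise differentiation of series\<close>

lemma has_vector_derivative_suminf:
  fixes f :: "nat \<Rightarrow> real \<Rightarrow> complex"
  assumes "\<And>i t. (f i has_vector_derivative f' i t) (at t)"
    and "\<And>i t. norm (f i t) \<le> a i" "\<And>i t. norm (f' i t) \<le> a i" "summable a"
  shows "((\<lambda>t. \<Sum>i. f i t) has_vector_derivative (\<Sum>i. f' i t)) (at t)"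
proof -
  have sf: "summable (\<lambda>i. f i t)" for t by (rule summable_comparison_test'[OF assms(4), of 0]) (use assms in auto)
  have ul: "uniform_limit UNIV (\<lambda>n t. \<Sum>i<n. f' i t) (\<lambda>t. \<Sum>i. f' i t) sequentially"
    using assms by (intro Weierstrass_m_test) auto
  have "\<exists>g. \<forall>t\<in>UNIV. (\<lambda>n. f n t) sums g t \<and> (g has_derivative (\<lambda>h. h *\<^sub>R (\<Sum>i. f' i t))) (at t within UNIV)"
  proof (rule has_derivative_series[where f'="\<lambda>n t h. h *\<^sub>R f' n t"])
    show "(f n has_derivative (\<lambda>h. h *\<^sub>R f' n t)) (at t within UNIV)" for n t
      using assms(1)[of n t] by (simp add: has_vector_derivative_def)
    show "\<forall>\<^sub>F n in sequentially. \<forall>t\<in>UNIV. \<forall>h. norm ((\<Sum>i<n. h *\<^sub>R f' i t) - h *\<^sub>R (\<Sum>i. f' i t)) \<le> e * norm h" if "e > 0" for e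
      using uniform_limitD[OF ul that]
    proof eventually_elim
      case (elim n)
      show ?case
      proof (intro ballI allI)
        fix t h :: real
        have "norm ((\<Sum>i<n. h *\<^sub>R f' i t) - h *\<^sub>R (\<Sum>i. f' i t)) = norm h * dist (\<Sum>i<n. f' i t) (\<Sum>i. f' i t)"
          by (simp add: dist_norm flip: scaleR_sum_right scaleR_diff_right)
        also have "\<dots> \<le> norm h * e" using elim by (intro mult_left_mono) (auto simp: less_imp_le)
        finally show "norm ((\<Sum>i<n. h *\<^sub>R f' i t) - h *\<^sub>R (\<Sum>i. f' i t)) \<le> e * norm h" by (simp add: mult.commute)
      qed
    qed
    show "(\<lambda>n. f n 0) sums (\<Sum>i. f i 0)" using sf by (rule summable_sums)
  qed auto
  then obtain g where g: "\<And>t. (\<lambda>n. f n t) sums g t" "\<And>t. (g has_derivative (\<lambda>h. h *\<^sub>R (\<Sum>i. f' i t))) (at t)"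
    by auto
  have "g = (\<lambda>t. \<Sum>i. f i t)" using g(1) sums_unique by blast
  then show ?thesis using g(2)[of t] by (simp add: has_vector_derivative_def)
qed

text \<open>Weierstrass test with one majorant for all words up to length m. The first induction
  removes the innermost letter, since the differentiated series is again of the same kind.\<close>

lemma C_k_on_suminf:
  fixes f :: "nat \<Rightarrow> ('a::euclidean_space) cfun"
  assumes "\<And>i. smooth (f i)" "summable a"
    and "\<And>i w y. set w \<subseteq> Basis \<Longrightarrow> length w \<le> m \<Longrightarrow> norm (pd w (f i) y) \<le> a i"
  shows "C_k_on m UNIV (\<lambda>y. \<Sum>i. f i y)"
    and "set w \<subseteq> Basis \<Longrightarrow> length w \<le> m \<Longrightarrow> pd w (\<lambda>y. \<Sum>i. f i y) = (\<lambda>y. \<Sum>i. pd w (f i) y)"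
proof -
  have cont: "continuous_on UNIV (\<lambda>y. \<Sum>i. f i y)"
    if "\<And>i. smooth (f i)" "\<And>i y. norm (f i y) \<le> a i" for f :: "nat \<Rightarrow> 'a cfun"
  proof (rule uniform_limit_theorem)
    show "uniform_limit UNIV (\<lambda>n y. \<Sum>i<n. f i y) (\<lambda>y. \<Sum>i. f i y) sequentially"
      using that assms(2) by (intro Weierstrass_m_test) auto
  qed (use that in \<open>auto intro!: always_eventually smooth_continuous smooth_sum\<close>)
  have deriv: "coord_diff b (\<lambda>y. \<Sum>i. f i y) y \<and> partial_deriv b (\<lambda>y. \<Sum>i. f i y) y = (\<Sum>i. partial_deriv b (f i) y)"
    if "\<And>i. smooth (f i)" "\<And>i y. norm (f i y) \<le> a i" "\<And>i y. norm (partial_deriv b (f i) y) \<le> a i" "b \<in> Basis"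
    for f :: "nat \<Rightarrow> 'a cfun" and b y
  proof -
    have "((\<lambda>t. \<Sum>i. f i (y + t *\<^sub>R b)) has_vector_derivative (\<Sum>i. partial_deriv b (f i) (y + 0 *\<^sub>R b))) (at 0)"
      using that assms(2)
      by (intro has_vector_derivative_suminf[where a=a] coord_vector_derivative_at smooth_coord_diff) auto
    then show ?thesis using partial_deriv_eqI[of "\<lambda>y. \<Sum>i. f i y" y b] by simp
  qed
  show "C_k_on m UNIV (\<lambda>y. \<Sum>i. f i y)"
    using assms(1,3)
  proof (induction m arbitrary: f)
    case 0
    then show ?case using cont[of f] 0(2)[of "[]"] by simp
  next
    case (Suc m)
    have b0: "norm (f i y) \<le> a i" for i y using Suc.prems(2)[of "[]"] by simp
    have b1: "norm (partial_deriv b (f i) y) \<le> a i" if "b \<in> Basis" for i y b using Suc.prems(2)[of "[b]"] that by simp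
    have e: "partial_deriv b (\<lambda>y. \<Sum>i. f i y) = (\<lambda>y. \<Sum>i. partial_deriv b (f i) y)" if "b \<in> Basis" for b
      using deriv[OF Suc.prems(1) b0 b1 that] that by auto
    have "C_k_on m UNIV (\<lambda>y. \<Sum>i. partial_deriv b (f i) y)" if b: "b \<in> Basis" for b
    proof (rule Suc.IH)
      show "norm (pd w (partial_deriv b (f i)) y) \<le> a i" if "set w \<subseteq> Basis" "length w \<le> m" for i w y
        using Suc.prems(2)[of "w @ [b]" i y] that b by simp
    qed (use Suc.prems(1) smooth_partial_deriv b in blast)
    then show ?case
      using cont[OF Suc.prems(1) b0] deriv[OF Suc.prems(1) b0 b1] e by simp
  qed
  show "pd w (\<lambda>y. \<Sum>i. f i y) = (\<lambda>y. \<Sum>i. pd w (f i) y)" if "set w \<subseteq> Basis" "length w \<le> m"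
    using that
  proof (induction w)
    case (Cons b w)
    have "norm (pd w (f i) y) \<le> a i" "norm (partial_deriv b (pd w (f i)) y) \<le> a i" for i y
      using assms(3)[of w i y] assms(3)[of "b # w" i y] Cons.prems by auto
    then show ?case
      using Cons deriv[of "\<lambda>i. pd w (f i)" b] smooth_pd[OF assms(1)] by auto
  qed simp
qed

subsection \<open>Approximate identities with vanishing moments\<close>

lemma smooth_cnj:
  assumes "smooth f" shows "smooth (\<lambda>z. cnj (f z))"
proof -
  have "C_k_on k UNIV (\<lambda>z. cnj (f z))" if "smooth f" for k f
    using that
  proof (induction k arbitrary: f)
    case 0
    then show ?case by (simp add: continuous_on_cnj smooth_continuous)
  next
    case (Suc k)
    have d: "((\<lambda>t. cnj (f (x + t *\<^sub>R b))) has_vector_derivative cnj (partial_deriv b f x)) (at 0)"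
      if "b \<in> Basis" for b x
      using smooth_coord_diff[OF Suc.prems that, of x] unfolding coord_diff_vector_derivative
      by (rule bounded_linear.has_vector_derivative[OF bounded_linear_cnj])
    have "coord_diff b (\<lambda>z. cnj (f z)) x" "partial_deriv b (\<lambda>z. cnj (f z)) = (\<lambda>x. cnj (partial_deriv b f x))"
      if "b \<in> Basis" for b x
      using partial_deriv_eqI[of "\<lambda>z. cnj (f z)", OF d[OF that]] by auto
    then show ?case
      using Suc.IH[OF smooth_partial_deriv[OF Suc.prems]] Suc.prems
      by (simp add: continuous_on_cnj smooth_continuous)
  qed
  from this[OF assms] show ?thesis unfolding smooth_def by blast
qed

lemma mi_power_scaleR: "mi_power \<alpha> (c *\<^sub>R z) = c ^ mi_order \<alpha> * mi_power \<alpha> z"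
  by (simp add: mi_power_def mi_order_def power_mult_distrib prod.distrib power_sum)

text \<open>Mass is invariant under this dilation while a moment of order j shrinks by 2^(-j);
  combinations of the two functions can therefore cancel a chosen order.\<close>

lemma moment_dilate:
  fixes f :: "('a::euclidean_space) cfun"
  assumes "f \<in> test_fun"
  shows "(LINT z|lborel. (2 ^ DIM('a) * f (2 *\<^sub>R z + 0)) * of_real (mi_power \<alpha> z)) =
    of_real ((1 / 2) ^ mi_order \<alpha>) * (LINT z|lborel. f z * of_real (mi_power \<alpha> z))"
proof -
  have "(LINT z|lborel. f (2 *\<^sub>R z + 0) * of_real (mi_power \<alpha> z)) =
      of_real (\<bar>2\<bar> powr - DIM('a)) * (LINT z|lborel. f z * of_real (mi_power \<alpha> ((1 / 2) *\<^sub>R z + (- (1 / 2)) *\<^sub>R 0)))"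
    using integral_affine_mult[OF _ assms smooth_continuous[OF smooth_mi_power[of \<alpha>]], of 2 0] by simp
  also have "\<dots> = of_real (2 powr - DIM('a)) * (of_real ((1 / 2) ^ mi_order \<alpha>) * (LINT z|lborel. f z * of_real (mi_power \<alpha> z)))"
  proof -
    have "(\<lambda>z. f z * complex_of_real (mi_power \<alpha> ((1 / 2) *\<^sub>R z + (- (1 / 2)) *\<^sub>R 0))) =
        (\<lambda>z. of_real ((1 / 2) ^ mi_order \<alpha>) * (f z * of_real (mi_power \<alpha> z)))"
      by (simp only: scaleR_zero_right add_0_right mi_power_scaleR of_real_mult mult_ac)
    then show ?thesis by (simp only: integral_mult_right_zero abs_numeral)
  qed
  finally have "2 ^ DIM('a) * (LINT z|lborel. f (2 *\<^sub>R z + 0) * of_real (mi_power \<alpha> z)) =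
      (2 ^ DIM('a) * of_real (2 powr - DIM('a))) * (of_real ((1 / 2) ^ mi_order \<alpha>) * (LINT z|lborel. f z * of_real (mi_power \<alpha> z)))"
    by (simp only: mult.assoc)
  moreover have "2 ^ DIM('a) * complex_of_real (2 powr - DIM('a)) = 1"
    by (simp add: powr_minus powr_realpow)
  ultimately show ?thesis by (simp add: mult.assoc del: of_real_power)
qed

text \<open>The function \<eta> is complex valued and its own integral may be 0, as it is when
  \<eta> comes from \<open>test_vm\<close>. Its squared modulus has integral at least the volume of
  the unit ball, and is smooth as a product with the conjugate.\<close>

lemma test_fun_mass_one:
  fixes \<eta> :: "('a::euclidean_space) cfun"
  assumes \<eta>: "\<eta> \<in> test_fun" "\<And>z. norm z < 1 \<Longrightarrow> \<eta> z = (1::complex)"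
  shows "\<exists>\<kappa>\<in>test_fun. (LINT z|lborel. \<kappa> (z::'a)) = 1"
proof -
  let ?g = "\<lambda>z. \<eta> z * cnj (\<eta> z)"
  have g: "?g \<in> test_fun" using \<eta> by (intro test_fun_mult smooth_cnj test_fun_smooth)
  define I where "I = (LINT z|lborel. (norm (\<eta> z))\<^sup>2)"
  have "integrable lborel (\<lambda>z. complex_of_real ((norm (\<eta> z))\<^sup>2))"
    using test_fun_integrable[OF g] by (simp add: complex_norm_square[symmetric])
  then have int: "integrable lborel (\<lambda>z. (norm (\<eta> z))\<^sup>2)" by (simp only: complex_of_real_integrable_eq)
  have "measure lborel (ball (0::'a) 1) = (LINT z|lborel. indicator (ball (0::'a) 1) z)" by simp
  also have "\<dots> \<le> I" unfolding I_def
  proof (rule Bochner_Integration.integral_mono[OF _ int])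
    show "integrable lborel (indicator (ball (0::'a) 1) :: 'a \<Rightarrow> real)"
      using emeasure_lborel_ball_finite[of "0::'a" 1] by (simp add: integrable_real_indicator)
    show "indicator (ball 0 1) z \<le> (norm (\<eta> z))\<^sup>2" for z using \<eta>(2)[of z] by (simp add: indicator_def)
  qed
  finally have I: "I > 0" using content_ball_pos[of 1 "0::'a"] by linarith
  have "(LINT z|lborel. ?g z) = of_real I"
    unfolding I_def by (simp add: complex_norm_square[symmetric] flip: integral_complex_of_real)
  then have "(LINT z|lborel. (1 / of_real I) * ?g z) = 1" using I by simp
  moreover have "(\<lambda>z. (1 / of_real I) * ?g z) \<in> test_fun" by (rule test_fun_cmult[OF g])
  ultimately show ?thesis by blast
qed

text \<open>
  If the moments of \<open>\<kappa>\<close> of order \<open>1, \<dots>, m\<close> vanish, then those of order \<open>1, \<dots>, m + 1\<close> of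
  \<open>(2\<^sup>m\<^sup>+\<^sup>1 2\<^sup>n \<kappa>(2z) - \<kappa>(z)) / (2\<^sup>m\<^sup>+\<^sup>1 - 1)\<close> vanish, and the mass is unchanged.
\<close>

lemma test_fun_mass_one_moments:
  assumes "\<exists>\<kappa>\<in>test_fun. (LINT z|lborel. \<kappa> (z::'a::euclidean_space)) = 1"
  shows "\<exists>\<kappa>\<in>test_fun. (LINT z|lborel. \<kappa> (z::'a)) = 1 \<and>
    (\<forall>\<alpha>. 1 \<le> mi_order \<alpha> \<longrightarrow> mi_order \<alpha> \<le> m \<longrightarrow> (LINT z|lborel. \<kappa> z * of_real (mi_power \<alpha> z)) = 0)"
proof (induction m)
  case 0
  then show ?case using assms by auto
next
  case (Suc m)
  then obtain \<kappa> :: "'a cfun" where \<kappa>: "\<kappa> \<in> test_fun" "(LINT z|lborel. \<kappa> z) = 1"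
    "\<And>\<alpha>. 1 \<le> mi_order \<alpha> \<Longrightarrow> mi_order \<alpha> \<le> m \<Longrightarrow> (LINT z|lborel. \<kappa> z * of_real (mi_power \<alpha> z)) = 0"
    by blast
  define c where "c = (2::complex) ^ Suc m"
  have c: "c \<noteq> 1"
  proof
    assume "c = 1"
    then have "norm c = 1" by simp
    then have "(2::real) ^ Suc m = 1" by (simp add: c_def norm_power norm_mult)
    then show False using power_increasing[of 1 "Suc m" "2::real"] by simp
  qed
  define \<kappa>1 where "\<kappa>1 = (\<lambda>z. (2::complex) ^ DIM('a) * \<kappa> (2 *\<^sub>R z + 0))"
  have \<kappa>1: "\<kappa>1 \<in> test_fun" unfolding \<kappa>1_def using \<kappa>(1) by (intro test_fun_cmult test_fun_affine) auto
  define \<kappa>' where "\<kappa>' = (\<lambda>z. (1 / (c - 1)) * (c * \<kappa>1 z - \<kappa> z))"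
  have \<kappa>': "\<kappa>' \<in> test_fun" unfolding \<kappa>'_def using \<kappa>(1) \<kappa>1 by (intro test_fun_cmult test_fun_diff)
  \<comment> \<open>The factor is 1 for order 0, vanishes for order m + 1 by the choice of c, and is
    irrelevant for the orders between, whose moments are already 0.\<close>
  have mom: "(LINT z|lborel. \<kappa>' z * of_real (mi_power \<alpha> z)) =
      (1 / (c - 1)) * (c * of_real ((1 / 2) ^ mi_order \<alpha>) - 1) * (LINT z|lborel. \<kappa> z * of_real (mi_power \<alpha> z))" for \<alpha>
  proof -
    have i: "integrable lborel (\<lambda>z. \<kappa>1 z * of_real (mi_power \<alpha> z))" "integrable lborel (\<lambda>z. \<kappa> z * of_real (mi_power \<alpha> z))"
      using \<kappa>(1) \<kappa>1 by (auto intro!: test_fun_integrable test_fun_mult smooth_mi_power)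
    have "(LINT z|lborel. \<kappa>' z * of_real (mi_power \<alpha> z)) =
        (LINT z|lborel. (1 / (c - 1)) * (c * (\<kappa>1 z * of_real (mi_power \<alpha> z)) - \<kappa> z * of_real (mi_power \<alpha> z)))"
      by (simp add: \<kappa>'_def algebra_simps)
    also have "\<dots> = (1 / (c - 1)) * (c * (LINT z|lborel. \<kappa>1 z * of_real (mi_power \<alpha> z)) - (LINT z|lborel. \<kappa> z * of_real (mi_power \<alpha> z)))"
      using i by (simp only: integral_mult_right_zero Bochner_Integration.integral_diff[OF integrable_mult_right])
    finally show ?thesis
      unfolding \<kappa>1_def moment_dilate[OF \<kappa>(1)] by (simp add: algebra_simps del: of_real_power)
  qed
  have "(LINT z|lborel. \<kappa>' z) = 1"
    using mom[of "\<lambda>_. 0"] \<kappa>(2) c by (simp add: mi_power_def mi_order_def)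
  moreover have "(LINT z|lborel. \<kappa>' z * of_real (mi_power \<alpha> z)) = 0" if "1 \<le> mi_order \<alpha>" "mi_order \<alpha> \<le> Suc m" for \<alpha>
  proof (cases "mi_order \<alpha> = Suc m")
    case True
    have "c * of_real ((1 / 2) ^ mi_order \<alpha>) = 1"
      unfolding True c_def of_real_power power_mult_distrib[symmetric] by simp
    then show ?thesis unfolding mom by simp
  next
    case False
    then show ?thesis unfolding mom using \<kappa>(3) that by simp
  qed
  ultimately show ?case using \<kappa>' by blast
qed

text \<open>Order 0 is settled by equal masses, the other orders by the hypothesis on
  \<kappa>.\<close>

lemma dilation_difference_vm:
  assumes \<kappa>: "\<kappa> \<in> test_fun"
    "\<And>\<alpha>. 1 \<le> mi_order \<alpha> \<Longrightarrow> mi_order \<alpha> \<le> P \<Longrightarrow> (LINT z|lborel. \<kappa> (z::'a::euclidean_space) * of_real (mi_power \<alpha> z)) = 0"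
  shows "(\<lambda>z. 2 ^ DIM('a) * \<kappa> (2 *\<^sub>R z + 0) - \<kappa> z) \<in> test_vm P"
proof (rule test_vmI)
  have \<kappa>1: "(\<lambda>z. 2 ^ DIM('a) * \<kappa> (2 *\<^sub>R z + 0)) \<in> test_fun" using \<kappa>(1) by (intro test_fun_cmult test_fun_affine) auto
  show "(\<lambda>z. 2 ^ DIM('a) * \<kappa> (2 *\<^sub>R z + 0) - \<kappa> z) \<in> test_fun" using \<kappa>(1) \<kappa>1 by (intro test_fun_diff)
  fix \<alpha> :: "'a multi_index" assume "mi_order \<alpha> \<le> P"
  then have "mi_order \<alpha> = 0 \<or> (LINT z|lborel. \<kappa> z * of_real (mi_power \<alpha> z)) = 0" using \<kappa>(2)[of \<alpha>] by linarith
  moreover have "(LINT z|lborel. (2 ^ DIM('a) * \<kappa> (2 *\<^sub>R z + 0) - \<kappa> z) * of_real (mi_power \<alpha> z)) =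
      of_real ((1 / 2) ^ mi_order \<alpha>) * (LINT z|lborel. \<kappa> z * of_real (mi_power \<alpha> z)) - (LINT z|lborel. \<kappa> z * of_real (mi_power \<alpha> z))"
    unfolding moment_dilate[OF \<kappa>(1), symmetric] left_diff_distrib
    by (intro Bochner_Integration.integral_diff test_fun_integrable
        test_fun_mult[OF \<kappa>(1) smooth_mi_power] test_fun_mult[OF \<kappa>1 smooth_mi_power])
  ultimately show "(LINT z|lborel. (2 ^ DIM('a) * \<kappa> (2 *\<^sub>R z + 0) - \<kappa> z) * of_real (mi_power \<alpha> z)) = 0" by auto
qed

subsection \<open>The kernel functions\<close>

lemma scl_conv_shift: "scl y s f = shift (\<lambda>v. f ((- (1 / s)) *\<^sub>R v + 0)) y"
  by (simp add: scl_def shift_def algebra_simps)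

text \<open>The function of y is a convolution, so a derivative falls on the profile and brings out
  -1/s. The differentiated profile keeps the moments and support of \<zeta>, so the pairing bounds
  apply to it too.\<close>

lemma
  fixes u :: "('a::euclidean_space) cfun \<Rightarrow> complex"
  assumes u: "distribution u" and \<zeta>: "\<zeta> \<in> test_fun" and s: "0 < s"
  shows smooth_distribution_scl: "smooth (\<lambda>y. u (scl y s \<zeta>))"
    and pd_distribution_scl: "set w \<subseteq> Basis \<Longrightarrow>
      pd w (\<lambda>y. u (scl y s \<zeta>)) = (\<lambda>y. of_real ((- (1 / s)) ^ length w) * u (scl y s (pd w \<zeta>)))"
proof -
  let ?g = "\<lambda>v. \<zeta> ((- (1 / s)) *\<^sub>R v + 0)"
  have g: "?g \<in> test_fun" using \<zeta> s by (intro test_fun_affine) auto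
  show "smooth (\<lambda>y. u (scl y s \<zeta>))"
    unfolding scl_conv_shift by (rule distribution_shift_smooth[OF u g])
  assume w: "set w \<subseteq> Basis"
  have sh: "shift (pd w ?g) y = (\<lambda>z. of_real ((- (1 / s)) ^ length w) * scl y s (pd w \<zeta>) z)" for y
    using pd_affine[OF test_fun_smooth[OF \<zeta>] w, of "- (1 / s)" 0]
    by (auto simp: shift_def scl_conv_shift fun_eq_iff)
  show "pd w (\<lambda>y. u (scl y s \<zeta>)) = (\<lambda>y. of_real ((- (1 / s)) ^ length w) * u (scl y s (pd w \<zeta>)))"
    unfolding scl_conv_shift[of _ s \<zeta>] pd_distribution_shift[OF u g w] sh
    by (simp only: distribution_cmult[OF u scl_test_fun[OF test_fun_pd[OF \<zeta> w] s]])
qed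

text \<open>Turns a size bound a and a Lipschitz bound b on an increment into a Hoelder bound of
  exponent g.\<close>

lemma interpolate_bounds:
  assumes "0 \<le> D" "D \<le> a" "D \<le> b" "0 \<le> g" "g \<le> (1::real)"
  shows "D \<le> a powr (1 - g) * b powr g"
proof (cases "D = 0")
  case False
  then have "D = D powr (1 - g) * D powr g" using assms by (simp flip: powr_add)
  also have "\<dots> \<le> a powr (1 - g) * b powr g"
    using assms by (intro mult_mono powr_mono2) auto
  finally show ?thesis .
qed simp

lemma half_power_powr: "(1 / 2 ^ i) powr a = (2 powr - a) ^ i" for a :: real
  by (simp add: powr_divide powr_minus power_inverse powr_powr mult.commute inverse_eq_divide flip: powr_realpow)

context sio begin

text \<open>For t = 2^(-k) this is the function \<Phi> of the theorem at x - y, without its factor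
  2^(kn).\<close>

definition weight :: "real \<Rightarrow> 'a \<Rightarrow> 'a \<Rightarrow> real" where
  "weight t x y = (1 + norm (x - y) / t) powr - N"

lemma weight_nonneg: "0 \<le> weight t x y"
  by (simp add: weight_def)

lemma weight_le_1: "0 < t \<Longrightarrow> weight t x y \<le> 1"
  unfolding weight_def using powr_mono2'[of "- N" 1 "1 + norm (x - y) / t"] N_pos by simp

text \<open>This is the role of the restriction on h: x - (y + h) cannot become small compared with
  t + |x - y|, so the weight changes by a bounded factor only.\<close>

lemma weight_shift:
  assumes "0 < t" "norm h \<le> (t + norm (x - y)) / 2"
  shows "weight t x (y + h) \<le> 2 powr N * weight t x y"
proof -
  have gen1: "X \<le> a + H \<Longrightarrow> H \<le> (t + X) / 2 \<Longrightarrow> X \<le> t + 2 * a"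
    and gen2: "X \<le> 1 + 2 * a \<Longrightarrow> (1 + X) / 2 \<le> 1 + a" for X a H :: real
    by simp_all
  have "norm (x - y) \<le> norm (x - (y + h)) + norm h"
    using norm_triangle_ineq[of "x - (y + h)" h] by simp
  then have "norm (x - y) \<le> t + 2 * norm (x - (y + h))"
    using gen1 assms(2) by blast
  then have "norm (x - y) / t \<le> (t + 2 * norm (x - (y + h))) / t" using assms by (intro divide_right_mono) auto
  also have "\<dots> = 1 + 2 * (norm (x - (y + h)) / t)" using assms by (simp add: add_divide_distrib)
  finally have "(1 + norm (x - y) / t) / 2 \<le> 1 + norm (x - (y + h)) / t" by (rule gen2)
  then have "weight t x (y + h) \<le> ((1 + norm (x - y) / t) / 2) powr - N"
    unfolding weight_def using assms N_pos by (intro powr_mono2') (auto intro!: divide_pos_pos add_pos_nonneg)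
  also have "\<dots> = 2 powr N * weight t x y"
    unfolding weight_def using assms by (subst powr_divide) (auto simp: powr_minus field_simps)
  finally show ?thesis .
qed

text \<open>
  The partial sums telescope: see \<open>sum_piece\<close>. The factor \<open>t powr - DIM('a)\<close> is needed because \<open>scl\<close> is not
  normalised in the integral.
\<close>

definition piece :: "'a cfun \<Rightarrow> 'a cfun \<Rightarrow> nat \<Rightarrow> real \<Rightarrow> 'a \<Rightarrow> 'a cfun" where
  "piece \<psi> \<kappa> i t x y = (case i of 0 \<Rightarrow> of_real (t powr - DIM('a)) * Tt (scl x t \<psi>) (scl y t \<kappa>)
    | Suc j \<Rightarrow> of_real ((t / 2 ^ j) powr - DIM('a)) *
        Tt (scl x t \<psi>) (scl y (t / 2 ^ j) (\<lambda>z. 2 ^ DIM('a) * \<kappa> (2 *\<^sub>R z + 0) - \<kappa> z)))"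

lemma sum_piece:
  assumes u: "distribution (Tt (scl x t \<psi>))" and \<kappa>: "\<kappa> \<in> test_fun" and t: "0 < t"
  shows "(\<Sum>i<Suc I. piece \<psi> \<kappa> i t x y) = of_real ((t / 2 ^ I) powr - DIM('a)) * Tt (scl x t \<psi>) (scl y (t / 2 ^ I) \<kappa>)"
proof (induction I)
  case 0
  then show ?case by (simp add: piece_def)
next
  case (Suc I)
  let ?u = "Tt (scl x t \<psi>)" and ?s = "t / 2 ^ I"
  have s: "0 < ?s" using t by simp
  have e: "scl y ?s (\<lambda>z. 2 ^ DIM('a) * \<kappa> (2 *\<^sub>R z + 0) - \<kappa> z) =
      (\<lambda>z. 2 ^ DIM('a) * scl y (t / 2 ^ Suc I) \<kappa> z - scl y ?s \<kappa> z)"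
    by (simp add: scl_def mult.commute)
  have "piece \<psi> \<kappa> (Suc I) t x y = of_real (?s powr - DIM('a)) * (2 ^ DIM('a) * ?u (scl y (t / 2 ^ Suc I) \<kappa>) - ?u (scl y ?s \<kappa>))"
    unfolding piece_def nat.case e using \<kappa> t
    by (simp add: distribution_diff[OF u] distribution_cmult[OF u] scl_test_fun test_fun_cmult)
  \<comment> \<open>Halving the scale multiplies the normalisation by 2^n, the coefficient built
    into the difference profile.\<close>
  moreover have "complex_of_real ((t / 2 ^ Suc I) powr - DIM('a)) = of_real (?s powr - DIM('a)) * 2 ^ DIM('a)"
  proof -
    have "(t / 2 ^ Suc I) powr - DIM('a) = (?s / 2) powr - DIM('a)" by (simp add: mult.commute)
    also have "\<dots> = ?s powr - DIM('a) * 2 ^ DIM('a)"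
      using s by (subst powr_divide) (auto simp: powr_minus powr_realpow field_simps)
    finally show ?thesis by simp
  qed
  ultimately show ?case using Suc by (simp add: algebra_simps)
qed

context
  fixes \<psi> \<kappa> :: "'a cfun" and m :: nat
  assumes dist: "\<And>\<zeta>. \<zeta> \<in> test_vm P \<Longrightarrow> distribution (Tt \<zeta>)"
    and \<psi>: "\<psi> \<in> test_vm P"
    and \<kappa>: "\<kappa> \<in> test_fun" "(LINT z|lborel. \<kappa> z) = 1"
      "(\<lambda>z. 2 ^ DIM('a) * \<kappa> (2 *\<^sub>R z + 0) - \<kappa> z) \<in> test_vm P"
    and m: "real m \<le> real L - \<nu>"
begin

lemma dist_psi: "0 < t \<Longrightarrow> distribution (Tt (scl x t \<psi>))"
  by (intro dist scl_test_vm \<psi>)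

lemma smooth_piece: "0 < t \<Longrightarrow> smooth (piece \<psi> \<kappa> i t x)"
  unfolding piece_def using \<kappa> test_vmD(1)[OF \<kappa>(3)]
  by (cases i) (auto intro!: smooth_cmult smooth_distribution_scl dist_psi)

text \<open>Words of length \<open>Suc m\<close> are included: the sum is not differentiated that
  often, but the Lipschitz half of the interpolation needs this derivative of each single
  term.\<close>

lemma piece_bound:
  assumes d: "0 < d" "d < \<gamma>"
  obtains C where "C > 0" "\<And>w i t x y. \<lbrakk>0 < t; set w \<subseteq> Basis; length w \<le> Suc m\<rbrakk> \<Longrightarrow>
    norm (pd w (piece \<psi> \<kappa> i t x) y) \<le>
      C * ((1 / 2 ^ i) powr (real L - \<nu> + d - real (length w)) * (t powr - (\<nu> + real (length w)) * weight t x y))"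
proof -
  define \<zeta> where "\<zeta> = (\<lambda>z. 2 ^ DIM('a) * \<kappa> (2 *\<^sub>R z + 0) - \<kappa> z)"
  have \<zeta>: "\<zeta> \<in> test_vm P" using \<kappa>(3) by (simp add: \<zeta>_def)
  obtain A1 where A1: "A1 > 0" "\<And>z. A1 < norm z \<Longrightarrow> \<psi> z = 0" using test_funE[OF test_vmD(1)[OF \<psi>]] by metis
  obtain A2 where A2: "A2 > 0" "\<And>z. A2 < norm z \<Longrightarrow> \<kappa> z = 0" using test_funE[OF \<kappa>(1)] by metis
  obtain A3 where A3: "A3 > 0" "\<And>z. A3 < norm z \<Longrightarrow> \<zeta> z = 0" using test_funE[OF test_vmD(1)[OF \<zeta>]] by metis
  define \<rho> where "\<rho> = Max {1, A1, A2, A3}"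
  have \<rho>: "1 \<le> \<rho>" "A1 \<le> \<rho>" "A2 \<le> \<rho>" "A3 \<le> \<rho>" by (auto simp: \<rho>_def)
  have s0: "\<psi> z = 0" "\<kappa> z = 0" "\<zeta> z = 0" if "\<rho> < norm z" for z
    using A1(2)[of z] A2(2)[of z] A3(2)[of z] \<rho> that by auto
  let ?W = "{w :: 'a list. set w \<subseteq> Basis \<and> length w \<le> Suc m}"
  \<comment> \<open>Every differentiated profile has its own constant; the conditions on the
    parameters are encoded by \<open>if\<close> so that the finite maximum can be taken over
    unrestricted tuples.\<close>
  have "\<exists>C>0. \<forall>w\<in>?W. \<forall>q. (case q of (x, y, t) \<Rightarrow> if 0 < t then norm (Tt (scl x t \<psi>) (scl y t (pd w \<kappa>))) else 0)
      \<le> C * (case q of (x, y, t) \<Rightarrow> t powr (real DIM('a) - \<nu>) * weight t x y)"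
  proof (rule finite_uniform_bound[OF finite_words])
    fix w :: "'a list" assume w: "w \<in> ?W"
    then have wB: "set w \<subseteq> Basis" by simp
    have z: "pd w \<kappa> z = 0" if "\<rho> < norm z" for z using pd_zero_outside[OF s0(2) _ that] w by auto
    obtain C where "C > 0" "\<And>x y t. 0 < t \<Longrightarrow> norm (Tt (scl x t \<psi>) (scl y t (pd w \<kappa>))) \<le> C * (t powr (real DIM('a) - \<nu>) * (1 + norm (x - y) / t) powr - N)"
      by (rule bound_same_scale[OF \<psi> s0(1) test_fun_pd[OF \<kappa>(1) wB] z \<rho>(1)], assumption+, rule that)
    then show "\<exists>C. \<forall>q. (case q of (x, y, t) \<Rightarrow> if 0 < t then norm (Tt (scl x t \<psi>) (scl y t (pd w \<kappa>))) else 0)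
      \<le> C * (case q of (x, y, t) \<Rightarrow> t powr (real DIM('a) - \<nu>) * weight t x y)"
      by (intro exI[of _ C]) (auto simp: weight_def)
  qed (auto simp: weight_def split: prod.splits)
  then obtain CB where CB0: "CB > 0" "\<forall>w\<in>?W. \<forall>q. (case q of (x, y, t) \<Rightarrow> if 0 < t then norm (Tt (scl x t \<psi>) (scl y t (pd w \<kappa>))) else 0)
      \<le> CB * (case q of (x, y, t) \<Rightarrow> t powr (real DIM('a) - \<nu>) * weight t x y)"
    by blast
  have CB: "CB > 0" "\<And>w x y t. \<lbrakk>set w \<subseteq> Basis; length w \<le> Suc m; 0 < t\<rbrakk> \<Longrightarrow>
      norm (Tt (scl x t \<psi>) (scl y t (pd w \<kappa>))) \<le> CB * (t powr (real DIM('a) - \<nu>) * weight t x y)"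
    subgoal by (rule CB0(1))
    subgoal for w x y t using CB0(2)[rule_format, of w "(x, y, t)"] by simp
    done
  have "\<exists>C>0. \<forall>w\<in>?W. \<forall>q. (case q of (x, y, s, t) \<Rightarrow> if 0 < s \<and> s \<le> t then norm (Tt (scl x t \<psi>) (scl y s (pd w \<zeta>))) else 0)
      \<le> C * (case q of (x, y, s, t) \<Rightarrow> s powr real DIM('a) * t powr - \<nu> * (s / t) powr (real L - \<nu> + d) * weight t x y)"
  proof (rule finite_uniform_bound[OF finite_words])
    fix w :: "'a list" assume w: "w \<in> ?W"
    then have wB: "set w \<subseteq> Basis" by simp
    have z: "pd w \<zeta> z = 0" if "\<rho> < norm z" for z using pd_zero_outside[OF s0(3) _ that] w by auto
    obtain C where "C > 0" "\<And>x y s t. 0 < s \<Longrightarrow> s \<le> t \<Longrightarrow> norm (Tt (scl x t \<psi>) (scl y s (pd w \<zeta>)))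
      \<le> C * (s powr real DIM('a) * t powr - \<nu> * (s / t) powr (real L - \<nu> + d) * (1 + norm (x - y) / t) powr - N)"
      by (rule bound_cancelling[OF \<psi> s0(1) test_vm_pd[OF \<zeta> wB] z \<rho>(1) d], assumption+, rule that)
    then show "\<exists>C. \<forall>q. (case q of (x, y, s, t) \<Rightarrow> if 0 < s \<and> s \<le> t then norm (Tt (scl x t \<psi>) (scl y s (pd w \<zeta>))) else 0)
      \<le> C * (case q of (x, y, s, t) \<Rightarrow> s powr real DIM('a) * t powr - \<nu> * (s / t) powr (real L - \<nu> + d) * weight t x y)"
      by (intro exI[of _ C]) (auto simp: weight_def)
  qed (auto simp: weight_def split: prod.splits)
  then obtain CA where CA0: "CA > 0" "\<forall>w\<in>?W. \<forall>q. (case q of (x, y, s, t) \<Rightarrow> if 0 < s \<and> s \<le> t then norm (Tt (scl x t \<psi>) (scl y s (pd w \<zeta>))) else 0)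
      \<le> CA * (case q of (x, y, s, t) \<Rightarrow> s powr real DIM('a) * t powr - \<nu> * (s / t) powr (real L - \<nu> + d) * weight t x y)"
    by blast
  have CA: "CA > 0" "\<And>w x y s t. \<lbrakk>set w \<subseteq> Basis; length w \<le> Suc m; 0 < s; s \<le> t\<rbrakk> \<Longrightarrow>
      norm (Tt (scl x t \<psi>) (scl y s (pd w \<zeta>))) \<le> CA * (s powr real DIM('a) * t powr - \<nu> * (s / t) powr (real L - \<nu> + d) * weight t x y)"
    subgoal by (rule CA0(1))
    subgoal for w x y s t using CA0(2)[rule_format, of w "(x, y, s, t)"] by simp
    done
  define C where "C = CB + CA * 2 powr (real L - \<nu> + d)"
  have C: "C > 0" "CB \<le> C" "CA * 2 powr (real L - \<nu> + d) \<le> C" using CA CB by (auto simp: C_def add_pos_pos)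
  have "norm (pd w (piece \<psi> \<kappa> i t x) y) \<le>
      C * ((1 / 2 ^ i) powr (real L - \<nu> + d - real (length w)) * (t powr - (\<nu> + real (length w)) * weight t x y))"
    if t: "0 < t" and w: "set w \<subseteq> Basis" "length w \<le> Suc m" for w i t x y
  proof (cases i)
    case 0
    let ?e = "real (length w)"
    have "piece \<psi> \<kappa> i t x = (\<lambda>y. of_real (t powr - DIM('a)) * Tt (scl x t \<psi>) (scl y t \<kappa>))"
      by (simp add: piece_def 0 fun_eq_iff)
    then have "norm (pd w (piece \<psi> \<kappa> i t x) y) = t powr - DIM('a) * ((1 / t) ^ length w * norm (Tt (scl x t \<psi>) (scl y t (pd w \<kappa>))))"
      using t w smooth_distribution_scl[OF dist_psi[OF t] \<kappa>(1) t] pd_distribution_scl[OF dist_psi[OF t] \<kappa>(1) t w(1)]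
      by (simp add: pd_cmult[OF open_UNIV] smooth_C_k_on norm_mult norm_power norm_divide del: of_real_power)
    also have "\<dots> \<le> t powr - DIM('a) * ((1 / t) ^ length w * (CB * (t powr (real DIM('a) - \<nu>) * weight t x y)))"
      using CB(2)[OF w t] t by (intro mult_left_mono) auto
    also have "\<dots> = CB * ((t powr - DIM('a) * (1 / t) ^ length w * t powr (real DIM('a) - \<nu>)) * weight t x y)"
      by (simp only: mult_ac)
    also have "t powr - DIM('a) * (1 / t) ^ length w * t powr (real DIM('a) - \<nu>) = t powr - (\<nu> + ?e)"
    proof -
      have "(1 / t) ^ length w = t powr - ?e" using t by (simp add: powr_minus powr_realpow power_one_over inverse_eq_divide)
      then show ?thesis by (simp add: algebra_simps flip: powr_add)
    qed
    also have "CB * (t powr - (\<nu> + ?e) * weight t x y) \<le> C * (t powr - (\<nu> + ?e) * weight t x y)"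
      using C weight_nonneg by (intro mult_right_mono) auto
    finally show ?thesis by (simp add: 0)
  next
    case (Suc j)
    let ?e = "real (length w)"
    define s where "s = t / 2 ^ j"
    have s: "0 < s" "s \<le> t" using t by (auto simp: s_def divide_le_eq mult_le_cancel_left1)
    have "piece \<psi> \<kappa> i t x = (\<lambda>y. of_real (s powr - DIM('a)) * Tt (scl x t \<psi>) (scl y s \<zeta>))"
      by (simp add: piece_def Suc fun_eq_iff s_def \<zeta>_def)
    then have "norm (pd w (piece \<psi> \<kappa> i t x) y) = s powr - DIM('a) * ((1 / s) ^ length w * norm (Tt (scl x t \<psi>) (scl y s (pd w \<zeta>))))"
      using s w smooth_distribution_scl[OF dist_psi[OF t] test_vmD(1)[OF \<zeta>] s(1)] pd_distribution_scl[OF dist_psi[OF t] test_vmD(1)[OF \<zeta>] s(1) w(1)]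
      by (simp add: pd_cmult[OF open_UNIV] smooth_C_k_on norm_mult norm_power norm_divide del: of_real_power)
    also have "\<dots> \<le> s powr - DIM('a) * ((1 / s) ^ length w * (CA * (s powr real DIM('a) * t powr - \<nu> * (s / t) powr (real L - \<nu> + d) * weight t x y)))"
      using CA(2)[OF w s] s by (intro mult_left_mono) auto
    also have "\<dots> = CA * ((s powr - DIM('a) * s powr real DIM('a)) * ((1 / s) ^ length w * t powr - \<nu> * (s / t) powr (real L - \<nu> + d)) * weight t x y)"
      by (simp only: mult_ac)
    also have "s powr - DIM('a) * s powr real DIM('a) = 1" using s by (simp flip: powr_add)
    also have "(1 / s) ^ length w * t powr - \<nu> * (s / t) powr (real L - \<nu> + d) =
        (s / t) powr (real L - \<nu> + d - ?e) * t powr - (\<nu> + ?e)"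
    proof -
      have "(1 / s) ^ length w = s powr - ?e" using s by (simp add: powr_minus powr_realpow power_one_over inverse_eq_divide)
      also have "\<dots> = (s / t) powr - ?e * t powr - ?e"
        using s t by (simp add: powr_ratio) (simp flip: powr_add)
      finally have "(1 / s) ^ length w * t powr - \<nu> * (s / t) powr (real L - \<nu> + d) =
          ((s / t) powr (real L - \<nu> + d) * (s / t) powr - ?e) * (t powr - \<nu> * t powr - ?e)"
        by (simp only: mult_ac)
      then show ?thesis by (simp add: algebra_simps flip: powr_add)
    qed
    \<comment> \<open>Off by one: piece \<open>Suc j\<close> lives at scale t / 2^j, which is twice
      t / 2^i. The resulting power of 2 goes into C.\<close>
    also have "(s / t) powr (real L - \<nu> + d - ?e) = (2 * (1 / 2 ^ i)) powr (real L - \<nu> + d - ?e)"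
      using t by (simp add: s_def Suc)
    also have "\<dots> = 2 powr (real L - \<nu> + d - ?e) * (1 / 2 ^ i) powr (real L - \<nu> + d - ?e)"
      by (rule powr_mult)
    also have "CA * (1 * (2 powr (real L - \<nu> + d - ?e) * (1 / 2 ^ i) powr (real L - \<nu> + d - ?e) * t powr - (\<nu> + ?e)) * weight t x y)
        \<le> CA * (2 powr (real L - \<nu> + d) * ((1 / 2 ^ i) powr (real L - \<nu> + d - ?e) * (t powr - (\<nu> + ?e) * weight t x y)))"
      using CA(1) weight_nonneg[of t x y]
      by (simp only: mult_1 mult.assoc) (intro mult_left_mono mult_right_mono powr_mono mult_nonneg_nonneg, auto)
    also have "\<dots> \<le> C * ((1 / 2 ^ i) powr (real L - \<nu> + d - ?e) * (t powr - (\<nu> + ?e) * weight t x y))"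
      unfolding mult.assoc[symmetric, of CA]
      using C(3) weight_nonneg[of t x y] by (intro mult_right_mono mult_nonneg_nonneg) auto
    finally show ?thesis .
  qed
  then show ?thesis using that C(1) by blast
qed

definition "theta t x y = (\<Sum>i. piece \<psi> \<kappa> i t x y)"

text \<open>For at most m \<le> L - \<nu> derivatives the exponent of 2^(-i) is still at least d, so
  the terms decay geometrically.\<close>

lemma piece_majorant:
  assumes d: "0 < d" "d < \<gamma>"
  obtains C where "C > 0" "\<And>w i t x y. \<lbrakk>0 < t; set w \<subseteq> Basis; length w \<le> m\<rbrakk> \<Longrightarrow>
    norm (pd w (piece \<psi> \<kappa> i t x) y) \<le> C * (2 powr - d) ^ i * (t powr - (\<nu> + real (length w)) * weight t x y)"
proof -
  obtain C where C: "C > 0" "\<And>w i t x y. \<lbrakk>0 < t; set w \<subseteq> Basis; length w \<le> Suc m\<rbrakk> \<Longrightarrow>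
    norm (pd w (piece \<psi> \<kappa> i t x) y) \<le>
      C * ((1 / 2 ^ i) powr (real L - \<nu> + d - real (length w)) * (t powr - (\<nu> + real (length w)) * weight t x y))"
    by (rule piece_bound[OF d], rule that)
  have "norm (pd w (piece \<psi> \<kappa> i t x) y) \<le> C * (2 powr - d) ^ i * (t powr - (\<nu> + real (length w)) * weight t x y)"
    if t: "0 < t" and w: "set w \<subseteq> Basis" "length w \<le> m" for w i t x y
  proof -
    have "(1 / 2 ^ i) powr (real L - \<nu> + d - real (length w)) \<le> (1 / 2 ^ i) powr d"
      using m w by (intro powr_mono') auto
    also have "\<dots> = (2 powr - d) ^ i"
      by (rule half_power_powr)
    finally have "C * ((1 / 2 ^ i) powr (real L - \<nu> + d - real (length w)) * (t powr - (\<nu> + real (length w)) * weight t x y))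
        \<le> C * ((2 powr - d) ^ i * (t powr - (\<nu> + real (length w)) * weight t x y))"
      using C(1) weight_nonneg[of t x y] by (intro mult_left_mono mult_right_mono) auto
    then show ?thesis using C(2)[of t w i x y] t w by (simp add: mult.assoc)
  qed
  then show ?thesis using that C(1) by blast
qed

lemma geometric_summable: "0 < d \<Longrightarrow> summable (\<lambda>i. c * (2 powr - d) ^ i * b)" for c b d :: real
  by (intro summable_mult2 summable_mult summable_geometric) (auto simp: powr_less_one)

lemma
  assumes t: "0 < t"
  shows theta_C_k: "C_k_on m UNIV (theta t x)"
    and pd_theta: "set w \<subseteq> Basis \<Longrightarrow> length w \<le> m \<Longrightarrow> pd w (theta t x) = (\<lambda>y. \<Sum>i. pd w (piece \<psi> \<kappa> i t x) y)"
    and pieces_sums: "(\<lambda>i. piece \<psi> \<kappa> i t x y) sums theta t x y"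
proof -
  \<comment> \<open>Any exponent strictly between 0 and \<gamma> would serve for
    convergence.\<close>
  have d: "0 < \<gamma> / 2" "\<gamma> / 2 < \<gamma>" using order by auto
  obtain C where C: "C > 0" "\<And>w i t x y. \<lbrakk>0 < t; set w \<subseteq> Basis; length w \<le> m\<rbrakk> \<Longrightarrow>
    norm (pd w (piece \<psi> \<kappa> i t x) y) \<le> C * (2 powr - (\<gamma> / 2)) ^ i * (t powr - (\<nu> + real (length w)) * weight t x y)"
    by (rule piece_majorant[OF d], rule that)
  \<comment> \<open>With t fixed, the sum over all orders dominates each one, which gives a single
    majorant for all words.\<close>
  define b where "b = (\<Sum>j\<le>m. t powr - (\<nu> + real j))"
  have bd: "norm (pd w (piece \<psi> \<kappa> i t x) y) \<le> C * (2 powr - (\<gamma> / 2)) ^ i * b" if w: "set w \<subseteq> Basis" "length w \<le> m" for w i y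
  proof -
    have "t powr - (\<nu> + real (length w)) * weight t x y \<le> t powr - (\<nu> + real (length w)) * 1"
      using weight_le_1[OF t] by (intro mult_left_mono) auto
    also have "\<dots> \<le> b"
      unfolding b_def using w member_le_sum[of "length w" "{..m}" "\<lambda>j. t powr - (\<nu> + real j)"] by simp
    finally have "C * (2 powr - (\<gamma> / 2)) ^ i * (t powr - (\<nu> + real (length w)) * weight t x y) \<le> C * (2 powr - (\<gamma> / 2)) ^ i * b"
      using C(1) by (intro mult_left_mono) auto
    then show ?thesis using C(2)[OF t w, of i x y] by linarith
  qed
  have e: "theta t x = (\<lambda>y. \<Sum>i. piece \<psi> \<kappa> i t x y)" by (simp add: theta_def fun_eq_iff)
  show "C_k_on m UNIV (theta t x)"
    unfolding e by (rule C_k_on_suminf(1)[OF smooth_piece[OF t] geometric_summable[OF d(1)] bd])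
  show "set w \<subseteq> Basis \<Longrightarrow> length w \<le> m \<Longrightarrow> pd w (theta t x) = (\<lambda>y. \<Sum>i. pd w (piece \<psi> \<kappa> i t x) y)"
    unfolding e by (rule C_k_on_suminf(2)[OF smooth_piece[OF t] geometric_summable[OF d(1)] bd])
  show "(\<lambda>i. piece \<psi> \<kappa> i t x y) sums theta t x y"
    unfolding theta_def using bd[of "[]"]
    by (intro summable_sums summable_comparison_test'[OF geometric_summable[OF d(1), of C b], of 0]) auto
qed

lemma theta_bound:
  obtains C where "C > 0" "\<And>w t x y. \<lbrakk>0 < t; set w \<subseteq> Basis; length w \<le> m\<rbrakk> \<Longrightarrow>
    norm (pd w (theta t x) y) \<le> C * (t powr - (\<nu> + real (length w)) * weight t x y)"
proof -
  have d: "0 < \<gamma> / 2" "\<gamma> / 2 < \<gamma>" using order by auto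
  obtain C where C: "C > 0" "\<And>w i t x y. \<lbrakk>0 < t; set w \<subseteq> Basis; length w \<le> m\<rbrakk> \<Longrightarrow>
    norm (pd w (piece \<psi> \<kappa> i t x) y) \<le> C * (2 powr - (\<gamma> / 2)) ^ i * (t powr - (\<nu> + real (length w)) * weight t x y)"
    by (rule piece_majorant[OF d], rule that)
  define q where "q = (2::real) powr - (\<gamma> / 2)"
  have q: "0 < q" "q < 1" using d by (auto simp: q_def powr_less_one)
  have "norm (pd w (theta t x) y) \<le> (C / (1 - q)) * (t powr - (\<nu> + real (length w)) * weight t x y)"
    if t: "0 < t" and w: "set w \<subseteq> Basis" "length w \<le> m" for w t x y
  proof -
    let ?X = "t powr - (\<nu> + real (length w)) * weight t x y"
    have "norm (\<Sum>i. pd w (piece \<psi> \<kappa> i t x) y) \<le> (\<Sum>i. C * q ^ i * ?X)"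
      using C(2)[OF t w] geometric_summable[OF d(1), of C ?X] by (intro norm_suminf_le) (auto simp: q_def)
    also have "\<dots> = (C / (1 - q)) * ?X"
      using q by (simp add: suminf_mult suminf_mult2[symmetric] summable_mult suminf_geometric)
    finally show ?thesis using pd_theta[OF t w] by simp
  qed
  then show ?thesis using that[of "C / (1 - q)"] C(1) q by simp
qed

text \<open>Termwise interpolation. With r = 2^(-i), the size bound carries r^d and the Lipschitz
  bound r^(d - 1) |h|/t; their mean with exponent g carries r^(d - g), which is summable.\<close>

lemma theta_Hoelder:
  assumes g: "0 < g" "g < \<gamma>"
  obtains C where "C > 0" "\<And>w t x y h. \<lbrakk>0 < t; set w \<subseteq> Basis; length w = m; norm h < (t + norm (x - y)) / 2\<rbrakk> \<Longrightarrow>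
    norm (pd w (theta t x) (y + h) - pd w (theta t x) y)
      \<le> C * (t powr - (\<nu> + real m) * (norm h / t) powr g * weight t x y)"
proof -
  \<comment> \<open>The midpoint of g and \<gamma>: below \<gamma> for \<open>piece_bound\<close>,
    above g for summation.\<close>
  define d where "d = (g + \<gamma>) / 2"
  have d: "0 < d" "d < \<gamma>" "g < d" using g by (auto simp: d_def)
  obtain C where C: "C > 0" "\<And>w i t x y. \<lbrakk>0 < t; set w \<subseteq> Basis; length w \<le> Suc m\<rbrakk> \<Longrightarrow>
    norm (pd w (piece \<psi> \<kappa> i t x) y) \<le>
      C * ((1 / 2 ^ i) powr (real L - \<nu> + d - real (length w)) * (t powr - (\<nu> + real (length w)) * weight t x y))"
    by (rule piece_bound[OF d(1,2)], rule that)
  define q where "q = (2::real) powr - (d - g)"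
  have q: "0 < q" "q < 1" using d by (auto simp: q_def powr_less_one)
  \<comment> \<open>Covers both the two terms of the triangle inequality and the dimension factor of
    the mean value estimate, with 2^N from the shifted weight.\<close>
  define C3 where "C3 = C * 2 powr N * 2 * DIM('a)"
  have n1: "1 \<le> real DIM('a)" by (simp add: Suc_leI)
  have N2: "1 \<le> 2 powr N" using N_pos by (simp add: ge_one_powr_ge_zero)
  have C3: "C3 > 0" using C by (simp add: C3_def)
  have "norm (pd w (theta t x) (y + h) - pd w (theta t x) y) \<le> (C3 / (1 - q)) * (t powr - (\<nu> + real m) * (norm h / t) powr g * weight t x y)"
    if t: "0 < t" and w: "set w \<subseteq> Basis" "length w = m" and h: "norm h < (t + norm (x - y)) / 2" for w t x y h
  proof -
    let ?X = "t powr - (\<nu> + real m) * weight t x y" and ?\<tau> = "norm h / t"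
    have X: "0 \<le> ?X" using weight_nonneg by simp
    have ws: "weight t x (y + h') \<le> 2 powr N * weight t x y" if "norm h' \<le> norm h" for h'
      using h that by (intro weight_shift[OF t]) simp
    have D: "norm (pd w (piece \<psi> \<kappa> i t x) (y + h) - pd w (piece \<psi> \<kappa> i t x) y) \<le> C3 * (q ^ i * (?\<tau> powr g * ?X))" for i
    proof -
      let ?r = "1 / 2 ^ i :: real"
      let ?D = "norm (pd w (piece \<psi> \<kappa> i t x) (y + h) - pd w (piece \<psi> \<kappa> i t x) y)"
      have r: "0 < ?r" "?r \<le> 1" by auto
      have b1: "norm (pd w (piece \<psi> \<kappa> i t x) (y + h')) \<le> C * 2 powr N * (?r powr d * ?X)" if h': "norm h' \<le> norm h" for h'
      proof -
        have "norm (pd w (piece \<psi> \<kappa> i t x) (y + h')) \<le> C * (?r powr (real L - \<nu> + d - real m) * (t powr - (\<nu> + real m) * weight t x (y + h')))"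
          using C(2)[OF t w(1), of i x "y + h'"] w by simp
        also have "\<dots> \<le> C * (?r powr d * (t powr - (\<nu> + real m) * (2 powr N * weight t x y)))"
          using C(1) ws[OF h'] m r by (intro mult_left_mono mult_mono powr_mono') (auto simp: weight_nonneg)
        finally show ?thesis by (simp only: mult_ac)
      qed
      have "?D \<le> C * 2 powr N * (?r powr d * ?X) + C * 2 powr N * (?r powr d * ?X)"
        using b1[of h] b1[of 0] by (intro order_trans[OF norm_triangle_ineq4] add_mono) auto
      also have "\<dots> = 1 * (C * 2 powr N * 2 * (?r powr d * ?X))" by simp
      also have "\<dots> \<le> DIM('a) * (C * 2 powr N * 2 * (?r powr d * ?X))"
        using n1 C(1) by (intro mult_right_mono mult_nonneg_nonneg weight_nonneg) auto
      also have "\<dots> = C3 * ?X * ?r powr d" by (simp only: C3_def mult_ac)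
      finally have D1: "?D \<le> C3 * ?X * ?r powr d" .
      \<comment> \<open>One derivative beyond m: the exponent of r is at least d - 1 and may be
        negative.\<close>
      have b2: "norm (partial_deriv b (pd w (piece \<psi> \<kappa> i t x)) z) \<le> C * 2 powr N * (?r powr (d - 1) * (?X / t))"
        if z: "norm (z - y) \<le> norm h" and b: "b \<in> Basis" for z b
      proof -
        have "norm (pd (b # w) (piece \<psi> \<kappa> i t x) z) \<le> C * (?r powr (real L - \<nu> + d - real (Suc m)) * (t powr - (\<nu> + real (Suc m)) * weight t x z))"
          using C(2)[OF t, of "b # w" i x z] w b by simp
        also have "\<dots> \<le> C * (?r powr (d - 1) * (t powr - (\<nu> + real (Suc m)) * (2 powr N * weight t x y)))"
          using C(1) ws[of "z - y"] z m r by (intro mult_left_mono mult_mono powr_mono') (auto simp: weight_nonneg)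
        also have "t powr - (\<nu> + real (Suc m)) = t powr - (\<nu> + real m) * t powr - 1"
        proof -
          have "- (\<nu> + real (Suc m)) = - (\<nu> + real m) + - 1" by simp
          then show ?thesis by (simp only: powr_add)
        qed
        also have "t powr - 1 = 1 / t" using t by (simp add: powr_minus_divide)
        finally show ?thesis by (simp add: mult_ac)
      qed
      have "?D \<le> DIM('a) * (C * 2 powr N * (?r powr (d - 1) * (?X / t))) * norm h"
        using t w smooth_pd[OF smooth_piece[OF t] w(1)] b2 C(1) X by (intro smooth_increment_le) auto
      also have "\<dots> = (C3 * ?X * (?\<tau> * ?r powr (d - 1))) / 2" by (simp add: C3_def mult_ac)
      also have "\<dots> \<le> C3 * ?X * (?\<tau> * ?r powr (d - 1))"
      proof -
        have half: "0 \<le> a \<Longrightarrow> a / 2 \<le> a" for a :: real by simp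
        show ?thesis using C3 t by (intro half mult_nonneg_nonneg weight_nonneg) auto
      qed
      finally have D2: "?D \<le> C3 * ?X * (?\<tau> * ?r powr (d - 1))" .
      have "?D \<le> (C3 * ?X * ?r powr d) powr (1 - g) * (C3 * ?X * (?\<tau> * ?r powr (d - 1))) powr g"
        using D1 D2 g order by (intro interpolate_bounds) auto
      also have "\<dots> = ((C3 * ?X) powr (1 - g) * (C3 * ?X) powr g) * (?\<tau> powr g * ((?r powr d) powr (1 - g) * (?r powr (d - 1)) powr g))"
        by (simp only: powr_mult) (simp only: mult_ac)
      also have "(C3 * ?X) powr (1 - g) * (C3 * ?X) powr g = C3 * ?X"
        using C3 X by (simp flip: powr_add)
      also have "(?r powr d) powr (1 - g) * (?r powr (d - 1)) powr g = ?r powr (d - g)"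
        by (simp add: powr_powr algebra_simps flip: powr_add)
      also have "?r powr (d - g) = q ^ i"
        unfolding q_def by (rule half_power_powr)
      finally show ?thesis by (simp only: mult_ac)
    qed
    have sm: "summable (\<lambda>i. pd w (piece \<psi> \<kappa> i t x) y)" for y
    proof -
      have d': "0 < \<gamma> / 2" "\<gamma> / 2 < \<gamma>" using order by auto
      obtain C where C: "C > 0" "\<And>w i t x y. \<lbrakk>0 < t; set w \<subseteq> Basis; length w \<le> m\<rbrakk> \<Longrightarrow>
        norm (pd w (piece \<psi> \<kappa> i t x) y) \<le> C * (2 powr - (\<gamma> / 2)) ^ i * (t powr - (\<nu> + real (length w)) * weight t x y)"
        by (rule piece_majorant[OF d'], rule that)
      show ?thesis
        using C(2)[OF t w(1)] w by (intro summable_comparison_test'[OF geometric_summable[OF d'(1)], of 0]) auto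
    qed
    have "norm (pd w (theta t x) (y + h) - pd w (theta t x) y) = norm (\<Sum>i. pd w (piece \<psi> \<kappa> i t x) (y + h) - pd w (piece \<psi> \<kappa> i t x) y)"
      using pd_theta[OF t w(1)] w sm by (simp add: suminf_diff)
    also have "\<dots> \<le> (\<Sum>i. C3 * (q ^ i * (?\<tau> powr g * ?X)))"
      using D q by (intro norm_suminf_le summable_mult summable_mult2 summable_geometric) auto
    also have "\<dots> = (C3 / (1 - q)) * (?\<tau> powr g * ?X)"
      using q by (simp add: suminf_mult suminf_mult2[symmetric] summable_mult2 summable_geometric suminf_geometric)
    finally show ?thesis by (simp only: mult_ac)
  qed
  then show ?thesis using that[of "C3 / (1 - q)"] C3 q by simp
qed

text \<open>The partial sums are mollifications of the functional at scale t / 2^I. Their integrals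
  against f tend to its value at f by mollification, and to the integral with the limit density by
  dominated convergence.\<close>

lemma theta_represents:
  assumes t: "0 < t" and f: "f \<in> test_fun"
  shows "Tt (scl x t \<psi>) f = (LINT y|lborel. theta t x y * f y)"
proof -
  let ?u = "Tt (scl x t \<psi>)"
  define G where "G I y = (\<Sum>i<Suc I. piece \<psi> \<kappa> i t x y)" for I y
  have GI: "G I y = of_real ((t / 2 ^ I) powr - DIM('a)) * ?u (scl y (t / 2 ^ I) \<kappa>)" for I y
    unfolding G_def by (rule sum_piece[OF dist_psi[OF t] \<kappa>(1) t])
  obtain C0 where C0: "\<And>s. 0 < s \<Longrightarrow> s \<le> 1 \<Longrightarrow>
      norm (?u f - (LINT y|lborel. (of_real (s powr - DIM('a)) * ?u (scl y s \<kappa>)) * f y)) \<le> C0 * s"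
    using distribution_mollify[OF dist_psi[OF t] \<kappa>(1,2) f] by blast
  have lim1: "(\<lambda>I. LINT y|lborel. G I y * f y) \<longlonglongrightarrow> ?u f"
  proof -
    have z: "(\<lambda>I. t / 2 ^ I) \<longlonglongrightarrow> 0" using tendsto_mult_right_zero[OF LIMSEQ_inverse_realpow_zero[of 2], of t] by (simp add: divide_inverse)
    \<comment> \<open>The mollification estimate is available for scales at most 1 only, which holds
      eventually whatever t is.\<close>
    have ev: "\<forall>\<^sub>F I in sequentially. norm ((LINT y|lborel. G I y * f y) - ?u f) \<le> C0 * (t / 2 ^ I)"
      using order_tendstoD(2)[OF z zero_less_one]
    proof eventually_elim
      case (elim I)
      then show ?case
        using C0[of "t / 2 ^ I"] t by (simp add: GI norm_minus_commute)
    qed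
    have "(\<lambda>I. (LINT y|lborel. G I y * f y) - ?u f) \<longlonglongrightarrow> 0"
      by (rule Lim_null_comparison[OF ev]) (use tendsto_mult_right_zero[OF z, of C0] in simp)
    then show ?thesis by (simp add: LIM_zero_iff)
  qed
  have d: "0 < \<gamma> / 2" "\<gamma> / 2 < \<gamma>" using order by auto
  obtain C where C: "C > 0" "\<And>w i t x y. \<lbrakk>0 < t; set w \<subseteq> Basis; length w \<le> m\<rbrakk> \<Longrightarrow>
    norm (pd w (piece \<psi> \<kappa> i t x) y) \<le> C * (2 powr - (\<gamma> / 2)) ^ i * (t powr - (\<nu> + real (length w)) * weight t x y)"
    by (rule piece_majorant[OF d], rule that)
  define a where "a i = C * (2 powr - (\<gamma> / 2)) ^ i * t powr - \<nu>" for i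
  have sa: "summable a" unfolding a_def by (rule geometric_summable[OF d(1)])
  have a: "norm (piece \<psi> \<kappa> i t x y) \<le> a i" for i y
  proof -
    have "norm (piece \<psi> \<kappa> i t x y) \<le> C * (2 powr - (\<gamma> / 2)) ^ i * (t powr - \<nu> * weight t x y)"
      using C(2)[OF t, of "[]" i x y] by simp
    also have "\<dots> \<le> C * (2 powr - (\<gamma> / 2)) ^ i * (t powr - \<nu> * 1)"
      using C(1) weight_le_1[OF t] by (intro mult_left_mono) auto
    finally show ?thesis by (simp add: a_def)
  qed
  have Gb: "norm (G I y) \<le> suminf a" for I y
  proof -
    have "norm (G I y) \<le> (\<Sum>i<Suc I. a i)" unfolding G_def using a by (intro sum_norm_le) auto
    also have "\<dots> \<le> suminf a" using sa a norm_ge_zero order_trans by (intro sum_le_suminf) blast+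
    finally show ?thesis .
  qed
  have G_meas: "G I \<in> borel_measurable borel" for I
    unfolding G_def using smooth_piece[OF t]
    by (intro borel_measurable_sum borel_measurable_continuous_onI smooth_continuous)
  have th_meas: "theta t x \<in> borel_measurable borel"
    using theta_C_k[OF t, of x] by (intro borel_measurable_continuous_onI C_k_on_continuous)
  have "(\<lambda>I. LINT y|lborel. G I y * f y) \<longlonglongrightarrow> (LINT y|lborel. theta t x y * f y)"
  proof (rule integral_dominated_convergence[where w="\<lambda>y. suminf a * norm (f y)"])
    show "AE y in lborel. (\<lambda>I. G I y * f y) \<longlonglongrightarrow> theta t x y * f y"
      using pieces_sums[OF t] unfolding G_def sums_def
      by (intro AE_I2 tendsto_mult tendsto_const LIMSEQ_Suc)
    show "AE y in lborel. norm (G I y * f y) \<le> suminf a * norm (f y)" for I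
      using Gb by (intro AE_I2) (simp add: norm_mult mult_right_mono)
  qed (use G_meas th_meas test_fun_measurable[OF f] test_fun_integrable[OF f] in auto)
  then show ?thesis using lim1 LIMSEQ_unique by blast
qed

end

lemma weight_decay:
  assumes "0 < t" "1 \<le> norm (y - x)"
  shows "weight t x y \<le> t powr N * norm (y - x) powr - N"
proof -
  have "weight t x y \<le> (norm (y - x) / t) powr - N"
    unfolding weight_def norm_minus_commute[of x y]
    using assms N_pos by (intro powr_mono2' divide_pos_pos) auto
  also have "\<dots> = t powr N * norm (y - x) powr - N"
    using assms by (simp add: powr_divide powr_minus_divide)
  finally show ?thesis .
qed

text \<open>The family is chosen before the exponent g, so the same kernel functions satisfy the
  Hoelder bound for every g; only the constant depends on g.\<close>

lemma kernel_functions: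
  assumes dist: "\<And>\<zeta>. \<zeta> \<in> test_vm P \<Longrightarrow> distribution (Tt \<zeta>)"
    and \<psi>: "\<psi> \<in> test_vm P" and m: "real m \<le> real L - \<nu>"
  obtains \<Theta> :: "real \<Rightarrow> 'a \<Rightarrow> 'a \<Rightarrow> complex" and C where
    "\<forall>t x. 0 < t \<longrightarrow> C_k_on m UNIV (\<Theta> t x)"
    "0 < C" "\<forall>w t x y. 0 < t \<longrightarrow> set w \<subseteq> Basis \<longrightarrow> length w \<le> m \<longrightarrow>
      norm (pd w (\<Theta> t x) y) \<le> C * (t powr - (\<nu> + real (length w)) * weight t x y)"
    "\<forall>g. 0 < g \<longrightarrow> g < \<gamma> \<longrightarrow> (\<exists>C. \<forall>w t x y h. 0 < t \<longrightarrow> set w \<subseteq> Basis \<longrightarrow> length w = m \<longrightarrow>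
      norm h < (t + norm (x - y)) / 2 \<longrightarrow> norm (pd w (\<Theta> t x) (y + h) - pd w (\<Theta> t x) y)
        \<le> C * (t powr - (\<nu> + real m) * (norm h / t) powr g * weight t x y))"
    "\<forall>t x f. 0 < t \<longrightarrow> f \<in> test_fun \<longrightarrow> Tt (scl x t \<psi>) f = (LINT y|lborel. \<Theta> t x y * f y)"
proof -
  obtain \<kappa> :: "'a cfun" where \<kappa>: "\<kappa> \<in> test_fun" "(LINT z|lborel. \<kappa> z) = 1"
    and mom: "\<forall>\<alpha>. 1 \<le> mi_order \<alpha> \<longrightarrow> mi_order \<alpha> \<le> P \<longrightarrow> (LINT z|lborel. \<kappa> z * of_real (mi_power \<alpha> z)) = 0"
    using test_fun_mass_one_moments[OF test_fun_mass_one[OF eta], of P] by blast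
  have vm: "(\<lambda>z. 2 ^ DIM('a) * \<kappa> (2 *\<^sub>R z + 0) - \<kappa> z) \<in> test_vm P"
    using mom by (intro dilation_difference_vm \<kappa>) blast
  note ctx = dist \<psi> \<kappa> vm m
  obtain C where C: "C > 0" "\<And>w t x y. \<lbrakk>0 < t; set w \<subseteq> Basis; length w \<le> m\<rbrakk> \<Longrightarrow>
      norm (pd w (theta \<psi> \<kappa> t x) y) \<le> C * (t powr - (\<nu> + real (length w)) * weight t x y)"
    by (rule theta_bound[OF ctx], assumption, rule that)
  show thesis
  proof (rule that[of "theta \<psi> \<kappa>" C]; (intro allI impI)?)
    show "C_k_on m UNIV (theta \<psi> \<kappa> t x)" if "0 < t" for t x by (rule theta_C_k[OF ctx that])
    show "\<exists>C. \<forall>w t x y h. 0 < t \<longrightarrow> set w \<subseteq> Basis \<longrightarrow> length w = m \<longrightarrow>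
      norm h < (t + norm (x - y)) / 2 \<longrightarrow> norm (pd w (theta \<psi> \<kappa> t x) (y + h) - pd w (theta \<psi> \<kappa> t x) y)
        \<le> C * (t powr - (\<nu> + real m) * (norm h / t) powr g * weight t x y)" if g: "0 < g" "g < \<gamma>" for g
    proof -
      obtain C where "\<And>w t x y h. \<lbrakk>0 < t; set w \<subseteq> Basis; length w = m; norm h < (t + norm (x - y)) / 2\<rbrakk> \<Longrightarrow>
        norm (pd w (theta \<psi> \<kappa> t x) (y + h) - pd w (theta \<psi> \<kappa> t x) y)
          \<le> C * (t powr - (\<nu> + real m) * (norm h / t) powr g * weight t x y)"
        by (rule theta_Hoelder[OF ctx g], assumption, rule that)
      then show ?thesis by blast
    qed
    show "Tt (scl x t \<psi>) f = (LINT y|lborel. theta \<psi> \<kappa> t x y * f y)" if "0 < t" "f \<in> test_fun" for t x f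
      by (rule theta_represents[OF ctx that])
  qed (use C in auto)
qed

end

subsection \<open>From test functions to Schwartz functions\<close>

text \<open>The seminorms contain monomials only. A power of |x| is reached by induction from |x|
  \<le> sum of the |x_b|, which spends one power on raising the multi-index.\<close>

lemma schwartz_decay:
  fixes f :: "('a::euclidean_space) cfun"
  assumes f: "f \<in> schwartz"
  shows "\<exists>D>0. \<forall>v x. set v \<subseteq> Basis \<longrightarrow> length v \<le> N \<longrightarrow> (1 + norm x) ^ k * norm (pd v f x) \<le> D"
proof -
  have *: "\<exists>D. \<forall>x. norm x ^ j * (\<bar>mi_power \<alpha> x\<bar> * norm (mi_deriv \<beta> f x)) \<le> D" for j \<alpha> \<beta>
  proof (induction j arbitrary: \<alpha>)
    case 0
    have "bounded (range (\<lambda>x. mi_power \<alpha> x *\<^sub>R mi_deriv \<beta> f x))" using f by (simp add: schwartz_def)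
    then show ?case unfolding bounded_iff by auto
  next
    case (Suc j)
    \<comment> \<open>Raises the exponent at b by one, absorbing the coordinate x_b.\<close>
    define \<alpha>' where "\<alpha>' b = (\<lambda>c. \<alpha> c + (if c = b then 1 else 0))" for b :: 'a
    have "\<forall>b. \<exists>D. \<forall>x. norm x ^ j * (\<bar>mi_power (\<alpha>' b) x\<bar> * norm (mi_deriv \<beta> f x)) \<le> D"
      using Suc by blast
    from choice[OF this] obtain D where D: "\<And>b x. norm x ^ j * (\<bar>mi_power (\<alpha>' b) x\<bar> * norm (mi_deriv \<beta> f x)) \<le> D b"
      by blast
    have "norm x ^ Suc j * (\<bar>mi_power \<alpha> x\<bar> * norm (mi_deriv \<beta> f x)) \<le> (\<Sum>b\<in>Basis. D b)" for x
    proof -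
      have "norm x ^ Suc j * (\<bar>mi_power \<alpha> x\<bar> * norm (mi_deriv \<beta> f x)) =
          norm x * (norm x ^ j * (\<bar>mi_power \<alpha> x\<bar> * norm (mi_deriv \<beta> f x)))" by simp
      also have "\<dots> \<le> (\<Sum>b\<in>Basis. \<bar>x \<bullet> b\<bar>) * (norm x ^ j * (\<bar>mi_power \<alpha> x\<bar> * norm (mi_deriv \<beta> f x)))"
        by (intro mult_right_mono norm_le_l1) auto
      also have "\<dots> = (\<Sum>b\<in>Basis. norm x ^ j * (\<bar>mi_power (\<alpha>' b) x\<bar> * norm (mi_deriv \<beta> f x)))"
        unfolding sum_distrib_right \<alpha>'_def
        by (intro sum.cong refl) (simp add: mi_power_add mi_power_unit abs_mult mult_ac)
      also have "\<dots> \<le> (\<Sum>b\<in>Basis. D b)" by (intro sum_mono D)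
      finally show ?thesis .
    qed
    then show ?case by blast
  qed
  have "\<exists>D>0. \<forall>v\<in>{v. set v \<subseteq> Basis \<and> length v \<le> N}. \<forall>x. (1 + norm x) ^ k * norm (pd v f x) \<le> D * 1"
  proof (rule finite_uniform_bound[OF finite_words])
    fix v :: "'a list" assume "v \<in> {v. set v \<subseteq> Basis \<and> length v \<le> N}"
    then have v: "pd v f x = mi_deriv (count (mset v)) f x" for x
      using f by (intro pd_conv_mi_deriv(1)[OF open_UNIV]) (auto simp: schwartz_def smooth_C_k_on)
    have one: "mi_power (\<lambda>_. 0) x = 1" for x :: 'a by (simp add: mi_power_def)
    obtain D0 where D0: "\<And>x. norm (pd v f x) \<le> D0"
      using *[of 0 "\<lambda>_. 0" "count (mset v)"] by (auto simp: v one)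
    obtain D1 where D1: "\<And>x. norm x ^ k * norm (pd v f x) \<le> D1"
      using *[of k "\<lambda>_. 0" "count (mset v)"] by (auto simp: v one)
    have "(1 + norm x) ^ k * norm (pd v f x) \<le> (2 ^ k * (D0 + D1)) * 1" for x
    proof -
      have "(1 + norm x) ^ k \<le> 2 ^ k * (1 + norm x ^ k)"
      proof (cases "norm x \<le> 1")
        case True
        then have "(1 + norm x) ^ k \<le> 2 ^ k" by (intro power_mono) auto
        then show ?thesis by (simp add: distrib_left add_increasing2)
      next
        case False
        then have "(1 + norm x) ^ k \<le> (2 * norm x) ^ k" by (intro power_mono) auto
        then show ?thesis by (simp add: power_mult_distrib distrib_left add_increasing)
      qed
      then have "(1 + norm x) ^ k * norm (pd v f x) \<le> 2 ^ k * (1 + norm x ^ k) * norm (pd v f x)"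
        by (intro mult_right_mono) auto
      also have "\<dots> = 2 ^ k * (norm (pd v f x) + norm x ^ k * norm (pd v f x))" by (simp add: algebra_simps)
      also have "\<dots> \<le> 2 ^ k * (D0 + D1)" by (intro mult_left_mono add_mono D0 D1) auto
      finally show ?thesis by simp
    qed
    then show "\<exists>C. \<forall>x. (1 + norm x) ^ k * norm (pd v f x) \<le> C * 1" by blast
  qed auto
  then show ?thesis by auto
qed

lemma schwartzI:
  fixes f :: "('a::euclidean_space) cfun"
  assumes "smooth f"
    and "\<And>N. \<exists>D. \<forall>v x. set v \<subseteq> Basis \<longrightarrow> length v \<le> N \<longrightarrow> (1 + norm x) ^ N * norm (pd v f x) \<le> D"
  shows "f \<in> schwartz"
proof -
  have "bounded (range (\<lambda>x. mi_power \<alpha> x *\<^sub>R mi_deriv \<beta> f x))" for \<alpha> \<beta> :: "'a multi_index"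
  proof -
    define N where "N = max (mi_order \<alpha>) (mi_order \<beta>)"
    obtain D where D: "\<And>v x. set v \<subseteq> Basis \<Longrightarrow> length v \<le> N \<Longrightarrow> (1 + norm x) ^ N * norm (pd v f x) \<le> D"
      using assms(2) by blast
    have "norm (mi_power \<alpha> x *\<^sub>R mi_deriv \<beta> f x) \<le> D" for x
    proof -
      have "\<bar>mi_power \<alpha> x\<bar> \<le> (1 + norm x) ^ N"
        by (rule order_trans[OF abs_mi_power_le power_increasing]) (auto simp: N_def)
      then have "norm (mi_power \<alpha> x *\<^sub>R mi_deriv \<beta> f x) \<le> (1 + norm x) ^ N * norm (mi_deriv \<beta> f x)"
        by (simp add: mult_right_mono)
      also have "\<dots> \<le> D"
        unfolding mi_deriv_conv_pd by (intro D set_canonical_word) (simp add: length_canonical_word N_def)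
      finally show ?thesis .
    qed
    then show ?thesis unfolding bounded_iff by blast
  qed
  then show ?thesis using assms(1) by (simp add: schwartz_def)
qed

lemma test_fun_schwartz: "test_fun \<subseteq> (schwartz :: ('a::euclidean_space) cfun set)"
proof
  fix f :: "'a cfun" assume f: "f \<in> test_fun"
  obtain A where A: "A > 0" "\<And>x. A < norm x \<Longrightarrow> f x = 0" using test_funE[OF f] by metis
  show "f \<in> schwartz"
  proof (rule schwartzI[OF test_fun_smooth[OF f]])
    fix N
    obtain B where B: "B > 0" "\<And>w x. set w \<subseteq> Basis \<Longrightarrow> length w \<le> N \<Longrightarrow> norm (pd w f x) \<le> B"
      using test_fun_pd_bounded[OF f] by metis
    have "(1 + norm x) ^ N * norm (pd v f x) \<le> (1 + A) ^ N * B" if v: "set v \<subseteq> Basis" "length v \<le> N" for v x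
    proof (cases "norm x \<le> A")
      case True
      then show ?thesis using B v A(1) by (intro mult_mono power_mono) auto
    next
      case False
      then have "pd v f x = 0" using pd_zero_outside[OF A(2) v(1)] by simp
      then show ?thesis using A(1) B(1) by simp
    qed
    then show "\<exists>D. \<forall>v x. set v \<subseteq> Basis \<longrightarrow> length v \<le> N \<longrightarrow> (1 + norm x) ^ N * norm (pd v f x) \<le> D" by blast
  qed
qed

lemma test_vm_schwartz_vm: "f \<in> test_vm P \<Longrightarrow> f \<in> schwartz_vm P"
  using test_fun_schwartz by (auto simp: test_vm_def schwartz_vm_def)

lemma schwartz_vm_mono: "f \<in> schwartz_vm P \<Longrightarrow> Q \<le> P \<Longrightarrow> f \<in> schwartz_vm Q"
  by (simp add: schwartz_vm_def vanishing_moments_def)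

text \<open>The absolute value is convenient because the constant in \<open>tempered\<close> has no
  prescribed sign.\<close>

lemma schwartz_seminorm_le:
  fixes f :: "('a::euclidean_space) cfun"
  assumes "\<And>v x. set v \<subseteq> Basis \<Longrightarrow> length v \<le> N \<Longrightarrow> (1 + norm x) ^ N * norm (pd v f x) \<le> D"
  shows "\<bar>schwartz_seminorm N f\<bar> \<le> D"
proof -
  define S where "S = {norm (mi_power \<alpha> x *\<^sub>R mi_deriv \<beta> f x) | \<alpha> \<beta> x. mi_order \<alpha> \<le> N \<and> mi_order \<beta> \<le> N}"
  have le: "s \<le> D" if sS: "s \<in> S" for s
  proof -
    obtain \<alpha> \<beta> :: "'a multi_index" and x where s: "s = norm (mi_power \<alpha> x *\<^sub>R mi_deriv \<beta> f x)"
        "mi_order \<alpha> \<le> N" "mi_order \<beta> \<le> N"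
      using sS unfolding S_def by blast
    have "\<bar>mi_power \<alpha> x\<bar> \<le> (1 + norm x) ^ N"
      by (rule order_trans[OF abs_mi_power_le power_increasing]) (use s in auto)
    then have "s \<le> (1 + norm x) ^ N * norm (mi_deriv \<beta> f x)"
      unfolding s(1) by (simp add: mult_right_mono)
    also have "\<dots> \<le> D"
      unfolding mi_deriv_conv_pd using s by (intro assms set_canonical_word) (simp add: length_canonical_word)
    finally show ?thesis .
  qed
  \<comment> \<open>A member is needed both for \<open>cSup_least\<close> and for the nonnegativity
    of the supremum.\<close>
  have mem: "norm (mi_power (\<lambda>_. 0) (0::'a) *\<^sub>R mi_deriv (\<lambda>_. 0) f 0) \<in> S"
    unfolding S_def mem_Collect_eq
    by (intro exI[of _ "\<lambda>_. 0"] exI[of _ "0::'a"] conjI refl) (auto simp: mi_order_def)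
  have "Sup S \<le> D" using mem le by (intro cSup_least) auto
  moreover have "0 \<le> Sup S"
    using order_trans[OF norm_ge_zero cSup_upper[OF mem bdd_aboveI[OF le]]] by simp
  ultimately show ?thesis unfolding schwartz_seminorm_def S_def[symmetric] by simp
qed

lemma temperedE:
  assumes "tempered u"
  obtains C N where "0 \<le> C" "\<And>f D. f \<in> schwartz \<Longrightarrow>
    \<forall>v x. set v \<subseteq> Basis \<longrightarrow> length v \<le> N \<longrightarrow> (1 + norm x) ^ N * norm (pd v f x) \<le> D \<Longrightarrow> norm (u f) \<le> C * D"
proof -
  obtain C N where C: "\<forall>f\<in>schwartz. norm (u f) \<le> C * schwartz_seminorm N f"
    using assms unfolding tempered_def by blast
  have "norm (u f) \<le> \<bar>C\<bar> * D" if "f \<in> schwartz"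
    and D: "\<forall>v x. set v \<subseteq> Basis \<longrightarrow> length v \<le> N \<longrightarrow> (1 + norm x) ^ N * norm (pd v f x) \<le> D" for f D
  proof -
    have "norm (u f) \<le> \<bar>C * schwartz_seminorm N f\<bar>" using C that(1) abs_ge_self order_trans by blast
    also have "\<dots> \<le> \<bar>C\<bar> * D"
      unfolding abs_mult using D by (intro mult_left_mono schwartz_seminorm_le) auto
    finally show ?thesis .
  qed
  then show ?thesis using that[of "\<bar>C\<bar>" N] by auto
qed

lemma tempered_add:
  "tempered u \<Longrightarrow> f \<in> schwartz \<Longrightarrow> g \<in> schwartz \<Longrightarrow> u (\<lambda>x. f x + g x) = u f + u g"
  unfolding tempered_def linear_functional_on_def by blast

lemma tempered_cmult: "tempered u \<Longrightarrow> f \<in> schwartz \<Longrightarrow> u (\<lambda>x. c * f x) = c * u f"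
  unfolding tempered_def linear_functional_on_def by blast

lemma tempered_linear_test_fun:
  assumes "tempered u" shows "linear_functional_on test_fun u"
  using assms test_fun_schwartz unfolding tempered_def linear_functional_on_def by blast

lemma tempered_distribution:
  fixes u :: "('a::euclidean_space) cfun \<Rightarrow> complex"
  assumes u: "tempered u" shows "distribution u"
proof -
  obtain C N where C: "0 \<le> C" "\<And>f D. f \<in> schwartz \<Longrightarrow>
    \<forall>v x. set v \<subseteq> Basis \<longrightarrow> length v \<le> N \<longrightarrow> (1 + norm x) ^ N * norm (pd v f x) \<le> D \<Longrightarrow> norm (u f) \<le> C * D"
    by (rule temperedE[OF u], rule that)
  \<comment> \<open>On the support the polynomial weight is bounded by a power of 1 + |A|; the
    absolute value allows for a negative radius A.\<close>
  have "norm (u g) \<le> (C * (1 + \<bar>A\<bar>) ^ N) * B"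
    if g: "g \<in> test_fun" "\<forall>x. A < norm x \<longrightarrow> g x = 0"
      and B: "\<forall>w x. set w \<subseteq> Basis \<longrightarrow> length w \<le> N \<longrightarrow> norm (pd w g x) \<le> B" for A g B
  proof -
    have "0 \<le> B" using order_trans[OF norm_ge_zero B[rule_format, of "[]" 0]] by simp
    have "norm (u g) \<le> C * ((1 + \<bar>A\<bar>) ^ N * B)"
    proof (rule C(2); (intro allI impI)?)
      show "g \<in> schwartz" using g(1) test_fun_schwartz by blast
      fix v :: "'a list" and x assume v: "set v \<subseteq> Basis" "length v \<le> N"
      show "(1 + norm x) ^ N * norm (pd v g x) \<le> (1 + \<bar>A\<bar>) ^ N * B"
      proof (cases "norm x \<le> \<bar>A\<bar>")
        case True
        then show ?thesis using B v by (intro mult_mono power_mono) auto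
      next
        case False
        then have "pd v g x = 0" using pd_zero_outside[of A g v x] g(2) v(1) by auto
        then show ?thesis using \<open>0 \<le> B\<close> by simp
      qed
    qed
    then show ?thesis by (simp add: mult.assoc)
  qed
  then have "\<exists>C m. 0 \<le> C \<and> (\<forall>g\<in>test_fun. \<forall>B. (\<forall>x. A < norm x \<longrightarrow> g x = 0) \<longrightarrow>
        (\<forall>w x. set w \<subseteq> Basis \<longrightarrow> length w \<le> m \<longrightarrow> norm (pd w g x) \<le> B) \<longrightarrow> norm (u g) \<le> C * B)" for A
    using C(1) by (intro exI[of _ "C * (1 + \<bar>A\<bar>) ^ N"] exI[of _ N]) auto
  then show ?thesis
    unfolding distribution_def using tempered_linear_test_fun[OF u] by blast
qed

text \<open>The remainder vanishes for |x| < R. Elsewhere one power of decay beyond N is spent on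
  the factor 1/R, while the derivatives of the dilated cut-off stay bounded because R \<ge>
  1.\<close>

lemma schwartz_cutoff:
  fixes f :: "('a::euclidean_space) cfun"
  assumes f: "f \<in> schwartz" and \<eta>: "\<eta> \<in> test_fun" "\<And>z. norm z < 1 \<Longrightarrow> \<eta> z = 1"
  obtains D where "0 \<le> D" "\<forall>R v x. 1 \<le> R \<longrightarrow> set v \<subseteq> Basis \<longrightarrow> length v \<le> N \<longrightarrow>
    (1 + norm x) ^ N * norm (pd v (\<lambda>z. f z * (1 - \<eta> ((1 / R) *\<^sub>R z + 0))) x) \<le> D / R"
proof -
  have smf: "smooth f" using f by (simp add: schwartz_def)
  obtain D1 where D1: "D1 > 0" "\<And>v x. set v \<subseteq> Basis \<Longrightarrow> length v \<le> N \<Longrightarrow> (1 + norm x) ^ Suc N * norm (pd v f x) \<le> D1"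
    using schwartz_decay[OF f] by metis
  obtain B where B: "B > 0" "\<And>w x. set w \<subseteq> Basis \<Longrightarrow> length w \<le> N \<Longrightarrow> norm (pd w \<eta> x) \<le> B"
    using test_fun_pd_bounded[OF \<eta>(1)] by metis
  define D where "D = 2 ^ N * D1 * (1 + B)"
  have D: "0 \<le> D" using D1 B by (simp add: D_def)
  have "(1 + norm x) ^ N * norm (pd v (\<lambda>z. f z * (1 - \<eta> ((1 / R) *\<^sub>R z + 0))) x) \<le> D / R"
    if R: "1 \<le> R" and v: "set v \<subseteq> Basis" "length v \<le> N" for R v x
  proof (cases "norm x < R")
    case True
    have "pd v (\<lambda>z. f z * (1 - \<eta> ((1 / R) *\<^sub>R z + 0))) x = pd v (\<lambda>z. 0) x"
    proof (rule pd_cong_open[of "ball 0 R"])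
      show "f z * (1 - \<eta> ((1 / R) *\<^sub>R z + 0)) = 0" if "z \<in> ball 0 R" for z
        using \<eta>(2)[of "(1 / R) *\<^sub>R z + 0"] that R by simp
    qed (use True in auto)
    also have "\<dots> = 0" using polyf_pd(2)[OF polyf_const[of 0] v(1)] by (cases v) auto
    finally show ?thesis using D R by simp
  next
    case False
    let ?g = "\<lambda>z. 1 - \<eta> ((1 / R) *\<^sub>R z + 0)"
    have sme: "smooth (\<lambda>z. \<eta> ((1 / R) *\<^sub>R z + 0))" using smooth_affine[OF test_fun_smooth[OF \<eta>(1)]] .
    have smg: "smooth ?g" using sme by (intro smooth_diff smooth_const)
    have gb: "norm (pd w ?g x) \<le> 1 + B" if w: "set w \<subseteq> Basis" "length w \<le> N" for w
    proof -
      have "pd w ?g x = pd w (\<lambda>_. 1) x - pd w (\<lambda>z. \<eta> ((1 / R) *\<^sub>R z + 0)) x"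
        using sme w(1) by (intro pd_diff[OF open_UNIV]) (auto intro: smooth_C_k_on smooth_const)
      moreover have "norm (pd w (\<lambda>_::'a. 1) x) \<le> 1"
        using polyf_pd(2)[OF polyf_const[of 1] w(1)] by (cases w) auto
      moreover have "norm (pd w (\<lambda>z. \<eta> ((1 / R) *\<^sub>R z + 0)) x) \<le> B"
      proof -
        have "norm (pd w (\<lambda>z. \<eta> ((1 / R) *\<^sub>R z + 0)) x) = (1 / R) ^ length w * norm (pd w \<eta> ((1 / R) *\<^sub>R x + 0))"
          unfolding pd_affine[OF test_fun_smooth[OF \<eta>(1)] w(1)] using R by (simp add: norm_mult norm_power norm_divide)
        also have "\<dots> \<le> 1 * B"
          using R B(2)[OF w] by (intro mult_mono power_le_one) auto
        finally show ?thesis by simp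
      qed
      ultimately show ?thesis
        using order_trans[OF norm_triangle_ineq4 add_mono] by simp
    qed
    let ?A = "D1 / (1 + norm x) ^ Suc N"
    have pos: "0 < 1 + norm x" by (simp add: add_pos_nonneg)
    have A: "0 \<le> ?A" using D1 pos by simp
    have fb: "norm (pd w f x) \<le> ?A" if "set w \<subseteq> Basis" "length w \<le> N" for w
      using D1(2)[OF that, of x] pos by (simp add: pos_le_divide_eq mult.commute del: power_Suc)
    have "norm (pd v (\<lambda>z. f z * ?g z) x) \<le> 2 ^ length v * ?A * (1 + B)"
      using v A B(1) by (intro norm_pd_mult_le smf smg fb gb) auto
    also have "\<dots> \<le> 2 ^ N * ?A * (1 + B)"
      using v A B(1) by (intro mult_right_mono power_increasing) auto
    finally have "(1 + norm x) ^ N * norm (pd v (\<lambda>z. f z * ?g z) x) \<le> (1 + norm x) ^ N * (2 ^ N * ?A * (1 + B))"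
      using pos by (intro mult_left_mono) auto
    also have "\<dots> = D / (1 + norm x)" using pos by (simp add: D_def)
    also have "\<dots> \<le> D / R" using False R D by (intro divide_left_mono) auto
    finally show ?thesis .
  qed
  then show ?thesis using that D by blast
qed

text \<open>Truncate f at radius j + 1: the left side converges because u is tempered and the
  remainders are small in its seminorm, the right side by dominated convergence.\<close>

lemma tempered_representation:
  fixes u :: "('a::euclidean_space) cfun \<Rightarrow> complex" and \<eta> \<Theta> :: "'a cfun"
  assumes u: "tempered u" and \<Theta>: "\<Theta> \<in> borel_measurable borel"
    and test: "\<And>f. f \<in> test_fun \<Longrightarrow> u f = (LINT y|lborel. \<Theta> y * f y)"
    and f: "f \<in> schwartz" and int: "integrable lborel (\<lambda>y. \<Theta> y * f y)"
    and \<eta>: "\<eta> \<in> test_fun" "\<And>z. norm z < 1 \<Longrightarrow> \<eta> z = 1"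
  shows "u f = (LINT y|lborel. \<Theta> y * f y)"
proof -
  have smf: "smooth f" using f by (simp add: schwartz_def)
  obtain C N where C: "0 \<le> C" "\<And>f D. f \<in> schwartz \<Longrightarrow>
    \<forall>v x. set v \<subseteq> Basis \<longrightarrow> length v \<le> N \<longrightarrow> (1 + norm x) ^ N * norm (pd v f x) \<le> D \<Longrightarrow> norm (u f) \<le> C * D"
    by (rule temperedE[OF u], rule that)
  define c where "c j = (\<lambda>z. \<eta> ((1 / real (Suc j)) *\<^sub>R z + 0))" for j
  have smc: "smooth (c j)" for j unfolding c_def using smooth_affine[OF test_fun_smooth[OF \<eta>(1)]] .
  have ctest: "c j \<in> test_fun" for j unfolding c_def using \<eta>(1) by (intro test_fun_affine) auto
  define g where "g j = (\<lambda>z. f z * c j z)" for j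
  have g: "g j \<in> test_fun" for j unfolding g_def using ctest smf by (intro test_fun_mult')
  define r where "r j = (\<lambda>z. f z * (1 - c j z))" for j
  have r: "r j \<in> schwartz" for j
  proof (rule schwartzI)
    show "smooth (r j)" unfolding r_def using smf smc by (intro smooth_mult smooth_diff smooth_const)
    fix N'
    obtain D where "0 \<le> D" "\<forall>R v x. 1 \<le> R \<longrightarrow> set v \<subseteq> Basis \<longrightarrow> length v \<le> N' \<longrightarrow>
      (1 + norm x) ^ N' * norm (pd v (\<lambda>z. f z * (1 - \<eta> ((1 / R) *\<^sub>R z + 0))) x) \<le> D / R"
      by (rule schwartz_cutoff[OF f \<eta>], assumption, rule that)
    then show "\<exists>D. \<forall>v x. set v \<subseteq> Basis \<longrightarrow> length v \<le> N' \<longrightarrow> (1 + norm x) ^ N' * norm (pd v (r j) x) \<le> D"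
      unfolding r_def c_def by (intro exI[of _ "D / real (Suc j)"]) auto
  qed
  obtain D where D: "0 \<le> D" "\<forall>R v x. 1 \<le> R \<longrightarrow> set v \<subseteq> Basis \<longrightarrow> length v \<le> N \<longrightarrow>
      (1 + norm x) ^ N * norm (pd v (\<lambda>z. f z * (1 - \<eta> ((1 / R) *\<^sub>R z + 0))) x) \<le> D / R"
    by (rule schwartz_cutoff[OF f \<eta>], assumption, rule that)
  have rb: "norm (u (r j)) \<le> C * (D / real (Suc j))" for j
    using D(2)[rule_format, of "real (Suc j)"] unfolding r_def c_def by (intro C(2)[OF r[unfolded r_def c_def]]) auto
  have split: "u f = u (g j) + u (r j)" for j
  proof -
    have "f = (\<lambda>z. g j z + r j z)" by (simp add: g_def r_def algebra_simps)
    then show ?thesis using tempered_add[OF u _ r[of j], of "g j"] g[of j] test_fun_schwartz by auto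
  qed
  have "(\<lambda>j. u (r j)) \<longlonglongrightarrow> 0"
  proof (rule Lim_null_comparison)
    show "\<forall>\<^sub>F j in sequentially. norm (u (r j)) \<le> C * (D / real (Suc j))" using rb by simp
    have "(\<lambda>j. (C * D) * inverse (real (Suc j))) \<longlonglongrightarrow> (C * D) * 0"
      by (intro tendsto_intros LIMSEQ_inverse_real_of_nat)
    then show "(\<lambda>j. C * (D / real (Suc j))) \<longlonglongrightarrow> 0" by (simp add: divide_inverse mult.assoc)
  qed
  then have "(\<lambda>j. u f - u (r j)) \<longlonglongrightarrow> u f - 0" by (intro tendsto_diff tendsto_const)
  moreover have "u f - u (r j) = u (g j)" for j using split[of j] by simp
  ultimately have l1: "(\<lambda>j. u (g j)) \<longlonglongrightarrow> u f" by simp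
  obtain B where B: "B > 0" "\<And>z. norm (\<eta> z) \<le> B" using test_fun_bounded[OF \<eta>(1)] by blast
  have "(\<lambda>j. LINT y|lborel. \<Theta> y * g j y) \<longlonglongrightarrow> (LINT y|lborel. \<Theta> y * f y)"
  proof (rule integral_dominated_convergence[where w="\<lambda>y. B * norm (\<Theta> y * f y)"])
    show "AE y in lborel. (\<lambda>j. \<Theta> y * g j y) \<longlonglongrightarrow> \<Theta> y * f y"
    proof (rule AE_I2)
      fix y :: 'a
      obtain j0 :: nat where j0: "norm y < real j0" using reals_Archimedean2 by blast
      have "\<forall>\<^sub>F j in sequentially. \<Theta> y * f y = \<Theta> y * g j y"
        using eventually_ge_at_top[of j0]
      proof eventually_elim
        case (elim j)
        then have "norm ((1 / real (Suc j)) *\<^sub>R y + 0) < 1" using j0 by (simp add: field_simps)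
        then show ?case using \<eta>(2) by (simp add: g_def c_def)
      qed
      then show "(\<lambda>j. \<Theta> y * g j y) \<longlonglongrightarrow> \<Theta> y * f y"
        by (rule Lim_transform_eventually[OF tendsto_const])
    qed
    show "AE y in lborel. norm (\<Theta> y * g j y) \<le> B * norm (\<Theta> y * f y)" for j
    proof (rule AE_I2)
      fix y :: 'a
      have "norm (\<Theta> y * g j y) = norm (\<Theta> y * f y) * norm (c j y)" by (simp add: g_def norm_mult)
      also have "\<dots> \<le> norm (\<Theta> y * f y) * B" unfolding c_def by (intro mult_left_mono B(2)) auto
      finally show "norm (\<Theta> y * g j y) \<le> B * norm (\<Theta> y * f y)" by (simp add: mult.commute)
    qed
  qed (use \<Theta> test_fun_measurable[OF g] borel_measurable_continuous_onI[OF smooth_continuous[OF smf]] int in auto)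
  then have "(\<lambda>j. u (g j)) \<longlonglongrightarrow> (LINT y|lborel. \<Theta> y * f y)" using test[OF g] by simp
  then show ?thesis using l1 LIMSEQ_unique by blast
qed

subsection \<open>Verification of the hypotheses\<close>

lemma mi_deriv_zero: "mi_deriv (\<lambda>_. 0) f = f"
proof -
  have "length (canonical_word (\<lambda>_::'a. 0)) = 0" by (simp add: length_canonical_word mi_order_def)
  then show ?thesis by (simp add: mi_deriv_conv_pd)
qed

lemma C_k_on_slices:
  fixes F :: "('a::euclidean_space \<times> 'a) cfun"
  assumes "C_k_on k S F"
  shows "C_k_on k {v. (u, v) \<in> S} (\<lambda>v. F (u, v))" "C_k_on k {u. (u, v) \<in> S} (\<lambda>u. F (u, v))"
proof -
  \<comment> \<open>A derivative of a slice is a derivative of F along a basis vector of one factor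
    of the product space.\<close>
  have e1: "coord_diff b (\<lambda>v. F (u, v)) v \<longleftrightarrow> coord_diff (0, b) F (u, v)"
    "partial_deriv b (\<lambda>v. F (u, v)) = (\<lambda>v. partial_deriv (0, b) F (u, v))"
    "coord_diff b (\<lambda>u. F (u, v)) u \<longleftrightarrow> coord_diff (b, 0) F (u, v)"
    "partial_deriv b (\<lambda>u. F (u, v)) = (\<lambda>u. partial_deriv (b, 0) F (u, v))" for b u v :: 'a and F :: "('a \<times> 'a) cfun"
    by (simp_all add: coord_diff_def partial_deriv_def fun_eq_iff)
  show "C_k_on k {v. (u, v) \<in> S} (\<lambda>v. F (u, v))"
    using assms
  proof (induction k arbitrary: F)
    case 0
    then show ?case by (auto intro!: continuous_on_compose2[of S F] continuous_intros)
  next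
    case (Suc k)
    have "(0, b) \<in> Basis" if "b \<in> Basis" for b :: 'a using that by (simp add: Basis_prod_def)
    then show ?case using Suc
      by (auto simp: e1 intro!: continuous_on_compose2[of S F] continuous_intros)
  qed
  show "C_k_on k {u. (u, v) \<in> S} (\<lambda>u. F (u, v))"
    using assms
  proof (induction k arbitrary: F)
    case 0
    then show ?case by (auto intro!: continuous_on_compose2[of S F] continuous_intros)
  next
    case (Suc k)
    have "(b, 0) \<in> Basis" if "b \<in> Basis" for b :: 'a using that by (simp add: Basis_prod_def)
    then show ?case using Suc
      by (auto simp: e1 intro!: continuous_on_compose2[of S F] continuous_intros)
  qed
qed

text \<open>
  The functions of the definition of the weak boundedness property are normalised by \<open>|B|\<close>; here the
  bounds on their derivatives are factored out.
\<close>

lemma WBP_scaled: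
  fixes T Tt :: "('a::euclidean_space) operator"
  assumes "WBP \<nu> T Tt"
  obtains CW N0 P1 where "CW > 0"
    "\<And>P y r \<zeta> \<phi> a b. \<lbrakk>P1 \<le> P; 0 < r; \<zeta> \<in> test_vm P; \<phi> \<in> test_fun; 0 < a; 0 < b;
        \<forall>z. 1 < norm z \<longrightarrow> \<zeta> z = 0; \<forall>z. 1 < norm z \<longrightarrow> \<phi> z = 0;
        \<forall>w z. set w \<subseteq> Basis \<longrightarrow> length w \<le> N0 \<longrightarrow> norm (pd w \<zeta> z) \<le> a;
        \<forall>w z. set w \<subseteq> Basis \<longrightarrow> length w \<le> N0 \<longrightarrow> norm (pd w \<phi> z) \<le> b\<rbrakk> \<Longrightarrow>
        norm (T (scl y r \<zeta>) (scl y r \<phi>)) + norm (Tt (scl y r \<zeta>) (scl y r \<phi>))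
          \<le> CW * a * b * r powr (real DIM('a) - \<nu>)"
proof -
  let ?n = "real DIM('a)"
  obtain P1 N0 C where C: "C > 0" and cont: "continuous_with_transpose P1 T Tt"
    and W: "\<And>c r \<psi> \<phi>. \<lbrakk>r > 0; \<psi> \<in> test_vm P1; \<phi> \<in> test_fun; fsupport \<psi> \<subseteq> ball c r; fsupport \<phi> \<subseteq> ball c r;
            \<forall>\<alpha> x. mi_order \<alpha> \<le> N0 \<longrightarrow>
               norm (mi_deriv \<alpha> \<psi> x) \<le> measure lborel (ball c r) powr - (real (mi_order \<alpha>) / real DIM('a)) \<and>
               norm (mi_deriv \<alpha> \<phi> x) \<le> measure lborel (ball c r) powr - (real (mi_order \<alpha>) / real DIM('a))\<rbrakk> \<Longrightarrow>
            norm (T \<psi> \<phi>) + norm (Tt \<psi> \<phi>) \<le> C * measure lborel (ball c r) powr (1 - \<nu> / real DIM('a))"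
    using assms unfolding WBP_def by blast
  define V where "V = unit_ball_vol ?n"
  have V: "V > 0" by (simp add: V_def)
  \<comment> \<open>For B of radius 2 r, |B|^(1/n) is V^(1/n) 2 r \<le> \<kappa> r. Division of the
    functions by \<kappa>^N0 therefore makes derivatives of size r^(-j), j \<le> N0,
    admissible.\<close>
  define \<kappa> where "\<kappa> = max 1 (2 * V powr (1 / ?n))"
  have \<kappa>: "1 \<le> \<kappa>" "2 * V powr (1 / ?n) \<le> \<kappa>" by (auto simp: \<kappa>_def)
  have n: "?n > 0" by simp
  define CW where "CW = C * V powr (1 - \<nu> / ?n) * 2 powr (?n - \<nu>) * \<kappa> ^ N0 * \<kappa> ^ N0"
  have CW: "CW > 0" using C V \<kappa> by (simp add: CW_def)
  have "norm (T (scl y r \<zeta>) (scl y r \<phi>)) + norm (Tt (scl y r \<zeta>) (scl y r \<phi>)) \<le> CW * a * b * r powr (?n - \<nu>)"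
    if P: "P1 \<le> P" and r: "0 < r" and \<zeta>: "\<zeta> \<in> test_vm P" and \<phi>: "\<phi> \<in> test_fun" and ab: "0 < a" "0 < b"
      and supp: "\<forall>z. 1 < norm z \<longrightarrow> \<zeta> z = 0" "\<forall>z. 1 < norm z \<longrightarrow> \<phi> z = 0"
      and bd: "\<forall>w z. set w \<subseteq> Basis \<longrightarrow> length w \<le> N0 \<longrightarrow> norm (pd w \<zeta> z) \<le> a"
        "\<forall>w z. set w \<subseteq> Basis \<longrightarrow> length w \<le> N0 \<longrightarrow> norm (pd w \<phi> z) \<le> b" for P y r \<zeta> \<phi> a b
  proof -
    \<comment> \<open>Twice the radius, since the supports lie in a closed ball of radius r and the
      definition asks for an open one.\<close>
    define m where "m = measure lborel (ball y (2 * r))"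
    have m: "m = V * (2 * r) powr ?n" using r by (simp add: m_def V_def content_ball powr_realpow)
    have m_pos: "m > 0" using V r by (simp add: m)
    have root: "m powr (1 / ?n) = V powr (1 / ?n) * (2 * r)"
      using r n by (simp add: m powr_mult powr_powr)
    have deriv: "norm (mi_deriv \<alpha> (\<lambda>z. of_real (1 / (A * \<kappa> ^ N0)) * scl y r g z) x) \<le> m powr - (real (mi_order \<alpha>) / ?n)"
      if \<alpha>: "mi_order \<alpha> \<le> N0" and g: "g \<in> test_fun" and A: "0 < A"
        and b: "\<forall>w z. set w \<subseteq> Basis \<longrightarrow> length w \<le> N0 \<longrightarrow> norm (pd w g z) \<le> A" for \<alpha> A g x
    proof -
      let ?w = "canonical_word \<alpha>" and ?j = "mi_order \<alpha>"
      have "norm (mi_deriv \<alpha> (\<lambda>z. of_real (1 / (A * \<kappa> ^ N0)) * scl y r g z) x) =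
          (1 / (A * \<kappa> ^ N0)) * ((1 / r) ^ ?j * norm (pd ?w g ((1 / r) *\<^sub>R x + (- (1 / r)) *\<^sub>R y)))"
        unfolding mi_deriv_conv_pd
          pd_cmult[OF open_UNIV smooth_C_k_on[OF smooth_scl[OF test_fun_smooth[OF g]]] set_canonical_word UNIV_I]
        unfolding scl_conv_affine pd_affine[OF test_fun_smooth[OF g] set_canonical_word]
        using r A \<kappa> by (simp add: norm_mult norm_power norm_divide length_canonical_word)
      also have "\<dots> \<le> (1 / (A * \<kappa> ^ N0)) * ((1 / r) ^ ?j * A)"
        using b set_canonical_word[of \<alpha>] \<alpha> r A \<kappa> by (intro mult_left_mono) (auto simp: length_canonical_word)
      also have "\<dots> = (1 / r) ^ ?j / \<kappa> ^ N0" using A by simp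
      also have "\<dots> \<le> (1 / r) ^ ?j / \<kappa> ^ ?j"
        using \<kappa> \<alpha> r by (intro divide_left_mono power_increasing) auto
      also have "\<dots> = (1 / (\<kappa> * r)) ^ ?j" by (simp add: power_divide power_mult_distrib)
      also have "\<dots> \<le> (1 / m powr (1 / ?n)) ^ ?j"
      proof (intro power_mono divide_left_mono)
        show "m powr (1 / ?n) \<le> \<kappa> * r" unfolding root using mult_right_mono[OF \<kappa>(2), of r] r by (simp add: mult_ac)
      qed (use \<kappa> r m_pos in auto)
      also have "\<dots> = (m powr (- (1 / ?n))) ^ ?j" by (simp add: powr_minus_divide)
      also have "\<dots> = m powr (- (1 / ?n) * real ?j)"
        using m_pos by (simp add: powr_powr flip: powr_realpow)
      finally show ?thesis by simp
    qed
    let ?c1 = "complex_of_real (1 / (a * \<kappa> ^ N0))" and ?c2 = "complex_of_real (1 / (b * \<kappa> ^ N0))"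
    let ?Z = "scl y r \<zeta>" and ?F = "scl y r \<phi>"
    have vm: "?Z \<in> test_vm P1" using \<zeta> P r by (intro scl_test_vm) (auto intro: test_vm_mono)
    have tf: "?F \<in> test_fun" using \<phi> r by (intro scl_test_fun)
    have fs: "fsupport (\<lambda>z. c * scl y r g z) \<subseteq> ball y (2 * r)" if "\<forall>z. 1 < norm z \<longrightarrow> g z = 0" for c g
    proof -
      have "fsupport (\<lambda>z. c * scl y r g z) \<subseteq> cball y r"
        using that scl_eq_0[where \<rho>=1 and f=g and s=r and y=y] r
        by (intro fsupport_subset) (auto simp: dist_norm norm_minus_commute not_le)
      then show ?thesis using r by auto
    qed
    \<comment> \<open>The normalising constants are taken out again by homogeneity in both
      arguments.\<close>
    have bil: "U (\<lambda>z. ?c1 * ?Z z) (\<lambda>z. ?c2 * ?F z) = ?c1 * ?c2 * U ?Z ?F" if "continuous_op P1 U" for U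
    proof -
      have sv: "(\<lambda>z. ?c1 * ?Z z) \<in> schwartz_vm P1" "?Z \<in> schwartz_vm P1"
        using vm test_vm_cmult test_vm_schwartz_vm by blast+
      have sf: "?F \<in> schwartz" using tf test_fun_schwartz by blast
      have "U (\<lambda>z. ?c1 * ?Z z) (\<lambda>z. ?c2 * ?F z) = ?c2 * U (\<lambda>z. ?c1 * ?Z z) ?F"
        using that sv(1) sf tempered_cmult unfolding continuous_op_def by blast
      also have "U (\<lambda>z. ?c1 * ?Z z) ?F = ?c1 * U ?Z ?F"
        using that sv(2) sf unfolding continuous_op_def linear_functional_on_def by blast
      finally show ?thesis by simp
    qed
    have ops: "continuous_op P1 T" "continuous_op P1 Tt" using cont by (auto simp: continuous_with_transpose_def)
    have "norm (T (\<lambda>z. ?c1 * ?Z z) (\<lambda>z. ?c2 * ?F z)) + norm (Tt (\<lambda>z. ?c1 * ?Z z) (\<lambda>z. ?c2 * ?F z)) \<le> C * m powr (1 - \<nu> / ?n)"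
      unfolding m_def
    proof (rule W[OF _ test_vm_cmult[OF vm] test_fun_cmult[OF tf] fs[OF supp(1)] fs[OF supp(2)]])
      show "\<forall>\<alpha> x. mi_order \<alpha> \<le> N0 \<longrightarrow>
          norm (mi_deriv \<alpha> (\<lambda>z. ?c1 * ?Z z) x) \<le> measure lborel (ball y (2 * r)) powr - (real (mi_order \<alpha>) / ?n) \<and>
          norm (mi_deriv \<alpha> (\<lambda>z. ?c2 * ?F z) x) \<le> measure lborel (ball y (2 * r)) powr - (real (mi_order \<alpha>) / ?n)"
        using deriv[OF _ test_vmD(1)[OF \<zeta>] ab(1) bd(1)] deriv[OF _ \<phi> ab(2) bd(2)] unfolding m_def by blast
    qed (use r in simp)
    then have "(1 / (a * \<kappa> ^ N0)) * (1 / (b * \<kappa> ^ N0)) * (norm (T ?Z ?F) + norm (Tt ?Z ?F)) \<le> C * m powr (1 - \<nu> / ?n)"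
      unfolding bil[OF ops(1)] bil[OF ops(2)] using ab \<kappa> by (simp add: norm_mult norm_divide norm_power distrib_left)
    then have "norm (T ?Z ?F) + norm (Tt ?Z ?F) \<le> (C * m powr (1 - \<nu> / ?n)) * ((a * \<kappa> ^ N0) * (b * \<kappa> ^ N0))"
      using ab \<kappa> by (simp add: pos_divide_le_eq)
    also have "m powr (1 - \<nu> / ?n) = V powr (1 - \<nu> / ?n) * (2 powr (?n - \<nu>) * r powr (?n - \<nu>))"
    proof -
      have "?n * (1 - \<nu> / ?n) = ?n - \<nu>" using n by (simp add: right_diff_distrib)
      then show ?thesis using r by (simp add: m powr_mult powr_powr)
    qed
    finally show ?thesis by (simp add: CW_def mult_ac)
  qed
  then show ?thesis using that[OF CW] by metis
qed

text \<open>Each monomial comes with its own orders and cut-off function. Finitely many monomials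
  allow a common threshold, and sums of cut-off monomials treat a polynomial without a common
  cut-off.\<close>

lemma moments_from_monomials:
  fixes T Tt :: "('a::euclidean_space) operator"
  assumes L: "real L \<le> real M + \<nu>"
    and T: "\<And>\<zeta>. \<zeta> \<in> test_vm P0 \<Longrightarrow> tempered (T \<zeta>)"
    and mono: "\<And>\<alpha>. mi_order \<alpha> \<le> L \<Longrightarrow> monomial_vanishes \<nu> M \<gamma> Tt T \<alpha>"
  obtains P1 where "\<And>p P. P1 \<le> P \<Longrightarrow> polyf L p \<Longrightarrow> \<exists>q C. 0 \<le> C \<and>
        (\<forall>R\<ge>1. q R \<in> test_fun \<and> (\<forall>z. norm z < R \<longrightarrow> q R z = p z) \<and> (\<forall>z. norm (q R z) \<le> C * (1 + norm z) ^ L)) \<and>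
        (\<forall>\<zeta>\<in>test_vm P. ((\<lambda>R::real. T \<zeta> (q R)) \<longlongrightarrow> 0) at_top)"
proof -
  define I where "I = {\<alpha> :: 'a multi_index. mi_order \<alpha> \<le> L \<and> (\<forall>b. b \<notin> Basis \<longrightarrow> \<alpha> b = 0)}"
  define good where "good \<alpha> Q \<longleftrightarrow> (\<exists>P \<eta>. SIO_with \<nu> M \<gamma> P Tt T \<and> real M + \<bar>\<nu>\<bar> \<le> real P \<and> \<eta> \<in> test_vm (2 * P) \<and>
      (\<forall>x\<in>ball 0 1. \<eta> x = 1) \<and> P \<le> Q \<and> (\<forall>\<psi>\<in>test_vm Q.
        ((\<lambda>R::real. Tt (\<lambda>x. complex_of_real (mi_power \<alpha> x) * \<eta> (x /\<^sub>R R)) \<psi>) \<longlongrightarrow> 0) at_top))" for \<alpha> Q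
  have "\<exists>Q. good \<alpha> Q" if "\<alpha> \<in> I" for \<alpha>
    using mono[of \<alpha>] that unfolding monomial_vanishes_def I_def good_def by blast
  then obtain Q where Q: "\<And>\<alpha>. \<alpha> \<in> I \<Longrightarrow> good \<alpha> (Q \<alpha>)" by metis
  \<comment> \<open>The sum is a convenient upper bound for all the orders.\<close>
  define P1 where "P1 = P0 + (\<Sum>\<alpha>\<in>I. Q \<alpha>)"
  have Q_le: "Q \<alpha> \<le> P1" if "\<alpha> \<in> I" for \<alpha>
  proof -
    have "finite I" unfolding I_def by (rule finite_multi_indices)
    then show ?thesis using member_le_sum[OF that, of Q] by (simp add: P1_def)
  qed
  have main: "\<exists>q C. 0 \<le> C \<and>
        (\<forall>R\<ge>1. q R \<in> test_fun \<and> (\<forall>z. norm z < R \<longrightarrow> q R z = p z) \<and> (\<forall>z. norm (q R z) \<le> C * (1 + norm z) ^ L)) \<and>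
        (\<forall>\<zeta>\<in>test_vm P. ((\<lambda>R::real. T \<zeta> (q R)) \<longlongrightarrow> 0) at_top)"
    if P: "P1 \<le> P" and "polyf l p" "l = L" for p P l
    using that(2,3)
  proof (induction rule: polyf.induct)
    case (monomial \<alpha>0 l c)
    \<comment> \<open>Normalised off \<open>Basis\<close> to lie in the finite set I; the monomial
      is the same.\<close>
    define \<alpha> where "\<alpha> b = (if b \<in> Basis then \<alpha>0 b else 0)" for b :: 'a
    have \<alpha>: "mi_power \<alpha>0 z = mi_power \<alpha> z" "mi_order \<alpha> = mi_order \<alpha>0" for z
      by (auto simp: mi_power_def mi_order_def \<alpha>_def intro!: prod.cong sum.cong)
    have \<alpha>I: "\<alpha> \<in> I" using monomial \<alpha>(2) by (simp add: I_def \<alpha>_def)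
    obtain P' \<eta> where P': "SIO_with \<nu> M \<gamma> P' Tt T" "real M + \<bar>\<nu>\<bar> \<le> real P'" and \<eta>: "\<eta> \<in> test_vm (2 * P')"
      "\<And>x. x \<in> ball 0 1 \<Longrightarrow> \<eta> x = 1" and P'Q: "P' \<le> Q \<alpha>" and lim: "\<And>\<psi>. \<psi> \<in> test_vm (Q \<alpha>) \<Longrightarrow>
        ((\<lambda>R::real. Tt (\<lambda>x. complex_of_real (mi_power \<alpha> x) * \<eta> (x /\<^sub>R R)) \<psi>) \<longlongrightarrow> 0) at_top"
      using Q[OF \<alpha>I] unfolding good_def by blast
    \<comment> \<open>From |\<alpha>| \<le> L \<le> M + \<nu> and M + |\<nu>| \<le> P'. Of the 2 P'
      moments of \<eta>, multiplication by the monomial leaves at least P'.\<close>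
    have LP: "mi_order \<alpha> \<le> P'" using monomial \<alpha>(2) L P'(2) by linarith
    define e where "e R = (\<lambda>x. complex_of_real (mi_power \<alpha> x) * \<eta> (x /\<^sub>R R))" for R :: real
    have e: "e R \<in> test_vm P'" if "R > 0" for R
    proof -
      have "(\<lambda>x. \<eta> (inverse R *\<^sub>R x + 0)) \<in> test_vm (P' + P')"
        using \<eta>(1) that by (intro test_vm_affine) (auto simp: mult_2)
      then show ?thesis unfolding e_def using test_vm_monomial_mult[OF _ LP] by simp
    qed
    obtain B where B: "B > 0" "\<And>z. norm (\<eta> z) \<le> B" using test_fun_bounded[OF test_vmD(1)[OF \<eta>(1)]] by blast
    define q where "q R = (\<lambda>z. c * e R z)" for R :: real
    show ?case
    proof (intro exI conjI allI impI ballI)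
      show "0 \<le> norm c * B" using B by simp
      show "q R \<in> test_fun" if "1 \<le> R" for R
        unfolding q_def using e[of R] that by (intro test_fun_cmult test_vmD) auto
      show "q R z = c * of_real (mi_power \<alpha>0 z)" if "1 \<le> R" "norm z < R" for R z
      proof -
        have "z /\<^sub>R R \<in> ball 0 1" using that by (simp add: field_simps)
        then show ?thesis using \<eta>(2) by (simp add: q_def e_def \<alpha>(1))
      qed
      show "norm (q R z) \<le> norm c * B * (1 + norm z) ^ L" for R z
      proof -
        have "\<bar>mi_power \<alpha> z\<bar> \<le> (1 + norm z) ^ L"
          using monomial \<alpha>(2) by (intro order_trans[OF abs_mi_power_le power_increasing]) auto
        then have "\<bar>mi_power \<alpha> z\<bar> * norm (\<eta> (z /\<^sub>R R)) \<le> (1 + norm z) ^ L * B"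
          using B(2) by (intro mult_mono) auto
        from mult_left_mono[OF this norm_ge_zero[of c]] show ?thesis by (simp add: q_def e_def norm_mult mult_ac)
      qed
      show "((\<lambda>R. T \<zeta> (q R)) \<longlongrightarrow> 0) at_top" if \<zeta>: "\<zeta> \<in> test_vm P" for \<zeta>
      proof -
        have \<zeta>Q: "\<zeta> \<in> test_vm (Q \<alpha>)" "\<zeta> \<in> test_vm P'" "\<zeta> \<in> test_vm P0"
          using \<zeta> P Q_le[OF \<alpha>I] P'Q by (auto intro: test_vm_mono simp: P1_def)
        have "\<forall>\<^sub>F R in at_top. c * Tt (e R) \<zeta> = T \<zeta> (q R)"
          using eventually_gt_at_top[of 0]
        proof eventually_elim
          case (elim R)
          \<comment> \<open>The hypothesis concerns \<open>Tt\<close> on cut-off monomials; both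
            arguments have vanishing moments, so it transposes to T.\<close>
          have "Tt (e R) \<zeta> = T \<zeta> (e R)"
            using P'(1) test_vm_schwartz_vm[OF e[OF elim]] test_vm_schwartz_vm[OF \<zeta>Q(2)]
            unfolding SIO_with_def continuous_with_transpose_def by blast
          moreover have "T \<zeta> (q R) = c * T \<zeta> (e R)"
            unfolding q_def using e[OF elim] test_fun_schwartz by (intro tempered_cmult T \<zeta>Q) (auto dest: test_vmD)
          ultimately show ?case by simp
        qed
        moreover have "((\<lambda>R. c * Tt (e R) \<zeta>) \<longlongrightarrow> c * 0) at_top"
          using lim[OF \<zeta>Q(1)] unfolding e_def by (intro tendsto_mult tendsto_const)
        ultimately show ?thesis using Lim_transform_eventually by fastforce
      qed
    qed
  next
    case (add l p1 p2)
    obtain q1 C1 where q1: "0 \<le> C1" "\<forall>R\<ge>1. q1 R \<in> test_fun \<and> (\<forall>z. norm z < R \<longrightarrow> q1 R z = p1 z) \<and> (\<forall>z. norm (q1 R z) \<le> C1 * (1 + norm z) ^ L)"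
      "\<forall>\<zeta>\<in>test_vm P. ((\<lambda>R::real. T \<zeta> (q1 R)) \<longlongrightarrow> 0) at_top" using add by blast
    obtain q2 C2 where q2: "0 \<le> C2" "\<forall>R\<ge>1. q2 R \<in> test_fun \<and> (\<forall>z. norm z < R \<longrightarrow> q2 R z = p2 z) \<and> (\<forall>z. norm (q2 R z) \<le> C2 * (1 + norm z) ^ L)"
      "\<forall>\<zeta>\<in>test_vm P. ((\<lambda>R::real. T \<zeta> (q2 R)) \<longlongrightarrow> 0) at_top" using add by blast
    show ?case
    proof (intro exI[of _ "\<lambda>R z. q1 R z + q2 R z"] exI[of _ "C1 + C2"] conjI allI impI ballI)
      show "0 \<le> C1 + C2" using q1 q2 by simp
      show "(\<lambda>z. q1 R z + q2 R z) \<in> test_fun" if "1 \<le> R" for R using q1 q2 that by (intro test_fun_add) auto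
      show "q1 R z + q2 R z = p1 z + p2 z" if "1 \<le> R" "norm z < R" for R z using q1 q2 that by auto
      show "norm (q1 R z + q2 R z) \<le> (C1 + C2) * (1 + norm z) ^ L" if "1 \<le> R" for R z
        using q1(2) q2(2) that unfolding distrib_right by (intro order_trans[OF norm_triangle_ineq add_mono]) auto
      show "((\<lambda>R. T \<zeta> (\<lambda>z. q1 R z + q2 R z)) \<longlongrightarrow> 0) at_top" if \<zeta>: "\<zeta> \<in> test_vm P" for \<zeta>
      proof -
        have \<zeta>0: "\<zeta> \<in> test_vm P0" using \<zeta> P by (auto intro: test_vm_mono simp: P1_def)
        have "\<forall>\<^sub>F R in at_top. T \<zeta> (q1 R) + T \<zeta> (q2 R) = T \<zeta> (\<lambda>z. q1 R z + q2 R z)"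
          using eventually_ge_at_top[of 1]
        proof eventually_elim
          case (elim R)
          then have "q1 R \<in> schwartz" "q2 R \<in> schwartz" using q1(2) q2(2) test_fun_schwartz by auto
          then show ?case using tempered_add[OF T[OF \<zeta>0]] by simp
        qed
        moreover have "((\<lambda>R. T \<zeta> (q1 R) + T \<zeta> (q2 R)) \<longlongrightarrow> 0 + 0) at_top"
          using q1(3) q2(3) \<zeta> by (intro tendsto_add) auto
        ultimately show ?thesis using Lim_transform_eventually by fastforce
      qed
    qed
  qed
  show ?thesis by (rule that[of P1]) (use main in blast)
qed

text \<open>Taking one of the two multi-indices to be 0 leaves pure derivatives in a single
  variable, and each of the two nonnegative terms of the Hoelder condition is bounded by their
  sum.\<close>

lemma standard_kernel_slices:
  fixes K :: "'a::euclidean_space \<Rightarrow> 'a \<Rightarrow> complex"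
  assumes "standard_kernel \<nu> M \<gamma> K"
  obtains CK where "CK > 0" "\<And>u. C_k_on M (- {u}) (K u)" "\<And>v. C_k_on M (- {v}) (\<lambda>u. K u v)"
    "\<forall>\<alpha> h u v. mi_order \<alpha> = M \<longrightarrow> norm h < norm (u - v) / 2 \<longrightarrow>
        norm (mi_deriv \<alpha> (K u) (v + h) - mi_deriv \<alpha> (K u) v)
          \<le> CK * norm (u - v) powr - (real DIM('a) + \<nu> + real M + \<gamma>) * norm h powr \<gamma>"
    "\<forall>\<alpha> h u v. mi_order \<alpha> = M \<longrightarrow> norm h < norm (u - v) / 2 \<longrightarrow>
        norm (mi_deriv \<alpha> (\<lambda>u. K u v) (u + h) - mi_deriv \<alpha> (\<lambda>u. K u v) u)
          \<le> CK * norm (u - v) powr - (real DIM('a) + \<nu> + real M + \<gamma>) * norm h powr \<gamma>"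
proof -
  let ?N = "real DIM('a) + \<nu> + real M + \<gamma>"
  have Ck: "C_k_on M {(x, y). x \<noteq> y} (\<lambda>(x, y). K x y)" using assms by (simp add: standard_kernel_def)
  obtain C where C: "\<And>\<alpha> \<beta> x y h. mi_order \<alpha> + mi_order \<beta> = M \<Longrightarrow> norm h < norm (x - y) / 2 \<Longrightarrow>
        norm (mixed_deriv \<alpha> \<beta> K (x + h) y - mixed_deriv \<alpha> \<beta> K x y)
        + norm (mixed_deriv \<alpha> \<beta> K x y - mixed_deriv \<alpha> \<beta> K x (y + h))
          \<le> C * norm h powr \<gamma> * norm (x - y) powr - ?N"
    using assms unfolding standard_kernel_def by blast
  \<comment> \<open>The maximum with 1 makes the constant positive.\<close>
  define CK where "CK = max C 1"
  have CK: "C * norm h powr \<gamma> * norm (x - y) powr - ?N \<le> CK * norm (x - y) powr - ?N * norm h powr \<gamma>" for h x y :: 'a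
    using mult_right_mono[of C CK "norm h powr \<gamma> * norm (x - y) powr - ?N"] by (simp add: CK_def mult_ac)
  have m1: "mixed_deriv (\<lambda>_. 0) \<alpha> K u v = mi_deriv \<alpha> (K u) v" "mixed_deriv \<alpha> (\<lambda>_. 0) K u v = mi_deriv \<alpha> (\<lambda>u. K u v) u" for \<alpha> u v
    by (simp_all add: mixed_deriv_def mi_deriv_zero)
  have z: "mi_order (\<lambda>_::'a. 0) = 0" by (simp add: mi_order_def)
  show ?thesis
  proof (rule that[of CK]; (intro allI impI)?)
    show "CK > 0" by (simp add: CK_def)
    show "C_k_on M (- {u}) (K u)" for u
      using C_k_on_slices(1)[OF Ck, of u] by (simp add: Compl_eq Collect_neg_eq[symmetric] eq_commute) 
    show "C_k_on M (- {v}) (\<lambda>u. K u v)" for v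
      using C_k_on_slices(2)[OF Ck, of v] by (simp add: Compl_eq)
    fix \<alpha> :: "'a multi_index" and h u v :: 'a
    assume a: "mi_order \<alpha> = M" "norm h < norm (u - v) / 2"
    show "norm (mi_deriv \<alpha> (K u) (v + h) - mi_deriv \<alpha> (K u) v) \<le> CK * norm (u - v) powr - ?N * norm h powr \<gamma>"
      using C[of "\<lambda>_. 0" \<alpha> h u v] a CK[of h u v] norm_ge_zero[of "mixed_deriv (\<lambda>_. 0) \<alpha> K (u + h) v - mixed_deriv (\<lambda>_. 0) \<alpha> K u v"]
      unfolding m1 z norm_minus_commute[of "mi_deriv \<alpha> (K u) v"] by linarith
    show "norm (mi_deriv \<alpha> (\<lambda>u. K u v) (u + h) - mi_deriv \<alpha> (\<lambda>u. K u v) u) \<le> CK * norm (u - v) powr - ?N * norm h powr \<gamma>"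
      using C[of \<alpha> "\<lambda>_. 0" h u v] a CK[of h u v] norm_ge_zero[of "mixed_deriv \<alpha> (\<lambda>_. 0) K u v - mixed_deriv \<alpha> (\<lambda>_. 0) K u (v + h)"]
      unfolding m1 z by linarith
  qed
qed

text \<open>The density is bounded and decays with exponent N, which exceeds the dimension; of f
  only boundedness is used.\<close>

lemma (in sio) kernel_function_integrable:
  assumes t: "0 < t" and C: "0 < C" and \<Theta>: "continuous_on UNIV \<Theta>"
    "\<And>y. norm (\<Theta> y) \<le> C * (t powr - \<nu> * weight t x y)" and f: "f \<in> schwartz"
  shows "integrable lborel (\<lambda>y. \<Theta> y * f y)"
proof -
  obtain D where D: "D > 0" "\<And>y. norm (f y) \<le> D"
    using schwartz_decay[OF f, of 0 0] by auto
  have smf: "smooth f" using f by (simp add: schwartz_def)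
  have b: "norm (\<Theta> y * f y) \<le> C * t powr - \<nu> * weight t x y * D" for y
  proof -
    have "norm (\<Theta> y) * norm (f y) \<le> (C * t powr - \<nu> * weight t x y) * D"
      using \<Theta>(2)[of y] D C by (intro mult_mono) (auto simp: mult.assoc weight_nonneg)
    then show ?thesis by (simp add: norm_mult)
  qed
  show ?thesis
  proof (rule integrable_decay[where y=x and b="C * t powr - \<nu> * 1 * D" and e="\<nu> + real M + \<gamma>"
        and a="C * t powr - \<nu> * D * t powr N"])
    show "(\<lambda>y. \<Theta> y * f y) \<in> borel_measurable borel"
      by (intro borel_measurable_times borel_measurable_continuous_onI \<Theta>(1) smooth_continuous[OF smf])
    show "norm (\<Theta> y * f y) \<le> C * t powr - \<nu> * 1 * D" for y
      using C D weight_le_1[OF t, of x y] by (intro order_trans[OF b] mult_right_mono mult_left_mono) auto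
    show "norm (\<Theta> y * f y) \<le> C * t powr - \<nu> * D * t powr N * norm (y - x) powr - (real DIM('a) + (\<nu> + real M + \<gamma>))"
      if "1 \<le> norm (y - x)" for y
    proof -
      have "norm (\<Theta> y * f y) \<le> C * t powr - \<nu> * (t powr N * norm (y - x) powr - N) * D"
        using C D weight_decay[OF t that] by (intro order_trans[OF b] mult_right_mono mult_left_mono) auto
      then show ?thesis by (simp add: N_def add.assoc mult_ac)
    qed
  qed (use order C D in auto)
qed

text \<open>As a function of y, the convolution kernel is a dilate about x of the reflected profile;
  hence the factor -1, and the factor 2^(kn) that \<open>scl\<close> does not contain.\<close>

lemma dilate_conv_scl:
  "dilate k \<psi> (x - y) = of_real (2 powr (real_of_int k * real DIM('a))) *
    scl x (2 powr - real_of_int k) (\<lambda>z. \<psi> ((- 1) *\<^sub>R z + 0)) (y :: 'a::euclidean_space)"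
proof -
  have "(- 1) *\<^sub>R ((1 / 2 powr - real_of_int k) *\<^sub>R (y - x)) + 0 = (2 powr real_of_int k) *\<^sub>R (x - y)"
    by (simp add: powr_minus_divide algebra_simps)
  then show ?thesis by (simp only: dilate_def scl_def)
qed

text \<open>Integrability and continuous differentiability are part of the conclusion because
  \<open>LINT\<close> and \<open>mi_deriv\<close> return default values otherwise, so that the
  equation and the bounds alone would say less. As \<nu> \<le> L, \<open>nat\<close> does not change
  the number of derivatives.\<close>

theorem theorem3p1:
  fixes T Tt :: "('a::euclidean_space) operator"
    and \<nu> \<gamma> :: real and M L :: nat
  assumes "\<nu> \<le> real L" and "real L \<le> real M + \<nu>"
    and "0 < \<gamma>" and "\<gamma> \<le> 1"
    and "SIO \<nu> M \<gamma> T Tt"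
    and "WBP \<nu> T Tt"
    and "\<And>\<alpha>. mi_order \<alpha> \<le> L \<Longrightarrow> monomial_vanishes \<nu> M \<gamma> Tt T \<alpha>"
  shows "\<exists>P\<^sub>0. \<forall>P\<ge>P\<^sub>0. \<forall>\<psi>\<in>test_vm P. \<exists>\<theta> :: int \<Rightarrow> 'a \<Rightarrow> 'a \<Rightarrow> complex.
    (\<forall>k x. \<forall>f\<in>schwartz_vm P.
        integrable lborel (\<lambda>y. \<theta> k x y * f y) \<and>
        conv_op (dilate k \<psi>) T f x = (LINT y|lborel. \<theta> k x y * f y)) \<and>
    (\<forall>k x. C_k_on (nat \<lfloor>real L - \<nu>\<rfloor>) UNIV (\<theta> k x)) \<and>
    (\<exists>C. \<forall>\<alpha> k x y. int (mi_order \<alpha>) \<le> \<lfloor>real L - \<nu>\<rfloor> \<longrightarrow>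
        norm (mi_deriv \<alpha> (\<theta> k x) y)
          \<le> C * 2 powr ((\<nu> + real (mi_order \<alpha>)) * real_of_int k)
              * bump k (real DIM('a) + \<nu> + real M + \<gamma>) (x - y)) \<and>
    (\<forall>\<gamma>'. 0 < \<gamma>' \<longrightarrow> \<gamma>' < \<gamma> \<longrightarrow>
      (\<exists>C. \<forall>\<alpha> k x y h. int (mi_order \<alpha>) = \<lfloor>real L - \<nu>\<rfloor> \<longrightarrow>
        norm h < (2 powr - real_of_int k + norm (x - y)) / 2 \<longrightarrow>
        norm (mi_deriv \<alpha> (\<theta> k x) (y + h) - mi_deriv \<alpha> (\<theta> k x) y)
          \<le> C * 2 powr ((\<nu> + real (mi_order \<alpha>)) * real_of_int k)
              * (2 powr real_of_int k * norm h) powr \<gamma>'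
              * bump k (real DIM('a) + \<nu> + real M + \<gamma>) (x - y)))"
proof -
  obtain P1 where S: "SIO_with \<nu> M \<gamma> P1 T Tt" using assms(5) by (auto simp: SIO_def)
  then have cont: "continuous_op P1 T" "continuous_op P1 Tt"
    and tr: "\<And>f g. f \<in> schwartz_vm P1 \<Longrightarrow> g \<in> schwartz_vm P1 \<Longrightarrow> T f g = Tt g f"
    by (auto simp: SIO_with_def continuous_with_transpose_def)
  have temp: "f \<in> schwartz_vm P1 \<Longrightarrow> tempered (T f)" "f \<in> schwartz_vm P1 \<Longrightarrow> tempered (Tt f)" for f
    using cont by (auto simp: continuous_op_def)
  obtain K where K: "standard_kernel \<nu> M \<gamma> K"
    and k1: "\<And>f g. f \<in> test_vm P1 \<Longrightarrow> g \<in> test_fun \<Longrightarrow> fsupport f \<inter> fsupport g = {} \<Longrightarrow> T f g = kernel_pairing K f g"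
    and k2: "\<And>f g. f \<in> test_fun \<Longrightarrow> g \<in> test_vm P1 \<Longrightarrow> fsupport f \<inter> fsupport g = {} \<Longrightarrow> Tt g f = kernel_pairing K f g"
    using S unfolding SIO_with_def by blast
  define N where "N = real DIM('a) + \<nu> + real M + \<gamma>"
  obtain CK where CK: "CK > 0" "\<And>u. C_k_on M (- {u}) (K u)" "\<And>v. C_k_on M (- {v}) (\<lambda>u. K u v)"
    "\<forall>\<alpha> h u v. mi_order \<alpha> = M \<longrightarrow> norm h < norm (u - v) / 2 \<longrightarrow>
        norm (mi_deriv \<alpha> (K u) (v + h) - mi_deriv \<alpha> (K u) v) \<le> CK * norm (u - v) powr - N * norm h powr \<gamma>"
    "\<forall>\<alpha> h u v. mi_order \<alpha> = M \<longrightarrow> norm h < norm (u - v) / 2 \<longrightarrow>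
        norm (mi_deriv \<alpha> (\<lambda>u. K u v) (u + h) - mi_deriv \<alpha> (\<lambda>u. K u v) u) \<le> CK * norm (u - v) powr - N * norm h powr \<gamma>"
    by (rule standard_kernel_slices[OF K, folded N_def], rule that)
  obtain CW N0 P2 where CW: "CW > 0" "\<And>P y r \<zeta> \<phi> a b. \<lbrakk>P2 \<le> P; 0 < r; \<zeta> \<in> test_vm P; \<phi> \<in> test_fun; 0 < a; 0 < b;
        \<forall>z::'a. 1 < norm z \<longrightarrow> \<zeta> z = 0; \<forall>z. 1 < norm z \<longrightarrow> \<phi> z = 0;
        \<forall>w z. set w \<subseteq> Basis \<longrightarrow> length w \<le> N0 \<longrightarrow> norm (pd w \<zeta> z) \<le> a;
        \<forall>w z. set w \<subseteq> Basis \<longrightarrow> length w \<le> N0 \<longrightarrow> norm (pd w \<phi> z) \<le> b\<rbrakk> \<Longrightarrow>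
        norm (T (scl y r \<zeta>) (scl y r \<phi>)) + norm (Tt (scl y r \<zeta>) (scl y r \<phi>))
          \<le> CW * a * b * r powr (real DIM('a) - \<nu>)"
    by (rule WBP_scaled[OF assms(6)], rule that)
  obtain P3 where P3: "\<And>p P. P3 \<le> P \<Longrightarrow> polyf L p \<Longrightarrow> \<exists>q C. 0 \<le> C \<and>
        (\<forall>R\<ge>1. q R \<in> test_fun \<and> (\<forall>z. norm z < R \<longrightarrow> q R z = p z) \<and> (\<forall>z. norm (q R z) \<le> C * (1 + norm z) ^ L)) \<and>
        (\<forall>\<zeta>\<in>test_vm P. ((\<lambda>R::real. T \<zeta> (q R)) \<longlongrightarrow> 0) at_top)"
    by (rule moments_from_monomials[OF assms(2) temp(1)[OF test_vm_schwartz_vm] assms(7)], assumption+, rule that)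
  \<comment> \<open>The hypothesis for the constant monomial also supplies the cut-off
    \<eta>.\<close>
  have "monomial_vanishes \<nu> M \<gamma> Tt T (\<lambda>_. 0)" using assms(7)[of "\<lambda>_. 0"] by (simp add: mi_order_def)
  then obtain \<eta> :: "'a cfun" where \<eta>: "\<eta> \<in> test_fun" "\<And>z. norm z < 1 \<Longrightarrow> \<eta> z = 1"
    unfolding monomial_vanishes_def by (fastforce dest: test_vmD(1))
  define m where "m = nat \<lfloor>real L - \<nu>\<rfloor>"
  have m: "real m \<le> real L - \<nu>" "int m = \<lfloor>real L - \<nu>\<rfloor>" using assms(1) by (auto simp: m_def)
  show ?thesis
  \<comment> \<open>The sum exceeds every threshold: those of the operator, of weak boundedness and
    of the polynomial limits, and the orders M and L of the Taylor polynomials.\<close>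
  proof (rule exI[of _ "P1 + P2 + P3 + M + L"]; intro allI impI ballI)
    fix P and \<psi> :: "'a cfun" assume P: "P1 + P2 + P3 + M + L \<le> P" and \<psi>: "\<psi> \<in> test_vm P"
    have vm1: "f \<in> schwartz_vm P \<Longrightarrow> f \<in> schwartz_vm P1" "f \<in> test_vm P \<Longrightarrow> f \<in> test_vm P1" for f :: "'a cfun"
      using P by (auto intro: schwartz_vm_mono test_vm_mono)
    have vm2: "f \<in> test_vm P \<Longrightarrow> f \<in> schwartz_vm P1" for f :: "'a cfun"
      using vm1(2) test_vm_schwartz_vm by blast
    interpret sio T Tt K \<nu> \<gamma> N CK CW M L P N0 \<eta>
    proof
      show "norm (T (scl y r \<zeta>) (scl y r \<phi>)) + norm (Tt (scl y r \<zeta>) (scl y r \<phi>)) \<le> CW * a * b * r powr (real DIM('a) - \<nu>)"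
        if "0 < r" "\<zeta> \<in> test_vm P" "\<phi> \<in> test_fun" "0 < a" "0 < b"
          "\<And>z. 1 < norm z \<Longrightarrow> \<zeta> z = 0" "\<And>z. 1 < norm z \<Longrightarrow> \<phi> z = 0"
          "\<And>w z. set w \<subseteq> Basis \<Longrightarrow> length w \<le> N0 \<Longrightarrow> norm (pd w \<zeta> z) \<le> a"
          "\<And>w z. set w \<subseteq> Basis \<Longrightarrow> length w \<le> N0 \<Longrightarrow> norm (pd w \<phi> z) \<le> b" for r \<zeta> \<phi> a b y
        using that P by (intro CW(2)[of P]) auto
      show "linear_functional_on test_fun (T \<zeta>)" if "\<zeta> \<in> test_vm P" for \<zeta>
        by (intro tempered_linear_test_fun temp vm2 that)
      show "T f g = Tt g f" if "f \<in> test_vm P" "g \<in> test_vm P" for f g by (intro tr vm2 that)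
      show "\<exists>q C. 0 \<le> C \<and> (\<forall>R\<ge>1. q R \<in> test_fun \<and> (\<forall>z. norm z < R \<longrightarrow> q R z = p z) \<and>
            (\<forall>z. norm (q R z) \<le> C * (1 + norm z) ^ L)) \<and>
          (\<forall>\<zeta>\<in>test_vm P. ((\<lambda>R::real. T \<zeta> (q R)) \<longlongrightarrow> 0) at_top)" if "polyf L p" for p
        using P by (intro P3 that) simp
    qed (use assms N_def CK CW(1) k1 k2 vm1 \<eta> P in simp_all)
    define c where "c k = complex_of_real (2 powr (real_of_int k * real DIM('a)))" for k
    define t where "t k = (2::real) powr - real_of_int k" for k
    \<comment> \<open>The reflection called for by the convolution; it keeps the vanishing
      moments.\<close>
    define \<psi>' where "\<psi>' = (\<lambda>z. \<psi> ((- 1) *\<^sub>R z + 0))"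
    have t: "0 < t k" for k by (simp add: t_def)
    have t_powr: "t k powr - s = 2 powr (s * real_of_int k)" for k s by (simp add: t_def powr_powr mult.commute)
    have \<psi>': "\<psi>' \<in> test_vm P" unfolding \<psi>'_def using \<psi> by (intro test_vm_affine) auto
    have bump: "bump k N (x - y) = norm (c k) * weight (t k) x y" for k x y
      by (simp add: bump_def c_def t_def weight_def powr_minus_divide mult.commute)
    have dist: "distribution (Tt \<zeta>)" if "\<zeta> \<in> test_vm P" for \<zeta> by (intro tempered_distribution temp vm2 that)
    obtain \<Theta> C where \<Theta>: "\<forall>t x. 0 < t \<longrightarrow> C_k_on m UNIV (\<Theta> t x)"
      and C: "0 < C" "\<forall>w t x y. 0 < t \<longrightarrow> set w \<subseteq> Basis \<longrightarrow> length w \<le> m \<longrightarrow>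
        norm (pd w (\<Theta> t x) y) \<le> C * (t powr - (\<nu> + real (length w)) * weight t x y)"
      and Hol: "\<forall>g. 0 < g \<longrightarrow> g < \<gamma> \<longrightarrow> (\<exists>C. \<forall>w t x y h. 0 < t \<longrightarrow> set w \<subseteq> Basis \<longrightarrow> length w = m \<longrightarrow>
        norm h < (t + norm (x - y)) / 2 \<longrightarrow> norm (pd w (\<Theta> t x) (y + h) - pd w (\<Theta> t x) y)
          \<le> C * (t powr - (\<nu> + real m) * (norm h / t) powr g * weight t x y))"
      and rep: "\<forall>t x f. 0 < t \<longrightarrow> f \<in> test_fun \<longrightarrow> Tt (scl x t \<psi>') f = (LINT y|lborel. \<Theta> t x y * f y)"
      by (rule kernel_functions[OF dist \<psi>' m(1)], assumption, rule that)
    define \<theta> where "\<theta> k x = (\<lambda>y. c k * \<Theta> (t k) x y)" for k x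
    have deriv: "mi_deriv \<alpha> (\<theta> k x) y = c k * pd (canonical_word \<alpha>) (\<Theta> (t k) x) y" if "mi_order \<alpha> \<le> m" for \<alpha> k x y
    proof -
      have "C_k_on (length (canonical_word \<alpha>)) UNIV (\<Theta> (t k) x)"
        by (rule C_k_on_le[OF \<Theta>[rule_format, OF t]]) (simp only: length_canonical_word that)
      then show ?thesis
        unfolding mi_deriv_conv_pd \<theta>_def by (rule pd_cmult[OF open_UNIV _ set_canonical_word UNIV_I])
    qed
    show "\<exists>\<theta> :: int \<Rightarrow> 'a \<Rightarrow> 'a \<Rightarrow> complex.
      (\<forall>k x. \<forall>f\<in>schwartz_vm P.
        integrable lborel (\<lambda>y. \<theta> k x y * f y) \<and>
        conv_op (dilate k \<psi>) T f x = (LINT y|lborel. \<theta> k x y * f y)) \<and>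
      (\<forall>k x. C_k_on (nat \<lfloor>real L - \<nu>\<rfloor>) UNIV (\<theta> k x)) \<and>
      (\<exists>C. \<forall>\<alpha> k x y. int (mi_order \<alpha>) \<le> \<lfloor>real L - \<nu>\<rfloor> \<longrightarrow>
        norm (mi_deriv \<alpha> (\<theta> k x) y)
          \<le> C * 2 powr ((\<nu> + real (mi_order \<alpha>)) * real_of_int k)
              * bump k (real DIM('a) + \<nu> + real M + \<gamma>) (x - y)) \<and>
      (\<forall>\<gamma>'. 0 < \<gamma>' \<longrightarrow> \<gamma>' < \<gamma> \<longrightarrow>
        (\<exists>C. \<forall>\<alpha> k x y h. int (mi_order \<alpha>) = \<lfloor>real L - \<nu>\<rfloor> \<longrightarrow>
          norm h < (2 powr - real_of_int k + norm (x - y)) / 2 \<longrightarrow>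
          norm (mi_deriv \<alpha> (\<theta> k x) (y + h) - mi_deriv \<alpha> (\<theta> k x) y)
            \<le> C * 2 powr ((\<nu> + real (mi_order \<alpha>)) * real_of_int k)
                * (2 powr real_of_int k * norm h) powr \<gamma>'
                * bump k (real DIM('a) + \<nu> + real M + \<gamma>) (x - y)))"
      unfolding N_def[symmetric] m(2)[symmetric] nat_int
    proof (rule exI[of _ \<theta>]; intro conjI allI impI ballI)
      fix k and x :: 'a and f :: "'a cfun" assume f: "f \<in> schwartz_vm P"
      have fs: "f \<in> schwartz" using f by (simp add: schwartz_vm_def)
      let ?h = "scl x (t k) \<psi>'"
      have h: "?h \<in> test_vm P" using \<psi>' t by (intro scl_test_vm)
      have \<Theta>c: "continuous_on UNIV (\<Theta> (t k) x)" using \<Theta> t C_k_on_continuous by blast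
      have int: "integrable lborel (\<lambda>y. \<Theta> (t k) x y * f y)"
        using C(2)[rule_format, OF t, of "[]"] by (intro kernel_function_integrable[OF t C(1) \<Theta>c _ fs]) simp
      then show "integrable lborel (\<lambda>y. \<theta> k x y * f y)" by (simp add: \<theta>_def mult.assoc)
      have "conv_op (dilate k \<psi>) T f x = T f (\<lambda>y. c k * ?h y)"
        unfolding conv_op_def dilate_conv_scl c_def t_def \<psi>'_def ..
      also have "\<dots> = c k * T f ?h"
        using temp(1)[OF vm1(1)[OF f]] vm2[OF h] by (intro tempered_cmult) (auto simp: schwartz_vm_def)
      \<comment> \<open>Here the moments of f are used, as f becomes an argument of the tempered
        functional on the other side.\<close>
      also have "T f ?h = Tt ?h f" by (intro tr vm1 vm2 f h)
      \<comment> \<open>The representation is known on test functions and is extended to f by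
        cut-off.\<close>
      also have "\<dots> = (LINT y|lborel. \<Theta> (t k) x y * f y)"
        using rep t by (intro tempered_representation[OF temp(2)[OF vm2[OF h]] _ _ fs int \<eta>] borel_measurable_continuous_onI \<Theta>c) auto
      finally show "conv_op (dilate k \<psi>) T f x = (LINT y|lborel. \<theta> k x y * f y)"
        by (simp add: \<theta>_def mult.assoc)
    next
      show "C_k_on m UNIV (\<theta> k x)" for k x
        unfolding \<theta>_def by (rule C_k_on_mult[OF open_UNIV C_k_on_const \<Theta>[rule_format, OF t]])
    next
      show "\<exists>C. \<forall>\<alpha> k x y. int (mi_order \<alpha>) \<le> int m \<longrightarrow>
        norm (mi_deriv \<alpha> (\<theta> k x) y)
          \<le> C * 2 powr ((\<nu> + real (mi_order \<alpha>)) * real_of_int k) * bump k N (x - y)"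
      proof (intro exI[of _ C] allI impI)
        fix \<alpha> :: "'a multi_index" and k and x y :: 'a assume \<alpha>: "int (mi_order \<alpha>) \<le> int m"
        have "norm (pd (canonical_word \<alpha>) (\<Theta> (t k) x) y) \<le>
            C * (2 powr ((\<nu> + real (mi_order \<alpha>)) * real_of_int k) * weight (t k) x y)"
          using C(2)[rule_format, OF t[of k] set_canonical_word[of \<alpha>], where x=x and y=y] \<alpha> unfolding t_powr length_canonical_word by simp
        from mult_left_mono[OF this norm_ge_zero[of "c k"]]
        show "norm (mi_deriv \<alpha> (\<theta> k x) y)
          \<le> C * 2 powr ((\<nu> + real (mi_order \<alpha>)) * real_of_int k) * bump k N (x - y)"
          using \<alpha> by (simp add: deriv bump norm_mult mult_ac)
      qed
    next
      fix \<gamma>' assume g: "0 < \<gamma>'" "\<gamma>' < \<gamma>"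
      obtain C' where C': "\<forall>w t x y h. 0 < t \<longrightarrow> set w \<subseteq> Basis \<longrightarrow> length w = m \<longrightarrow>
        norm h < (t + norm (x - y)) / 2 \<longrightarrow> norm (pd w (\<Theta> t x) (y + h) - pd w (\<Theta> t x) y)
          \<le> C' * (t powr - (\<nu> + real m) * (norm h / t) powr \<gamma>' * weight t x y)"
        using Hol g by blast
      show "\<exists>C. \<forall>\<alpha> k x y h. int (mi_order \<alpha>) = int m \<longrightarrow>
          norm h < (2 powr - real_of_int k + norm (x - y)) / 2 \<longrightarrow>
          norm (mi_deriv \<alpha> (\<theta> k x) (y + h) - mi_deriv \<alpha> (\<theta> k x) y)
            \<le> C * 2 powr ((\<nu> + real (mi_order \<alpha>)) * real_of_int k)
                * (2 powr real_of_int k * norm h) powr \<gamma>' * bump k N (x - y)"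
      proof (intro exI[of _ C'] allI impI)
        fix \<alpha> :: "'a multi_index" and k and x y h :: 'a
        assume "int (mi_order \<alpha>) = int m" and h: "norm h < (2 powr - real_of_int k + norm (x - y)) / 2"
        then have \<alpha>: "mi_order \<alpha> = m" by simp
        have q: "norm h / t k = 2 powr real_of_int k * norm h" by (simp add: t_def powr_minus_divide)
        have "norm (pd (canonical_word \<alpha>) (\<Theta> (t k) x) (y + h) - pd (canonical_word \<alpha>) (\<Theta> (t k) x) y) \<le>
            C' * (2 powr ((\<nu> + real m) * real_of_int k) * (2 powr real_of_int k * norm h) powr \<gamma>' * weight (t k) x y)"
          using C'[rule_format, OF t[of k] set_canonical_word[of \<alpha>], where x=x and y=y and h=h] h \<alpha>
          unfolding t_powr length_canonical_word q t_def[symmetric] by simp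
        from mult_left_mono[OF this norm_ge_zero[of "c k"]]
        show "norm (mi_deriv \<alpha> (\<theta> k x) (y + h) - mi_deriv \<alpha> (\<theta> k x) y)
            \<le> C' * 2 powr ((\<nu> + real (mi_order \<alpha>)) * real_of_int k)
                * (2 powr real_of_int k * norm h) powr \<gamma>' * bump k N (x - y)"
          using \<alpha> by (simp add: deriv bump norm_mult mult_ac flip: right_diff_distrib)
      qed
    qed
  qed
qed

end
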